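(* Let $r,s,t>0$. The set $\mathcal{O}_{r,s,t}$ is not empty. Moreover, if $\{\mathbf{f}_n\}$ is any minimizing sequence for $\lambda(r,s,t)$, then: 1. There exist a sequence $\{y_n\}\subset\mathbb{R}$ and an element $\mathbf{\Phi}\in\mathcal{O}_{r,s,t}$ such that $\{\mathbf{f}_n(\cdot+y_n)\}$ has a subsequence converging strongly in $Y$ to $\mathbf{\Phi}$. 2. Each function $\mathbf{\Phi}=(\Phi_1,\Phi_2,\Phi_3)\in\mathcal{O}_{r,s,t}$ is, for some $\omega_1,\omega_2,\omega_3>0$, a solution of the system $$-\Phi_j''+\omega_j\Phi_j=\Big(\sum_{k=1}^{3}a_{jk}|\Phi_k|^{p}\Big)|\Phi_j|^{p-2}\Phi_j,\qquad j=1,2,3,$$ and therefore, when inserted into $$u_j(x,\tau)=e^{i(\omega_j-\sigma^2)\tau+i\sigma x+i\beta_j}\,\Phi_j(x-2\sigma\tau),\qquad j=1,2,3,\quad \sigma,\beta_j\in\mathbb{R},$$ it yields a solitary-wave solution of the nonlinear Schr\"odinger system $$i\partial_\tau u_j+\partial_{xx}u_j+\Big(\sum_{k=1}^{3}a_{kj}|u_k|^p\Big)|u_j|^{p-2}u_j=0,\qquad j=1,2,3$$ (so that, as $(r,s,t)$ varies, one has a three-parameter family of solitary waves). 3. $$\lim_{n\to\infty}\ \inf_{y\in\mathbb{R}}\ \inf_{\mathbf{\Phi}\in\mathcal{O}_{r,s,t}}\|\mathbf{f}_n(\cdot+y)-\mathbf{\Phi}\|_Y=0.$$ 4. $$\lim_{n\to\infty}\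 \inf_{\mathbf{\Phi}\in\mathcal{O}_{r,s,t}}\|\mathbf{f}_n-\mathbf{\Phi}\|_Y=0.$$
   Context: Standing assumptions: $p\in[2,3)$, and $a_{kj}$ ($k,j\in\{1,2,3\}$) are positive real constants with $a_{kj}=a_{jk}$. Notation: $H^1=H^1(\mathbb{R})$ is the Sobolev space of complex-valued functions on $\mathbb{R}$ with norm $\|f\|_1=\big(\int_{\mathbb{R}}(|f|^2+|f'|^2)\,dx\big)^{1/2}$; $\|f\|$ denotes the $L^2(\mathbb{R})$ norm. $Y=H^1\times H^1\times H^1$ with $\|(f_1,f_2,f_3)\|_Y^2=\sum_{j=1}^3\|f_j\|_1^2$. Write $\mathbf{f}=(f_1,f_2,f_3)$, $\mathbf{f}_n=(f_{1,n},f_{2,n},f_{3,n})$, $\mathbf{\Phi}=(\Phi_1,\Phi_2,\Phi_3)$. For $\mathbf{f}\in Y$ set $$\mathcal{H}(\mathbf{f})=\int_{-\infty}^{\infty}\Big(\sum_{j=1}^{3}|f_j'|^2-\frac1p\sum_{k,j=1}^{3}a_{kj}|f_k|^p|f_j|^p\Big)dx.$$ For $r,s,t>0$ set $\Delta_{r,s,t}=\{\mathbf{f}\in Y:\|f_1\|^2=r,\ \|f_2\|^2=s,\ \|f_3\|^2=t\}$, $\lambda(r,s,t)=\inf\{\mathcal{H}(\mathbf{f}):\mathbf{f}\in\Delta_{r,s,t}\}$, and $\mathcal{O}_{r,s,t}=\{\mathbf{\Phi}\in\Delta_{r,s,t}:\mathcal{H}(\mathbf{\Phi})=\lambda(r,s,t)\}$.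 A minimizing sequence for $\lambda(r,s,t)$ is any sequence $\{\mathbf{f}_n\}$ in $Y$ with $\|f_{1,n}\|^2\to r$, $\|f_{2,n}\|^2\to s$, $\|f_{3,n}\|^2\to t$ and $\mathcal{H}(\mathbf{f}_n)\to\lambda(r,s,t)$ as $n\to\infty$ (the mass constraints need only hold in the limit). The time variable is written $\tau$, since $t$ denotes a mass. *)

theory Defs
  imports "HOL-Analysis.Analysis"
begin

text \<open>
  Elements of Sobolev spaces are represented by arbitrary Borel representatives; no notion below
  distinguishes between functions that agree almost everywhere. The components of a triple are
  indexed by the three-element type \<open>3\<close>, whose elements are \<open>1\<close>, \<open>2\<close> and \<open>3\<close> (with \<open>3 = 0\<close>).
\<close>

section \<open>Test functions and weak derivatives\<close>

definition dir_deriv :: "'a::euclidean_space \<Rightarrow> ('a \<Rightarrow> real) \<Rightarrow> 'a \<Rightarrow> real" where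
  "dir_deriv b \<phi> = (\<lambda>x. frechet_derivative \<phi> (at x) b)"

text \<open>\<open>C\<^sub>c\<^sup>\<infinity>\<close>: every iterated partial derivative, of any order, is differentiable everywhere.\<close>

definition test_function :: "('a::euclidean_space \<Rightarrow> real) \<Rightarrow> bool" where
  "test_function \<phi> \<longleftrightarrow>
     (\<forall>bs\<in>lists Basis. foldr dir_deriv bs \<phi> differentiable_on UNIV) \<and>
     compact (closure {x. \<phi> x \<noteq> 0})"

definition locally_integrable :: "('a::euclidean_space \<Rightarrow> complex) \<Rightarrow> bool" where
  "locally_integrable f \<longleftrightarrow> (\<forall>K. compact K \<longrightarrow> set_integrable lborel K f)"

definition weak_derivative :: "(real \<Rightarrow> complex) \<Rightarrow> (real \<Rightarrow> complex) \<Rightarrow> bool" where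
  "weak_derivative f g \<longleftrightarrow> locally_integrable f \<and> locally_integrable g \<and>
     (\<forall>\<phi>. test_function \<phi> \<longrightarrow>
        (LINT x|lborel. dir_deriv 1 \<phi> x *\<^sub>R f x) = - (LINT x|lborel. \<phi> x *\<^sub>R g x))"

section \<open>The spaces \<open>H\<^sup>1\<close> and \<open>Y\<close>\<close>

definition L2 :: "(real \<Rightarrow> complex) set" where
  "L2 = {f \<in> borel_measurable lborel. integrable lborel (\<lambda>x. (norm (f x))\<^sup>2)}"

definition L2_norm :: "(real \<Rightarrow> complex) \<Rightarrow> real" where
  "L2_norm f = sqrt (LINT x|lborel. (norm (f x))\<^sup>2)"

definition H1 :: "(real \<Rightarrow> complex) set" where
  "H1 = {f \<in> L2. \<exists>g\<in>L2. weak_derivative f g}"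

text \<open>The weak derivative is unique only up to null sets; this picks a representative.\<close>

definition wderiv :: "(real \<Rightarrow> complex) \<Rightarrow> real \<Rightarrow> complex" where
  "wderiv f = (SOME g. g \<in> L2 \<and> weak_derivative f g)"

definition H1_norm :: "(real \<Rightarrow> complex) \<Rightarrow> real" where
  "H1_norm f = sqrt (LINT x|lborel. (norm (f x))\<^sup>2 + (norm (wderiv f x))\<^sup>2)"

type_synonym triple = "3 \<Rightarrow> real \<Rightarrow> complex"

definition Y :: "triple set" where
  "Y = {f. \<forall>j. f j \<in> H1}"

definition Y_norm :: "triple \<Rightarrow> real" where
  "Y_norm f = sqrt (\<Sum>j\<in>UNIV. (H1_norm (f j))\<^sup>2)"

definition Y_dist :: "triple \<Rightarrow> triple \<Rightarrow> real" where
  "Y_dist f g = Y_norm (\<lambda>j x. f j x - g j x)"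

definition translate :: "real \<Rightarrow> triple \<Rightarrow> triple" where
  "translate y f = (\<lambda>j x. f j (x + y))"

section \<open>The variational problem\<close>

definition energy :: "real \<Rightarrow> (3 \<Rightarrow> 3 \<Rightarrow> real) \<Rightarrow> triple \<Rightarrow> real" where
  "energy p a f = (LINT x|lborel.
     (\<Sum>j\<in>UNIV. (norm (wderiv (f j) x))\<^sup>2) -
     1 / p * (\<Sum>k\<in>UNIV. \<Sum>j\<in>UNIV. a k j * norm (f k x) powr p * norm (f j x) powr p))"

definition Delta :: "real \<Rightarrow> real \<Rightarrow> real \<Rightarrow> triple set" where
  "Delta r s t = {f \<in> Y. (L2_norm (f 1))\<^sup>2 = r \<and> (L2_norm (f 2))\<^sup>2 = s \<and> (L2_norm (f 3))\<^sup>2 = t}"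

definition min_energy :: "real \<Rightarrow> (3 \<Rightarrow> 3 \<Rightarrow> real) \<Rightarrow> real \<Rightarrow> real \<Rightarrow> real \<Rightarrow> real" where
  "min_energy p a r s t = (INF f\<in>Delta r s t. energy p a f)"

definition minimizers :: "real \<Rightarrow> (3 \<Rightarrow> 3 \<Rightarrow> real) \<Rightarrow> real \<Rightarrow> real \<Rightarrow> real \<Rightarrow> triple set" where
  "minimizers p a r s t = {\<Phi> \<in> Delta r s t. energy p a \<Phi> = min_energy p a r s t}"

definition minimizing_sequence ::
    "real \<Rightarrow> (3 \<Rightarrow> 3 \<Rightarrow> real) \<Rightarrow> real \<Rightarrow> real \<Rightarrow> real \<Rightarrow> (nat \<Rightarrow> triple) \<Rightarrow> bool" where
  "minimizing_sequence p a r s t f \<longleftrightarrow>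
     (\<forall>n. f n \<in> Y) \<and>
     (\<lambda>n. (L2_norm (f n 1))\<^sup>2) \<longlonglongrightarrow> r \<and>
     (\<lambda>n. (L2_norm (f n 2))\<^sup>2) \<longlonglongrightarrow> s \<and>
     (\<lambda>n. (L2_norm (f n 3))\<^sup>2) \<longlonglongrightarrow> t \<and>
     (\<lambda>n. energy p a (f n)) \<longlonglongrightarrow> min_energy p a r s t"

section \<open>The differential equations\<close>

text \<open>
  The term \<open>\<bar>w\<^sub>j\<bar>\<^sup>p\<^sup>-\<^sup>2 w\<^sub>j\<close> vanishes at \<open>w\<^sub>j = 0\<close> also for \<open>p = 2\<close>, so the convention
  \<open>0 powr 0 = 0\<close> is harmless.
\<close>

definition nonlinearity :: "real \<Rightarrow> (3 \<Rightarrow> 3 \<Rightarrow> real) \<Rightarrow> (3 \<Rightarrow> complex) \<Rightarrow> 3 \<Rightarrow> complex" where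
  "nonlinearity p a w j =
     ((\<Sum>k\<in>UNIV. a k j * norm (w k) powr p) * norm (w j) powr (p - 2)) *\<^sub>R w j"

text \<open>
  The stationary system for \<open>\<Phi> \<in> Y\<close>: here \<open>g\<close> is the second weak derivative of \<open>\<Phi>\<^sub>j\<close>, and the
  equation is an identity of (classes of) functions. Since \<open>a\<close> is symmetric, \<open>a k j\<close> in
  \<open>nonlinearity\<close> may be read as \<open>a j k\<close>.
\<close>

definition solves_stationary ::
    "real \<Rightarrow> (3 \<Rightarrow> 3 \<Rightarrow> real) \<Rightarrow> (3 \<Rightarrow> real) \<Rightarrow> triple \<Rightarrow> bool" where
  "solves_stationary p a \<omega> \<Phi> \<longleftrightarrow> \<Phi> \<in> Y \<and>
     (\<forall>j. \<exists>g. weak_derivative (wderiv (\<Phi> j)) g \<and>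
       (AE x in lborel. - g x + \<omega> j *\<^sub>R \<Phi> j x = nonlinearity p a (\<lambda>k. \<Phi> k x) j))"

text \<open>
  Solutions of the evolution system in the energy space: \<open>u \<in> C(\<real>; Y)\<close>, and the equation holds in
  the sense of distributions on the \<open>(x, \<tau>)\<close>-plane, i.e. for all test functions \<open>\<phi>\<close>
  \<open>\<integral>\<integral> (- \<i> u\<^sub>j \<partial>\<^sub>\<tau>\<phi> + u\<^sub>j \<partial>\<^sub>x\<^sub>x\<phi> + (nonlinear term)\<^sub>j \<phi>) dx d\<tau> = 0\<close>.
\<close>

definition solves_NLS ::
    "real \<Rightarrow> (3 \<Rightarrow> 3 \<Rightarrow> real) \<Rightarrow> (3 \<Rightarrow> real \<Rightarrow> real \<Rightarrow> complex) \<Rightarrow> bool" where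
  "solves_NLS p a u \<longleftrightarrow>
     (\<forall>\<tau>. (\<lambda>j x. u j x \<tau>) \<in> Y) \<and>
     (\<forall>\<tau>\<^sub>0. ((\<lambda>\<tau>. Y_dist (\<lambda>j x. u j x \<tau>) (\<lambda>j x. u j x \<tau>\<^sub>0)) \<longlongrightarrow> 0) (at \<tau>\<^sub>0)) \<and>
     (\<forall>j. locally_integrable (\<lambda>(x, \<tau>). u j x \<tau>) \<and>
          locally_integrable (\<lambda>(x, \<tau>). nonlinearity p a (\<lambda>k. u k x \<tau>) j)) \<and>
     (\<forall>j \<phi>. test_function \<phi> \<longrightarrow>
        (LINT (x, \<tau>)|lborel.
           - (\<i> * of_real (dir_deriv (0, 1) \<phi> (x, \<tau>)) * u j x \<tau>)
           + of_real (dir_deriv (1, 0) (dir_deriv (1, 0) \<phi>) (x, \<tau>)) * u j x \<tau>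
           + of_real (\<phi> (x, \<tau>)) * nonlinearity p a (\<lambda>k. u k x \<tau>) j) = 0)"

definition solitary_wave ::
    "(3 \<Rightarrow> real) \<Rightarrow> real \<Rightarrow> (3 \<Rightarrow> real) \<Rightarrow> triple \<Rightarrow> 3 \<Rightarrow> real \<Rightarrow> real \<Rightarrow> complex" where
  "solitary_wave \<omega> \<sigma> \<beta> \<Phi> j x \<tau> =
     exp (\<i> * of_real ((\<omega> j - \<sigma>\<^sup>2) * \<tau> + \<sigma> * x + \<beta> j)) * \<Phi> j (x - 2 * \<sigma> * \<tau>)"

end

theory Submission
  imports Defs "HOL-Complex_Analysis.Great_Picard" "HOL-Computational_Algebra.Polynomial"
begin

text \<open>
  Let \<open>m = (r, s, t)\<close>. For finite energy triples \<open>f\<close>, \<open>h\<close> the componentwise combination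
  \<open>g\<^sub>j = sqrt (\<bar>f\<^sub>j\<bar>\<^sup>2 + \<bar>h\<^sub>j\<bar>\<^sup>2)\<close> adds masses, does not increase the kinetic energy, and, since \<open>p \<ge> 2\<close>,
  has at least the sum of the two interaction energies plus a multiple of
  \<open>\<integral> \<bar>f\<bar>\<^sup>p \<bar>h\<bar>\<^sup>p\<close>. It takes the place of symmetric rearrangements and of strict subadditivity of \<open>\<lambda>\<close>.

  A minimizing sequence is bounded because \<open>p < 3\<close>, and it does not vanish uniformly because the
  infimum is negative. After translation it converges pointwise to some \<open>P \<noteq> 0\<close>; masses and
  energy split into those of \<open>P\<close> and of the remainders \<open>w\<^sub>n\<close>. If \<open>w\<^sub>n\<close> did not tend to \<open>0\<close> uniformly,
  moving it on top of \<open>P\<close> and combining would push the energy below the infimum. Hence the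
  interaction energy of \<open>w\<^sub>n\<close> vanishes, so \<open>P\<close> has at most the minimal energy, and combining \<open>P\<close>
  with a negative energy triple carrying the missing mass shows that no mass is missing. Then \<open>w\<^sub>n\<close>
  tends to \<open>0\<close> in \<open>H\<^sup>1\<close>.

  The same filling argument shows that every triple with masses at most \<open>m\<close> has at least the
  minimal energy. This one-sided constraint gives the Euler--Lagrange equations with
  \<open>\<omega>\<^sub>j \<ge> 0\<close>; testing the equation of the minimizer \<open>\<bar>\<Phi>\<bar>\<close>, which has the same frequencies, with wide
  bumps excludes \<open>\<omega>\<^sub>j = 0\<close>.
\<close>

section \<open>Square integrable functions\<close>

text \<open>The usual concentration-compactness argument needs strict subadditivity of the infimum
  in three masses, with separate cases for parts in which some components carry no mass. The
  square-root combination treats all cases alike: every \<open>a k j\<close> is positive, so two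
  nonzero profiles interact whichever components carry them, and overlap alone yields a gain.

  The exponent enters twice. For p >= 2 the function x^(p/2) is superadditive, which combining uses.
  For p < 3 the interaction grows with the power p - 1 < 2 of the derivative norm; this gives
  coercivity, and negative energy for wide flat profiles.

  The analysis uses continuous representatives paired with their derivatives, with values in any
  Euclidean space, so that scalars, pairs and triples share one theory; weak derivatives and null
  sets matter only at the two ends. A modulus is not smooth where its argument vanishes, so
  difference quotients replace the chain rule. Derivatives converge only weakly, and only their
  inner product with the limit derivative is ever passed to the limit.\<close>

definition square_integrable :: "(real \<Rightarrow> 'e::euclidean_space) \<Rightarrow> bool" where
  "square_integrable f \<longleftrightarrow> f \<in> borel_measurable borel \<and> integrable lborel (\<lambda>x. (norm (f x))\<^sup>2)"

definition l2sq :: "(real \<Rightarrow> 'e::euclidean_space) \<Rightarrow> real" where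
  "l2sq f = (LINT x|lborel. (norm (f x))\<^sup>2)"

lemma square_integrable_measurable [measurable_dest]:
  "square_integrable f \<Longrightarrow> f \<in> borel_measurable borel"
  by (simp add: square_integrable_def)

lemma square_integrable_integrable:
  "square_integrable f \<Longrightarrow> integrable lborel (\<lambda>x. (norm (f x))\<^sup>2)"
  by (simp add: square_integrable_def)

lemma l2sq_nonneg [simp]: "0 \<le> l2sq f"
  unfolding l2sq_def by (rule Bochner_Integration.integral_nonneg) simp

lemma square_integrable_norm_mult:
  fixes f :: "real \<Rightarrow> 'e::euclidean_space" and g :: "real \<Rightarrow> 'd::euclidean_space"
  assumes f: "square_integrable f" and g: "square_integrable g"
  shows "integrable lborel (\<lambda>x. norm (f x) * norm (g x))"
proof (rule Bochner_Integration.integrable_bound)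
  show "integrable lborel (\<lambda>x. (norm (f x))\<^sup>2 + (norm (g x))\<^sup>2)"
    using f g by (intro Bochner_Integration.integrable_add square_integrable_integrable)
  show "(\<lambda>x. norm (f x) * norm (g x)) \<in> borel_measurable lborel"
    using f g by (auto dest!: square_integrable_measurable)
  have "norm (f x) * norm (g x) \<le> (norm (f x))\<^sup>2 + (norm (g x))\<^sup>2" for x
  proof -
    have "2 * (norm (f x) * norm (g x)) \<le> (norm (f x))\<^sup>2 + (norm (g x))\<^sup>2"
      using sum_squares_bound[of "norm (f x)" "norm (g x)"] by (simp add: mult.assoc)
    moreover have "0 \<le> norm (f x) * norm (g x)" by simp
    ultimately show ?thesis by linarith
  qed
  then show "AE x in lborel. norm (norm (f x) * norm (g x)) \<le> norm ((norm (f x))\<^sup>2 + (norm (g x))\<^sup>2)"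
    by (intro AE_I2) (auto simp: abs_mult)
qed

lemma square_integrable_inner:
  fixes f g :: "real \<Rightarrow> 'e::euclidean_space"
  assumes f: "square_integrable f" and g: "square_integrable g"
  shows "integrable lborel (\<lambda>x. f x \<bullet> g x)"
proof (rule Bochner_Integration.integrable_bound[OF square_integrable_norm_mult[OF f g]])
  show "(\<lambda>x. f x \<bullet> g x) \<in> borel_measurable lborel"
    using f g by (auto dest!: square_integrable_measurable)
  show "AE x in lborel. norm (f x \<bullet> g x) \<le> norm (norm (f x) * norm (g x))"
    by (intro AE_I2) (simp add: Cauchy_Schwarz_ineq2 abs_mult)
qed

lemma square_integrable_cmult:
  "square_integrable f \<Longrightarrow> square_integrable (\<lambda>x. c *\<^sub>R f x)"
  by (auto simp: square_integrable_def power_mult_distrib)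

lemma square_integrable_bound:
  fixes f :: "real \<Rightarrow> 'e::euclidean_space" and g :: "real \<Rightarrow> 'd::euclidean_space"
  assumes "f \<in> borel_measurable borel" "square_integrable g" "\<And>x. norm (f x) \<le> norm (g x)"
  shows "square_integrable f"
  unfolding square_integrable_def
proof (intro conjI)
  show "integrable lborel (\<lambda>x. (norm (f x))\<^sup>2)"
    by (rule Bochner_Integration.integrable_bound[OF square_integrable_integrable[OF assms(2)]])
      (use assms in \<open>auto intro!: power_mono\<close>)
qed fact

lemma l2sq_mono:
  fixes f :: "real \<Rightarrow> 'e::euclidean_space" and g :: "real \<Rightarrow> 'd::euclidean_space"
  assumes "square_integrable f" "square_integrable g" "\<And>x. norm (f x) \<le> norm (g x)"
  shows "l2sq f \<le> l2sq g"
  unfolding l2sq_def using assms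
  by (intro integral_mono) (auto intro!: power_mono square_integrable_integrable)

lemma l2sq_cmult: "l2sq (\<lambda>x. c *\<^sub>R f x) = c\<^sup>2 * l2sq f"
  by (simp add: l2sq_def power_mult_distrib)

lemma square_integrable_add:
  assumes f: "square_integrable f" and g: "square_integrable g"
  shows "square_integrable (\<lambda>x. f x + g x)"
    and "l2sq (\<lambda>x. f x + g x) = l2sq f + 2 * (LINT x|lborel. f x \<bullet> g x) + l2sq g"
proof -
  have eq: "(\<lambda>x. (norm (f x + g x))\<^sup>2) = (\<lambda>x. (norm (f x))\<^sup>2 + 2 * (f x \<bullet> g x) + (norm (g x))\<^sup>2)"
    by (auto simp: power2_norm_eq_inner inner_simps inner_commute)
  note int = square_integrable_integrable[OF f] square_integrable_integrable[OF g]
    square_integrable_inner[OF f g]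
  show "square_integrable (\<lambda>x. f x + g x)"
    using f g int by (auto simp: square_integrable_def eq)
  show "l2sq (\<lambda>x. f x + g x) = l2sq f + 2 * (LINT x|lborel. f x \<bullet> g x) + l2sq g"
    using int by (simp add: l2sq_def eq)
qed

lemma square_integrable_diff:
  assumes f: "square_integrable f" and g: "square_integrable g"
  shows "square_integrable (\<lambda>x. f x - g x)"
    and "l2sq (\<lambda>x. f x - g x) = l2sq f - 2 * (LINT x|lborel. f x \<bullet> g x) + l2sq g"
proof -
  have g': "square_integrable (\<lambda>x. - g x)" "l2sq (\<lambda>x. - g x) = l2sq g"
    using square_integrable_cmult[OF g, of "-1"] l2sq_cmult[of "-1" g] by auto
  show "square_integrable (\<lambda>x. f x - g x)"
    "l2sq (\<lambda>x. f x - g x) = l2sq f - 2 * (LINT x|lborel. f x \<bullet> g x) + l2sq g"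
    using square_integrable_add[OF f g'(1)] by (auto simp: g'(2))
qed

lemma quadratic_discriminant_bound:
  fixes A B I :: real
  assumes q: "\<And>t. 0 \<le> t\<^sup>2 * A - 2 * t * I + B" and "0 \<le> A"
  shows "I\<^sup>2 \<le> A * B"
proof (cases "A = 0")
  case True
  have "I = 0"
  proof (rule ccontr)
    assume "I \<noteq> 0"
    \<comment> \<open>For \<open>A = 0\<close> the quadratic is linear in \<open>t\<close>, and this
      argument makes it equal to -1.\<close>
    with q[of "(B + 1) / (2 * I)"] True show False by simp
  qed
  with True show ?thesis by simp
next
  case False
  with \<open>0 \<le> A\<close> have A: "0 < A" by simp
  have "0 \<le> A * ((I / A)\<^sup>2 * A - 2 * (I / A) * I + B)" using q[of "I / A"] A by simp
  also have "\<dots> = A * B - I\<^sup>2" using A by (simp add: field_simps power2_eq_square)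
  finally show ?thesis by simp
qed

text \<open>Integrating the square of \<open>t * norm (f x) - norm (g x)\<close> gives a nonnegative
  quadratic in \<open>t\<close>. Working with norms lets the two functions take values in different
  spaces.\<close>

lemma l2_Cauchy_Schwarz:
  fixes f :: "real \<Rightarrow> 'e::euclidean_space" and g :: "real \<Rightarrow> 'd::euclidean_space"
  assumes f: "square_integrable f" and g: "square_integrable g"
  shows "(LINT x|lborel. norm (f x) * norm (g x))\<^sup>2 \<le> l2sq f * l2sq g"
proof (rule quadratic_discriminant_bound)
  fix t :: real
  have "0 \<le> (LINT x|lborel. (t * norm (f x) - norm (g x))\<^sup>2)" by (rule Bochner_Integration.integral_nonneg) simp
  also have "(\<lambda>x. (t * norm (f x) - norm (g x))\<^sup>2) =
      (\<lambda>x. t\<^sup>2 * (norm (f x))\<^sup>2 - 2 * t * (norm (f x) * norm (g x)) + (norm (g x))\<^sup>2)"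
    by (auto simp: power2_eq_square algebra_simps)
  also have "(LINT x|lborel. t\<^sup>2 * (norm (f x))\<^sup>2 - 2 * t * (norm (f x) * norm (g x)) + (norm (g x))\<^sup>2)
      = t\<^sup>2 * l2sq f - 2 * t * (LINT x|lborel. norm (f x) * norm (g x)) + l2sq g"
    using square_integrable_integrable[OF f] square_integrable_integrable[OF g]
      square_integrable_norm_mult[OF f g] by (simp add: l2sq_def)
  finally show "0 \<le> t\<^sup>2 * l2sq f - 2 * t * (LINT x|lborel. norm (f x) * norm (g x)) + l2sq g" .
qed simp

lemma l2_inner_bound:
  fixes f g :: "real \<Rightarrow> 'e::euclidean_space"
  assumes f: "square_integrable f" and g: "square_integrable g"
  shows "\<bar>LINT x|lborel. f x \<bullet> g x\<bar> \<le> sqrt (l2sq f) * sqrt (l2sq g)"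
proof -
  have "\<bar>LINT x|lborel. f x \<bullet> g x\<bar> \<le> (LINT x|lborel. \<bar>f x \<bullet> g x\<bar>)"
    using integral_norm_bound[of lborel "\<lambda>x. f x \<bullet> g x"] by simp
  also have "\<dots> \<le> (LINT x|lborel. norm (f x) * norm (g x))"
    using square_integrable_inner[OF f g] square_integrable_norm_mult[OF f g]
    by (intro integral_mono) (auto simp: Cauchy_Schwarz_ineq2)
  also have "\<dots> \<le> sqrt (l2sq f * l2sq g)"
    using l2_Cauchy_Schwarz[OF f g] by (simp add: real_le_rsqrt)
  finally show ?thesis by (simp add: real_sqrt_mult)
qed

lemma l2_triangle:
  assumes f: "square_integrable f" and g: "square_integrable g"
  shows "sqrt (l2sq (\<lambda>x. f x + g x)) \<le> sqrt (l2sq f) + sqrt (l2sq g)"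
proof (rule real_le_lsqrt)
  show "l2sq (\<lambda>x. f x + g x) \<le> (sqrt (l2sq f) + sqrt (l2sq g))\<^sup>2"
    using l2_inner_bound[OF f g]
    by (simp add: square_integrable_add(2)[OF f g] power2_sum)
qed simp

lemma l2sq_translate: "l2sq (\<lambda>x. f (x + c)) = l2sq f"
  unfolding l2sq_def
  using lborel_integral_real_affine[of 1 "\<lambda>x. (norm (f x))\<^sup>2" c] by (simp add: add.commute)

lemma square_integrable_translate:
  "square_integrable f \<Longrightarrow> square_integrable (\<lambda>x. f (x + c))"
  using lborel_integrable_real_affine[of "\<lambda>x. (norm (f x))\<^sup>2" 1 c]
  by (auto simp: square_integrable_def add.commute)

lemma square_integrable_indicator:
  assumes f: "square_integrable f" and [measurable]: "A \<in> sets borel"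
  shows "square_integrable (\<lambda>x. indicator A x *\<^sub>R f x)"
  by (rule square_integrable_bound[OF _ f])
    (use f in \<open>auto simp: indicator_def dest: square_integrable_measurable\<close>)

text \<open>Cauchy--Schwarz against the indicator of the interval. The third bound keeps only the
  local integral of the square on the right; the difference quotient estimate integrates it over all
  translates.\<close>

lemma l2_set_integrable:
  assumes f: "square_integrable f"
  shows "set_integrable lborel {a..b} f"
    and "norm (LINT x:{a..b}|lborel. f x) \<le> sqrt \<bar>b - a\<bar> * sqrt (l2sq f)"
    and "a \<le> b \<Longrightarrow> (norm (LINT x:{a..b}|lborel. f x))\<^sup>2 \<le> (b - a) * (LINT x:{a..b}|lborel. (norm (f x))\<^sup>2)"
proof -
  have [measurable]: "f \<in> borel_measurable borel" using f by (rule square_integrable_measurable)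
  define u where "u = (\<lambda>x. indicator {a..b} x :: real)"
  have u: "square_integrable u" "l2sq u \<le> \<bar>b - a\<bar>" "a \<le> b \<Longrightarrow> l2sq u = b - a"
  proof -
    have eq: "(\<lambda>x. (norm (u x))\<^sup>2) = (\<lambda>x. indicator {a..b} x)"
      by (auto simp: u_def indicator_def)
    show "square_integrable u" "l2sq u \<le> \<bar>b - a\<bar>" "a \<le> b \<Longrightarrow> l2sq u = b - a"
      unfolding square_integrable_def l2sq_def eq
      by (auto simp: u_def measure_def emeasure_lborel_Icc_eq intro!: integrable_real_indicator)
  qed
  define f' where "f' = (\<lambda>x. indicator {a..b} x *\<^sub>R f x)"
  have f': "square_integrable f'" unfolding f'_def by (rule square_integrable_indicator[OF f]) simp
  have f'2: "l2sq f' = (LINT x:{a..b}|lborel. (norm (f x))\<^sup>2)"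
    unfolding l2sq_def f'_def set_lebesgue_integral_def
    by (intro Bochner_Integration.integral_cong) (auto simp: indicator_def)
  show int: "set_integrable lborel {a..b} f"
    unfolding set_integrable_def
    by (rule Bochner_Integration.integrable_bound[OF square_integrable_norm_mult[OF u(1) f]])
      (auto simp: u_def)
  have *: "norm (LINT x:{a..b}|lborel. f x) \<le> (LINT x|lborel. norm (u x) * norm (f' x))"
  proof -
    have "norm (LINT x:{a..b}|lborel. f x) \<le> (LINT x|lborel. norm (indicator {a..b} x *\<^sub>R f x))"
      unfolding set_lebesgue_integral_def by (rule integral_norm_bound)
    also have "(\<lambda>x. norm (indicator {a..b} x *\<^sub>R f x)) = (\<lambda>x. norm (u x) * norm (f' x))"
      by (auto simp: u_def f'_def indicator_def)
    finally show ?thesis .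
  qed
  have sq: "(norm (LINT x:{a..b}|lborel. f x))\<^sup>2 \<le> l2sq u * l2sq f'"
    using * l2_Cauchy_Schwarz[OF u(1) f'] by (meson norm_ge_zero order_trans power_mono)
  show "(norm (LINT x:{a..b}|lborel. f x))\<^sup>2 \<le> (b - a) * (LINT x:{a..b}|lborel. (norm (f x))\<^sup>2)" if "a \<le> b"
    using sq u(3)[OF that] f'2 by simp
  have "l2sq f' \<le> l2sq f" by (rule l2sq_mono[OF f' f]) (auto simp: f'_def indicator_def)
  then have "l2sq u * l2sq f' \<le> \<bar>b - a\<bar> * l2sq f" using u(2) by (intro mult_mono) auto
  with sq show "norm (LINT x:{a..b}|lborel. f x) \<le> sqrt \<bar>b - a\<bar> * sqrt (l2sq f)"
    by (simp add: real_le_rsqrt real_sqrt_mult[symmetric])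
qed

text \<open>Fatou's lemma for the squared norms; square integrability of the limit is part of the
  conclusion.\<close>

lemma l2_Fatou:
  fixes f :: "nat \<Rightarrow> real \<Rightarrow> 'e::euclidean_space"
  assumes f: "\<And>n. square_integrable (f n)" and C: "\<And>n. l2sq (f n) \<le> C"
    and g [measurable]: "g \<in> borel_measurable borel"
    and lim: "AE x in lborel. (\<lambda>n. f n x) \<longlonglongrightarrow> g x"
  shows "square_integrable g" "l2sq g \<le> C"
proof -
  have [measurable]: "f n \<in> borel_measurable borel" for n using f by (rule square_integrable_measurable)
  have C0: "0 \<le> C" using C[of 0] l2sq_nonneg[of "f 0"] by linarith
  have "(\<integral>\<^sup>+x. ennreal ((norm (g x))\<^sup>2) \<partial>lborel) = (\<integral>\<^sup>+x. liminf (\<lambda>n. ennreal ((norm (f n x))\<^sup>2)) \<partial>lborel)"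
  proof (rule nn_integral_cong_AE)
    show "AE x in lborel. ennreal ((norm (g x))\<^sup>2) = liminf (\<lambda>n. ennreal ((norm (f n x))\<^sup>2))"
      using lim
    proof eventually_elim
      case (elim x)
      then have "(\<lambda>n. ennreal ((norm (f n x))\<^sup>2)) \<longlonglongrightarrow> ennreal ((norm (g x))\<^sup>2)"
        by (intro tendsto_ennrealI tendsto_power tendsto_norm)
      then show ?case by (rule lim_imp_Liminf[OF sequentially_bot, symmetric])
    qed
  qed
  also have "\<dots> \<le> liminf (\<lambda>n. \<integral>\<^sup>+x. ennreal ((norm (f n x))\<^sup>2) \<partial>lborel)"
    by (rule nn_integral_liminf) simp
  also have "\<dots> = liminf (\<lambda>n. ennreal (l2sq (f n)))"
    unfolding l2sq_def by (subst nn_integral_eq_integral) (auto intro: square_integrable_integrable[OF f])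
  also have "\<dots> \<le> ennreal C"
    by (rule Liminf_le) (auto intro!: always_eventually ennreal_leI C)
  finally have le: "(\<integral>\<^sup>+x. ennreal ((norm (g x))\<^sup>2) \<partial>lborel) \<le> ennreal C" .
  have int: "integrable lborel (\<lambda>x. (norm (g x))\<^sup>2)"
    using le by (intro integrableI_bounded) (auto simp: order_le_less_trans[OF le])
  then show "square_integrable g" by (simp add: square_integrable_def)
  show "l2sq g \<le> C"
    using le int C0 unfolding l2sq_def by (subst (asm) nn_integral_eq_integral) auto
qed

text \<open>Riesz--Fischer. Along a subsequence the squared gaps are at most (1/4)^k, so they stay
  summable after weighting with 2^k; this makes the telescoping series converge absolutely almost
  everywhere. Fatou then turns pointwise convergence into convergence in norm.\<close>

lemma l2_complete:
  fixes h :: "nat \<Rightarrow> real \<Rightarrow> 'e::euclidean_space"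
  assumes h: "\<And>n. square_integrable (h n)"
    and Cauchy: "\<And>e. 0 < e \<Longrightarrow> \<exists>N. \<forall>m\<ge>N. \<forall>n\<ge>N. l2sq (\<lambda>x. h m x - h n x) < e"
  shows "\<exists>g. square_integrable g \<and> (\<lambda>n. l2sq (\<lambda>x. h n x - g x)) \<longlonglongrightarrow> 0"
proof -
  have [measurable]: "h n \<in> borel_measurable borel" for n using h by (rule square_integrable_measurable)
  have "\<forall>k. \<exists>N. \<forall>m\<ge>N. \<forall>n\<ge>N. l2sq (\<lambda>x. h m x - h n x) < (1/4)^k"
    using Cauchy by (meson zero_less_power zero_less_divide_1_iff zero_less_numeral)
  then obtain N where N: "\<And>k m n. N k \<le> m \<Longrightarrow> N k \<le> n \<Longrightarrow> l2sq (\<lambda>x. h m x - h n x) < (1/4)^k"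
    by metis
  \<comment> \<open>Summing the thresholds, plus one each, makes the indices strictly increasing and
    still at least \<open>N k\<close>.\<close>
  define \<kappa> where "\<kappa> k = (\<Sum>i\<le>k. N i + 1)" for k
  have \<kappa>N: "N k \<le> \<kappa> k" for k
    unfolding \<kappa>_def by (rule order_trans[OF _ member_le_sum[of k]]) auto
  have \<kappa>: "strict_mono \<kappa>" unfolding \<kappa>_def by (rule strict_monoI_Suc) auto
  define u where "u k = h (\<kappa> k)" for k
  define d where "d k x = norm (u (Suc k) x - u k x)" for k x
  have [measurable]: "u k \<in> borel_measurable borel" for k unfolding u_def by simp
  have [measurable]: "d k \<in> borel_measurable borel" for k unfolding d_def by simp
  have dint: "integrable lborel (\<lambda>x. (d k x)\<^sup>2)" "(LINT x|lborel. (d k x)\<^sup>2) \<le> (1/4)^k" for k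
  proof -
    show "integrable lborel (\<lambda>x. (d k x)\<^sup>2)"
      unfolding d_def u_def by (rule square_integrable_integrable[OF square_integrable_diff(1)[OF h h]])
    have "N k \<le> \<kappa> (Suc k)" using \<kappa>N[of k] strict_monoD[OF \<kappa>, of k "Suc k"] by simp
    then show "(LINT x|lborel. (d k x)\<^sup>2) \<le> (1/4)^k"
      using N[of k "\<kappa> (Suc k)" "\<kappa> k"] \<kappa>N[of k] by (simp add: d_def u_def l2sq_def)
  qed
  have "(\<integral>\<^sup>+x. (\<Sum>k. ennreal (2^k * (d k x)\<^sup>2)) \<partial>lborel) = (\<Sum>k. \<integral>\<^sup>+x. ennreal (2^k * (d k x)\<^sup>2) \<partial>lborel)"
    by (rule nn_integral_suminf) simp
  also have "\<dots> \<le> (\<Sum>k. ennreal ((1/2)^k))"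
  proof (rule suminf_le)
    fix k
    have "(\<integral>\<^sup>+x. ennreal (2^k * (d k x)\<^sup>2) \<partial>lborel) = ennreal (2^k * (LINT x|lborel. (d k x)\<^sup>2))"
      using dint(1)[of k] by (subst nn_integral_eq_integral) auto
    also have "\<dots> \<le> ennreal (2^k * (1/4)^k)"
      by (intro ennreal_leI mult_left_mono dint) auto
    also have "2^k * (1/4)^k = ((1/2)^k :: real)" by (simp add: power_mult_distrib[symmetric])
    finally show "(\<integral>\<^sup>+x. ennreal (2^k * (d k x)\<^sup>2) \<partial>lborel) \<le> ennreal ((1/2)^k)" .
  qed auto
  also have "\<dots> < \<infinity>"
    by (subst suminf_ennreal2) (auto simp: summable_geometric)
  finally have "AE x in lborel. (\<Sum>k. ennreal (2^k * (d k x)\<^sup>2)) \<noteq> \<infinity>"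
    by (intro nn_integral_noteq_infinite) auto
  then have conv: "AE x in lborel. convergent (\<lambda>k. u k x)"
  proof eventually_elim
    case (elim x)
    have s: "summable (\<lambda>k. 2^k * (d k x)\<^sup>2)"
      using elim by (intro summable_suminf_not_top) auto
    have "summable (\<lambda>k. norm (u (Suc k) x - u k x))"
    proof (rule summable_comparison_test')
      show "summable (\<lambda>k. 2^k * (d k x)\<^sup>2 + (1/2)^k)"
        using s by (intro summable_add summable_geometric) auto
      fix k :: nat
      \<comment> \<open>Young's inequality: it trades the square, which is controlled, for the first
        power, at the price of the summable term (1/2)^k.\<close>
      have "0 \<le> 2^k * (d k x - (1/2)^k)\<^sup>2" by simp
      also have "\<dots> = 2^k * (d k x)\<^sup>2 - 2 * d k x * (2 * (1/2))^k + (1/2)^k * (2*(1/2))^k"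
        unfolding power_mult_distrib by (simp add: power2_eq_square algebra_simps)
      finally have "2 * d k x \<le> 2^k * (d k x)\<^sup>2 + (1/2)^k" by simp
      moreover have "0 \<le> d k x" by (simp add: d_def)
      ultimately show "norm (norm (u (Suc k) x - u k x)) \<le> 2^k * (d k x)\<^sup>2 + (1/2)^k"
        unfolding d_def[symmetric] by simp
    qed
    then have "summable (\<lambda>k. u (Suc k) x - u k x)" by (rule summable_norm_cancel)
    then have "convergent (\<lambda>n. \<Sum>k<n. u (Suc k) x - u k x)"
      by (simp add: summable_iff_convergent)
    then have "convergent (\<lambda>n. u n x - u 0 x)" by (simp only: sum_lessThan_telescope[of "\<lambda>k. u k x"])
    then have "convergent (\<lambda>n. (u n x - u 0 x) + u 0 x)" by (intro convergent_add convergent_const)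
    then show ?case by simp
  qed
  define g where "g x = lim (\<lambda>k. u k x)" for x
  have [measurable]: "g \<in> borel_measurable borel"
    unfolding g_def by (rule borel_measurable_lim_metric) simp
  have lim: "AE x in lborel. (\<lambda>k. u k x) \<longlonglongrightarrow> g x"
    using conv by eventually_elim (simp add: g_def convergent_LIMSEQ_iff)
  have close: "square_integrable (\<lambda>x. h n x - g x) \<and> l2sq (\<lambda>x. h n x - g x) \<le> (1/4)^k" if "N k \<le> n" for n k
  proof -
    have sq: "square_integrable (\<lambda>x. h n x - u (l + k) x)" for l
      unfolding u_def by (rule square_integrable_diff(1)[OF h h])
    have le: "l2sq (\<lambda>x. h n x - u (l + k) x) \<le> (1/4)^k" for l
    proof -
      have "N k \<le> \<kappa> (l + k)"
        using \<kappa>N[of k] \<kappa> by (meson le_add2 order_trans strict_mono_less_eq)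
      then show ?thesis using N[OF that] by (auto simp: u_def less_imp_le)
    qed
    have "AE x in lborel. (\<lambda>l. h n x - u (l + k) x) \<longlonglongrightarrow> h n x - g x"
      using lim by eventually_elim (intro tendsto_diff tendsto_const LIMSEQ_ignore_initial_segment)
    from l2_Fatou[OF sq le _ this] show ?thesis by simp
  qed
  show ?thesis
  proof (intro exI conjI)
    from close[of 0 "N 0"] have "square_integrable (\<lambda>x. h (N 0) x - g x)" by simp
    from square_integrable_diff(1)[OF h this, of "N 0"] show "square_integrable g" by simp
    show "(\<lambda>n. l2sq (\<lambda>x. h n x - g x)) \<longlonglongrightarrow> 0"
    proof (rule LIMSEQ_I)
      fix r :: real assume "0 < r"
      then obtain k where k: "(1/4)^k < r" using real_arch_pow_inv[of r "1/4"] by auto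
      have "norm (l2sq (\<lambda>x. h n x - g x) - 0) < r" if "N k \<le> n" for n
        using close[OF that] k by simp
      then show "\<exists>no. \<forall>n\<ge>no. norm (l2sq (\<lambda>x. h n x - g x) - 0) < r" by blast
    qed
  qed
qed

text \<open>Closed intervals form an intersection-stable generator of the Borel sets, so vanishing
  of the integral spreads to all Borel sets by a Dynkin argument. The truncation to
  \<open>{-real n..real n}\<close> makes the function integrable, as needed for complements.\<close>

lemma AE_eq_0_if_interval_integrals_eq_0:
  fixes f :: "real \<Rightarrow> 'e::euclidean_space"
  assumes int: "\<And>a b. set_integrable lborel {a..b} f"
    and eq: "\<And>a b. a \<le> b \<Longrightarrow> (LINT x:{a..b}|lborel. f x) = 0"
  shows "AE x in lborel. f x = 0"
proof -
  have zero: "AE x in lborel. indicator {-real n..real n} x *\<^sub>R f x = 0" for n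
  proof (rule sigma_finite_measure.density_zero[OF sigma_finite_lborel])
    define I where "I = {-real n..real n}"
    show int': "integrable lborel (\<lambda>x. indicator {-real n..real n} x *\<^sub>R f x)"
      using int[of "-real n" "real n"] by (simp add: set_integrable_def)
    have gen: "sets (lborel :: real measure) = sigma_sets UNIV (range (\<lambda>(a,b). {a..b::real}))"
      by (simp add: borel_eq_atLeastAtMost)
    have stable: "Int_stable (range (\<lambda>(a,b). {a..b::real}))"
      by (auto simp: Int_stable_def intro!: image_eqI[where x="(max _ _, min _ _)"])
    have subset_Pow_UNIV: "range (\<lambda>(a,b). {a..b::real}) \<subseteq> Pow UNIV" by simp
    have intA: "set_integrable lborel A (\<lambda>x. indicator {-real n..real n} x *\<^sub>R f x)" if "A \<in> sets lborel" for A
      using integrable_mult_indicator[OF that int'] by (simp add: set_integrable_def)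
    have all: "(LINT x:{-real n..real n}|lborel. f x) = 0"
      by (rule eq) simp
    fix A :: "real set" assume "A \<in> sets lborel"
    then have "A \<in> sigma_sets UNIV (range (\<lambda>(a,b). {a..b::real}))" using gen by simp
    then show "(LINT x:A|lborel. indicator {-real n..real n} x *\<^sub>R f x) = 0"
    proof (induction rule: sigma_sets_induct_disjoint[OF stable subset_Pow_UNIV, consumes 1, case_names basic empty compl union])
      case (basic A)
      then obtain a b where A: "A = {a..b}" by auto
      have "(LINT x:A|lborel. indicator {-real n..real n} x *\<^sub>R f x) = (LINT x:{max a (-real n)..min b (real n)}|lborel. f x)"
        unfolding set_lebesgue_integral_def A
        by (intro Bochner_Integration.integral_cong) (auto simp: indicator_def)
      also have "\<dots> = 0"
        by (cases "max a (-real n) \<le> min b (real n)") (use eq in \<open>auto simp: set_lebesgue_integral_def\<close>)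
      finally show ?case .
    next
      case empty
      show ?case by (simp add: set_lebesgue_integral_def)
    next
      case (compl A)
      then have A: "A \<in> sets lborel" using gen by simp
      have "(LINT x:(UNIV - A)|lborel. indicator {-real n..real n} x *\<^sub>R f x) +
          (LINT x:A|lborel. indicator {-real n..real n} x *\<^sub>R f x) = (LINT x:((UNIV - A) \<union> A)|lborel. indicator {-real n..real n} x *\<^sub>R f x)"
        by (rule set_integral_Un[symmetric]) (use A intA in auto)
      also have "\<dots> = (LINT x:{-real n..real n}|lborel. f x)"
        by (simp add: set_lebesgue_integral_def)
      finally show ?case using compl all by simp
    next
      case (union B)
      then have B: "B i \<in> sets lborel" for i using gen by auto
      have "(LINT x:(\<Union>i. B i)|lborel. indicator {-real n..real n} x *\<^sub>R f x)
        = (\<Sum>i. LINT x:B i|lborel. indicator {-real n..real n} x *\<^sub>R f x)"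
        using union B
        by (intro lebesgue_integral_countable_add intA) (auto simp: disjoint_family_on_def)
      then show ?case using union by simp
    qed
  qed
  then have "AE x in lborel. \<forall>n. indicator {-real n..real n} x *\<^sub>R f x = 0"
    unfolding AE_all_countable by blast
  then show ?thesis
  proof eventually_elim
    case (elim x)
    obtain n where "\<bar>x\<bar> \<le> real n" using real_arch_simple by blast
    then show ?case using elim[rule_format, of n] by (auto simp: indicator_def abs_le_iff split: if_splits)
  qed
qed

section \<open>Primitives and weak limits\<close>

text \<open>Local absolute continuity with derivative \<open>g\<close>, written as an integral
  identity. It fixes \<open>P\<close> at every point up to a constant, but \<open>g\<close> only up
  to a null set.\<close>

definition is_primitive :: "(real \<Rightarrow> 'e::euclidean_space) \<Rightarrow> (real \<Rightarrow> 'e) \<Rightarrow> bool" where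
  "is_primitive P g \<longleftrightarrow> (\<forall>a b. set_integrable lborel {a..b} g) \<and>
     (\<forall>a b. a \<le> b \<longrightarrow> P b - P a = (LINT x:{a..b}|lborel. g x))"

lemma is_primitiveD:
  assumes "is_primitive P g"
  shows "set_integrable lborel {a..b} g" "a \<le> b \<Longrightarrow> P b - P a = (LINT x:{a..b}|lborel. g x)"
  using assms by (auto simp: is_primitive_def)

lemma is_primitive_AE_unique:
  assumes g: "is_primitive P g" and g': "is_primitive P g'"
  shows "AE x in lborel. g x = g' x"
proof -
  have "AE x in lborel. g x - g' x = 0"
  proof (rule AE_eq_0_if_interval_integrals_eq_0)
    show "set_integrable lborel {a..b} (\<lambda>x. g x - g' x)" for a b
      using is_primitiveD(1)[OF g] is_primitiveD(1)[OF g'] by (intro set_integral_diff) auto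
    show "(LINT x:{a..b}|lborel. g x - g' x) = 0" if "a \<le> b" for a b
      using is_primitiveD[OF g] is_primitiveD[OF g'] that by (subst set_integral_diff) auto
  qed
  then show ?thesis by simp
qed

text \<open>The dyadic convex hull. Midpoints suffice for the parallelogram identity and for staying
  in balls and half-spaces, and rule induction replaces bookkeeping of convex weights.\<close>

inductive_set midpoint_hull :: "(real \<Rightarrow> 'e::euclidean_space) set \<Rightarrow> (real \<Rightarrow> 'e) set" for S where
  base: "f \<in> S \<Longrightarrow> f \<in> midpoint_hull S"
| mid: "f \<in> midpoint_hull S \<Longrightarrow> g \<in> midpoint_hull S \<Longrightarrow> (\<lambda>x. (1/2) *\<^sub>R (f x + g x)) \<in> midpoint_hull S"

lemma midpoint_hull_mono:
  assumes "S \<subseteq> T"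
  shows "midpoint_hull S \<subseteq> midpoint_hull T"
proof
  fix f assume "f \<in> midpoint_hull S"
  then show "f \<in> midpoint_hull T"
    by induction (use assms in \<open>auto intro: midpoint_hull.intros\<close>)
qed

lemma l2sq_midpoint:
  assumes f: "square_integrable f" and g: "square_integrable g"
  shows "square_integrable (\<lambda>x. (1/2) *\<^sub>R (f x + g x))"
    and "l2sq (\<lambda>x. f x - g x) = 2 * l2sq f + 2 * l2sq g - 4 * l2sq (\<lambda>x. (1/2) *\<^sub>R (f x + g x))"
proof -
  show "square_integrable (\<lambda>x. (1/2) *\<^sub>R (f x + g x))"
    by (intro square_integrable_cmult square_integrable_add f g)
  show "l2sq (\<lambda>x. f x - g x) = 2 * l2sq f + 2 * l2sq g - 4 * l2sq (\<lambda>x. (1/2) *\<^sub>R (f x + g x))"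
    unfolding l2sq_cmult by (simp add: square_integrable_diff[OF f g] square_integrable_add[OF f g] power2_eq_square
      add_divide_distrib)
qed

lemma midpoint_hull_l2:
  assumes "h \<in> midpoint_hull S" and S: "\<And>f. f \<in> S \<Longrightarrow> square_integrable f \<and> l2sq f \<le> C"
  shows "square_integrable h \<and> l2sq h \<le> C"
  using assms(1)
proof induction
  case (base f)
  then show ?case by (rule S)
next
  case (mid f g)
  then have sq: "square_integrable f" "square_integrable g" by auto
  have "0 \<le> l2sq (\<lambda>x. f x - g x)" by simp
  with l2sq_midpoint[OF sq] mid show ?case by auto
qed

lemma l2_convergence:
  fixes h :: "nat \<Rightarrow> real \<Rightarrow> 'e::euclidean_space"
  assumes h: "\<And>n. square_integrable (h n)" and g: "square_integrable g"
    and lim: "(\<lambda>n. l2sq (\<lambda>x. h n x - g x)) \<longlonglongrightarrow> 0"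
  shows "square_integrable k \<Longrightarrow> (\<lambda>n. LINT x|lborel. h n x \<bullet> k x) \<longlonglongrightarrow> (LINT x|lborel. g x \<bullet> k x)"
    and "(\<lambda>n. LINT x:{a..b}|lborel. h n x) \<longlonglongrightarrow> (LINT x:{a..b}|lborel. g x)"
    and "(\<lambda>n. l2sq (h n)) \<longlonglongrightarrow> l2sq g"
proof -
  note d = square_integrable_diff(1)[OF h g]
  have s0: "(\<lambda>n. sqrt (l2sq (\<lambda>x. h n x - g x))) \<longlonglongrightarrow> 0"
    using tendsto_real_sqrt[OF lim] by simp
  show inner: "(\<lambda>n. LINT x|lborel. h n x \<bullet> k x) \<longlonglongrightarrow> (LINT x|lborel. g x \<bullet> k x)"
    if k: "square_integrable k" for k
  proof (rule LIM_zero_cancel, rule Lim_null_comparison)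
    show "\<forall>\<^sub>F n in sequentially. norm ((LINT x|lborel. h n x \<bullet> k x) - (LINT x|lborel. g x \<bullet> k x))
        \<le> sqrt (l2sq (\<lambda>x. h n x - g x)) * sqrt (l2sq k)"
    proof (intro always_eventually allI)
      fix n
      have "(LINT x|lborel. h n x \<bullet> k x) - (LINT x|lborel. g x \<bullet> k x) = (LINT x|lborel. (h n x - g x) \<bullet> k x)"
        using square_integrable_inner[OF h k] square_integrable_inner[OF g k]
        by (subst Bochner_Integration.integral_diff[symmetric]) (auto simp: inner_diff_left)
      then show "norm ((LINT x|lborel. h n x \<bullet> k x) - (LINT x|lborel. g x \<bullet> k x))
        \<le> sqrt (l2sq (\<lambda>x. h n x - g x)) * sqrt (l2sq k)"
        using l2_inner_bound[OF d k, of n] by simp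
    qed
    show "(\<lambda>n. sqrt (l2sq (\<lambda>x. h n x - g x)) * sqrt (l2sq k)) \<longlonglongrightarrow> 0"
      using tendsto_mult_left_zero[OF s0] .
  qed
  show "(\<lambda>n. LINT x:{a..b}|lborel. h n x) \<longlonglongrightarrow> (LINT x:{a..b}|lborel. g x)"
  proof (rule LIM_zero_cancel, rule Lim_null_comparison)
    show "\<forall>\<^sub>F n in sequentially. norm ((LINT x:{a..b}|lborel. h n x) - (LINT x:{a..b}|lborel. g x))
        \<le> sqrt \<bar>b - a\<bar> * sqrt (l2sq (\<lambda>x. h n x - g x))"
    proof (intro always_eventually allI)
      fix n
      have "(LINT x:{a..b}|lborel. h n x) - (LINT x:{a..b}|lborel. g x) = (LINT x:{a..b}|lborel. h n x - g x)"
        using l2_set_integrable(1)[OF h] l2_set_integrable(1)[OF g] by (subst set_integral_diff) auto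
      then show "norm ((LINT x:{a..b}|lborel. h n x) - (LINT x:{a..b}|lborel. g x))
        \<le> sqrt \<bar>b - a\<bar> * sqrt (l2sq (\<lambda>x. h n x - g x))"
        using l2_set_integrable(2)[OF d, of a b n] by simp
    qed
    show "(\<lambda>n. sqrt \<bar>b - a\<bar> * sqrt (l2sq (\<lambda>x. h n x - g x))) \<longlonglongrightarrow> 0"
      using tendsto_mult_right_zero[OF s0] .
  qed
  have "(\<lambda>n. l2sq (\<lambda>x. h n x - g x) + 2 * (LINT x|lborel. h n x \<bullet> g x) - l2sq g) \<longlonglongrightarrow> 0 + 2 * (LINT x|lborel. g x \<bullet> g x) - l2sq g"
    by (intro tendsto_intros lim inner g)
  then show "(\<lambda>n. l2sq (h n)) \<longlonglongrightarrow> l2sq g"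
    by (simp add: square_integrable_diff(2)[OF h g]) (simp add: l2sq_def power2_norm_eq_inner)
qed

text \<open>Elements of almost minimal norm in the convex hulls of the tails form a Cauchy sequence by
  the parallelogram identity, so no weak compactness theorem for \<open>L\<^sup>2\<close> is needed.\<close>

lemma l2_bounded_midpoint_convergent:
  fixes G :: "nat \<Rightarrow> real \<Rightarrow> 'e::euclidean_space"
  assumes G: "\<And>n. square_integrable (G n)" and C: "\<And>n. l2sq (G n) \<le> C"
  shows "\<exists>h g. square_integrable g \<and> l2sq g \<le> C \<and> (\<forall>n. h n \<in> midpoint_hull (G ` {n..})) \<and>
    (\<lambda>n. l2sq (\<lambda>x. h n x - g x)) \<longlonglongrightarrow> 0"
proof -
  define H where "H n = midpoint_hull (G ` {n..})" for n
  define d where "d n = Inf (l2sq ` H n)" for n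
  have Hsq: "square_integrable f" "l2sq f \<le> C" if "f \<in> H n" for f n
    using midpoint_hull_l2[of f "G ` {n..}" C] that G C by (auto simp: H_def)
  have GH: "G n \<in> H n" for n by (auto simp: H_def intro: midpoint_hull.base)
  have bdd: "bdd_below (l2sq ` H n)" for n by (rule bdd_belowI2[of _ 0]) simp
  have Hmono: "H m \<subseteq> H n" if "n \<le> m" for m n
    unfolding H_def by (rule midpoint_hull_mono) (use that in auto)
  have dmono: "d n \<le> d m" if "n \<le> m" for n m
    unfolding d_def by (rule cInf_superset_mono) (use GH[of m] bdd Hmono[OF that] in auto)
  have dC: "d n \<le> C" for n
    unfolding d_def by (rule order_trans[OF cInf_lower[OF _ bdd] C[of n]]) (use GH in auto)
  \<comment> \<open>Later tails have smaller hulls, so the infima increase; far out they are all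
    close to \<open>D\<close>, which forces almost minimal elements to be close to each
    other.\<close>
  obtain D where D: "d \<longlonglongrightarrow> D" "\<And>n. d n \<le> D"
    using incseq_convergent[of d C] dmono dC by (auto simp: incseq_def)
  have "\<exists>f\<in>H n. l2sq f < d n + 1 / real (Suc n)" for n
  proof -
    have "\<exists>y\<in>l2sq ` H n. y < d n + 1 / real (Suc n)"
      by (rule cInf_lessD) (use GH[of n] in \<open>auto simp: d_def\<close>)
    then show ?thesis by auto
  qed
  then obtain h where h: "\<And>n. h n \<in> H n" "\<And>n. l2sq (h n) < d n + 1 / real (Suc n)" by metis
  have close: "l2sq (\<lambda>x. h m x - h n x) \<le> 4 * (D + 1 / real (Suc N)) - 4 * d N" if "N \<le> m" "N \<le> n" for m n N
  proof -
    have "(\<lambda>x. (1/2) *\<^sub>R (h m x + h n x)) \<in> H N"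
      using h(1)[of m] h(1)[of n] Hmono[OF that(1)] Hmono[OF that(2)] by (auto simp: H_def intro: midpoint_hull.mid)
    then have "d N \<le> l2sq (\<lambda>x. (1/2) *\<^sub>R (h m x + h n x))"
      unfolding d_def by (intro cInf_lower bdd) auto
    moreover have "l2sq (h k) \<le> D + 1 / real (Suc N)" if "N \<le> k" for k
    proof -
      have "1 / real (Suc k) \<le> 1 / real (Suc N)" using that by (simp add: frac_le)
      then show ?thesis using h(2)[of k] D(2)[of k] by linarith
    qed
    moreover have "c \<le> 4 * (D + q) - 4 * d" if "d \<le> M" "a \<le> D + q" "b \<le> D + q" "c = 2 * a + 2 * b - 4 * M"
      for a b c d q M :: real using that by simp
    ultimately show ?thesis
      using l2sq_midpoint(2)[OF Hsq(1)[OF h(1)] Hsq(1)[OF h(1)], of m n] that by blast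
  qed
  have "(\<lambda>N. 4 * (D + 1 / real (Suc N)) - 4 * d N) \<longlonglongrightarrow> 4 * (D + 0) - 4 * D"
    by (intro tendsto_intros D(1) LIMSEQ_Suc[OF lim_1_over_n])
  then have small: "(\<lambda>N. 4 * (D + 1 / real (Suc N)) - 4 * d N) \<longlonglongrightarrow> 0" by simp
  have "\<exists>g. square_integrable g \<and> (\<lambda>n. l2sq (\<lambda>x. h n x - g x)) \<longlonglongrightarrow> 0"
  proof (rule l2_complete[OF Hsq(1)[OF h(1)]])
    fix e :: real assume "0 < e"
    then obtain N where "4 * (D + 1 / real (Suc N)) - 4 * d N < e"
      using order_tendstoD(2)[OF small] by (auto simp: eventually_sequentially)
    then show "\<exists>N. \<forall>m\<ge>N. \<forall>n\<ge>N. l2sq (\<lambda>x. h m x - h n x) < e"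
      using close by (meson order_le_less_trans)
  qed
  then obtain g where g: "square_integrable g" "(\<lambda>n. l2sq (\<lambda>x. h n x - g x)) \<longlonglongrightarrow> 0" by blast
  have "l2sq g \<le> C"
    by (rule LIMSEQ_le_const2[OF l2_convergence(3)[OF Hsq(1)[OF h(1)] g]]) (use Hsq(2)[OF h(1)] in auto)
  with g h(1) show ?thesis unfolding H_def by blast
qed

text \<open>Stands in for the weak limit of a bounded sequence of derivatives. The assumption on
  interval integrals says that they enter every ball around \<open>P b - P a\<close>; balls are
  convex, so the convex combinations \<open>h n\<close> inherit it and their strong limit is a
  derivative of \<open>P\<close>.\<close>

lemma l2_weak_primitive:
  fixes G :: "nat \<Rightarrow> real \<Rightarrow> 'e::euclidean_space"
  assumes G: "\<And>n. square_integrable (G n)" and C: "\<And>n. l2sq (G n) \<le> C"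
    and lim: "\<And>a b. a \<le> b \<Longrightarrow> (\<lambda>n. LINT x:{a..b}|lborel. G n x) \<longlonglongrightarrow> P b - P a"
  shows "\<exists>h g. square_integrable g \<and> l2sq g \<le> C \<and> is_primitive P g \<and>
    (\<forall>n. h n \<in> midpoint_hull (G ` {n..})) \<and> (\<lambda>n. l2sq (\<lambda>x. h n x - g x)) \<longlonglongrightarrow> 0"
proof -
  obtain h g where g: "square_integrable g" "l2sq g \<le> C"
    and h: "\<And>n. h n \<in> midpoint_hull (G ` {n..})" and hg: "(\<lambda>n. l2sq (\<lambda>x. h n x - g x)) \<longlonglongrightarrow> 0"
    using l2_bounded_midpoint_convergent[of G C, OF G C] by blast
  have hsq: "square_integrable (h n)" for n
    using midpoint_hull_l2[OF h[of n], of C] G C by blast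
  have "P b - P a = (LINT x:{a..b}|lborel. g x)" if ab: "a \<le> b" for a b
  proof -
    have "(\<lambda>n. LINT x:{a..b}|lborel. h n x) \<longlonglongrightarrow> P b - P a"
    proof (rule LIMSEQ_I)
      fix r :: real assume "0 < r"
      then obtain N where N: "\<And>n. N \<le> n \<Longrightarrow> norm ((LINT x:{a..b}|lborel. G n x) - (P b - P a)) < r"
        using LIMSEQ_D[OF lim[OF ab] \<open>0 < r\<close>] by blast
      have "square_integrable f \<and> norm ((LINT x:{a..b}|lborel. f x) - (P b - P a)) < r" if "f \<in> midpoint_hull (G ` {N..})" for f
        using that
      proof induction
        case (base f)
        then show ?case using N G by auto
      next
        case (mid f g)
        then have int: "set_integrable lborel {a..b} f" "set_integrable lborel {a..b} g"
          by (auto intro: l2_set_integrable(1))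
        have "(LINT x:{a..b}|lborel. (1/2) *\<^sub>R (f x + g x)) - (P b - P a) =
          (1/2) *\<^sub>R (((LINT x:{a..b}|lborel. f x) - (P b - P a)) + ((LINT x:{a..b}|lborel. g x) - (P b - P a)))"
          using int by (simp add: set_integral_add algebra_simps flip: scaleR_add_left)
        also have "norm \<dots> < r"
          using mid norm_triangle_ineq[of "(LINT x:{a..b}|lborel. f x) - (P b - P a)" "(LINT x:{a..b}|lborel. g x) - (P b - P a)"]
          by simp
        finally show ?case using mid l2sq_midpoint(1) by auto
      qed
      then have "norm ((LINT x:{a..b}|lborel. h n x) - (P b - P a)) < r" if "N \<le> n" for n
        using h[of n] midpoint_hull_mono[of "G ` {n..}" "G ` {N..}"] that by (auto simp: image_mono)
      then show "\<exists>no. \<forall>n\<ge>no. norm ((LINT x:{a..b}|lborel. h n x) - (P b - P a)) < r" by blast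
    qed
    then show ?thesis using l2_convergence(2)[OF hsq g(1) hg] LIMSEQ_unique by blast
  qed
  then have "is_primitive P g" using l2_set_integrable(1)[OF g(1)] by (simp add: is_primitive_def)
  with g h hg show ?thesis by blast
qed

text \<open>If the inner products stayed off by \<open>e\<close> along a subsequence, so would those
  of all its convex combinations, because half-spaces are convex. But some of these converge
  strongly to a derivative of \<open>P\<close>, which equals \<open>g\<close> almost everywhere. The
  sign \<open>s\<close> treats both directions at once.\<close>

lemma l2_weak_inner_limit:
  fixes G :: "nat \<Rightarrow> real \<Rightarrow> 'e::euclidean_space"
  assumes G: "\<And>n. square_integrable (G n)" and C: "\<And>n. l2sq (G n) \<le> C"
    and lim: "\<And>a b. a \<le> b \<Longrightarrow> (\<lambda>n. LINT x:{a..b}|lborel. G n x) \<longlonglongrightarrow> P b - P a"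
    and g: "square_integrable g" "is_primitive P g"
  shows "(\<lambda>n. LINT x|lborel. G n x \<bullet> g x) \<longlonglongrightarrow> l2sq g"
proof -
  have ev: "\<forall>\<^sub>F n in sequentially. s * (LINT x|lborel. G n x \<bullet> g x) < s * l2sq g + e" if "0 < e" for e s :: real
  proof (rule ccontr)
    assume "\<not> ?thesis"
    then have "\<exists>\<^sub>F n in sequentially. s * (LINT x|lborel. G n x \<bullet> g x) \<ge> s * l2sq g + e"
      by (simp add: not_eventually not_less)
    then have "infinite {n. s * (LINT x|lborel. G n x \<bullet> g x) \<ge> s * l2sq g + e}"
      by (simp add: INFM_iff_infinite frequently_cofinite[symmetric] cofinite_eq_sequentially)
    then obtain \<kappa> :: "nat \<Rightarrow> nat" where \<kappa>: "strict_mono \<kappa>"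
      "\<And>n. s * (LINT x|lborel. G (\<kappa> n) x \<bullet> g x) \<ge> s * l2sq g + e"
      using infinite_enumerate by blast
    have "(\<lambda>n. LINT x:{a..b}|lborel. G (\<kappa> n) x) \<longlonglongrightarrow> P b - P a" if "a \<le> b" for a b
      using LIMSEQ_subseq_LIMSEQ[OF lim[OF that] \<kappa>(1)] by (simp add: o_def)
    from l2_weak_primitive[of "\<lambda>n. G (\<kappa> n)" C, OF G C this] obtain h g'
      where g': "square_integrable g'" "is_primitive P g'"
        and h: "\<And>n. h n \<in> midpoint_hull ((\<lambda>n. G (\<kappa> n)) ` {n..})" and hg: "(\<lambda>n. l2sq (\<lambda>x. h n x - g' x)) \<longlonglongrightarrow> 0"
      by blast
    have *: "square_integrable f \<and> s * (LINT x|lborel. f x \<bullet> g x) \<ge> s * l2sq g + e"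
      if "f \<in> midpoint_hull ((\<lambda>n. G (\<kappa> n)) ` {n..})" for f n
      using that
    proof induction
      case (base f)
      then show ?case using \<kappa>(2) G by auto
    next
      case (mid f h)
      have "(LINT x|lborel. ((1/2) *\<^sub>R (f x + h x)) \<bullet> g x) = (1/2) * ((LINT x|lborel. f x \<bullet> g x) + (LINT x|lborel. h x \<bullet> g x))"
        using mid square_integrable_inner[OF _ g(1)] by (simp add: inner_add_left)
      with mid show ?case using l2sq_midpoint(1)[of f h] by (simp add: distrib_left)
    qed
    then have hsq: "square_integrable (h n)" for n using h by blast
    have "(\<lambda>n. s * (LINT x|lborel. h n x \<bullet> g x)) \<longlonglongrightarrow> s * (LINT x|lborel. g' x \<bullet> g x)"
      by (intro tendsto_mult tendsto_const l2_convergence(1)[OF hsq g'(1) hg g(1)])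
    moreover have "(LINT x|lborel. g' x \<bullet> g x) = l2sq g"
    proof -
      have "AE x in lborel. g' x \<bullet> g x = (norm (g x))\<^sup>2"
        using is_primitive_AE_unique[OF g'(2) g(2)] by eventually_elim (simp add: power2_norm_eq_inner)
      then show ?thesis unfolding l2sq_def
        using g' g by (intro integral_cong_AE) (auto dest!: square_integrable_measurable)
    qed
    ultimately have "s * l2sq g + e \<le> s * l2sq g"
      using * h by (intro LIMSEQ_le_const[where X="\<lambda>n. s * (LINT x|lborel. h n x \<bullet> g x)"]) auto
    with \<open>0 < e\<close> show False by simp
  qed
  show ?thesis
  proof (rule LIMSEQ_I)
    fix r :: real assume "0 < r"
    have "\<forall>\<^sub>F n in sequentially. norm ((LINT x|lborel. G n x \<bullet> g x) - l2sq g) < r"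
      using ev[OF \<open>0 < r\<close>, of 1] ev[OF \<open>0 < r\<close>, of "-1"] by eventually_elim (auto simp: abs_less_iff)
    then show "\<exists>no. \<forall>n\<ge>no. norm ((LINT x|lborel. G n x \<bullet> g x) - l2sq g) < r"
      by (simp add: eventually_sequentially)
  qed
qed

section \<open>Sobolev functions on the line\<close>

text \<open>A function of class H^1 in its continuous representative, carried together with its
  derivative, so that no derivative ever has to be chosen.\<close>

definition sobolev :: "(real \<Rightarrow> 'e::euclidean_space) \<Rightarrow> (real \<Rightarrow> 'e) \<Rightarrow> bool" where
  "sobolev P g \<longleftrightarrow> square_integrable P \<and> square_integrable g \<and> is_primitive P g"

lemma sobolevD:
  assumes "sobolev P g"
  shows "square_integrable P" "square_integrable g" "is_primitive P g"
  using assms by (auto simp: sobolev_def)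

lemma sobolev_Hoelder:
  assumes "sobolev P g"
  shows "norm (P y - P x) \<le> sqrt \<bar>y - x\<bar> * sqrt (l2sq g)"
proof -
  have *: "norm (P b - P a) \<le> sqrt \<bar>b - a\<bar> * sqrt (l2sq g)" if "a \<le> b" for a b
    using is_primitiveD(2)[OF sobolevD(3)[OF assms] that] l2_set_integrable(2)[OF sobolevD(2)[OF assms], of a b] by simp
  show ?thesis using *[of x y] *[of y x] by (cases "x \<le> y") (auto simp: norm_minus_commute abs_minus_commute)
qed

lemma sobolev_isCont:
  assumes "sobolev P g"
  shows "isCont P x"
  unfolding isCont_def
proof (rule LIM_zero_cancel, rule Lim_null_comparison)
  show "\<forall>\<^sub>F y in at x. norm (P y - P x) \<le> sqrt \<bar>y - x\<bar> * sqrt (l2sq g)"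
    by (intro always_eventually allI sobolev_Hoelder assms)
  have "((\<lambda>y. sqrt \<bar>y - x\<bar> * sqrt (l2sq g)) \<longlongrightarrow> sqrt \<bar>x - x\<bar> * sqrt (l2sq g)) (at x)"
    by (intro tendsto_intros)
  then show "((\<lambda>y. sqrt \<bar>y - x\<bar> * sqrt (l2sq g)) \<longlongrightarrow> 0) (at x)" by simp
qed

lemma square_integrable_norm: "square_integrable f \<Longrightarrow> square_integrable (\<lambda>x. norm (f x))"
  by (auto simp: square_integrable_def)

lemma l2sq_norm: "l2sq (\<lambda>x. norm (f x)) = l2sq f"
  by (simp add: l2sq_def)

text \<open>Average over \<open>{x..x+h}\<close>: there the norm of \<open>P\<close> is at least
  \<open>norm (P x)\<close> minus the Hoelder error, and Cauchy--Schwarz bounds the average from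
  above. The length \<open>h\<close> is left free for optimization.\<close>

lemma sobolev_sup_bound_scaled:
  assumes P: "sobolev P g" and h: "0 < h"
  shows "norm (P x) \<le> sqrt (l2sq P) / sqrt h + sqrt h * sqrt (l2sq g)"
proof -
  define D where "D = sqrt h * sqrt (l2sq g)"
  note sq = square_integrable_norm[OF sobolevD(1)[OF P]]
  have pt: "norm (P x) - D \<le> norm (P y)" if "y \<in> {x..x+h}" for y
  proof -
    have "norm (P y - P x) \<le> sqrt \<bar>y - x\<bar> * sqrt (l2sq g)" by (rule sobolev_Hoelder[OF P])
    also have "\<dots> \<le> D" unfolding D_def using that by (intro mult_right_mono) auto
    finally show ?thesis using norm_triangle_ineq3[of "P y" "P x"] by linarith
  qed
  have ind: "integrable lborel (indicat_real {x..x+h})"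
    by (rule integrable_real_indicator) (auto simp: emeasure_lborel_Icc_eq)
  have "h * (norm (P x) - D) = (LINT y:{x..x+h}|lborel. norm (P x) - D)"
    using h by (simp add: set_lebesgue_integral_def measure_def)
  also have "\<dots> \<le> (LINT y:{x..x+h}|lborel. norm (P y))"
    using pt by (intro set_integral_mono l2_set_integrable(1)[OF sq]) (auto simp: set_integrable_def ind)
  also have "\<dots> \<le> sqrt h * sqrt (l2sq P)"
    using l2_set_integrable(2)[OF sq, of x "x+h"] h by (simp add: l2sq_norm)
  finally have "norm (P x) - D \<le> sqrt h * sqrt (l2sq P) / h"
    using h by (simp add: pos_le_divide_eq mult.commute)
  also have "\<dots> = sqrt (l2sq P) / sqrt h"
    using h by (simp add: field_simps)
  finally show ?thesis unfolding D_def by simp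
qed

text \<open>The Gagliardo--Nirenberg inequality: \<open>h = A / B\<close> balances the two terms.
  Positive majorants \<open>A\<close> and \<open>B\<close> are used because the norms themselves may
  vanish.\<close>

lemma sobolev_sup_bound:
  assumes P: "sobolev P g" and "sqrt (l2sq P) \<le> A" "sqrt (l2sq g) \<le> B" "0 < A" "0 < B"
  shows "norm (P x) \<le> 2 * sqrt (A * B)"
proof -
  have "norm (P x) \<le> sqrt (l2sq P) / sqrt (A / B) + sqrt (A / B) * sqrt (l2sq g)"
    by (rule sobolev_sup_bound_scaled[OF P]) (use assms in auto)
  also have "\<dots> \<le> A / sqrt (A / B) + sqrt (A / B) * B"
    using assms by (intro add_mono divide_right_mono mult_left_mono) auto
  also have "A / sqrt (A / B) = sqrt (A * B)"
    using assms by (simp add: real_sqrt_divide real_sqrt_mult field_simps)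
  also have "sqrt (A / B) * B = sqrt (A * B)"
    using assms by (simp add: real_sqrt_divide real_sqrt_mult field_simps)
  finally show ?thesis by simp
qed

lemma sobolev_bounded:
  fixes P :: "real \<Rightarrow> 'e::euclidean_space"
  assumes "sobolev P g"
  shows "norm (P x) \<le> sqrt (l2sq P) + sqrt (l2sq g)"
  using sobolev_sup_bound_scaled[OF assms, of 1] by simp

section \<open>Linear operations on Sobolev functions\<close>

lemma square_integrable_linear:
  fixes f :: "real \<Rightarrow> 'e::euclidean_space" and T :: "'e \<Rightarrow> 'd::euclidean_space"
  assumes f: "square_integrable f" and T: "linear T"
  shows "square_integrable (\<lambda>x. T (f x))"
proof -
  obtain B where B: "\<And>x. norm (T x) \<le> B * norm x" "0 < B" using linear_bounded_pos[OF T] by blast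
  have [measurable]: "f \<in> borel_measurable borel" using f by (rule square_integrable_measurable)
  have [measurable]: "T \<in> borel_measurable borel"
    by (intro borel_measurable_continuous_onI linear_continuous_on linear_conv_bounded_linear[THEN iffD1] T)
  show ?thesis
    by (rule square_integrable_bound[OF _ square_integrable_cmult[OF f, of B]]) (use B in auto)
qed

lemma is_primitive_linear:
  fixes P :: "real \<Rightarrow> 'e::euclidean_space" and T :: "'e \<Rightarrow> 'd::euclidean_space"
  assumes P: "is_primitive P g" and T: "linear T"
  shows "is_primitive (\<lambda>x. T (P x)) (\<lambda>x. T (g x))"
proof -
  have bl: "bounded_linear T" using T by (simp add: linear_conv_bounded_linear)
  have eq: "indicator {a..b} x *\<^sub>R T (g x) = T (indicator {a..b} x *\<^sub>R g x)" for a b x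
    by (simp add: linear_scale[OF T])
  note int = is_primitiveD(1)[OF P, unfolded set_integrable_def]
  show ?thesis
    unfolding is_primitive_def set_integrable_def set_lebesgue_integral_def eq
    using is_primitiveD(2)[OF P, unfolded set_lebesgue_integral_def] int
    by (auto intro!: integrable_bounded_linear[OF bl]
        simp: integral_bounded_linear[OF bl] linear_diff[OF T, symmetric])
qed

lemma sobolev_linear:
  fixes P :: "real \<Rightarrow> 'e::euclidean_space" and T :: "'e \<Rightarrow> 'd::euclidean_space"
  assumes "sobolev P g" "linear T"
  shows "sobolev (\<lambda>x. T (P x)) (\<lambda>x. T (g x))"
  using assms by (auto simp: sobolev_def intro: square_integrable_linear is_primitive_linear)

lemma is_primitive_add:
  assumes P: "is_primitive P g" and Q: "is_primitive Q k"
  shows "is_primitive (\<lambda>x. P x + Q x) (\<lambda>x. g x + k x)"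
  unfolding is_primitive_def
proof (intro conjI allI impI)
  fix a b :: real
  note int = is_primitiveD(1)[OF P, of a b] is_primitiveD(1)[OF Q, of a b]
  show "set_integrable lborel {a..b} (\<lambda>x. g x + k x)" using int by (rule set_integral_add(1))
  assume "a \<le> b"
  then show "P b + Q b - (P a + Q a) = (LINT x:{a..b}|lborel. g x + k x)"
    unfolding set_integral_add(2)[OF int] add_diff_add
    using is_primitiveD(2)[OF P, of a b] is_primitiveD(2)[OF Q, of a b] by simp
qed

lemma sobolev_add:
  "sobolev P g \<Longrightarrow> sobolev Q k \<Longrightarrow> sobolev (\<lambda>x. P x + Q x) (\<lambda>x. g x + k x)"
  by (auto simp: sobolev_def intro: square_integrable_add(1) is_primitive_add)

lemma sobolev_cmult: "sobolev P g \<Longrightarrow> sobolev (\<lambda>x. c *\<^sub>R P x) (\<lambda>x. c *\<^sub>R g x)"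
  by (rule sobolev_linear) (auto intro: linearI simp: scaleR_add_right)

lemma sobolev_diff:
  "sobolev P g \<Longrightarrow> sobolev Q k \<Longrightarrow> sobolev (\<lambda>x. P x - Q x) (\<lambda>x. g x - k x)"
  using sobolev_add[of P g "\<lambda>x. (-1) *\<^sub>R Q x" "\<lambda>x. (-1) *\<^sub>R k x"] sobolev_cmult[of Q k "-1"] by simp

section \<open>Translations and difference quotients\<close>

lemma set_lborel_integral_shift:
  fixes g :: "real \<Rightarrow> 'e::euclidean_space"
  shows "(LINT x:{a..b}|lborel. g (x + c)) = (LINT x:{a+c..b+c}|lborel. g x)"
    and "set_integrable lborel {a+c..b+c} g \<Longrightarrow> set_integrable lborel {a..b} (\<lambda>x. g (x + c))"
proof -
  have eq: "indicator {a+c..b+c} (c + 1 * x) *\<^sub>R g (c + 1 * x) = indicator {a..b} x *\<^sub>R g (x + c)" for x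
    by (auto simp: indicator_def add.commute)
  show "(LINT x:{a..b}|lborel. g (x + c)) = (LINT x:{a+c..b+c}|lborel. g x)"
    unfolding set_lebesgue_integral_def
    using lborel_integral_real_affine[of 1 "\<lambda>x. indicator {a+c..b+c} x *\<^sub>R g x" c] by (simp add: eq[simplified])
  show "set_integrable lborel {a..b} (\<lambda>x. g (x + c))" if "set_integrable lborel {a+c..b+c} g"
    using lborel_integrable_real_affine[of "\<lambda>x. indicator {a+c..b+c} x *\<^sub>R g x" 1 c] that
    unfolding set_integrable_def by (simp add: eq[simplified])
qed

lemma is_primitive_translate:
  assumes "is_primitive P g"
  shows "is_primitive (\<lambda>x. P (x + c)) (\<lambda>x. g (x + c))"
  unfolding is_primitive_def
  using is_primitiveD[OF assms] by (auto intro: set_lborel_integral_shift(2) simp: set_lborel_integral_shift(1))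

lemma sobolev_translate: "sobolev P g \<Longrightarrow> sobolev (\<lambda>x. P (x + c)) (\<lambda>x. g (x + c))"
  by (auto simp: sobolev_def intro: square_integrable_translate is_primitive_translate)

text \<open>Cauchy--Schwarz on an interval of length \<open>h\<close> costs one factor
  \<open>h\<close>; Tonelli's theorem and translation invariance contribute the second one.\<close>

lemma sobolev_difference_quotient:
  fixes P :: "real \<Rightarrow> 'e::euclidean_space"
  assumes P: "sobolev P g" and h: "0 < h"
  shows "l2sq (\<lambda>x. (1/h) *\<^sub>R (P (x + h) - P x)) \<le> l2sq g"
proof -
  note [measurable] = square_integrable_measurable[OF sobolevD(2)[OF P]] square_integrable_measurable[OF sobolevD(1)[OF P]]
  have sqd: "square_integrable (\<lambda>x. P (x + h) - P x)"
    by (intro square_integrable_diff(1) square_integrable_translate sobolevD(1)[OF P])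
  have pt: "ennreal ((norm (P (x + h) - P x))\<^sup>2) \<le> ennreal h * (\<integral>\<^sup>+t. indicator {0..h} t * ennreal ((norm (g (x + t)))\<^sup>2) \<partial>lborel)" for x
  proof -
    note sqx = square_integrable_translate[OF sobolevD(2)[OF P], of x]
    have "P (x + h) - P x = (LINT t:{0..h}|lborel. g (t + x))"
      using is_primitiveD(2)[OF sobolevD(3)[OF P], of x "x+h"] h
      by (simp add: set_lborel_integral_shift add.commute)
    then have "(norm (P (x + h) - P x))\<^sup>2 \<le> h * (LINT t:{0..h}|lborel. (norm (g (t + x)))\<^sup>2)"
      using l2_set_integrable(3)[OF sqx, of 0 h] h by simp
    then have "ennreal ((norm (P (x + h) - P x))\<^sup>2) \<le> ennreal (h * (LINT t:{0..h}|lborel. (norm (g (t + x)))\<^sup>2))"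
      by (rule ennreal_leI)
    also have "\<dots> = ennreal h * ennreal (LINT t|lborel. indicator {0..h} t * (norm (g (t + x)))\<^sup>2)"
      using h by (simp add: ennreal_mult set_lebesgue_integral_def)
    also have "ennreal (LINT t|lborel. indicator {0..h} t * (norm (g (t + x)))\<^sup>2) = (\<integral>\<^sup>+t. ennreal (indicator {0..h} t * (norm (g (t + x)))\<^sup>2) \<partial>lborel)"
      using integrable_mult_indicator[OF _ square_integrable_integrable[OF sqx], of "{0..h}"]
      by (subst nn_integral_eq_integral) auto
    also have "\<dots> = (\<integral>\<^sup>+t. indicator {0..h} t * ennreal ((norm (g (x + t)))\<^sup>2) \<partial>lborel)"
      by (intro nn_integral_cong) (auto simp: indicator_def add.commute)
    finally show ?thesis .
  qed
  have "ennreal (l2sq (\<lambda>x. P (x + h) - P x)) = (\<integral>\<^sup>+x. ennreal ((norm (P (x + h) - P x))\<^sup>2) \<partial>lborel)"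
    unfolding l2sq_def using square_integrable_integrable[OF sqd] by (subst nn_integral_eq_integral) auto
  also have "\<dots> \<le> (\<integral>\<^sup>+x. ennreal h * (\<integral>\<^sup>+t. indicator {0..h} t * ennreal ((norm (g (x + t)))\<^sup>2) \<partial>lborel) \<partial>lborel)"
    by (intro nn_integral_mono pt)
  also have "\<dots> = ennreal h * (\<integral>\<^sup>+x. (\<integral>\<^sup>+t. indicator {0..h} t * ennreal ((norm (g (x + t)))\<^sup>2) \<partial>lborel) \<partial>lborel)"
    by (rule nn_integral_cmult) measurable
  also have "(\<integral>\<^sup>+x. (\<integral>\<^sup>+t. indicator {0..h} t * ennreal ((norm (g (x + t)))\<^sup>2) \<partial>lborel) \<partial>lborel) =
      (\<integral>\<^sup>+t. (\<integral>\<^sup>+x. indicator {0..h} t * ennreal ((norm (g (x + t)))\<^sup>2) \<partial>lborel) \<partial>lborel)"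
    by (rule lborel_pair.Fubini') measurable
  also have "\<dots> = (\<integral>\<^sup>+t. ennreal (l2sq g) * indicator {0..h} t \<partial>lborel)"
  proof (intro nn_integral_cong)
    fix t :: real
    have "(\<integral>\<^sup>+x. indicator {0..h} t * ennreal ((norm (g (x + t)))\<^sup>2) \<partial>lborel) = indicator {0..h} t * (\<integral>\<^sup>+x. ennreal ((norm (g (x + t)))\<^sup>2) \<partial>lborel)"
      by (rule nn_integral_cmult) measurable
    also have "(\<integral>\<^sup>+x. ennreal ((norm (g (x + t)))\<^sup>2) \<partial>lborel) = ennreal (l2sq (\<lambda>x. g (x + t)))"
      unfolding l2sq_def
      using square_integrable_integrable[OF square_integrable_translate[OF sobolevD(2)[OF P], of t]]
      by (subst nn_integral_eq_integral) auto
    finally show "(\<integral>\<^sup>+x. indicator {0..h} t * ennreal ((norm (g (x + t)))\<^sup>2) \<partial>lborel) = ennreal (l2sq g) * indicator {0..h} t"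
      by (simp add: l2sq_translate mult.commute)
  qed
  also have "\<dots> = ennreal (l2sq g) * ennreal h"
    using h by (subst nn_integral_cmult_indicator) auto
  also have "ennreal h * (ennreal (l2sq g) * ennreal h) = ennreal (h\<^sup>2 * l2sq g)"
    using h by (simp add: ennreal_mult[symmetric] power2_eq_square mult_ac)
  finally have "l2sq (\<lambda>x. P (x + h) - P x) \<le> h\<^sup>2 * l2sq g" by (simp add: ennreal_le_iff)
  then have "(1/h)\<^sup>2 * l2sq (\<lambda>x. P (x + h) - P x) \<le> (1/h)\<^sup>2 * (h\<^sup>2 * l2sq g)"
    by (rule mult_left_mono) simp
  then show ?thesis unfolding l2sq_cmult using h by (simp add: power2_eq_square)
qed

text \<open>With \<open>Q\<close> an antiderivative of \<open>R\<close>, the integral of a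
  difference quotient of \<open>R\<close> over \<open>{a..b}\<close> is a difference of two
  difference quotients of \<open>Q\<close>, which tends to \<open>R b - R a\<close>. The bounded
  quotients therefore have a weak limit of which \<open>R\<close> is a primitive; continuity of
  \<open>R\<close> gives this at every point.\<close>

lemma sobolev_if_difference_quotients_bounded:
  fixes R :: "real \<Rightarrow> 'e::euclidean_space"
  assumes R: "square_integrable R" and cont: "\<And>x. isCont R x"
    and C: "\<And>h. 0 < h \<Longrightarrow> l2sq (\<lambda>x. (1/h) *\<^sub>R (R (x + h) - R x)) \<le> C"
  shows "\<exists>L. sobolev R L \<and> l2sq L \<le> C"
proof -
  have R_cont: "continuous_on UNIV R" using cont by (simp add: continuous_at_imp_continuous_on)
  define e where "e n = 1 / real (Suc n)" for n
  have e0: "0 < e n" for n by (simp add: e_def)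
  have e_lim: "e \<longlonglongrightarrow> 0" unfolding e_def by (rule LIMSEQ_Suc[OF lim_1_over_n])
  define G where "G n x = (1/e n) *\<^sub>R (R (x + e n) - R x)" for n x
  have G: "square_integrable (G n)" for n unfolding G_def
    by (intro square_integrable_cmult square_integrable_diff(1) square_integrable_translate R)
  have GC: "l2sq (G n) \<le> C" for n unfolding G_def by (rule C[OF e0])
  obtain Q where "\<forall>x. - \<infinity> < ereal x \<longrightarrow> ereal x < \<infinity> \<longrightarrow> (Q has_vector_derivative R x) (at x)"
    using einterval_antiderivative[of "-\<infinity>" "\<infinity>" R] cont by auto
  then have Q: "(Q has_vector_derivative R x) (at x)" for x by simp
  have quot: "(\<lambda>n. (1/e n) *\<^sub>R (Q (x + e n) - Q x)) \<longlonglongrightarrow> R x" for x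
  proof -
    have lim0: "((\<lambda>y. (1 / norm (y - x)) *\<^sub>R (Q y - (Q x + (y - x) *\<^sub>R R x))) \<longlongrightarrow> 0) (at x)"
      using Q[of x] by (simp add: has_vector_derivative_def has_derivative_at2)
    have filt: "filterlim (\<lambda>n. x + e n) (at x) sequentially"
      unfolding filterlim_at using e0 by (auto intro!: tendsto_eq_intros e_lim always_eventually simp: less_imp_neq[OF e0, symmetric])
    from tendsto_add[OF filterlim_compose[OF lim0 filt] tendsto_const[of "R x"]]
    moreover have "(1 / norm (x + e n - x)) *\<^sub>R (Q (x + e n) - (Q x + (x + e n - x) *\<^sub>R R x)) + R x
        = (1/e n) *\<^sub>R (Q (x + e n) - Q x)" for n
    proof -
      have "norm (x + e n - x) = e n" "x + e n - x = e n" using e0[of n] by auto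
      moreover have "(1 / e n) *\<^sub>R (A - (B + e n *\<^sub>R C)) + C = (1 / e n) *\<^sub>R (A - B)" for A B C :: 'e
        using e0[of n] by (simp add: scaleR_diff_right scaleR_add_right)
      ultimately show ?thesis by simp
    qed
    ultimately show ?thesis by (simp only: add_0)
  qed
  have lim: "(\<lambda>n. LINT x:{a..b}|lborel. G n x) \<longlonglongrightarrow> R b - R a" if "a \<le> b" for a b
  proof -
    have "(LINT x:{a..b}|lborel. G n x) = (1/e n) *\<^sub>R (Q (b + e n) - Q b) - (1/e n) *\<^sub>R (Q (a + e n) - Q a)" for n
      unfolding set_lebesgue_integral_def
    proof (rule integral_FTC_atLeastAtMost[OF that])
      fix x
      have shift: "((\<lambda>x. x + e n) has_vector_derivative 1) (at x)"
        by (auto simp flip: has_real_derivative_iff_has_vector_derivative intro!: derivative_eq_intros)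
      have chain: "((\<lambda>x. Q (x + e n)) has_vector_derivative R (x + e n)) (at x)"
        using vector_diff_chain_at[OF shift, of Q "R (x + e n)"] Q[of "x + e n"] by (simp add: o_def)
      show "((\<lambda>x. (1/e n) *\<^sub>R (Q (x + e n) - Q x)) has_vector_derivative G n x) (at x within {a..b})"
        unfolding G_def
        by (rule has_vector_derivative_at_within[OF bounded_linear.has_vector_derivative[OF
              bounded_linear_scaleR_right has_vector_derivative_diff[OF chain Q]]])
      show "continuous_on {a..b} (G n)"
        unfolding G_def using cont
        by (intro continuous_intros continuous_on_compose2[OF R_cont]) auto
    qed
    then show ?thesis by (simp only:) (intro tendsto_diff quot)
  qed
  from l2_weak_primitive[of G C R, OF G GC lim] obtain L where "square_integrable L" "l2sq L \<le> C" "is_primitive R L"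
    by blast
  with R show ?thesis by (auto simp: sobolev_def)
qed

text \<open>The norm is 1-Lipschitz, so difference quotients do not grow when it is applied. This
  avoids differentiating the norm at zeros of \<open>P\<close>.\<close>

lemma sobolev_norm:
  fixes P :: "real \<Rightarrow> 'e::euclidean_space"
  assumes P: "sobolev P g"
  shows "\<exists>L. sobolev (\<lambda>x. norm (P x)) L \<and> l2sq L \<le> l2sq g"
proof (rule sobolev_if_difference_quotients_bounded)
  show sq: "square_integrable (\<lambda>x. norm (P x))" by (rule square_integrable_norm[OF sobolevD(1)[OF P]])
  show "isCont (\<lambda>x. norm (P x)) x" for x using sobolev_isCont[OF P] by (rule continuous_norm)
  fix h :: real assume h: "0 < h"
  have "l2sq (\<lambda>x. (1/h) *\<^sub>R (norm (P (x + h)) - norm (P x))) \<le> l2sq (\<lambda>x. (1/h) *\<^sub>R (P (x + h) - P x))"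
  proof (rule l2sq_mono)
    show "square_integrable (\<lambda>x. (1/h) *\<^sub>R (norm (P (x + h)) - norm (P x)))"
      by (intro square_integrable_cmult square_integrable_diff(1) square_integrable_translate[of "\<lambda>x. norm (P x)"] sq)
    show "square_integrable (\<lambda>x. (1/h) *\<^sub>R (P (x + h) - P x))"
      by (intro square_integrable_cmult square_integrable_diff(1) square_integrable_translate sobolevD(1)[OF P])
    show "norm ((1/h) *\<^sub>R (norm (P (x + h)) - norm (P x))) \<le> norm ((1/h) *\<^sub>R (P (x + h) - P x))" for x
      using h norm_triangle_ineq3[of "P (x+h)" "P x"] by (simp add: divide_right_mono)
  qed
  then show "l2sq (\<lambda>x. (1/h) *\<^sub>R (norm (P (x + h)) - norm (P x))) \<le> l2sq g"
    using sobolev_difference_quotient[OF P h] by linarith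
qed

section \<open>Splitting and compactness\<close>

text \<open>The common core of the Brezis--Lieb splittings of mass and of the nonlinear energy.\<close>

lemma integral_cross_terms_vanish:
  fixes a :: "nat \<Rightarrow> real \<Rightarrow> 'd::euclidean_space" and b :: "real \<Rightarrow> 'e::euclidean_space"
    and \<psi> :: "nat \<Rightarrow> real \<Rightarrow> real"
  assumes a: "\<And>n. square_integrable (a n)" "\<And>n. l2sq (a n) \<le> M" and b: "square_integrable b"
    and \<psi>: "\<And>n. \<psi> n \<in> borel_measurable borel" "\<And>x. (\<lambda>n. \<psi> n x) \<longlonglongrightarrow> 0"
    and bound: "\<And>n x. \<bar>\<psi> n x\<bar> \<le> C * (norm (a n x) * norm (b x) + (norm (b x))\<^sup>2)"
  shows "integrable lborel (\<psi> n)" and "(\<lambda>n. LINT x|lborel. \<psi> n x) \<longlonglongrightarrow> 0"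
proof -
  note [measurable] = square_integrable_measurable[OF a(1)] square_integrable_measurable[OF b] \<psi>(1)
  have M: "0 \<le> M" using a(2)[of 0] l2sq_nonneg[of "a 0"] by linarith
  show int: "integrable lborel (\<psi> n)" for n
  proof (rule Bochner_Integration.integrable_bound)
    show "integrable lborel (\<lambda>x. C * (norm (a n x) * norm (b x) + (norm (b x))\<^sup>2))"
      using square_integrable_norm_mult[OF a(1) b] square_integrable_integrable[OF b] by simp
    show "AE x in lborel. norm (\<psi> n x) \<le> norm (C * (norm (a n x) * norm (b x) + (norm (b x))\<^sup>2))"
      by (intro AE_I2) (simp only: real_norm_def, rule order_trans[OF bound abs_ge_self])
  qed simp
  show "(\<lambda>n. LINT x|lborel. \<psi> n x) \<longlonglongrightarrow> 0"
  proof (rule LIMSEQ_I)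
    fix r :: real assume r: "0 < r"
    \<comment> \<open>Chosen so that the part \<open>e * M\<close>, contributed by the sequence
      itself, stays below \<open>r / 2\<close>; the added 1 covers \<open>M = 0\<close>.\<close>
    define e where "e = r / (2 * (M + 1))"
    have e: "0 < e" "e * M < r / 2" using r M by (auto simp: e_def field_simps)
    define D where "D = C\<^sup>2 / (4 * e) + \<bar>C\<bar>"
    \<comment> \<open>The excess of the integrand over a small multiple of the square of
      \<open>a n\<close>. By Young's inequality it is dominated by the fixed function
      \<open>D * (norm (b x))\<^sup>2\<close>, so dominated convergence applies although the
      integrand itself has no fixed majorant.\<close>
    define W where "W n x = max 0 (\<bar>\<psi> n x\<bar> - e * (norm (a n x))\<^sup>2)" for n x
    have WD: "W n x \<le> D * (norm (b x))\<^sup>2" for n x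
    proof -
      have "0 \<le> (2 * e * norm (a n x) - C * norm (b x))\<^sup>2 / (4 * e)" using e by simp
      also have "\<dots> = e * (norm (a n x))\<^sup>2 - C * (norm (a n x) * norm (b x)) + C\<^sup>2 / (4 * e) * (norm (b x))\<^sup>2"
        using e by (simp add: power2_eq_square field_simps)
      finally have "C * (norm (a n x) * norm (b x)) \<le> e * (norm (a n x))\<^sup>2 + C\<^sup>2 / (4 * e) * (norm (b x))\<^sup>2" by simp
      moreover have "C * (norm (b x))\<^sup>2 \<le> \<bar>C\<bar> * (norm (b x))\<^sup>2" by (intro mult_right_mono) auto
      moreover have "0 \<le> D * (norm (b x))\<^sup>2" using e by (auto simp: D_def)
      moreover have "D * (norm (b x))\<^sup>2 = C\<^sup>2 / (4 * e) * (norm (b x))\<^sup>2 + \<bar>C\<bar> * (norm (b x))\<^sup>2"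
        unfolding D_def by (rule distrib_right)
      ultimately show ?thesis using bound[of n x] unfolding W_def distrib_left by (auto simp: max_def)
    qed
    have [measurable]: "W n \<in> borel_measurable borel" for n unfolding W_def by simp
    have W0: "0 \<le> W n x" for n x by (simp add: W_def)
    have "(\<lambda>n. LINT x|lborel. W n x) \<longlonglongrightarrow> integral\<^sup>L lborel (\<lambda>x::real. 0::real)"
    proof (rule Bochner_Integration.integral_dominated_convergence)
      show "integrable lborel (\<lambda>x. D * (norm (b x))\<^sup>2)" using square_integrable_integrable[OF b] by simp
      show "AE x in lborel. norm (W n x) \<le> D * (norm (b x))\<^sup>2" for n using WD W0 by auto
      show "AE x in lborel. (\<lambda>n. W n x) \<longlonglongrightarrow> 0"
      proof (intro AE_I2, rule Lim_null_comparison)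
        fix x
        show "(\<lambda>n. \<bar>\<psi> n x\<bar>) \<longlonglongrightarrow> 0" using \<psi>(2)[of x] by (rule tendsto_rabs_zero)
        show "\<forall>\<^sub>F n in sequentially. norm (W n x) \<le> \<bar>\<psi> n x\<bar>"
          using e by (auto simp: W_def max_def)
      qed
    qed auto
    then have ev: "\<forall>\<^sub>F n in sequentially. (LINT x|lborel. W n x) < r / 2"
      using r by (intro order_tendstoD(2)) auto
    have intW: "integrable lborel (W n)" for n
    proof (rule Bochner_Integration.integrable_bound)
      show "integrable lborel (\<lambda>x. D * (norm (b x))\<^sup>2)" using square_integrable_integrable[OF b] by simp
      show "AE x in lborel. norm (W n x) \<le> norm (D * (norm (b x))\<^sup>2)"
        using WD[of n] W0[of n] by (intro AE_I2) (smt (verit) real_norm_def)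
    qed simp
    have "norm ((LINT x|lborel. \<psi> n x) - 0) < r" if "(LINT x|lborel. W n x) < r / 2" for n
    proof -
      have "norm ((LINT x|lborel. \<psi> n x)) \<le> (LINT x|lborel. \<bar>\<psi> n x\<bar>)"
        using integral_norm_bound[of lborel "\<psi> n"] by simp
      also have "\<dots> \<le> (LINT x|lborel. W n x + e * (norm (a n x))\<^sup>2)"
        using int[of n] intW[of n] square_integrable_integrable[OF a(1)[of n]]
        by (intro integral_mono) (auto simp: W_def)
      also have "\<dots> = (LINT x|lborel. W n x) + e * l2sq (a n)"
        using intW[of n] square_integrable_integrable[OF a(1)[of n]] by (simp add: l2sq_def)
      also have "\<dots> \<le> (LINT x|lborel. W n x) + e * M" using e a(2)[of n] by simp
      also have "\<dots> < r" using e(2) that by simp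
      finally show ?thesis by simp
    qed
    with ev show "\<exists>no. \<forall>n\<ge>no. norm ((LINT x|lborel. \<psi> n x) - 0) < r"
      by (meson eventually_sequentially)
  qed
qed

text \<open>After expanding the squares only the inner product of \<open>a n - b\<close> with
  \<open>b\<close> survives, and it is a cross term that vanishes in the limit.\<close>

lemma l2sq_splitting:
  fixes a :: "nat \<Rightarrow> real \<Rightarrow> 'd::euclidean_space"
  assumes a: "\<And>n. square_integrable (a n)" "\<And>n. l2sq (a n) \<le> M" and b: "square_integrable b"
    and lim: "\<And>x. (\<lambda>n. a n x) \<longlonglongrightarrow> b x"
  shows "(\<lambda>n. l2sq (a n) - l2sq (\<lambda>x. a n x - b x)) \<longlonglongrightarrow> l2sq b"
proof -
  note [measurable] = square_integrable_measurable[OF a(1)] square_integrable_measurable[OF b]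
  note d = square_integrable_diff[OF a(1) b]
  have inner: "(LINT x|lborel. a n x \<bullet> b x) = (LINT x|lborel. (a n x - b x) \<bullet> b x) + l2sq b" for n
  proof -
    have "(LINT x|lborel. (a n x - b x) \<bullet> b x) = (LINT x|lborel. a n x \<bullet> b x) - (LINT x|lborel. b x \<bullet> b x)"
      unfolding inner_diff_left by (intro Bochner_Integration.integral_diff square_integrable_inner a b)
    then show ?thesis by (simp add: l2sq_def power2_norm_eq_inner)
  qed
  have bdd: "l2sq (\<lambda>x. a n x - b x) \<le> (sqrt M + sqrt (l2sq b))\<^sup>2" for n
  proof -
    have "sqrt (l2sq (\<lambda>x. a n x + - 1 *\<^sub>R b x)) \<le> sqrt (l2sq (a n)) + sqrt (l2sq (\<lambda>x. - 1 *\<^sub>R b x))"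
      by (intro l2_triangle a square_integrable_cmult b)
    also have "\<dots> \<le> sqrt M + sqrt (l2sq b)" unfolding l2sq_cmult using a(2)[of n] by simp
    finally have "sqrt (l2sq (\<lambda>x. a n x - b x)) \<le> sqrt M + sqrt (l2sq b)" by simp
    from power_mono[OF this, of 2] show ?thesis by simp
  qed
  have z: "(\<lambda>n. LINT x|lborel. (a n x - b x) \<bullet> b x) \<longlonglongrightarrow> 0"
  proof (rule integral_cross_terms_vanish(2)[OF d(1) bdd b, of _ 1])
    show "(\<lambda>n. (a n x - b x) \<bullet> b x) \<longlonglongrightarrow> 0" for x
      using tendsto_inner[OF tendsto_diff[OF lim[of x] tendsto_const[of "b x"]] tendsto_const[of "b x"]] by simp
    show "\<bar>(a n x - b x) \<bullet> b x\<bar> \<le> 1 * (norm (a n x - b x) * norm (b x) + (norm (b x))\<^sup>2)" for n x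
      using Cauchy_Schwarz_ineq2[of "a n x - b x" "b x"] by (simp add: add_increasing2)
  qed simp
  have "l2sq (a n) - l2sq (\<lambda>x. a n x - b x) = 2 * (LINT x|lborel. (a n x - b x) \<bullet> b x) + l2sq b" for n
    unfolding d(2) inner by simp
  then show ?thesis using tendsto_add[OF tendsto_mult_right_zero[OF z, of 2] tendsto_const[of "l2sq b"]] by simp
qed

text \<open>A diagonal sequence converges at all rationals, and the uniform Hoelder bound extends
  this to every point. Derivatives need not converge strongly; the last conclusion is what weak
  convergence leaves of the kinetic energy.\<close>

lemma sobolev_bounded_sequence_compact:
  fixes F G :: "nat \<Rightarrow> real \<Rightarrow> 'e::euclidean_space"
  assumes FG: "\<And>n. sobolev (F n) (G n)" and B: "\<And>n. l2sq (F n) \<le> B" "\<And>n. l2sq (G n) \<le> B"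
  shows "\<exists>\<kappa> P g. strict_mono (\<kappa> :: nat \<Rightarrow> nat) \<and> sobolev P g \<and> (\<forall>x. (\<lambda>n. F (\<kappa> n) x) \<longlonglongrightarrow> P x) \<and>
    (\<lambda>n. l2sq (G (\<kappa> n)) - l2sq (\<lambda>x. G (\<kappa> n) x - g x)) \<longlonglongrightarrow> l2sq g"
proof -
  have bdd: "norm (F n x) \<le> sqrt B + sqrt B" for n x
  proof -
    have "norm (F n x) \<le> sqrt (l2sq (F n)) + sqrt (l2sq (G n))"
      using sobolev_sup_bound_scaled[OF FG, of 1] by simp
    also have "\<dots> \<le> sqrt B + sqrt B" using B by (intro add_mono) auto
    finally show ?thesis .
  qed
  obtain \<kappa> :: "nat \<Rightarrow> nat" where \<kappa>: "strict_mono \<kappa>"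
    and rat: "\<And>x. x \<in> \<rat> \<Longrightarrow> \<exists>l. (\<lambda>n. F (\<kappa> n) x) \<longlonglongrightarrow> l"
    using function_convergent_subsequence[of "\<rat>::real set" F "sqrt B + sqrt B"] bdd countable_rat by metis
  have conv: "convergent (\<lambda>n. F (\<kappa> n) x)" for x
  proof -
    have "Cauchy (\<lambda>n. F (\<kappa> n) x)"
    proof (rule metric_CauchyI)
      fix e :: real assume e: "0 < e"
      \<comment> \<open>Makes the Hoelder error equal to \<open>e / 4\<close>, so that three such
        errors stay below \<open>e\<close>; the added 1 prevents division by zero.\<close>
      define \<delta> where "\<delta> = (e / (4 * (sqrt B + 1)))\<^sup>2"
      have B0: "0 \<le> B" using B(1)[of 0] l2sq_nonneg[of "F 0"] by linarith
      have "0 < 4 * (sqrt B + 1)" using B0 by (simp add: add_nonneg_pos)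
      then have \<delta>: "0 < \<delta>" unfolding \<delta>_def using e by (intro zero_less_power divide_pos_pos)
      obtain q where q: "q \<in> \<rat>" "\<bar>q - x\<bar> < \<delta>"
        using Rats_dense_in_real[of "x - \<delta>" "x + \<delta>"] \<delta> by (auto simp: abs_less_iff)
      have near: "norm (F n q - F n x) \<le> e / 4" for n
      proof -
        have "norm (F n q - F n x) \<le> sqrt \<bar>q - x\<bar> * sqrt (l2sq (G n))" by (rule sobolev_Hoelder[OF FG])
        also have "\<dots> \<le> sqrt \<delta> * (sqrt B + 1)"
        proof (intro mult_mono)
          show "sqrt (l2sq (G n)) \<le> sqrt B + 1"
            by (rule order_trans[OF real_sqrt_le_mono[OF B(2)]]) simp
        qed (use q \<delta> in auto)
        also have "sqrt \<delta> = e / (4 * (sqrt B + 1))" unfolding \<delta>_def using e B0 by simp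
        also have "e / (4 * (sqrt B + 1)) * (sqrt B + 1) = e / 4"
          using \<open>0 < 4 * (sqrt B + 1)\<close> by (simp add: nonzero_divide_eq_eq)
        finally show ?thesis .
      qed
      from rat[OF q(1)] have "Cauchy (\<lambda>n. F (\<kappa> n) q)" using LIMSEQ_imp_Cauchy by blast
      then obtain N where N: "\<And>m n. N \<le> m \<Longrightarrow> N \<le> n \<Longrightarrow> dist (F (\<kappa> m) q) (F (\<kappa> n) q) < e / 4"
        using e metric_CauchyD[of "\<lambda>n. F (\<kappa> n) q" "e/4"] by auto
      have "dist (F (\<kappa> m) x) (F (\<kappa> n) x) < e" if "N \<le> m" "N \<le> n" for m n
      proof -
        have "dist (F (\<kappa> m) x) (F (\<kappa> n) x) \<le> dist (F (\<kappa> m) q) (F (\<kappa> m) x) + dist (F (\<kappa> m) q) (F (\<kappa> n) q) + dist (F (\<kappa> n) q) (F (\<kappa> n) x)"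
          by (metis (no_types) add_mono dist_commute dist_triangle dist_triangle_le order_refl)
        with near[of "\<kappa> m"] near[of "\<kappa> n"] N[OF that] e show ?thesis unfolding dist_norm by linarith
      qed
      then show "\<exists>M. \<forall>m\<ge>M. \<forall>n\<ge>M. dist (F (\<kappa> m) x) (F (\<kappa> n) x) < e" by blast
    qed
    then show ?thesis by (rule Cauchy_convergent)
  qed
  define P where "P x = lim (\<lambda>n. F (\<kappa> n) x)" for x
  have P: "(\<lambda>n. F (\<kappa> n) x) \<longlonglongrightarrow> P x" for x
    unfolding P_def using conv convergent_LIMSEQ_iff by blast
  note [measurable] = square_integrable_measurable[OF sobolevD(1)[OF FG]]
  have Pm: "P \<in> borel_measurable borel"
    by (rule borel_measurable_LIMSEQ_metric[where f="\<lambda>n. F (\<kappa> n)"]) (use P in auto)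
  have Psq: "square_integrable P"
    by (rule l2_Fatou(1)[of "\<lambda>n. F (\<kappa> n)" B, OF _ _ Pm]) (use P B sobolevD(1)[OF FG] in auto)
  have Gsq: "square_integrable (G (\<kappa> n))" for n by (rule sobolevD(2)[OF FG])
  have Glim: "(\<lambda>n. LINT x:{a..b}|lborel. G (\<kappa> n) x) \<longlonglongrightarrow> P b - P a" if "a \<le> b" for a b
    using tendsto_diff[OF P[of b] P[of a]] is_primitiveD(2)[OF sobolevD(3)[OF FG] that] by simp
  obtain g where g: "square_integrable g" "is_primitive P g"
    using l2_weak_primitive[of "\<lambda>n. G (\<kappa> n)" B P, OF Gsq B(2) Glim] by blast
  \<comment> \<open>Expanding the square, the kinetic difference is twice the inner product with
    \<open>g\<close> minus the square of \<open>g\<close>, so the weak inner limit is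
    enough.\<close>
  have "(\<lambda>n. 2 * (LINT x|lborel. G (\<kappa> n) x \<bullet> g x) - l2sq g) \<longlonglongrightarrow> 2 * l2sq g - l2sq g"
    by (intro tendsto_intros l2_weak_inner_limit[of "\<lambda>n. G (\<kappa> n)" B P, OF Gsq B(2) Glim g])
  then have "(\<lambda>n. l2sq (G (\<kappa> n)) - l2sq (\<lambda>x. G (\<kappa> n) x - g x)) \<longlonglongrightarrow> l2sq g"
    by (simp add: square_integrable_diff(2)[OF Gsq g(1)])
  with \<kappa> Psq g P show ?thesis unfolding sobolev_def by blast
qed

section \<open>Test functions\<close>

lemma has_real_derivative_dir_deriv:
  assumes "(f has_real_derivative d) (at x)"
  shows "dir_deriv 1 f x = d"
proof -
  have "(f has_derivative (\<lambda>h. d * h)) (at x)" using assms by (simp add: has_field_derivative_def)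
  then have "frechet_derivative f (at x) = (\<lambda>h. d * h)" by (rule frechet_derivative_at[symmetric])
  then show ?thesis by (simp add: dir_deriv_def)
qed

lemma differentiable_dir_deriv:
  fixes f :: "real \<Rightarrow> real"
  assumes "f differentiable at x"
  shows "(f has_real_derivative dir_deriv 1 f x) (at x)"
proof -
  obtain d where "(f has_real_derivative d) (at x)" using assms unfolding real_differentiable_def by blast
  with has_real_derivative_dir_deriv[OF this] show ?thesis by simp
qed

lemma foldr_dir_deriv_in_invariant_set:
  fixes S :: "(real \<Rightarrow> real) set"
  assumes "\<phi> \<in> S" and D: "\<And>f. f \<in> S \<Longrightarrow> \<exists>g\<in>S. \<forall>x. (f has_real_derivative g x) (at x)"
    and "bs \<in> lists (Basis :: real set)"
  shows "foldr dir_deriv bs \<phi> \<in> S"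
  using assms(3)
proof (induction bs)
  case Nil
  then show ?case using assms(1) by simp
next
  case (Cons b bs)
  then have b: "b = 1" and "foldr dir_deriv bs \<phi> \<in> S" by auto
  with D obtain g where g: "g \<in> S" "\<And>x. (foldr dir_deriv bs \<phi> has_real_derivative g x) (at x)" by blast
  then have "dir_deriv 1 (foldr dir_deriv bs \<phi>) = g" by (auto intro!: ext has_real_derivative_dir_deriv)
  with g(1) b show ?case by simp
qed

text \<open>Smoothness is obtained from a set of functions that is closed under differentiation,
  without formulas for higher derivatives.\<close>

lemma test_function_if_invariant_set:
  fixes S :: "(real \<Rightarrow> real) set"
  assumes "\<phi> \<in> S" "\<And>f. f \<in> S \<Longrightarrow> \<exists>g\<in>S. \<forall>x. (f has_real_derivative g x) (at x)"
    and supp: "\<And>x. x \<notin> {a..b} \<Longrightarrow> \<phi> x = 0"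
  shows "test_function \<phi>"
  unfolding test_function_def
proof (intro conjI ballI)
  fix bs :: "real list" assume "bs \<in> lists Basis"
  from assms(2)[OF foldr_dir_deriv_in_invariant_set[OF assms(1,2) this]]
  show "foldr dir_deriv bs \<phi> differentiable_on UNIV"
    by (auto simp: differentiable_on_def real_differentiable_def)
next
  have "closure {x. \<phi> x \<noteq> 0} \<subseteq> {a..b}"
  proof (rule closure_minimal)
    show "{x. \<phi> x \<noteq> 0} \<subseteq> {a..b}" using supp by blast
  qed simp
  then show "compact (closure {x. \<phi> x \<noteq> 0})"
    by (meson bounded_closed_interval bounded_subset closed_closure compact_eq_bounded_closed)
qed

lemma test_function_derivative:
  fixes \<phi> :: "real \<Rightarrow> real"
  assumes "test_function \<phi>"
  shows "(\<phi> has_real_derivative dir_deriv 1 \<phi> x) (at x)" "test_function (dir_deriv 1 \<phi>)"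
    "isCont \<phi> x" "isCont (dir_deriv 1 \<phi>) x"
    "\<exists>M>0. \<forall>x. x \<notin> {-M..M} \<longrightarrow> \<phi> x = 0 \<and> dir_deriv 1 \<phi> x = 0"
proof -
  have diff: "foldr dir_deriv bs \<phi> differentiable at x" if "bs \<in> lists Basis" for bs x
    using assms that unfolding test_function_def differentiable_on_def by blast
  from diff[of "[]"] show d: "(\<phi> has_real_derivative dir_deriv 1 \<phi> x) (at x)" for x
    by (intro differentiable_dir_deriv) simp
  then show "isCont \<phi> x" by (rule DERIV_isCont)
  have "(dir_deriv 1 \<phi> has_real_derivative dir_deriv 1 (dir_deriv 1 \<phi>) x) (at x)"
    using diff[of "[1]" x] by (intro differentiable_dir_deriv) simp
  then show "isCont (dir_deriv 1 \<phi>) x" by (rule DERIV_isCont)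
  obtain M where M: "0 < M" "\<And>x. \<phi> x \<noteq> 0 \<Longrightarrow> \<bar>x\<bar> \<le> M"
  proof -
    have "bounded {x. \<phi> x \<noteq> 0}"
      using assms compact_imp_bounded bounded_subset closure_subset unfolding test_function_def by blast
    then show ?thesis using that unfolding bounded_pos by auto
  qed
  have d0: "dir_deriv 1 \<phi> x = 0" if "x \<notin> {-M..M}" for x
  proof -
    have op: "open (- {-M..M})" by (simp add: open_Compl)
    have "((\<lambda>x. 0) has_real_derivative dir_deriv 1 \<phi> x) (at x)"
      by (rule has_field_derivative_transform_within_open[OF d op]) (use that M in force)+
    then show ?thesis using DERIV_unique[OF _ DERIV_const] by blast
  qed
  show "\<exists>M>0. \<forall>x. x \<notin> {-M..M} \<longrightarrow> \<phi> x = 0 \<and> dir_deriv 1 \<phi> x = 0"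
    using M d0 by (intro exI[of _ M]) force
  show "test_function (dir_deriv 1 \<phi>)"
  proof (rule test_function_if_invariant_set)
    show "dir_deriv 1 \<phi> \<in> {foldr dir_deriv bs \<phi> |bs. bs \<in> lists Basis}"
      by (intro CollectI exI[of _ "[1]"]) simp
    show "x \<notin> {-M..M} \<Longrightarrow> dir_deriv 1 \<phi> x = 0" for x by (rule d0)
    fix f assume "f \<in> {foldr dir_deriv bs \<phi> |bs. bs \<in> lists Basis}"
    then obtain bs where bs: "bs \<in> lists Basis" "f = foldr dir_deriv bs \<phi>" by blast
    show "\<exists>g\<in>{foldr dir_deriv bs \<phi> |bs. bs \<in> lists Basis}. \<forall>x. (f has_real_derivative g x) (at x)"
    proof (intro bexI allI)
      show "(f has_real_derivative dir_deriv 1 f x) (at x)" for x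
        using differentiable_dir_deriv diff bs by blast
      show "dir_deriv 1 f \<in> {foldr dir_deriv bs \<phi> |bs. bs \<in> lists Basis}"
        using bs by (intro CollectI exI[of _ "1 # bs"]) simp
    qed
  qed
qed

text \<open>The standard bump is \<open>q = 1\<close>, \<open>k = 0\<close>. Polynomial numerators
  and powers in the denominator are included because they make the family closed under
  differentiation.\<close>

definition bump_family :: "real \<Rightarrow> real \<Rightarrow> real \<Rightarrow> real poly \<Rightarrow> nat \<Rightarrow> real \<Rightarrow> real" where
  "bump_family a b c q k x = (if a < x \<and> x < b
     then poly q x / ((x - a) * (b - x)) ^ k * exp (- c / ((x - a) * (b - x))) else 0)"

text \<open>The term of order \<open>k + 2\<close> of the exponential series beats the denominator
  with two powers to spare. Second order vanishing at both ends is what makes the derivative zero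
  there.\<close>

lemma bump_family_bound:
  assumes "a < b" "0 < c"
  shows "\<exists>M. \<forall>x. \<bar>bump_family a b c q k x\<bar> \<le> M * ((x - a) * (b - x))\<^sup>2"
proof -
  have "continuous_on {a..b} (poly q)" by (intro continuous_intros)
  then have "compact (poly q ` {a..b})" by (intro compact_continuous_image) auto
  then obtain Q where Q: "\<And>x. x \<in> {a..b} \<Longrightarrow> \<bar>poly q x\<bar> \<le> Q"
    using compact_imp_bounded bounded_iff by (metis imageI real_norm_def)
  define M where "M = Q * (fact (k + 2) / c ^ (k + 2))"
  show ?thesis
  proof (intro exI[of _ M] allI)
    fix x
    define u where "u = (x - a) * (b - x)"
    show "\<bar>bump_family a b c q k x\<bar> \<le> M * ((x - a) * (b - x))\<^sup>2"
    proof (cases "a < x \<and> x < b")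
      case False
      have "0 \<le> Q" using Q[of a] assms by force
      then show ?thesis using assms False by (auto simp: bump_family_def M_def)
    next
      case True
      then have u: "0 < u" by (simp add: u_def)
      have e2: "(c / u) ^ (k + 2) / fact (k + 2) \<le> exp (c / u)"
      proof -
        have "(\<Sum>i\<in>{k+2}. (c / u) ^ i / fact i) \<le> (\<Sum>i. (c / u) ^ i / fact i)"
          using summable_exp[of "c / u"] u assms by (intro sum_le_suminf) (auto simp: field_simps)
        then show ?thesis by (simp add: exp_def field_simps)
      qed
      have e1: "exp (- T) \<le> fact n / T ^ n" if "0 < T" "T ^ n / fact n \<le> exp T" for T :: real and n
        using that by (simp add: exp_minus field_simps)
      have "exp (- (c / u)) \<le> fact (k + 2) / (c / u) ^ (k + 2)"
        by (rule e1[OF _ e2]) (use u assms in auto)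
      also have "\<dots> = fact (k + 2) / c ^ (k + 2) * u ^ (k + 2)" by (simp add: power_divide)
      finally have e: "exp (- (c / u)) \<le> fact (k + 2) / c ^ (k + 2) * u ^ (k + 2)" .
      have "\<bar>bump_family a b c q k x\<bar> = \<bar>poly q x\<bar> / u ^ k * exp (- (c / u))"
        using True u by (simp add: bump_family_def u_def[symmetric] abs_mult)
      also have "\<dots> \<le> Q / u ^ k * (fact (k + 2) / c ^ (k + 2) * u ^ (k + 2))"
        using Q[of x] True u e by (intro mult_mono divide_right_mono) auto
      also have "\<dots> = M * u\<^sup>2" using u by (simp add: M_def power_add power2_eq_square)
      finally show ?thesis by (simp add: u_def)
    qed
  qed
qed

text \<open>With u = (x - a)(b - x), the derivative of q u^(-k) exp(-c/u) has three terms, brought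
  here to the common denominator u^(k+2). At the endpoints the difference quotient is squeezed by
  the quadratic bound.\<close>

lemma bump_family_derivative:
  assumes ab: "a < b" and c: "0 < c"
  defines "U \<equiv> [:-a, 1:] * [:b, -1:]"
  shows "(bump_family a b c q k has_real_derivative
    bump_family a b c (pderiv q * U ^ 2 - smult (real k) (q * pderiv U * U) + smult c (q * pderiv U)) (k + 2) x) (at x)"
    (is "(_ has_real_derivative bump_family a b c ?q (k + 2) x) _")
proof -
  have U: "poly U x = (x - a) * (b - x)" for x by (simp add: U_def algebra_simps)
  consider "a < x \<and> x < b" | "x < a \<or> b < x" | "x = a \<or> x = b" using ab by linarith
  then show ?thesis
  proof cases
    case 1
    define u where "u = poly U x"
    have u: "0 < u" using 1 by (simp add: u_def U)
    have d: "((\<lambda>x. poly q x / poly U x ^ k * exp (- c / poly U x)) has_real_derivative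
       poly ?q x / u ^ (k + 2) * exp (- c / u)) (at x)"
    proof -
      have "((\<lambda>x. poly q x / poly U x ^ k * exp (- c / poly U x)) has_real_derivative
        (poly (pderiv q) x * u ^ k - poly q x * (real k * u ^ (k - 1) * poly (pderiv U) x)) / (u ^ k * u ^ k) * exp (- c / u)
         + poly q x / u ^ k * (exp (- c / u) * (c * poly (pderiv U) x / (u * u)))) (at x)"
        using u unfolding u_def by (auto intro!: derivative_eq_intros poly_DERIV simp: field_simps)
      moreover have "(poly (pderiv q) x * u ^ k - poly q x * (real k * u ^ (k - 1) * poly (pderiv U) x)) / (u ^ k * u ^ k) * exp (- c / u)
         + poly q x / u ^ k * (exp (- c / u) * (c * poly (pderiv U) x / (u * u))) = poly ?q x / u ^ (k + 2) * exp (- c / u)"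
      proof -
        have "real k * u ^ (k - 1) * u = real k * u ^ k" by (cases k) auto
        then have k: "real k * u ^ (k - 1) = real k * u ^ k / u" using u by (simp add: field_simps)
        show ?thesis unfolding k using u
          by (simp add: u_def[symmetric] power_add power2_eq_square field_simps)
      qed
      ultimately show ?thesis by simp
    qed
    have "(bump_family a b c q k has_real_derivative poly ?q x / u ^ (k + 2) * exp (- c / u)) (at x)"
      by (rule has_field_derivative_transform_within_open[OF d, of "{a<..<b}"])
        (use 1 in \<open>auto simp: bump_family_def U\<close>)
    then show ?thesis using 1 unfolding bump_family_def u_def U by simp
  next
    case 2
    have "(bump_family a b c q k has_real_derivative 0) (at x)"
      by (rule has_field_derivative_transform_within_open[OF DERIV_const, of "- {a..b}" _ 0])
        (use 2 in \<open>auto simp: bump_family_def open_Compl\<close>)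
    then show ?thesis using 2 by (auto simp: bump_family_def)
  next
    case 3
    obtain M where M: "\<And>x. \<bar>bump_family a b c q k x\<bar> \<le> M * ((x - a) * (b - x))\<^sup>2"
      using bump_family_bound[OF ab c] by blast
    have x0: "bump_family a b c q k x = 0" "\<And>q k. bump_family a b c q k x = 0" using 3 by (auto simp: bump_family_def)
    have "((\<lambda>y. (bump_family a b c q k y - bump_family a b c q k x) / (y - x)) \<longlongrightarrow> 0) (at x)"
    proof (rule Lim_null_comparison)
      \<comment> \<open>The opposite endpoint: if \<open>x\<close> is one of \<open>a\<close>,
        \<open>b\<close>, then \<open>y'\<close> is the other.\<close>
      define y' where "y' = a + b - x"
      show "\<forall>\<^sub>F y in at x. norm ((bump_family a b c q k y - bump_family a b c q k x) / (y - x)) \<le> M * (\<bar>y - x\<bar> * (y - y')\<^sup>2)"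
      proof (intro eventually_at_filter[THEN iffD2] always_eventually allI impI)
        fix y :: real assume "y \<noteq> x"
        have "((y - a) * (b - y))\<^sup>2 = (\<bar>y - x\<bar> * (y - y')\<^sup>2) * \<bar>y - x\<bar>"
          using 3 by (auto simp: y'_def power2_eq_square abs_mult_self_eq algebra_simps)
        then show "norm ((bump_family a b c q k y - bump_family a b c q k x) / (y - x)) \<le> M * (\<bar>y - x\<bar> * (y - y')\<^sup>2)"
          using M[of y] \<open>y \<noteq> x\<close> by (simp add: x0 pos_divide_le_eq mult.assoc)
      qed
      have "((\<lambda>y. M * (\<bar>y - x\<bar> * (y - y')\<^sup>2)) \<longlongrightarrow> M * (\<bar>x - x\<bar> * (x - y')\<^sup>2)) (at x)"
        by (intro tendsto_intros)
      then show "((\<lambda>y. M * (\<bar>y - x\<bar> * (y - y')\<^sup>2)) \<longlongrightarrow> 0) (at x)" by simp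
    qed
    then show ?thesis by (simp add: has_field_derivative_iff x0)
  qed
qed

lemma bump_test_function:
  assumes "a < b" "0 < c"
  shows "test_function (bump_family a b c q k)"
proof (rule test_function_if_invariant_set[of _ "{bump_family a b c q k |q k. True}" a b])
  show "\<exists>g\<in>{bump_family a b c q k |q k. True}. \<forall>x. (f has_real_derivative g x) (at x)"
    if "f \<in> {bump_family a b c q k |q k. True}" for f
    using that bump_family_derivative[OF assms] by blast
qed (auto simp: bump_family_def)

text \<open>The bumps with parameter \<open>c n\<close> tending to 0 are bounded by 1 and converge
  to 1 inside the interval, so dominated convergence reduces the claim to integrals over
  intervals.\<close>

lemma AE_eq_0_if_test_integrals_eq_0:
  fixes h :: "real \<Rightarrow> complex"
  assumes h: "locally_integrable h" and zero: "\<And>\<phi>. test_function \<phi> \<Longrightarrow> (LINT x|lborel. \<phi> x *\<^sub>R h x) = 0"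
  shows "AE x in lborel. h x = 0"
proof (rule AE_eq_0_if_interval_integrals_eq_0)
  show int: "set_integrable lborel {a..b} h" for a b
    using h unfolding locally_integrable_def by blast
  have [measurable]: "indicator {a..b} \<in> borel_measurable (borel :: real measure)" for a b :: real by simp
  fix a b :: real assume "a \<le> b"
  have ends: "AE x in lborel. x \<noteq> a" "AE x in lborel. x \<noteq> b" by (rule AE_lborel_singleton)+
  show "(LINT x:{a..b}|lborel. h x) = 0"
  proof (cases "a = b")
    case True
    have "AE x in lborel. indicator {a..b} x *\<^sub>R h x = 0"
      using ends(1) by eventually_elim (use True in \<open>auto simp: indicator_def\<close>)
    then show ?thesis unfolding set_lebesgue_integral_def by (rule integral_eq_zero_AE)
  next
    case False
    with \<open>a \<le> b\<close> have ab: "a < b" by simp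
    define c where "c n = 1 / real (Suc n)" for n
    have c: "0 < c n" for n by (simp add: c_def)
    define \<phi> where "\<phi> n = bump_family a b (c n) 1 0" for n
    have \<phi>: "test_function (\<phi> n)" for n unfolding \<phi>_def by (rule bump_test_function[OF ab c])
    have [measurable]: "\<phi> n \<in> borel_measurable borel" for n
      using test_function_derivative(3)[OF \<phi>] by (intro borel_measurable_continuous_onI continuous_at_imp_continuous_on) auto
    have eq: "\<phi> n x *\<^sub>R h x = \<phi> n x *\<^sub>R (indicator {a..b} x *\<^sub>R h x)" for n x
      by (auto simp: \<phi>_def bump_family_def indicator_def)
    have [measurable]: "(\<lambda>x. indicator {a..b} x *\<^sub>R h x) \<in> borel_measurable borel"
      using int[of a b] unfolding set_integrable_def by (auto dest: borel_measurable_integrable)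
    have "(\<lambda>n. LINT x|lborel. \<phi> n x *\<^sub>R (indicator {a..b} x *\<^sub>R h x)) \<longlonglongrightarrow> (LINT x|lborel. indicator {a..b} x *\<^sub>R h x)"
    proof (rule Bochner_Integration.integral_dominated_convergence)
      show "integrable lborel (\<lambda>x. norm (indicator {a..b} x *\<^sub>R h x))"
        using int[of a b] unfolding set_integrable_def by (rule integrable_norm)
      show "AE x in lborel. norm (\<phi> n x *\<^sub>R (indicator {a..b} x *\<^sub>R h x)) \<le> norm (indicator {a..b} x *\<^sub>R h x)" for n
      proof (rule AE_I2)
        fix x
        have "\<bar>\<phi> n x\<bar> \<le> 1" using c[of n] by (auto simp: \<phi>_def bump_family_def)
        then show "norm (\<phi> n x *\<^sub>R (indicator {a..b} x *\<^sub>R h x)) \<le> norm (indicator {a..b} x *\<^sub>R h x)"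
          unfolding norm_scaleR[of "\<phi> n x"] by (intro mult_left_le_one_le) auto
      qed
      show "AE x in lborel. (\<lambda>n. \<phi> n x *\<^sub>R (indicator {a..b} x *\<^sub>R h x)) \<longlonglongrightarrow> indicator {a..b} x *\<^sub>R h x"
        using ends
      proof eventually_elim
        case (elim x)
        show ?case
        proof (cases "a < x \<and> x < b")
          case True
          have "(\<lambda>n. exp (- c n / ((x - a) * (b - x)))) \<longlonglongrightarrow> exp (- 0 / ((x - a) * (b - x)))"
            unfolding c_def using True by (intro tendsto_intros LIMSEQ_Suc[OF lim_1_over_n]) auto
          then have "(\<lambda>n. \<phi> n x) \<longlonglongrightarrow> 1" using True by (simp add: \<phi>_def bump_family_def)
          from tendsto_scaleR[OF this tendsto_const[of "indicator {a..b} x *\<^sub>R h x"]]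
          show ?thesis by (simp only: scaleR_one)
        next
          case False
          with elim show ?thesis by (auto simp: indicator_def)
        qed
      qed
      have hm: "(\<lambda>x. indicator {a..b} x *\<^sub>R h x) \<in> borel_measurable lborel" by simp
      then show "(\<lambda>x. indicator {a..b} x *\<^sub>R h x) \<in> borel_measurable lborel" .
      show "(\<lambda>x. \<phi> n x *\<^sub>R (indicator {a..b} x *\<^sub>R h x)) \<in> borel_measurable lborel" for n
        by (rule borel_measurable_scaleR[OF _ hm]) simp
    qed
    moreover have "(LINT x|lborel. \<phi> n x *\<^sub>R (indicator {a..b} x *\<^sub>R h x)) = 0" for n
      using zero[OF \<phi>[of n]] unfolding eq .
    ultimately show ?thesis by (simp add: set_lebesgue_integral_def LIMSEQ_const_iff)
  qed
qed

lemma test_function_integrable: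
  fixes \<phi> :: "real \<Rightarrow> real"
  assumes "test_function \<phi>"
  shows "integrable lborel \<phi>"
proof -
  obtain M where M: "\<And>x. x \<notin> {-M..M} \<Longrightarrow> \<phi> x = 0" using test_function_derivative(5)[OF assms] by metis
  have "integrable lborel (\<lambda>x. indicator {-M..M} x *\<^sub>R \<phi> x)"
    using test_function_derivative(3)[OF assms]
    by (intro borel_integrable_compact continuous_at_imp_continuous_on) auto
  also have "(\<lambda>x. indicator {-M..M} x *\<^sub>R \<phi> x) = \<phi>"
  proof
    show "indicator {-M..M} x *\<^sub>R \<phi> x = \<phi> x" for x using M[of x] by (cases "x \<in> {-M..M}") auto
  qed
  finally show ?thesis .
qed

lemma test_function_linear_combination:
  fixes \<phi> \<psi> :: "real \<Rightarrow> real"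
  assumes \<phi>: "test_function \<phi>" and \<psi>: "test_function \<psi>"
  shows "test_function (\<lambda>x. \<phi> x + c * \<psi> x)"
proof -
  obtain M N where M: "\<And>x. x \<notin> {-M..M} \<Longrightarrow> \<phi> x = 0" and N: "\<And>x. x \<notin> {-N..N} \<Longrightarrow> \<psi> x = 0"
    using test_function_derivative(5)[OF \<phi>] test_function_derivative(5)[OF \<psi>] by metis
  show ?thesis
  proof (rule test_function_if_invariant_set)
    show "(\<lambda>x. \<phi> x + c * \<psi> x) \<in> {\<lambda>x::real. f x + c * g x |f g. test_function f \<and> test_function g}"
      using assms by blast
    show "x \<notin> {- max M N..max M N} \<Longrightarrow> \<phi> x + c * \<psi> x = 0" for x
      using M[of x] N[of x] by (cases "x \<in> {-M..M}"; cases "x \<in> {-N..N}") auto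
    fix f assume "f \<in> {\<lambda>x::real. f x + c * g x |f g. test_function f \<and> test_function g}"
    then obtain u v where f: "f = (\<lambda>x. u x + c * v x)" and uv: "test_function u" "test_function v" by blast
    show "\<exists>g\<in>{\<lambda>x::real. f x + c * g x |f g. test_function f \<and> test_function g}. \<forall>x. (f has_real_derivative g x) (at x)"
    proof (intro bexI allI)
      show "(f has_real_derivative dir_deriv 1 u x + c * dir_deriv 1 v x) (at x)" for x
        unfolding f using test_function_derivative(1)[OF uv(1)] test_function_derivative(1)[OF uv(2)]
        by (auto intro!: derivative_eq_intros)
      show "(\<lambda>x. dir_deriv 1 u x + c * dir_deriv 1 v x) \<in> {\<lambda>x::real. f x + c * g x |f g. test_function f \<and> test_function g}"
        using test_function_derivative(2) uv by blast
    qed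
  qed
qed

text \<open>The vanishing integral is exactly what makes the antiderivative return to zero on the
  right of the support.\<close>

lemma test_function_antiderivative:
  assumes \<psi>: "test_function \<psi>" and zero: "(LINT x|lborel. \<psi> x) = 0"
  shows "\<exists>\<phi>. test_function \<phi> \<and> dir_deriv 1 \<phi> = (\<psi> :: real \<Rightarrow> real)"
proof -
  obtain M where M: "0 < M" "\<And>x. x \<notin> {-M..M} \<Longrightarrow> \<psi> x = 0" using test_function_derivative(5)[OF \<psi>] by metis
  note cont = test_function_derivative(3)[OF \<psi>]
  obtain Q where "\<forall>x. - \<infinity> < ereal x \<longrightarrow> ereal x < \<infinity> \<longrightarrow> (Q has_vector_derivative \<psi> x) (at x)"
    using einterval_antiderivative[of "-\<infinity>" "\<infinity>" \<psi>] cont by auto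
  then have Q: "(Q has_vector_derivative \<psi> x) (at x)" for x by simp
  \<comment> \<open>The margin 1 keeps the base point strictly outside \<open>{-M..M}\<close>, where
    \<open>\<psi>\<close> is known to vanish, so that no endpoint has to be discussed.\<close>
  define \<phi> where "\<phi> x = Q x - Q (- (M + 1))" for x
  have d: "(\<phi> has_real_derivative \<psi> x) (at x)" for x
    unfolding \<phi>_def using Q[of x] by (auto intro!: derivative_eq_intros simp: has_real_derivative_iff_has_vector_derivative[symmetric])
  have FTC: "(LINT x|lborel. indicator {a..b} x *\<^sub>R \<psi> x) = Q b - Q a" if "a \<le> b" for a b
    using that by (intro integral_FTC_atLeastAtMost has_vector_derivative_at_within[OF Q] continuous_at_imp_continuous_on)
      (auto simp: cont)
  have supp: "\<phi> x = 0" if "x \<notin> {- (M + 1)..M + 1}" for x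
  proof (cases "x < - (M + 1)")
    case True
    have "(\<lambda>y. indicator {x..- (M + 1)} y *\<^sub>R \<psi> y) = (\<lambda>y. 0)" using M by (auto simp: indicator_def)
    then show ?thesis using FTC[of x "- (M + 1)"] True by (simp add: \<phi>_def)
  next
    case False
    then have x: "M + 1 < x" using that by auto
    have "(\<lambda>y. indicator {- (M + 1)..x} y *\<^sub>R \<psi> y) = \<psi>" using M x by (force simp: indicator_def)
    then show ?thesis using FTC[of "- (M + 1)" x] x M zero by (simp add: \<phi>_def)
  qed
  have "test_function \<phi>"
  proof (rule test_function_if_invariant_set[of _ "insert \<phi> (Collect test_function)"])
    fix f assume "f \<in> insert \<phi> (Collect test_function)"
    then show "\<exists>g\<in>insert \<phi> (Collect test_function). \<forall>x. (f has_real_derivative g x) (at x)"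
      using d \<psi> test_function_derivative(1,2) by blast
  qed (use supp in auto)
  moreover have "dir_deriv 1 \<phi> = \<psi>" using d by (auto intro!: ext has_real_derivative_dir_deriv)
  ultimately show ?thesis by blast
qed

section \<open>Weak derivatives and primitives\<close>

lemma integral_derivative_Icc:
  fixes \<phi> :: "real \<Rightarrow> real"
  assumes d: "\<And>x. (\<phi> has_real_derivative \<phi>' x) (at x)" and cont: "\<And>x. isCont \<phi>' x" and "a \<le> b"
  shows "(LINT x|lborel. indicator {a..b} x *\<^sub>R \<phi>' x) = \<phi> b - \<phi> a"
  using assms
  by (intro integral_FTC_atLeastAtMost continuous_at_imp_continuous_on
      has_vector_derivative_at_within[OF has_real_derivative_iff_has_vector_derivative[THEN iffD1, OF d]]) auto

text \<open>Here \<open>g\<close> is only locally integrable, so no Hoelder estimate is available;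
  continuity comes from the indefinite integral.\<close>

lemma is_primitive_continuous:
  assumes P: "is_primitive P g"
  shows "continuous_on A P"
proof -
  have eq: "P x = P a + integral {a..x} g" if "x \<in> {a..b}" for a b x
    using is_primitiveD(2)[OF P, of a x] set_borel_integral_eq_integral(2)[OF is_primitiveD(1)[OF P], of a x] that
    by (simp add: algebra_simps)
  have "continuous_on {a..b} P" for a b
  proof -
    have "continuous_on {a..b} (\<lambda>x. P a + integral {a..x} g)"
      by (intro continuous_intros indefinite_integral_continuous_1 set_borel_integral_eq_integral(1) is_primitiveD(1)[OF P])
    then show ?thesis by (rule continuous_on_eq) (use eq in auto)
  qed
  then have "isCont P x" for x
    using continuous_on_interior[of "{x - 1..x + 1}" P x] by simp
  then show ?thesis by (simp add: continuous_at_imp_continuous_on)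
qed

text \<open>\<open>P\<close> need not be differentiable everywhere, so the product rule is replaced
  by Fubini: write \<open>P\<close> as the integral of \<open>g\<close> up to \<open>x\<close> and
  exchange the order of integration.\<close>

lemma is_primitive_test_function_parts:
  fixes P g :: "real \<Rightarrow> 'e::euclidean_space"
  assumes P: "is_primitive P g" and \<phi>: "test_function \<phi>"
  shows "(LINT x|lborel. dir_deriv 1 \<phi> x *\<^sub>R P x) = - (LINT x|lborel. \<phi> x *\<^sub>R g x)"
proof -
  note d = test_function_derivative(1)[OF \<phi>] and dcont = test_function_derivative(4)[OF \<phi>]
  define \<phi>' where "\<phi>' = dir_deriv 1 \<phi>"
  obtain M0 where M0: "0 < M0" "\<And>x. x \<notin> {-M0..M0} \<Longrightarrow> \<phi> x = 0 \<and> \<phi>' x = 0"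
    using test_function_derivative(5)[OF \<phi>] unfolding \<phi>'_def by blast
  \<comment> \<open>The hypothesis gives zeros only outside \<open>{-M0..M0}\<close>; enlarging by 1
    makes \<open>\<phi>\<close> vanish at both endpoints as well.\<close>
  define M where "M = M0 + 1"
  have M: "0 < M" "\<And>x. x \<notin> {-M..M} \<Longrightarrow> \<phi> x = 0 \<and> \<phi>' x = 0" "\<phi> M = 0" "\<phi> (-M) = 0"
    using M0 by (auto simp: M_def)
  have [measurable]: "\<phi>' \<in> borel_measurable borel"
    unfolding \<phi>'_def by (intro borel_measurable_continuous_onI continuous_at_imp_continuous_on ballI dcont)
  have int: "integrable lborel (\<lambda>x. indicator {a..b} x *\<^sub>R g x)" for a b
    using is_primitiveD(1)[OF P] unfolding set_integrable_def .
  define gM where "gM t = indicator {-M..M} t *\<^sub>R g t" for t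
  have intM: "integrable lborel gM" unfolding gM_def by (rule int)
  then have [measurable]: "gM \<in> borel_measurable borel" by (auto dest: borel_measurable_integrable)
  have int': "integrable lborel \<phi>'"
    unfolding \<phi>'_def by (rule test_function_integrable[OF test_function_derivative(2)[OF \<phi>]])
  \<comment> \<open>The kernel of the double integral over \<open>t \<le> x\<close>: integrating in
    \<open>t\<close> produces \<open>P\<close>, integrating in \<open>x\<close> produces
    \<open>\<phi>\<close>.\<close>
  define f where "f x t = (if t \<le> x then \<phi>' x else 0) *\<^sub>R gM t" for x t
  have fm [measurable]: "case_prod f \<in> borel_measurable (lborel \<Otimes>\<^sub>M lborel)"
    unfolding f_def by (simp add: split_beta) measurable
  have fint: "integrable (lborel \<Otimes>\<^sub>M lborel) (case_prod f)"
  proof (rule lborel_pair.Fubini_integrable[OF fm])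
    have le: "norm (f x t) \<le> \<bar>\<phi>' x\<bar> * norm (gM t)" for x t by (simp add: f_def)
    have fx: "integrable lborel (\<lambda>t. f x t)" for x
      by (rule Bochner_Integration.integrable_bound[where f="\<lambda>t. \<bar>\<phi>' x\<bar> * norm (gM t)"])
        (use intM le in \<open>auto simp: f_def\<close>)
    then show "AE x in lborel. integrable lborel (\<lambda>t. case_prod f (x, t))" by simp
    show "integrable lborel (\<lambda>x. LINT t|lborel. norm (case_prod f (x, t)))"
    proof (rule Bochner_Integration.integrable_bound)
      show "integrable lborel (\<lambda>x. \<bar>\<phi>' x\<bar> * (LINT t|lborel. norm (gM t)))" using int' by simp
      have "(LINT t|lborel. norm (f x t)) \<le> \<bar>\<phi>' x\<bar> * (LINT t|lborel. norm (gM t))" for x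
      proof -
        have "(LINT t|lborel. norm (f x t)) \<le> (LINT t|lborel. \<bar>\<phi>' x\<bar> * norm (gM t))"
          using fx[of x] intM le by (intro integral_mono) auto
        then show ?thesis by simp
      qed
      then show "AE x in lborel. norm (LINT t|lborel. norm (case_prod f (x, t))) \<le> norm (\<bar>\<phi>' x\<bar> * (LINT t|lborel. norm (gM t)))"
        by (intro AE_I2) (auto intro: order_trans[OF _ abs_ge_self])
    qed measurable
  qed
  have inner1: "(LINT t|lborel. f x t) = \<phi>' x *\<^sub>R (P x - P (-M))" for x
  proof (cases "x \<in> {-M..M}")
    case True
    have "f x t = \<phi>' x *\<^sub>R (indicator {-M..x} t *\<^sub>R g t)" for t
      using True by (auto simp: f_def gM_def indicator_def)
    then have "(LINT t|lborel. f x t) = \<phi>' x *\<^sub>R (LINT t|lborel. indicator {-M..x} t *\<^sub>R g t)"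
      by (simp del: scaleR_scaleR)
    then show ?thesis
      using is_primitiveD(2)[OF P, of "-M" x] True unfolding set_lebesgue_integral_def by simp
  next
    case False
    then have "f x t = 0" for t using M(2) by (simp add: f_def)
    then show ?thesis using M(2)[OF False] by simp
  qed
  have inner2: "(LINT x|lborel. f x t) = - (\<phi> t *\<^sub>R g t)" for t
  proof (cases "t \<in> {-M..M}")
    case True
    have "f x t = (indicator {t..M} x *\<^sub>R \<phi>' x) *\<^sub>R g t" for x
    proof -
      have "x \<le> M \<or> \<phi>' x = 0" using M(2)[of x] by force
      then show ?thesis using True by (auto simp: f_def gM_def indicator_def)
    qed
    moreover have "integrable lborel (\<lambda>x. indicator {t..M} x *\<^sub>R \<phi>' x)"
      using int' by (intro integrable_mult_indicator) auto
    ultimately have "(LINT x|lborel. f x t) = (LINT x|lborel. indicator {t..M} x *\<^sub>R \<phi>' x) *\<^sub>R g t" by simp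
    also have "(LINT x|lborel. indicator {t..M} x *\<^sub>R \<phi>' x) = \<phi> M - \<phi> t"
      unfolding \<phi>'_def using True by (intro integral_derivative_Icc d dcont) auto
    finally show ?thesis using M(3) by simp
  next
    case False
    then show ?thesis using M(2)[OF False] by (simp add: f_def gM_def)
  qed
  \<comment> \<open>The constant \<open>P (-M)\<close> that was subtracted from \<open>P\<close> is
    paired with this integral and drops out.\<close>
  have zero: "(LINT x|lborel. \<phi>' x) = 0"
  proof -
    have "(LINT x|lborel. \<phi>' x) = (LINT x|lborel. indicator {-M..M} x *\<^sub>R \<phi>' x)"
      using M(2) by (intro Bochner_Integration.integral_cong) (auto simp: indicator_def)
    also have "\<dots> = \<phi> M - \<phi> (-M)"
      unfolding \<phi>'_def using M(1) by (intro integral_derivative_Icc d dcont) auto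
    finally show ?thesis using M by simp
  qed
  have "integrable lborel (\<lambda>x. \<phi>' x *\<^sub>R (P x - P (-M)))"
    using lborel_pair.integrable_fst[OF fint] by (simp add: inner1)
  moreover have c: "integrable lborel (\<lambda>x. \<phi>' x *\<^sub>R P (-M))" using int' by (rule integrable_scaleR_left)
  ultimately have "integrable lborel (\<lambda>x. \<phi>' x *\<^sub>R (P x - P (-M)) + \<phi>' x *\<^sub>R P (-M))"
    by (rule Bochner_Integration.integrable_add)
  then have i: "integrable lborel (\<lambda>x. \<phi>' x *\<^sub>R P x)" by (simp add: scaleR_diff_right)
  have "(LINT x|lborel. \<phi>' x *\<^sub>R P x) = (LINT x|lborel. \<phi>' x *\<^sub>R (P x - P (-M)))"
    using i c zero int' by (simp add: scaleR_diff_right)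
  also have "\<dots> = (LINT x|lborel. LINT t|lborel. f x t)" by (simp add: inner1)
  also have "\<dots> = (LINT t|lborel. LINT x|lborel. f x t)"
    by (rule lborel_pair.Fubini_integral[symmetric, OF fint])
  also have "\<dots> = - (LINT t|lborel. \<phi> t *\<^sub>R g t)" by (simp add: inner2)
  finally show ?thesis by (simp add: \<phi>'_def)
qed

lemma locally_integrable_iff_intervals:
  fixes f :: "real \<Rightarrow> complex"
  shows "locally_integrable f \<longleftrightarrow> (\<forall>a b. set_integrable lborel {a..b} f)"
proof
  assume *: "\<forall>a b. set_integrable lborel {a..b} f"
  show "locally_integrable f" unfolding locally_integrable_def
  proof (intro allI impI)
    fix K :: "real set" assume K: "compact K"
    then obtain B where "\<And>x. x \<in> K \<Longrightarrow> \<bar>x\<bar> \<le> B" using compact_imp_bounded[OF K] unfolding bounded_iff by auto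
    then have "K \<subseteq> {-B..B}" by force
    then show "set_integrable lborel K f"
      using K by (intro set_integrable_subset[OF *[rule_format, of "-B" B]]) (auto intro: borel_compact)
  qed
qed (auto simp: locally_integrable_def)

lemma locally_integrable_continuous_AE:
  fixes f P :: "'a::euclidean_space \<Rightarrow> complex"
  assumes f: "f \<in> borel_measurable borel" and eq: "AE x in lborel. f x = P x" and P: "continuous_on UNIV P"
  shows "locally_integrable f"
  unfolding locally_integrable_def set_integrable_def
proof (intro allI impI)
  fix K :: "'a set" assume K: "compact K"
  have [measurable]: "K \<in> sets borel" "f \<in> borel_measurable borel" using K f by (auto intro: borel_compact)
  have i: "integrable lborel (\<lambda>x. indicator K x *\<^sub>R P x)"
    by (intro borel_integrable_compact K continuous_on_subset[OF P]) simp
  show "integrable lborel (\<lambda>x. indicator K x *\<^sub>R f x)"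
  proof (rule integrable_cong_AE_imp[OF i])
    show "AE x in lborel. indicator K x *\<^sub>R P x = indicator K x *\<^sub>R f x" by (rule eventually_mono[OF eq]) simp
  qed simp
qed

lemma weak_derivative_of_primitive:
  assumes P: "is_primitive P g" and f: "f \<in> borel_measurable borel" and fP: "AE x in lborel. f x = P x"
  shows "weak_derivative f g"
  unfolding weak_derivative_def
proof (intro conjI allI impI)
  show "locally_integrable f"
    using locally_integrable_continuous_AE[OF f fP is_primitive_continuous[OF P]] .
  show "locally_integrable g"
    using is_primitiveD(1)[OF P] by (simp add: locally_integrable_iff_intervals)
  fix \<phi> :: "real \<Rightarrow> real" assume \<phi>: "test_function \<phi>"
  have [measurable]: "P \<in> borel_measurable borel" by (rule borel_measurable_continuous_onI[OF is_primitive_continuous[OF P]])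
  have [measurable]: "dir_deriv 1 \<phi> \<in> borel_measurable borel"
    by (intro borel_measurable_continuous_onI continuous_at_imp_continuous_on ballI test_function_derivative(4)[OF \<phi>])
  note [measurable] = f
  have "(LINT x|lborel. dir_deriv 1 \<phi> x *\<^sub>R f x) = (LINT x|lborel. dir_deriv 1 \<phi> x *\<^sub>R P x)"
  proof (rule integral_cong_AE)
    show "AE x in lborel. dir_deriv 1 \<phi> x *\<^sub>R f x = dir_deriv 1 \<phi> x *\<^sub>R P x"
      by (rule eventually_mono[OF fP]) simp
  qed simp_all
  then show "(LINT x|lborel. dir_deriv 1 \<phi> x *\<^sub>R f x) = - (LINT x|lborel. \<phi> x *\<^sub>R g x)"
    using is_primitive_test_function_parts[OF P \<phi>] by simp
qed

lemma test_function_mult_integrable: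
  fixes h :: "real \<Rightarrow> complex"
  assumes \<phi>: "test_function \<phi>" and h: "locally_integrable h"
  shows "integrable lborel (\<lambda>x. \<phi> x *\<^sub>R h x)"
proof -
  obtain M where M: "\<And>x. x \<notin> {-M..M} \<Longrightarrow> \<phi> x = 0" using test_function_derivative(5)[OF \<phi>] by metis
  have cont: "continuous_on A \<phi>" for A
    by (intro continuous_at_imp_continuous_on ballI test_function_derivative(3)[OF \<phi>])
  then have "compact (\<phi> ` {-M..M})" by (intro compact_continuous_image) auto
  from compact_imp_bounded[OF this] obtain B where "\<forall>y\<in>\<phi> ` {-M..M}. norm y \<le> B"
    unfolding bounded_iff by blast
  then have B: "\<bar>\<phi> x\<bar> \<le> B" if "x \<in> {-M..M}" for x using that by simp
  have [measurable]: "\<phi> \<in> borel_measurable borel" by (rule borel_measurable_continuous_onI[OF cont])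
  have i: "integrable lborel (\<lambda>x. indicator {-M..M} x *\<^sub>R h x)"
    using h unfolding locally_integrable_iff_intervals set_integrable_def by blast
  then have "integrable lborel (\<lambda>x. \<phi> x *\<^sub>R (indicator {-M..M} x *\<^sub>R h x))"
  proof (intro Bochner_Integration.integrable_bound[OF integrable_mult_right[OF integrable_norm[OF i], of B]])
    show "AE x in lborel. norm (\<phi> x *\<^sub>R (indicator {-M..M} x *\<^sub>R h x)) \<le> norm (B * norm (indicator {-M..M} x *\<^sub>R h x))"
    proof (rule AE_I2)
      fix x
      have "\<bar>\<phi> x\<bar> * norm (indicator {-M..M} x *\<^sub>R h x) \<le> B * norm (indicator {-M..M} x *\<^sub>R h x)"
        using B[of x] by (cases "x \<in> {-M..M}") (auto intro: mult_right_mono)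
      then show "norm (\<phi> x *\<^sub>R (indicator {-M..M} x *\<^sub>R h x)) \<le> norm (B * norm (indicator {-M..M} x *\<^sub>R h x))"
        unfolding norm_scaleR[of "\<phi> x"] by (rule order_trans) simp
    qed
    show "(\<lambda>x. \<phi> x *\<^sub>R (indicator {-M..M} x *\<^sub>R h x)) \<in> borel_measurable lborel"
      by (rule borel_measurable_scaleR[OF _ borel_measurable_integrable[OF i]]) simp
  qed
  also have "(\<lambda>x. \<phi> x *\<^sub>R (indicator {-M..M} x *\<^sub>R h x)) = (\<lambda>x. \<phi> x *\<^sub>R h x)"
  proof
    show "\<phi> x *\<^sub>R (indicator {-M..M} x *\<^sub>R h x) = \<phi> x *\<^sub>R h x" for x
      using M[of x] by (cases "x \<in> {-M..M}") auto
  qed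
  finally show ?thesis .
qed

text \<open>The lemma of du Bois-Reymond. Any test function becomes the derivative of another one
  after subtracting the multiple of a fixed bump that cancels its integral.\<close>

lemma AE_const_if_weak_derivative_0:
  assumes h: "weak_derivative h (\<lambda>x. 0)"
  shows "\<exists>c. AE x in lborel. h x = c"
proof -
  have lh: "locally_integrable h" using h by (simp add: weak_derivative_def)
  have h0: "(LINT x|lborel. dir_deriv 1 \<phi> x *\<^sub>R h x) = 0" if "test_function \<phi>" for \<phi>
    using h that by (simp add: weak_derivative_def)
  define \<rho> where "\<rho> = bump_family 0 1 1 1 0"
  have \<rho>: "test_function \<rho>" unfolding \<rho>_def by (rule bump_test_function) auto
  have pos: "0 < (LINT x|lborel. \<rho> x)"
  proof -
    have nn: "0 \<le> \<rho> x" for x by (auto simp: \<rho>_def bump_family_def)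
    have "(LINT x|lborel. \<rho> x) \<noteq> 0"
    proof
      assume "(LINT x|lborel. \<rho> x) = 0"
      then have "AE x in lborel. \<rho> x = 0"
        using integral_nonneg_eq_0_iff_AE[OF test_function_integrable[OF \<rho>]] nn by simp
      moreover have "{0<..<1} \<subseteq> {x. \<rho> x \<noteq> 0}" by (auto simp: \<rho>_def bump_family_def)
      ultimately have "AE x in lborel. x \<notin> {0<..<1::real}" by (elim eventually_mono) blast
      then have "{0<..<1::real} \<in> null_sets lborel" by (subst AE_iff_null_sets) simp_all
      then show False by (simp add: null_sets_def)
    qed
    moreover have "0 \<le> (LINT x|lborel. \<rho> x)" using nn by (intro Bochner_Integration.integral_nonneg)
    ultimately show ?thesis by linarith
  qed
  define I where "I = (LINT x|lborel. \<rho> x)"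
  \<comment> \<open>The mean of \<open>h\<close> weighted by the normalized bump, the only possible
    value of the constant.\<close>
  define c where "c = (1 / I) *\<^sub>R (LINT x|lborel. \<rho> x *\<^sub>R h x)"
  have "AE x in lborel. h x - c = 0"
  proof (rule AE_eq_0_if_test_integrals_eq_0)
    show "locally_integrable (\<lambda>x. h x - c)"
      unfolding locally_integrable_iff_intervals
    proof (intro allI set_integral_diff(1))
      show "set_integrable lborel {a..b} h" for a b :: real using lh unfolding locally_integrable_iff_intervals by blast
      show "set_integrable lborel {a..b} (\<lambda>x. c)" for a b :: real
        by (rule borel_integrable_atLeastAtMost') (intro continuous_intros)
    qed
    fix \<psi> :: "real \<Rightarrow> real" assume \<psi>: "test_function \<psi>"
    define J where "J = (LINT x|lborel. \<psi> x)"
    have t: "test_function (\<lambda>x. \<psi> x + (- J / I) * \<rho> x)" by (rule test_function_linear_combination[OF \<psi> \<rho>])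
    have "(LINT x|lborel. \<psi> x + (- J / I) * \<rho> x) = 0"
      using test_function_integrable[OF \<psi>] test_function_integrable[OF \<rho>] pos by (simp add: J_def I_def)
    then obtain \<phi> where \<phi>: "test_function \<phi>" "dir_deriv 1 \<phi> = (\<lambda>x. \<psi> x + (- J / I) * \<rho> x)"
      using test_function_antiderivative[OF t] by blast
    have "0 = (LINT x|lborel. (\<psi> x + (- J / I) * \<rho> x) *\<^sub>R h x)" using h0[OF \<phi>(1)] \<phi>(2) by simp
    also have "\<dots> = (LINT x|lborel. \<psi> x *\<^sub>R h x + (- J / I) *\<^sub>R (\<rho> x *\<^sub>R h x))"
      by (simp only: scaleR_add_left scaleR_scaleR)
    also have "\<dots> = (LINT x|lborel. \<psi> x *\<^sub>R h x) + (LINT x|lborel. (- J / I) *\<^sub>R (\<rho> x *\<^sub>R h x))"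
      by (rule Bochner_Integration.integral_add[OF test_function_mult_integrable[OF \<psi> lh]
            integrable_scaleR_right[OF test_function_mult_integrable[OF \<rho> lh]]])
    also have "(LINT x|lborel. (- J / I) *\<^sub>R (\<rho> x *\<^sub>R h x)) = (- J / I) *\<^sub>R (LINT x|lborel. \<rho> x *\<^sub>R h x)"
      by (simp del: scaleR_scaleR)
    also have "(- J / I) *\<^sub>R (LINT x|lborel. \<rho> x *\<^sub>R h x) = - (J *\<^sub>R c)" by (simp add: c_def)
    also have "(LINT x|lborel. \<psi> x *\<^sub>R h x) + - (J *\<^sub>R c) = (LINT x|lborel. \<psi> x *\<^sub>R h x) - J *\<^sub>R c" by simp
    finally have 1: "0 = (LINT x|lborel. \<psi> x *\<^sub>R h x) - J *\<^sub>R c" .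
    have "(LINT x|lborel. \<psi> x *\<^sub>R (h x - c)) = (LINT x|lborel. \<psi> x *\<^sub>R h x) - (LINT x|lborel. \<psi> x *\<^sub>R c)"
      unfolding scaleR_diff_right
      by (rule Bochner_Integration.integral_diff[OF test_function_mult_integrable[OF \<psi> lh] integrable_scaleR_left[OF test_function_integrable[OF \<psi>]]])
    also have "(LINT x|lborel. \<psi> x *\<^sub>R c) = J *\<^sub>R c"
      using test_function_integrable[OF \<psi>] by (simp add: J_def)
    also note 1[symmetric]
    finally show "(LINT x|lborel. \<psi> x *\<^sub>R (h x - c)) = 0" .
  qed
  then show ?thesis by auto
qed

text \<open>The oriented integral from 0 gives one formula on both sides of the origin.\<close>

lemma primitive_exists:
  fixes g :: "real \<Rightarrow> 'e::euclidean_space"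
  assumes "\<And>a b. set_integrable lborel {a..b} g"
  shows "\<exists>P. is_primitive P g"
proof -
  define P where "P x = (LBINT t=ereal 0..ereal x. g t)" for x :: real
  have "P b - P a = (LINT x:{a..b}|lborel. g x)" if "a \<le> b" for a b
  proof -
    define lo hi where "lo = min 0 (min a b)" and "hi = max 0 (max a b)"
    have "lo \<le> hi" by (simp add: lo_def hi_def)
    then have "interval_lebesgue_integrable lborel (ereal lo) (ereal hi) g"
      by (simp add: interval_lebesgue_integrable_def einterval_eq set_integrable_subset[OF assms[of lo hi]] greaterThanLessThan_subseteq_atLeastAtMost_iff)
    moreover have "ereal lo = min (ereal 0) (min (ereal a) (ereal b))" "ereal hi = max (ereal 0) (max (ereal a) (ereal b))"
      by (simp_all add: lo_def hi_def)
    ultimately have "P a + (LBINT t=ereal a..ereal b. g t) = P b"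
      unfolding P_def by (intro interval_integral_sum) simp
    then show ?thesis using interval_integral_Icc[OF that, of g] by (simp add: algebra_simps)
  qed
  then show ?thesis using assms unfolding is_primitive_def by blast
qed

text \<open>The entrance from distributions to continuous representatives: \<open>f\<close> minus
  any primitive of \<open>g\<close> has weak derivative zero and is therefore constant almost
  everywhere.\<close>

lemma weak_derivative_imp_primitive:
  assumes fg: "weak_derivative f g"
  shows "\<exists>P. is_primitive P g \<and> (AE x in lborel. f x = P x)"
proof -
  have lf: "locally_integrable f" and lg: "locally_integrable g" using fg by (auto simp: weak_derivative_def)
  obtain P where P: "is_primitive P g"
    using primitive_exists[of g] lg by (auto simp: locally_integrable_iff_intervals)
  have Pm: "P \<in> borel_measurable borel" by (rule borel_measurable_continuous_onI[OF is_primitive_continuous[OF P]])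
  note wP = weak_derivative_of_primitive[OF P Pm AE_I2]
  have lP: "locally_integrable P" using wP by (simp add: weak_derivative_def)
  have "weak_derivative (\<lambda>x. f x - P x) (\<lambda>x. 0)"
    unfolding weak_derivative_def
  proof (intro conjI allI impI)
    show "locally_integrable (\<lambda>x. f x - P x)" "locally_integrable (\<lambda>x::real. 0)"
      using lf lP unfolding locally_integrable_iff_intervals
      by (blast intro: set_integral_diff(1), simp add: set_integrable_def)
    fix \<phi> :: "real \<Rightarrow> real" assume \<phi>: "test_function \<phi>"
    note d = test_function_derivative(2)[OF \<phi>]
    have "(LINT x|lborel. dir_deriv 1 \<phi> x *\<^sub>R (f x - P x)) = (LINT x|lborel. dir_deriv 1 \<phi> x *\<^sub>R f x) - (LINT x|lborel. dir_deriv 1 \<phi> x *\<^sub>R P x)"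
      unfolding scaleR_diff_right
      by (rule Bochner_Integration.integral_diff[OF test_function_mult_integrable[OF d lf] test_function_mult_integrable[OF d lP]])
    also have "\<dots> = 0" using fg wP \<phi> by (simp add: weak_derivative_def)
    finally show "(LINT x|lborel. dir_deriv 1 \<phi> x *\<^sub>R (f x - P x)) = - (LINT x|lborel. \<phi> x *\<^sub>R (0::complex))" by simp
  qed
  then obtain c where c: "AE x in lborel. f x - P x = c" using AE_const_if_weak_derivative_0 by blast
  have "is_primitive (\<lambda>x. P x + c) g" using P by (simp add: is_primitive_def)
  moreover have "AE x in lborel. f x = P x + c" using c by eventually_elim (simp add: algebra_simps)
  ultimately show ?thesis by (intro exI[of _ "\<lambda>x. P x + c"] conjI)
qed

lemma weak_derivative_AE_unique:
  assumes g: "weak_derivative f g" and g': "weak_derivative f g'"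
  shows "AE x in lborel. g x = g' x"
proof -
  have l: "locally_integrable g" "locally_integrable g'" using g g' by (auto simp: weak_derivative_def)
  have "AE x in lborel. g x - g' x = 0"
  proof (rule AE_eq_0_if_test_integrals_eq_0)
    show "locally_integrable (\<lambda>x. g x - g' x)"
      using l unfolding locally_integrable_iff_intervals by (blast intro: set_integral_diff(1))
    fix \<phi> :: "real \<Rightarrow> real" assume \<phi>: "test_function \<phi>"
    have "(LINT x|lborel. \<phi> x *\<^sub>R (g x - g' x)) = (LINT x|lborel. \<phi> x *\<^sub>R g x) - (LINT x|lborel. \<phi> x *\<^sub>R g' x)"
      unfolding scaleR_diff_right
      by (rule Bochner_Integration.integral_diff[OF test_function_mult_integrable[OF \<phi> l(1)] test_function_mult_integrable[OF \<phi> l(2)]])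
    also have "\<dots> = 0" using g g' \<phi> by (simp add: weak_derivative_def)
    finally show "(LINT x|lborel. \<phi> x *\<^sub>R (g x - g' x)) = 0" .
  qed
  then show ?thesis by simp
qed

section \<open>Continuous representatives of elements of \<open>H1\<close>\<close>

lemma L2_iff_square_integrable: "f \<in> L2 \<longleftrightarrow> square_integrable f"
  by (simp add: L2_def square_integrable_def)

lemma L2_norm_square: "(L2_norm f)\<^sup>2 = l2sq f"
  by (simp add: L2_norm_def l2sq_def Bochner_Integration.integral_nonneg)

lemma l2sq_cong_AE:
  assumes "f \<in> borel_measurable borel" "g \<in> borel_measurable borel" "AE x in lborel. f x = g x"
  shows "l2sq f = l2sq g"
  unfolding l2sq_def
proof (rule integral_cong_AE)
  show "AE x in lborel. (norm (f x))\<^sup>2 = (norm (g x))\<^sup>2" by (rule eventually_mono[OF assms(3)]) simp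
qed (use assms in simp_all)

lemma square_integrable_cong_AE:
  assumes f: "f \<in> borel_measurable borel" and g: "square_integrable g" and "AE x in lborel. f x = g x"
  shows "square_integrable f"
  unfolding square_integrable_def
proof
  show "integrable lborel (\<lambda>x. (norm (f x))\<^sup>2)"
  proof (rule integrable_cong_AE_imp[OF square_integrable_integrable[OF g]])
    show "AE x in lborel. (norm (g x))\<^sup>2 = (norm (f x))\<^sup>2" by (rule eventually_mono[OF assms(3)]) simp
  qed (use f in simp)
qed fact

lemma H1_sobolev:
  assumes "f \<in> H1"
  shows "\<exists>P. sobolev P (wderiv f) \<and> (AE x in lborel. f x = P x)"
proof -
  have "\<exists>g. g \<in> L2 \<and> weak_derivative f g" using assms by (auto simp: H1_def)
  from someI_ex[OF this] have w: "wderiv f \<in> L2" "weak_derivative f (wderiv f)" by (auto simp: wderiv_def)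
  obtain P where P: "is_primitive P (wderiv f)" "AE x in lborel. f x = P x"
    using weak_derivative_imp_primitive[OF w(2)] by blast
  have Pm: "P \<in> borel_measurable borel" by (rule borel_measurable_continuous_onI[OF is_primitive_continuous[OF P(1)]])
  have f: "square_integrable f" using assms by (simp add: H1_def L2_iff_square_integrable)
  have "square_integrable P"
    by (rule square_integrable_cong_AE[OF Pm f]) (rule eventually_mono[OF P(2)], simp)
  then show ?thesis using w(1) P by (auto simp: sobolev_def L2_iff_square_integrable)
qed

text \<open>Since weak derivatives agree almost everywhere, everything defined through the arbitrary
  choice \<open>wderiv\<close> can be computed from any pair \<open>P\<close>,
  \<open>g\<close>.\<close>

lemma H1_if_sobolev:
  assumes P: "sobolev P g" and f: "f \<in> borel_measurable borel" and fP: "AE x in lborel. f x = P x"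
  shows "f \<in> H1" "AE x in lborel. wderiv f x = g x" "wderiv f \<in> borel_measurable borel"
    "(L2_norm f)\<^sup>2 = l2sq P" "(H1_norm f)\<^sup>2 = l2sq P + l2sq g"
proof -
  note w = weak_derivative_of_primitive[OF sobolevD(3)[OF P] f fP]
  have sf: "square_integrable f" by (rule square_integrable_cong_AE[OF f sobolevD(1)[OF P] fP])
  show fH: "f \<in> H1"
    using w sobolevD(2)[OF P] sf by (auto simp: H1_def L2_iff_square_integrable)
  obtain Q where Q: "sobolev Q (wderiv f)" "AE x in lborel. f x = Q x" using H1_sobolev[OF fH] by blast
  have "weak_derivative f (wderiv f)" by (rule weak_derivative_of_primitive[OF sobolevD(3)[OF Q(1)] f Q(2)])
  then show ae: "AE x in lborel. wderiv f x = g x" using weak_derivative_AE_unique w by blast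
  show wm: "wderiv f \<in> borel_measurable borel"
    by (rule square_integrable_measurable[OF sobolevD(2)[OF Q(1)]])
  have lf: "l2sq f = l2sq P"
    by (rule l2sq_cong_AE[OF f square_integrable_measurable[OF sobolevD(1)[OF P]] fP])
  then show "(L2_norm f)\<^sup>2 = l2sq P" by (simp add: L2_norm_square)
  have lw: "l2sq (wderiv f) = l2sq g"
    by (rule l2sq_cong_AE[OF wm square_integrable_measurable[OF sobolevD(2)[OF P]] ae])
  have "(H1_norm f)\<^sup>2 = (LINT x|lborel. (norm (f x))\<^sup>2 + (norm (wderiv f x))\<^sup>2)"
    by (simp add: H1_norm_def Bochner_Integration.integral_nonneg)
  also have "\<dots> = l2sq f + l2sq (wderiv f)"
    unfolding l2sq_def
    by (rule Bochner_Integration.integral_add[OF square_integrable_integrable[OF sf] square_integrable_integrable[OF sobolevD(2)[OF Q(1)]]])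
  finally show "(H1_norm f)\<^sup>2 = l2sq P + l2sq g" using lf lw by simp
qed

section \<open>The coupled energy\<close>

lemma linear_nth: "linear (\<lambda>z :: complex ^ 'n. z $ j)"
  by (rule linearI) auto

lemma linear_axis: "linear (\<lambda>z. axis j z :: complex ^ 'n)"
  by (rule linearI) (auto simp: axis_def vec_eq_iff)

lemma sobolev_nth:
  fixes P :: "real \<Rightarrow> complex ^ 'n"
  shows "sobolev P g \<Longrightarrow> sobolev (\<lambda>x. P x $ j) (\<lambda>x. g x $ j)"
  by (rule sobolev_linear[OF _ linear_nth])

lemma square_integrable_nth:
  fixes P :: "real \<Rightarrow> complex ^ 'n"
  shows "square_integrable P \<Longrightarrow> square_integrable (\<lambda>x. P x $ j)"
  by (rule square_integrable_linear[OF _ linear_nth])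

lemma sobolev_zero: "sobolev (\<lambda>x. 0) (\<lambda>x. 0)"
  by (simp add: sobolev_def square_integrable_def is_primitive_def set_integrable_def set_lebesgue_integral_def)

lemma sobolev_sum:
  assumes "finite I" "\<And>i. i \<in> I \<Longrightarrow> sobolev (P i) (g i)"
  shows "sobolev (\<lambda>x. \<Sum>i\<in>I. P i x) (\<lambda>x. \<Sum>i\<in>I. g i x)"
  using assms
proof (induction I rule: finite_induct)
  case empty
  show ?case using sobolev_zero by simp
next
  case (insert i I)
  then show ?case using sobolev_add[of "P i" "g i" "\<lambda>x. \<Sum>i\<in>I. P i x"] by simp
qed

lemma sobolev_vec_lambda:
  fixes P g :: "'n::finite \<Rightarrow> real \<Rightarrow> complex"
  assumes "\<And>j. sobolev (P j) (g j)"
  shows "sobolev (\<lambda>x. \<chi> j. P j x) (\<lambda>x. \<chi> j. g j x)"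
proof -
  have eq: "(\<chi> j. z j) = (\<Sum>j\<in>UNIV. axis j (z j))" for z :: "'n \<Rightarrow> complex"
    by (auto simp: vec_eq_iff axis_def sum_component if_distrib cong: if_cong)
  show ?thesis unfolding eq
    by (intro sobolev_sum sobolev_linear[OF assms linear_axis]) simp
qed

lemma norm_vec_square: "(norm (z :: complex ^ 'n))\<^sup>2 = (\<Sum>j\<in>UNIV. (norm (z $ j))\<^sup>2)"
  by (simp add: norm_vec_def L2_set_def sum_nonneg)

lemma l2sq_vec:
  fixes P :: "real \<Rightarrow> complex ^ 'n"
  assumes "square_integrable P"
  shows "l2sq P = (\<Sum>j\<in>UNIV. l2sq (\<lambda>x. P x $ j))"
  unfolding l2sq_def norm_vec_square
  by (rule Bochner_Integration.integral_sum) (rule square_integrable_integrable[OF square_integrable_nth[OF assms]])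

text \<open>Writing the square root as the norm of a pair exhibits each component as the modulus of
  a map into a four-dimensional space, so the general statement on moduli of Sobolev functions
  applies. All components are real and nonnegative, and phases are lost.\<close>

definition combine :: "complex ^ 'n \<Rightarrow> complex ^ 'n \<Rightarrow> complex ^ 'n" where
  "combine z w = (\<chi> j. of_real (norm (z $ j, w $ j)))"

lemma combine_nth_square: "(norm (combine z w $ j))\<^sup>2 = (norm (z $ j))\<^sup>2 + (norm (w $ j))\<^sup>2"
  by (simp add: combine_def norm_Pair)

lemma linear_of_real: "linear (of_real :: real \<Rightarrow> complex)"
  by (rule linearI) (auto simp: scaleR_conv_of_real)

text \<open>The pair has as derivative the pair of derivatives, whose squares add; taking the
  modulus does not increase the result.\<close>

lemma sobolev_combine:
  fixes F K :: "real \<Rightarrow> complex ^ 'n"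
  assumes F: "sobolev F G" and K: "sobolev K L"
  shows "\<exists>M. sobolev (\<lambda>x. combine (F x) (K x)) M \<and>
    (\<forall>j. l2sq (\<lambda>x. M x $ j) \<le> l2sq (\<lambda>x. G x $ j) + l2sq (\<lambda>x. L x $ j))"
proof -
  have "\<forall>j. \<exists>m :: real \<Rightarrow> complex. sobolev (\<lambda>x. of_real (norm (F x $ j, K x $ j))) m \<and>
    l2sq m \<le> l2sq (\<lambda>x. G x $ j) + l2sq (\<lambda>x. L x $ j)"
  proof
    fix j
    note Fj = sobolev_nth[OF F, of j] and Kj = sobolev_nth[OF K, of j]
    have l1: "linear (\<lambda>z :: complex. (z, 0 :: complex))" and l2: "linear (\<lambda>z :: complex. (0 :: complex, z))"
      by (auto intro!: linearI)
    have "sobolev (\<lambda>x. (F x $ j, 0) + (0, K x $ j)) (\<lambda>x. (G x $ j, 0) + (0, L x $ j))"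
      by (rule sobolev_add[OF sobolev_linear[OF Fj l1] sobolev_linear[OF Kj l2]])
    then have pair: "sobolev (\<lambda>x. (F x $ j, K x $ j)) (\<lambda>x. (G x $ j, L x $ j))" by simp
    have lp: "l2sq (\<lambda>x. (G x $ j, L x $ j)) = l2sq (\<lambda>x. G x $ j) + l2sq (\<lambda>x. L x $ j)"
      using square_integrable_integrable[OF sobolevD(2)[OF Fj]] square_integrable_integrable[OF sobolevD(2)[OF Kj]]
      by (simp add: l2sq_def norm_Pair)
    obtain m where m: "sobolev (\<lambda>x. norm (F x $ j, K x $ j)) m" "l2sq m \<le> l2sq (\<lambda>x. (G x $ j, L x $ j))"
      using sobolev_norm[OF pair] by blast
    have "l2sq (\<lambda>x. complex_of_real (m x)) = l2sq m" by (simp add: l2sq_def)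
    then show "\<exists>m :: real \<Rightarrow> complex. sobolev (\<lambda>x. of_real (norm (F x $ j, K x $ j))) m \<and>
        l2sq m \<le> l2sq (\<lambda>x. G x $ j) + l2sq (\<lambda>x. L x $ j)"
      using sobolev_linear[OF m(1) linear_of_real] m(2) lp by (intro exI[of _ "\<lambda>x. of_real (m x)"]) simp
  qed
  from choice[OF this] obtain m :: "'n \<Rightarrow> real \<Rightarrow> complex" where m: "\<And>j. sobolev (\<lambda>x. of_real (norm (F x $ j, K x $ j))) (m j)"
    "\<And>j. l2sq (m j) \<le> l2sq (\<lambda>x. G x $ j) + l2sq (\<lambda>x. L x $ j)" by blast
  show ?thesis
    using sobolev_vec_lambda[OF m(1)] m(2) unfolding combine_def
    by (intro exI[of _ "\<lambda>x. \<chi> j. m j x"]) simp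
qed

lemma l2sq_combine:
  fixes F K :: "real \<Rightarrow> complex ^ 'n"
  assumes "square_integrable F" "square_integrable K"
  shows "l2sq (\<lambda>x. combine (F x) (K x) $ j) = l2sq (\<lambda>x. F x $ j) + l2sq (\<lambda>x. K x $ j)"
  unfolding l2sq_def combine_nth_square
  by (intro Bochner_Integration.integral_add square_integrable_integrable square_integrable_nth assms)

section \<open>Inequalities for real powers\<close>

lemma powr_Lipschitz:
  fixes p s t S :: real
  assumes "1 < p" "0 \<le> s" "s \<le> S" "0 \<le> t" "t \<le> S"
  shows "\<bar>s powr p - t powr p\<bar> \<le> p * S powr (p - 1) * \<bar>s - t\<bar>"
proof -
  have *: "t powr p - s powr p \<le> p * S powr (p - 1) * (t - s)" if "0 \<le> s" "s < t" "t \<le> S" for s t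
  proof -
    \<comment> \<open>The absolute value makes the function two-sided differentiable at 0, so that
      the mean value theorem also covers \<open>s = 0\<close>.\<close>
    have "\<exists>\<xi>>s. \<xi> < t \<and> \<bar>t\<bar> powr p - \<bar>s\<bar> powr p = (t - s) * (p * \<xi> powr (p - 1))"
    proof (rule MVT2[OF that(2), where f="\<lambda>x. \<bar>x\<bar> powr p" and f'="\<lambda>x. p * x powr (p - 1)"])
      fix x assume "s \<le> x" "x \<le> t"
      show "((\<lambda>x. \<bar>x\<bar> powr p) has_real_derivative p * x powr (p - 1)) (at x)"
      proof (cases "x = 0")
        case False
        then have x: "0 < x" using that \<open>s \<le> x\<close> by simp
        show ?thesis
          by (rule has_field_derivative_transform_within_open[OF has_real_derivative_powr[OF x], of "{0<..}"])
            (use x in auto)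
      next
        case True
        have "((\<lambda>h. \<bar>h\<bar> powr (p - 1)) \<longlongrightarrow> \<bar>0\<bar> powr (p - 1)) (at (0::real))"
          using assms by (intro tendsto_intros) auto
        then have l: "((\<lambda>h. \<bar>h\<bar> powr (p - 1)) \<longlongrightarrow> 0) (at (0::real))" by simp
        have "((\<lambda>h. (\<bar>h\<bar> powr p - \<bar>0\<bar> powr p) / (h - 0)) \<longlongrightarrow> 0) (at (0::real))"
        proof (rule Lim_null_comparison[OF always_eventually l], rule allI)
          fix h :: real
          have "\<bar>h\<bar> powr p = \<bar>h\<bar> powr (p - 1) * \<bar>h\<bar>" if "h \<noteq> 0"
            using powr_add[of "\<bar>h\<bar>" "p - 1" 1] that by simp
          then show "norm ((\<bar>h\<bar> powr p - \<bar>0\<bar> powr p) / (h - 0)) \<le> \<bar>h\<bar> powr (p - 1)"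
            by (cases "h = 0") (simp_all add: abs_mult)
        qed
        then show ?thesis using True assms by (simp add: has_field_derivative_iff)
      qed
    qed
    then have "\<exists>\<xi>>s. \<xi> < t \<and> t powr p - s powr p = (t - s) * (p * \<xi> powr (p - 1))"
      using that by simp
    then obtain \<xi> where \<xi>: "s < \<xi>" "\<xi> < t" "t powr p - s powr p = (t - s) * (p * \<xi> powr (p - 1))" by blast
    have "\<xi> powr (p - 1) \<le> S powr (p - 1)" using \<xi> that assms by (intro powr_mono2) auto
    then show ?thesis using \<xi>(3) assms that by (simp add: mult_left_mono mult.commute)
  qed
  have mono: "x powr p \<le> y powr p" if "0 \<le> x" "x \<le> y" for x y using that assms by (intro powr_mono2) auto
  consider "s < t" | "t < s" | "s = t" by linarith
  then show ?thesis
    using *[of s t] *[of t s] mono[of s t] mono[of t s] assms by cases auto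
qed

lemma powr_add_ge:
  fixes x y q :: real
  assumes "0 \<le> x" "0 \<le> y" "1 \<le> q"
  shows "x powr q + y powr q \<le> (x + y) powr q"
proof -
  have split: "z powr q = z * z powr (q - 1)" if "0 \<le> z" for z :: real
    using powr_add[of z 1 "q - 1"] that by (cases "z = 0") auto
  have "x powr q + y powr q \<le> x * (x + y) powr (q - 1) + y * (x + y) powr (q - 1)"
    unfolding split[OF assms(1)] split[OF assms(2)]
    using assms by (intro add_mono mult_left_mono powr_mono2) auto
  also have "\<dots> = (x + y) powr q" using split[of "x + y"] assms by (simp add: distrib_right)
  finally show ?thesis .
qed

text \<open>This is where \<open>2 \<le> p\<close> enters: in terms of squares the exponent is
  \<open>p / 2\<close>, and powers with exponent at least 1 are superadditive.\<close>

lemma norm_Pair_powr_ge: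
  fixes z w :: complex
  assumes "2 \<le> p"
  shows "norm z powr p + norm w powr p \<le> norm (z, w) powr p"
proof -
  have sq: "x powr p = (x\<^sup>2) powr (p / 2)" if "0 \<le> x" for x :: real
    using that powr_powr[of x 2 "p/2"] by (simp add: powr_numeral)
  have "norm z powr p + norm w powr p = ((norm z)\<^sup>2) powr (p/2) + ((norm w)\<^sup>2) powr (p/2)"
    using sq[of "norm z"] sq[of "norm w"] by simp
  also have "\<dots> \<le> ((norm z)\<^sup>2 + (norm w)\<^sup>2) powr (p/2)"
    using assms by (intro powr_add_ge) auto
  also have "(norm z)\<^sup>2 + (norm w)\<^sup>2 = (norm (z, w))\<^sup>2" by (simp add: norm_Pair)
  also have "((norm (z, w))\<^sup>2) powr (p/2) = norm (z, w) powr p" using sq[of "norm (z, w)"] by simp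
  finally show ?thesis .
qed

section \<open>Interaction density and the gain from combining two triples\<close>

locale coupled_nls =
  fixes p :: real and a :: "3 \<Rightarrow> 3 \<Rightarrow> real"
  assumes p_ge_2: "2 \<le> p" and p_less_3: "p < 3"
    and a_pos: "\<And>k j. 0 < a k j" and a_sym: "\<And>k j. a k j = a j k"
begin

definition W :: "complex ^ 3 \<Rightarrow> real" where
  "W z = 1 / p * (\<Sum>k\<in>UNIV. \<Sum>j\<in>UNIV. a k j * norm (z $ k) powr p * norm (z $ j) powr p)"

definition en :: "(real \<Rightarrow> complex ^ 3) \<Rightarrow> (real \<Rightarrow> complex ^ 3) \<Rightarrow> real" where
  "en F G = l2sq G - (LINT x|lborel. W (F x))"

text \<open>The Lipschitz constant of the interaction on the ball of radius \<open>S\<close>, in the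
  quadratic form below. It is of order S^(2p-2), so uniformly small functions of bounded mass have
  negligible interaction.\<close>

definition K :: "real \<Rightarrow> real" where
  "K S = (\<Sum>k\<in>UNIV. \<Sum>j\<in>UNIV. a k j) * (S powr (p - 1))\<^sup>2"

lemma K_nonneg: "0 \<le> K S"
  unfolding K_def using a_pos by (intro mult_nonneg_nonneg sum_nonneg) (auto intro: less_imp_le)

lemma W_nonneg: "0 \<le> W z"
  unfolding W_def using p_ge_2 a_pos by (intro mult_nonneg_nonneg sum_nonneg) (auto intro: less_imp_le)

lemma W_measurable [measurable]: "W \<in> borel_measurable borel"
proof -
  have [measurable]: "(\<lambda>z. z $ j) \<in> borel_measurable (borel :: (complex ^ 3) measure)" for j
    by (intro borel_measurable_continuous_onI continuous_intros)
  show ?thesis unfolding W_def by measurable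
qed

lemma powr_le_linear:
  assumes "0 \<le> s" "s \<le> S"
  shows "s powr p \<le> S powr (p - 1) * s"
proof -
  have "s powr p = s powr (p - 1) * s" using powr_add[of s "p - 1" 1] assms by (cases "s = 0") auto
  also have "\<dots> \<le> S powr (p - 1) * s" using assms p_ge_2 by (intro mult_right_mono powr_mono2) auto
  finally show ?thesis .
qed

lemma powr_product_Lipschitz:
  fixes z w :: "complex ^ 3"
  assumes "norm z \<le> S" "norm w \<le> S"
  shows "\<bar>norm (z $ k) powr p * norm (z $ j) powr p - norm (w $ k) powr p * norm (w $ j) powr p\<bar>
    \<le> p * (S powr (p - 1))\<^sup>2 * ((norm z + norm w) * norm (z - w))"
proof -
  define s where "s = S powr (p - 1)"
  have s: "0 \<le> s" by (simp add: s_def)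
  have le: "norm (z $ i) \<le> norm z" for z :: "complex ^ 3" and i by (rule Finite_Cartesian_Product.norm_nth_le)
  have b: "norm (z $ i) \<le> S" "norm (w $ i) \<le> S" for i using le[of z i] le[of w i] assms by auto
  have d: "\<bar>norm (z $ i) - norm (w $ i)\<bar> \<le> norm (z - w)" for i
    using norm_triangle_ineq3[of "z $ i" "w $ i"] le[of "z - w" i] by simp
  have dp: "\<bar>norm (z $ i) powr p - norm (w $ i) powr p\<bar> \<le> p * s * norm (z - w)" for i
  proof -
    have "\<bar>norm (z $ i) powr p - norm (w $ i) powr p\<bar> \<le> p * s * \<bar>norm (z $ i) - norm (w $ i)\<bar>"
      unfolding s_def using p_ge_2 b by (intro powr_Lipschitz) auto
    also have "\<dots> \<le> p * s * norm (z - w)" using d p_ge_2 s by (intro mult_left_mono) auto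
    finally show ?thesis .
  qed
  have pz: "norm (z $ i) powr p \<le> s * norm z" and pw: "norm (w $ i) powr p \<le> s * norm w" for i
    using powr_le_linear[OF norm_ge_zero b(1), of i] powr_le_linear[OF norm_ge_zero b(2), of i]
      mult_left_mono[OF le[of z i] s] mult_left_mono[OF le[of w i] s]
    unfolding s_def by linarith+
  have "\<bar>norm (z $ k) powr p * norm (z $ j) powr p - norm (w $ k) powr p * norm (w $ j) powr p\<bar>
     = \<bar>(norm (z $ k) powr p - norm (w $ k) powr p) * norm (z $ j) powr p + norm (w $ k) powr p * (norm (z $ j) powr p - norm (w $ j) powr p)\<bar>"
    by (simp add: algebra_simps)
  also have "\<dots> \<le> \<bar>norm (z $ k) powr p - norm (w $ k) powr p\<bar> * norm (z $ j) powr p + norm (w $ k) powr p * \<bar>norm (z $ j) powr p - norm (w $ j) powr p\<bar>"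
    by (rule order_trans[OF abs_triangle_ineq]) (simp add: abs_mult)
  also have "\<dots> \<le> (p * s * norm (z - w)) * (s * norm z) + (s * norm w) * (p * s * norm (z - w))"
    using dp pz pw s p_ge_2 by (intro add_mono mult_mono) auto
  also have "\<dots> = p * s\<^sup>2 * ((norm z + norm w) * norm (z - w))"
    by (simp add: power2_eq_square algebra_simps)
  finally show ?thesis unfolding s_def .
qed

text \<open>The factor \<open>norm z + norm w\<close> is kept because only products of two functions
  are integrable for square integrable arguments; a plain Lipschitz bound could not be
  integrated.\<close>

lemma W_Lipschitz:
  assumes "norm z \<le> S" "norm w \<le> S"
  shows "\<bar>W z - W w\<bar> \<le> K S * ((norm z + norm w) * norm (z - w))"
proof -
  define T where "T = p * (S powr (p - 1))\<^sup>2 * ((norm z + norm w) * norm (z - w))"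
  have "W z - W w = 1 / p * (\<Sum>k\<in>UNIV. \<Sum>j\<in>UNIV. a k j * (norm (z $ k) powr p * norm (z $ j) powr p - norm (w $ k) powr p * norm (w $ j) powr p))"
    unfolding W_def by (simp add: right_diff_distrib sum_subtractf mult.assoc)
  also have "\<bar>\<dots>\<bar> \<le> 1 / p * (\<Sum>k\<in>UNIV. \<Sum>j\<in>UNIV. a k j * T)"
  proof -
    have "\<bar>\<Sum>k\<in>UNIV. \<Sum>j\<in>UNIV. a k j * (norm (z $ k) powr p * norm (z $ j) powr p - norm (w $ k) powr p * norm (w $ j) powr p)\<bar>
      \<le> (\<Sum>k\<in>UNIV. \<Sum>j\<in>UNIV. a k j * T)"
      using powr_product_Lipschitz[OF assms] less_imp_le[OF a_pos] unfolding T_def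
      by (intro order_trans[OF sum_abs] sum_mono) (auto simp: abs_mult intro!: mult_mono)
    then show ?thesis using p_ge_2 unfolding abs_mult by (intro mult_mono) auto
  qed
  also have "\<dots> = K S * ((norm z + norm w) * norm (z - w))"
  proof -
    have "(\<Sum>k\<in>UNIV. \<Sum>j\<in>UNIV. a k j * T) = (\<Sum>k\<in>UNIV. \<Sum>j\<in>UNIV. a k j) * T"
      by (simp only: sum_distrib_right)
    then show ?thesis using p_ge_2 by (simp add: K_def T_def)
  qed
  finally show ?thesis .
qed

lemma W_zero: "W 0 = 0"
  using p_ge_2 by (simp add: W_def)

lemma W_le: "norm z \<le> S \<Longrightarrow> W z \<le> K S * (norm z)\<^sup>2"
  using W_Lipschitz[of z S 0] by (simp add: W_zero power2_eq_square order_trans[OF norm_ge_zero] abs_le_iff)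

lemma continuous_W: "isCont W z"
  unfolding isCont_def
proof (rule LIM_zero_cancel, rule Lim_null_comparison)
  define S where "S = norm z + 1"
  have "\<forall>\<^sub>F w in at z. norm w < S"
    by (rule order_tendstoD(2)[of norm "norm z"]) (auto simp: S_def intro!: tendsto_intros)
  then show "\<forall>\<^sub>F w in at z. norm (W w - W z) \<le> K S * ((norm w + norm z) * norm (w - z))"
  proof eventually_elim
    case (elim w)
    then show ?case using W_Lipschitz[of w S z] by (simp add: S_def)
  qed
  have "((\<lambda>w. K S * ((norm w + norm z) * norm (w - z))) \<longlongrightarrow> K S * ((norm z + norm z) * norm (z - z))) (at z)"
    by (intro tendsto_intros)
  then show "((\<lambda>w. K S * ((norm w + norm z) * norm (w - z))) \<longlongrightarrow> 0) (at z)" by simp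
qed

lemma integrable_W:
  assumes F: "square_integrable F" and S: "\<And>x. norm (F x) \<le> S"
  shows "integrable lborel (\<lambda>x. W (F x))" "(LINT x|lborel. W (F x)) \<le> K S * l2sq F"
proof -
  note [measurable] = square_integrable_measurable[OF F]
  note int = integrable_mult_right[OF square_integrable_integrable[OF F], of "K S"]
  show i: "integrable lborel (\<lambda>x. W (F x))"
    by (rule Bochner_Integration.integrable_bound[OF int]) (use W_le[OF S] W_nonneg K_nonneg in auto)
  have "(LINT x|lborel. W (F x)) \<le> (LINT x|lborel. K S * (norm (F x))\<^sup>2)"
    using i int W_le[OF S] by (intro integral_mono) auto
  then show "(LINT x|lborel. W (F x)) \<le> K S * l2sq F" by (simp add: l2sq_def)
qed

lemma sobolev_integrable_W: "sobolev F G \<Longrightarrow> integrable lborel (\<lambda>x. W (F x))"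
  by (rule integrable_W(1)[OF sobolevD(1) sobolev_bounded])

text \<open>Multiplying the componentwise inequalities for two indices leaves, besides the two
  separate interactions, the mixed terms \<open>Z k * V j\<close>. As all coefficients are bounded
  below by a positive number, these dominate a multiple of the product of the full norms, whichever
  components are nonzero.\<close>

lemma W_combine_gain:
  "\<exists>c>0. \<forall>z w. W z + W w + c * (norm z powr p * norm w powr p) \<le> W (combine z w)"
proof -
  define \<delta> where "\<delta> = Min (range (\<lambda>(k, j). a k j))"
  have \<delta>: "\<delta> \<le> a k j" for k j unfolding \<delta>_def by (rule Min_le) (auto intro: rev_image_eqI[of "(k, j)"])
  have "\<delta> \<in> range (\<lambda>(k, j). a k j)" unfolding \<delta>_def by (intro Min_in) auto
  then have \<delta>0: "0 < \<delta>" using a_pos by auto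
  have comp: "(norm z / 3) powr p \<le> (\<Sum>k\<in>UNIV. norm (z $ k) powr p)" for z :: "complex ^ 3"
  proof -
    \<comment> \<open>The norm is at most the sum of the three component norms, so one of them has
      at least a third of it.\<close>
    have "\<exists>k. norm z / 3 \<le> norm (z $ k)"
    proof (rule ccontr)
      assume "\<not> ?thesis"
      then have "norm (z $ k) < norm z / 3" for k by (simp add: not_le)
      then have "(\<Sum>k\<in>UNIV. norm (z $ k)) < (\<Sum>k\<in>(UNIV :: 3 set). norm z / 3)" by (intro sum_strict_mono) auto
      moreover have "norm z \<le> (\<Sum>k\<in>UNIV. norm (z $ k))"
        unfolding norm_vec_def by (intro L2_set_le_sum) auto
      ultimately show False by simp
    qed
    then obtain k where k: "norm z / 3 \<le> norm (z $ k)" ..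
    have "(norm z / 3) powr p \<le> norm (z $ k) powr p" using k p_ge_2 by (intro powr_mono2) auto
    also have "\<dots> \<le> (\<Sum>k\<in>UNIV. norm (z $ k) powr p)" by (rule member_le_sum) auto
    finally show ?thesis .
  qed
  \<comment> \<open>The smallest coefficient, the prefactor of \<open>W\<close>, and one factor
    (1/3)^p for each of the two vectors.\<close>
  define c where "c = \<delta> / p * ((1/3) powr p * (1/3) powr p)"
  have "W z + W w + c * (norm z powr p * norm w powr p) \<le> W (combine z w)" for z w
  proof -
    define Z where "Z k = norm (z $ k) powr p" for k
    define V where "V k = norm (w $ k) powr p" for k
    define R where "R k = norm (combine z w $ k) powr p" for k
    have nn: "0 \<le> Z k" "0 \<le> V k" for k by (auto simp: Z_def V_def)
    have ZV: "Z k + V k \<le> R k" for k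
      using norm_Pair_powr_ge[OF p_ge_2, of "z $ k" "w $ k"] by (simp add: Z_def V_def R_def combine_def)
    have "c * (norm z powr p * norm w powr p) = 1 / p * (\<delta> * ((norm z / 3) powr p * (norm w / 3) powr p))"
      unfolding c_def by (simp add: powr_divide)
    also have "\<dots> \<le> 1 / p * (\<delta> * ((\<Sum>k\<in>UNIV. Z k) * (\<Sum>j\<in>UNIV. V j)))"
      using comp p_ge_2 \<delta>0 unfolding Z_def V_def by (intro mult_left_mono mult_mono sum_nonneg) auto
    also have "(\<Sum>k\<in>UNIV. Z k) * (\<Sum>j\<in>UNIV. V j) = (\<Sum>k\<in>UNIV. \<Sum>j\<in>UNIV. Z k * V j)"
      by (rule sum_product)
    also have "1 / p * (\<delta> * (\<Sum>k\<in>UNIV. \<Sum>j\<in>UNIV. Z k * V j)) \<le> 1 / p * (\<Sum>k\<in>UNIV. \<Sum>j\<in>UNIV. a k j * (Z k * V j))"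
      unfolding sum_distrib_left[of \<delta>] using \<delta> nn p_ge_2 by (intro mult_left_mono sum_mono mult_right_mono) auto
    finally have 1: "c * (norm z powr p * norm w powr p) \<le> 1 / p * (\<Sum>k\<in>UNIV. \<Sum>j\<in>UNIV. a k j * (Z k * V j))" .
    have "W z + W w + 1 / p * (\<Sum>k\<in>UNIV. \<Sum>j\<in>UNIV. a k j * (Z k * V j)) =
      1 / p * (\<Sum>k\<in>UNIV. \<Sum>j\<in>UNIV. a k j * (Z k * Z j + V k * V j + Z k * V j))"
      unfolding W_def Z_def V_def by (simp add: distrib_left sum.distrib mult.assoc)
    also have "\<dots> \<le> 1 / p * (\<Sum>k\<in>UNIV. \<Sum>j\<in>UNIV. a k j * (R k * R j))"
    proof (intro mult_left_mono sum_mono)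
      fix k j
      \<comment> \<open>One of the two mixed products, \<open>V k * Z j\<close>, is discarded; the
        other one is enough.\<close>
      have "Z k * Z j + V k * V j + Z k * V j \<le> (Z k + V k) * (Z j + V j)"
        using nn by (simp add: algebra_simps)
      also have "\<dots> \<le> R k * R j" using ZV nn by (intro mult_mono) (auto simp: R_def)
      finally show "Z k * Z j + V k * V j + Z k * V j \<le> R k * R j" .
    qed (use p_ge_2 less_imp_le[OF a_pos] in auto)
    also have "\<dots> = W (combine z w)" by (simp add: W_def R_def mult.assoc)
    finally show ?thesis using 1 by linarith
  qed
  moreover have "0 < c" using \<delta>0 p_ge_2 by (simp add: c_def)
  ultimately show ?thesis by blast
qed

definition gain :: real where
  "gain = (SOME c. 0 < c \<and> (\<forall>z w. W z + W w + c * (norm z powr p * norm w powr p) \<le> W (combine z w)))"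

lemma gain: "0 < gain" "W z + W w + gain * (norm z powr p * norm w powr p) \<le> W (combine z w)"
  using someI_ex[OF W_combine_gain] unfolding gain_def by auto

text \<open>The overlap integral is finite because its integrand is bounded by a multiple of the
  interaction density of the combination.\<close>

lemma energy_combine:
  assumes F: "sobolev F G" and V: "sobolev V L"
  shows "\<exists>M. sobolev (\<lambda>x. combine (F x) (V x)) M \<and>
    (\<forall>j. l2sq (\<lambda>x. M x $ j) \<le> l2sq (\<lambda>x. G x $ j) + l2sq (\<lambda>x. L x $ j)) \<and>
    integrable lborel (\<lambda>x. norm (F x) powr p * norm (V x) powr p) \<and>
    en (\<lambda>x. combine (F x) (V x)) M \<le> en F G + en V L - gain * (LINT x|lborel. norm (F x) powr p * norm (V x) powr p)"
proof -
  obtain M where M: "sobolev (\<lambda>x. combine (F x) (V x)) M"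
    "\<And>j. l2sq (\<lambda>x. M x $ j) \<le> l2sq (\<lambda>x. G x $ j) + l2sq (\<lambda>x. L x $ j)"
    using sobolev_combine[OF F V] by blast
  note [measurable] = square_integrable_measurable[OF sobolevD(1)[OF F]] square_integrable_measurable[OF sobolevD(1)[OF V]]
  note iF = sobolev_integrable_W[OF F] and iV = sobolev_integrable_W[OF V] and iM = sobolev_integrable_W[OF M(1)]
  have i: "integrable lborel (\<lambda>x. gain * (norm (F x) powr p * norm (V x) powr p))"
  proof (rule Bochner_Integration.integrable_bound[OF iM])
    show "AE x in lborel. norm (gain * (norm (F x) powr p * norm (V x) powr p)) \<le> norm (W (combine (F x) (V x)))"
    proof (rule AE_I2)
      fix x
      have "0 \<le> gain * (norm (F x) powr p * norm (V x) powr p)" using gain(1) by simp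
      then show "norm (gain * (norm (F x) powr p * norm (V x) powr p)) \<le> norm (W (combine (F x) (V x)))"
        using gain(2)[of "F x" "V x"] W_nonneg[of "F x"] W_nonneg[of "V x"] by (simp add: abs_of_nonneg)
    qed
  qed simp
  then have i': "integrable lborel (\<lambda>x. norm (F x) powr p * norm (V x) powr p)"
    using gain(1) by simp
  have "(LINT x|lborel. W (F x)) + (LINT x|lborel. W (V x)) + gain * (LINT x|lborel. norm (F x) powr p * norm (V x) powr p)
      = (LINT x|lborel. W (F x) + W (V x) + gain * (norm (F x) powr p * norm (V x) powr p))"
    using iF iV i by simp
  also have "\<dots> \<le> (LINT x|lborel. W (combine (F x) (V x)))"
    using iF iV iM i by (intro integral_mono) (auto intro: gain(2))
  finally have "(LINT x|lborel. W (F x)) + (LINT x|lborel. W (V x)) + gain * (LINT x|lborel. norm (F x) powr p * norm (V x) powr p)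
      \<le> (LINT x|lborel. W (combine (F x) (V x)))" .
  moreover have "l2sq M \<le> l2sq G + l2sq L"
    unfolding l2sq_vec[OF sobolevD(2)[OF M(1)]] l2sq_vec[OF sobolevD(2)[OF F]] l2sq_vec[OF sobolevD(2)[OF V]]
      sum.distrib[symmetric] by (intro sum_mono M(2))
  ultimately have "en (\<lambda>x. combine (F x) (V x)) M \<le> en F G + en V L - gain * (LINT x|lborel. norm (F x) powr p * norm (V x) powr p)"
    unfolding en_def by linarith
  with M i' show ?thesis by blast
qed

end

section \<open>Scaling, negative energy and coercivity\<close>

lemma integral_pos_if_isCont:
  fixes f :: "real \<Rightarrow> real"
  assumes f: "integrable lborel f" "\<And>x. 0 \<le> f x" and x0: "isCont f x0" "0 < f x0"
  shows "0 < (LINT x|lborel. f x)"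
proof -
  have "\<forall>\<^sub>F x in at x0. f x0 / 2 < f x"
    using x0 by (intro order_tendstoD(1)[OF x0(1)[unfolded isCont_def]]) simp
  then obtain d where d: "0 < d" "\<And>x. x \<noteq> x0 \<Longrightarrow> dist x x0 < d \<Longrightarrow> f x0 / 2 < f x"
    unfolding eventually_at by blast
  have ge: "f x0 / 2 \<le> f x" if "x \<in> {x0 - d / 2..x0 + d / 2}" for x
    using d(2)[of x] that d(1) x0(2) by (cases "x = x0") (auto simp: dist_real_def abs_less_iff intro: less_imp_le)
  have "0 < d * (f x0 / 2)" using d x0 by simp
  also have "\<dots> = (LINT x|lborel. indicator {x0 - d / 2..x0 + d / 2} x * (f x0 / 2))"
    using d(1) by (simp add: measure_def)
  also have "\<dots> \<le> (LINT x|lborel. f x)"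
    using f(2) ge by (intro integral_mono f(1) integrable_mult_left integrable_real_indicator)
      (auto simp: indicator_def emeasure_lborel_Icc_eq)
  finally show ?thesis .
qed

lemma square_integrable_compact_support:
  fixes f :: "real \<Rightarrow> real"
  assumes "\<And>x. isCont f x" "\<And>x. x \<notin> {-M..M} \<Longrightarrow> f x = 0"
  shows "square_integrable f"
  unfolding square_integrable_def
proof
  have c: "continuous_on A f" for A using assms(1) by (simp add: continuous_at_imp_continuous_on)
  show "f \<in> borel_measurable borel" by (rule borel_measurable_continuous_onI[OF c])
  have "integrable lborel (\<lambda>x. indicator {-M..M} x *\<^sub>R (norm (f x))\<^sup>2)"
    by (intro borel_integrable_compact compact_Icc continuous_intros c)
  also have "(\<lambda>x. indicator {-M..M} x *\<^sub>R (norm (f x))\<^sup>2) = (\<lambda>x. (norm (f x))\<^sup>2)"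
  proof
    show "indicator {-M..M} x *\<^sub>R (norm (f x))\<^sup>2 = (norm (f x))\<^sup>2" for x
      using assms(2)[of x] by (cases "x \<in> {-M..M}") auto
  qed
  finally show "integrable lborel (\<lambda>x. (norm (f x))\<^sup>2)" .
qed

lemma test_function_sobolev:
  assumes \<phi>: "test_function \<phi>"
  shows "sobolev \<phi> (dir_deriv 1 \<phi> :: real \<Rightarrow> real)"
proof -
  obtain M where M: "\<And>x. x \<notin> {-M..M} \<Longrightarrow> \<phi> x = 0 \<and> dir_deriv 1 \<phi> x = 0"
    using test_function_derivative(5)[OF \<phi>] by blast
  note d = test_function_derivative[OF \<phi>]
  have sq: "square_integrable \<phi>" "square_integrable (dir_deriv 1 \<phi>)"
    by (rule square_integrable_compact_support[of _ M], use d(3,4) M in blast, use M in blast)+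
  have "is_primitive \<phi> (dir_deriv 1 \<phi>)"
    unfolding is_primitive_def
    using l2_set_integrable(1)[OF sq(2)] integral_derivative_Icc[OF d(1) d(4)]
    by (simp add: set_lebesgue_integral_def)
  with sq show ?thesis by (simp add: sobolev_def)
qed

lemma l2sq_dilate: "0 < \<theta> \<Longrightarrow> l2sq (\<lambda>x. f (\<theta> * x)) = l2sq f / \<theta>"
  unfolding l2sq_def using lborel_integral_real_affine[of \<theta> "\<lambda>x. (norm (f x))\<^sup>2" 0] by simp

lemma sobolev_dilate:
  assumes P: "sobolev P g" and \<theta>: "0 < \<theta>"
  shows "sobolev (\<lambda>x. P (\<theta> * x)) (\<lambda>x. \<theta> *\<^sub>R g (\<theta> * x))"
proof -
  have sq: "square_integrable (\<lambda>x. f (\<theta> * x))" if "square_integrable f" for f :: "real \<Rightarrow> 'a"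
    using lborel_integrable_real_affine[of "\<lambda>x. (norm (f x))\<^sup>2" \<theta> 0] that \<theta>
    by (auto simp: square_integrable_def)
  note sqg = square_integrable_cmult[OF sq[OF sobolevD(2)[OF P]], of \<theta>]
  have "P (\<theta> * b) - P (\<theta> * a) = (LINT x:{a..b}|lborel. \<theta> *\<^sub>R g (\<theta> * x))" if "a \<le> b" for a b
  proof -
    have eq: "indicator {\<theta> * a..\<theta> * b} (\<theta> * x) = (indicator {a..b} x :: real)" for x
      using \<theta> by (auto simp: indicator_def mult_le_cancel_left_pos)
    have "P (\<theta> * b) - P (\<theta> * a) = (LINT x:{\<theta> * a..\<theta> * b}|lborel. g x)"
      using is_primitiveD(2)[OF sobolevD(3)[OF P]] that \<theta> by simp
    also have "\<dots> = \<theta> *\<^sub>R (LINT x|lborel. indicator {a..b} x *\<^sub>R g (\<theta> * x))"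
      unfolding set_lebesgue_integral_def
      using lborel_integral_real_affine[of \<theta> "\<lambda>x. indicator {\<theta> * a..\<theta> * b} x *\<^sub>R g x" 0] \<theta> by (simp add: eq)
    also have "\<dots> = (LINT x|lborel. \<theta> *\<^sub>R (indicator {a..b} x *\<^sub>R g (\<theta> * x)))"
      by (rule integral_scaleR_right[symmetric])
    also have "\<dots> = (LINT x:{a..b}|lborel. \<theta> *\<^sub>R g (\<theta> * x))"
      unfolding set_lebesgue_integral_def by (simp add: mult.commute)
    finally show ?thesis .
  qed
  then show ?thesis
    using sq[OF sobolevD(1)[OF P]] sqg l2_set_integrable(1)[OF sqg] by (auto simp: sobolev_def is_primitive_def)
qed

lemma l2sq_diff_le:
  assumes "square_integrable f" "square_integrable g"
  shows "l2sq (\<lambda>x. f x - g x) \<le> 2 * l2sq f + 2 * l2sq g"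
  unfolding l2sq_midpoint(2)[OF assms] by simp

context coupled_nls
begin

lemma W_homogeneous: "W (t *\<^sub>R z) = \<bar>t\<bar> powr (2 * p) * W z"
proof -
  have "norm ((t *\<^sub>R z) $ k) powr p = \<bar>t\<bar> powr p * norm (z $ k) powr p" for k
    by (simp add: powr_mult)
  then have "a k j * norm ((t *\<^sub>R z) $ k) powr p * norm ((t *\<^sub>R z) $ j) powr p =
      \<bar>t\<bar> powr (2 * p) * (a k j * norm (z $ k) powr p * norm (z $ j) powr p)" for k j
    using powr_add[of "\<bar>t\<bar>" p p] by (simp only:) (simp add: mult_ac)
  then show ?thesis unfolding W_def by (simp only: sum_distrib_left[symmetric]) (simp add: mult_ac)
qed

lemma W_pos:
  assumes "z $ i \<noteq> 0"
  shows "0 < W z"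
proof -
  have nn: "0 \<le> a k j * norm (z $ k) powr p * norm (z $ j) powr p" for k j
    using less_imp_le[OF a_pos] by simp
  have "0 < a i i * norm (z $ i) powr p * norm (z $ i) powr p" using assms a_pos by simp
  also have "\<dots> \<le> (\<Sum>j\<in>UNIV. a i j * norm (z $ i) powr p * norm (z $ j) powr p)"
    by (rule member_le_sum[of i UNIV "\<lambda>j. a i j * norm (z $ i) powr p * norm (z $ j) powr p"]) (use nn in auto)
  also have "\<dots> \<le> (\<Sum>k\<in>UNIV. \<Sum>j\<in>UNIV. a k j * norm (z $ k) powr p * norm (z $ j) powr p)"
    by (rule member_le_sum[of i UNIV "\<lambda>k. \<Sum>j\<in>UNIV. a k j * norm (z $ k) powr p * norm (z $ j) powr p"])
      (use nn in \<open>auto intro: sum_nonneg\<close>)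
  finally show ?thesis unfolding W_def using p_ge_2 by simp
qed

text \<open>The mass-preserving dilation with parameter \<open>\<theta>\<close> multiplies the
  kinetic energy by \<theta>^2 and the interaction by \<theta>^(p-1). For p < 3 the interaction wins
  when \<open>\<theta>\<close> is small. Some of the prescribed masses may be zero, since the lemma
  also serves to fill up missing mass that concerns only some components.\<close>

lemma negative_energy:
  assumes \<mu>: "\<And>j. 0 \<le> \<mu> j" "0 < \<mu> i"
  shows "\<exists>F G. sobolev F G \<and> (\<forall>j. l2sq (\<lambda>x. F x $ j) = \<mu> j) \<and> en F G < 0"
proof -
  define q where "q = bump_family 0 1 1 1 0"
  have tq: "test_function q" unfolding q_def by (rule bump_test_function) auto
  define q' where "q' = dir_deriv 1 q"
  have sq: "sobolev q q'" unfolding q'_def by (rule test_function_sobolev[OF tq])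
  have cq: "isCont q x" for x by (rule test_function_derivative(3)[OF tq])
  have qh: "0 < q (1/2)" by (simp add: q_def bump_family_def)
  define \<kappa> where "\<kappa> = l2sq q"
  have \<kappa>: "0 < \<kappa>"
    unfolding \<kappa>_def l2sq_def
    using qh square_integrable_integrable[OF sobolevD(1)[OF sq]]
    by (intro integral_pos_if_isCont[of _ "1/2"]) (auto intro!: continuous_intros cq)
  \<comment> \<open>All components are multiples of the same bump, whose squared norm is
    \<open>\<kappa>\<close>; the weights turn it into the prescribed masses.\<close>
  define v :: "complex ^ 3" where "v = (\<chi> j. of_real (sqrt (\<mu> j / \<kappa>)))"
  have vj: "(norm (v $ j))\<^sup>2 = \<mu> j / \<kappa>" for j using \<mu>(1)[of j] \<kappa> by (simp add: v_def)
  have "v $ i \<noteq> 0" using \<mu>(2) \<kappa> by (simp add: v_def)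
  then have Wv: "0 < W v" by (rule W_pos)
  have lin: "linear (\<lambda>t::real. t *\<^sub>R v)" by (rule linearI) (auto simp: scaleR_add_left)
  define A where "A = (norm v)\<^sup>2 * l2sq q'"
  define Q where "Q = (LINT x|lborel. \<bar>q x\<bar> powr (2 * p))"
  have Qi: "integrable lborel (\<lambda>x. \<bar>q x\<bar> powr (2 * p))"
  proof -
    have "integrable lborel (\<lambda>x. W (q x *\<^sub>R v))" by (rule sobolev_integrable_W[OF sobolev_linear[OF sq lin]])
    then show ?thesis using Wv by (simp add: W_homogeneous)
  qed
  have Q: "0 < Q"
    unfolding Q_def using qh p_ge_2
    by (intro integral_pos_if_isCont[OF Qi, of "1/2"]) (auto intro!: continuous_intros cq)
  define B where "B = W v * Q"
  have B: "0 < B" using Q Wv by (simp add: B_def)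
  have A: "0 \<le> A" by (simp add: A_def)
  \<comment> \<open>Solves \<theta>^(3-p) (A + 1) = B, so that \<theta>^(3-p) A is strictly below
    B.\<close>
  define \<theta> where "\<theta> = (B / (A + 1)) powr (1 / (3 - p))"
  have \<theta>: "0 < \<theta>" using A B by (simp add: \<theta>_def)
  have \<theta>p: "\<theta> powr (3 - p) = B / (A + 1)" unfolding \<theta>_def powr_powr using p_less_3 A B by simp
  define F where "F x = (sqrt \<theta> * q (\<theta> * x)) *\<^sub>R v" for x
  define G where "G x = (sqrt \<theta> * (\<theta> * q' (\<theta> * x))) *\<^sub>R v" for x
  have FG: "sobolev F G"
    unfolding F_def G_def
    using sobolev_linear[OF sobolev_cmult[OF sobolev_dilate[OF sq \<theta>], of "sqrt \<theta>"] lin] by simp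
  have mass: "l2sq (\<lambda>x. F x $ j) = \<mu> j" for j
  proof -
    have "l2sq (\<lambda>x. F x $ j) = (LINT x|lborel. (\<theta> * (norm (v $ j))\<^sup>2) * (norm (q (\<theta> * x)))\<^sup>2)"
      unfolding l2sq_def F_def using \<theta> by (simp add: power_mult_distrib mult_ac)
    also have "\<dots> = (\<theta> * (norm (v $ j))\<^sup>2) * l2sq (\<lambda>x. q (\<theta> * x))" by (simp add: l2sq_def)
    also have "\<dots> = \<mu> j" unfolding l2sq_dilate[OF \<theta>] vj using \<theta> \<kappa> by (simp add: \<kappa>_def)
    finally show ?thesis .
  qed
  have lG: "l2sq G = \<theta>\<^sup>2 * A"
  proof -
    have "l2sq G = (LINT x|lborel. (\<theta> * \<theta>\<^sup>2 * (norm v)\<^sup>2) * (norm (q' (\<theta> * x)))\<^sup>2)"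
      unfolding l2sq_def G_def using \<theta> by (simp add: power_mult_distrib mult_ac)
    also have "\<dots> = (\<theta> * \<theta>\<^sup>2 * (norm v)\<^sup>2) * l2sq (\<lambda>x. q' (\<theta> * x))" by (simp add: l2sq_def)
    also have "\<dots> = \<theta>\<^sup>2 * A" unfolding l2sq_dilate[OF \<theta>] A_def using \<theta> by simp
    finally show ?thesis .
  qed
  have WF: "(LINT x|lborel. W (F x)) = \<theta> powr (p - 1) * B"
  proof -
    have sp: "sqrt \<theta> powr (2 * p) = \<theta> powr p"
      using \<theta> by (simp add: powr_half_sqrt[symmetric] powr_powr)
    have "(LINT x|lborel. W (F x)) = (LINT x|lborel. (\<theta> powr p * W v) * \<bar>q (\<theta> * x)\<bar> powr (2 * p))"
      unfolding F_def W_homogeneous using \<theta> sp by (simp add: abs_mult powr_mult mult_ac)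
    also have "\<dots> = (\<theta> powr p * W v) * (LINT x|lborel. \<bar>q (\<theta> * x)\<bar> powr (2 * p))" by simp
    also have "(LINT x|lborel. \<bar>q (\<theta> * x)\<bar> powr (2 * p)) = Q / \<theta>"
      unfolding Q_def using lborel_integral_real_affine[of \<theta> "\<lambda>x. \<bar>q x\<bar> powr (2 * p)" 0] \<theta> by simp
    also have "\<theta> powr p * W v * (Q / \<theta>) = \<theta> powr (p - 1) * B"
      using \<theta> by (simp add: B_def powr_diff)
    finally show ?thesis .
  qed
  have "en F G = \<theta> powr (p - 1) * (\<theta> powr (3 - p) * A - B)"
  proof -
    have "\<theta> powr (p - 1) * \<theta> powr (3 - p) = \<theta>\<^sup>2"
      using \<theta> by (simp add: powr_add[symmetric])
    then show ?thesis unfolding en_def lG WF by (simp add: right_diff_distrib mult.assoc[symmetric])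
  qed
  also have "\<dots> < 0"
  proof -
    have "\<theta> powr (3 - p) * A < B" unfolding \<theta>p using A B by (simp add: field_simps)
    then show ?thesis using \<theta> by (simp add: mult_pos_neg)
  qed
  finally show ?thesis using FG mass by blast
qed

text \<open>For radius at most 1, the square of \<delta>^(p-1) is at most \<open>\<delta>\<close>
  because p - 1 is at least 1, so \<open>K\<close> decays at least linearly.\<close>

lemma K_small: "0 < \<epsilon> \<Longrightarrow> 0 \<le> B \<Longrightarrow> \<exists>\<delta>>0. K \<delta> * B < \<epsilon>"
proof -
  assume \<epsilon>: "0 < \<epsilon>" and B: "0 \<le> B"
  define \<delta> where "\<delta> = min 1 (\<epsilon> / (K 1 * B + 1))"
  have KB: "0 \<le> K 1 * B" using B K_nonneg by simp
  then have \<delta>: "0 < \<delta>" "\<delta> \<le> 1" "\<delta> \<le> \<epsilon> / (K 1 * B + 1)" using \<epsilon> by (auto simp: \<delta>_def)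
  have "\<delta> powr (p - 1) \<le> \<delta> powr 1" using \<delta> p_ge_2 by (intro powr_mono') auto
  then have le: "\<delta> powr (p - 1) \<le> \<delta>" using \<delta> by simp
  have "(\<delta> powr (p - 1))\<^sup>2 \<le> \<delta> * 1"
    unfolding power2_eq_square using le \<delta> by (intro mult_mono) auto
  then have "K \<delta> \<le> K 1 * \<delta>"
    unfolding K_def using less_imp_le[OF a_pos] by (simp add: mult_left_mono sum_nonneg)
  then have "K \<delta> * B \<le> (K 1 * \<delta>) * B" using B by (rule mult_right_mono)
  also have "\<dots> \<le> K 1 * B * (\<epsilon> / (K 1 * B + 1))"
    using mult_left_mono[OF \<delta>(3) KB] by (simp add: mult_ac)
  also have "\<dots> < \<epsilon>" using KB \<epsilon> by (simp add: field_simps)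
  finally show ?thesis using \<delta>(1) by blast
qed

text \<open>With bounded mass, the supremum bound makes the interaction at most a constant times
  b^(p-1), where \<open>b\<close> is the derivative norm plus 1. As p - 1 < 2 it cannot compensate a
  large kinetic energy.\<close>

lemma energy_coercive: "\<exists>B. \<forall>F G. sobolev F G \<longrightarrow> l2sq F \<le> M \<longrightarrow> en F G \<le> E \<longrightarrow> l2sq G \<le> B"
proof -
  define M' where "M' = max 0 M"
  define A where "A = sqrt M' + 1"
  have A: "0 < A" "0 \<le> M'" by (auto simp: A_def M'_def add_nonneg_pos)
  define C where "C = K 1 * (4 * A) powr (p - 1) * M'"
  have C: "0 \<le> C" using K_nonneg A by (simp add: C_def)
  have "((\<lambda>b. C * b powr (p - 3)) \<longlongrightarrow> C * 0) at_top"
    using p_less_3 by (intro tendsto_intros tendsto_neg_powr filterlim_ident) auto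
  then have "\<forall>\<^sub>F b in at_top. C * b powr (p - 3) < 1 / 4"
    by (intro order_tendstoD(2)) auto
  then obtain b0 where b0: "\<And>b. b0 \<le> b \<Longrightarrow> C * b powr (p - 3) < 1 / 4"
    by (auto simp: eventually_at_top_linorder)
  \<comment> \<open>Above \<open>b0\<close> the interaction is below a quarter of b^2; then 4 <= b
    and 4|E| <= b make (b - 1)^2 - b^2/4 exceed \<open>E\<close>.\<close>
  define b1 where "b1 = max (max 4 b0) (4 * \<bar>E\<bar>)"
  show ?thesis
  proof (intro exI[of _ "b1\<^sup>2"] allI impI, rule ccontr)
    fix F G assume FG: "sobolev F G" and M: "l2sq F \<le> M" and E: "en F G \<le> E" and "\<not> l2sq G \<le> b1\<^sup>2"
    have b1: "0 \<le> b1" by (simp add: b1_def)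
    have "b1 < sqrt (l2sq G)" using \<open>\<not> l2sq G \<le> b1\<^sup>2\<close> b1 by (intro real_less_rsqrt) simp
    \<comment> \<open>The added 1 supplies the positive majorant that the supremum bound
      requires.\<close>
    define b where "b = sqrt (l2sq G) + 1"
    have b: "b1 < b" "4 < b" "b0 < b" "4 * \<bar>E\<bar> < b" using \<open>b1 < sqrt (l2sq G)\<close> by (auto simp: b_def b1_def)
    have MM: "l2sq F \<le> M'" using M by (simp add: M'_def)
    have S: "norm (F x) \<le> 2 * sqrt (A * b)" for x
    proof (rule sobolev_sup_bound[OF FG])
      have "sqrt (l2sq F) \<le> sqrt M'" using MM by simp
      then show "sqrt (l2sq F) \<le> A" unfolding A_def by linarith
    qed (use b A in \<open>auto simp: b_def\<close>)
    have KS: "K (2 * sqrt (A * b)) = K 1 * (4 * A) powr (p - 1) * b powr (p - 1)"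
    proof -
      have "((2 * sqrt (A * b)) powr (p - 1))\<^sup>2 = ((2 * sqrt (A * b))\<^sup>2) powr (p - 1)"
      proof -
        have "(X powr (p - 1))\<^sup>2 = (X\<^sup>2) powr (p - 1)" if "0 \<le> X" for X :: real
          using that by (simp add: power2_eq_square powr_mult)
        then show ?thesis using A b by simp
      qed
      also have "(2 * sqrt (A * b))\<^sup>2 = 4 * A * b" using A b by (simp add: power_mult_distrib)
      also have "(4 * A * b) powr (p - 1) = (4 * A) powr (p - 1) * b powr (p - 1)"
        using A b by (intro powr_mult)
      finally show ?thesis by (simp add: K_def)
    qed
    have "(LINT x|lborel. W (F x)) \<le> K (2 * sqrt (A * b)) * l2sq F"
      by (rule integrable_W(2)[OF sobolevD(1)[OF FG] S])
    also have "\<dots> \<le> K (2 * sqrt (A * b)) * M'" using MM K_nonneg by (intro mult_left_mono)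
    also have "\<dots> = C * b powr (p - 3) * b\<^sup>2"
    proof -
      have "b powr (p - 1) = b powr (p - 3) * b powr 2" using powr_add[of b "p - 3" 2] by simp
      also have "b powr 2 = b\<^sup>2" using b by (intro powr_numeral) auto
      finally show ?thesis unfolding KS C_def by simp
    qed
    also have "\<dots> \<le> 1 / 4 * b\<^sup>2" using b0[of b] b by (intro mult_right_mono) auto
    finally have W: "(LINT x|lborel. W (F x)) \<le> 1 / 4 * b\<^sup>2" .
    have "l2sq G = (b - 1)\<^sup>2" by (simp add: b_def)
    then have "(b - 1)\<^sup>2 - 1 / 4 * b\<^sup>2 \<le> E" using E W unfolding en_def by linarith
    moreover have "4 * b \<le> b * b" using b by (intro mult_right_mono) auto
    moreover have "(b - 1)\<^sup>2 = b * b - 2 * b + 1" "b\<^sup>2 = b * b" by (simp_all add: power2_eq_square algebra_simps)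
    ultimately show False using b(2,4) by linarith
  qed
qed

section \<open>Rescaling components and masses that are correct only in the limit\<close>

definition N :: "(real \<Rightarrow> complex ^ 3) \<Rightarrow> 3 \<Rightarrow> 3 \<Rightarrow> real" where
  "N F k j = (LINT x|lborel. norm (F x $ k) powr p * norm (F x $ j) powr p)"

lemma N_integrable:
  assumes F: "square_integrable F" and S: "\<And>x. norm (F x) \<le> S"
  shows "integrable lborel (\<lambda>x. norm (F x $ k) powr p * norm (F x $ j) powr p)"
    and "0 \<le> N F k j" and "N F k j \<le> p * (S powr (p - 1))\<^sup>2 * l2sq F"
proof -
  note [measurable] = square_integrable_measurable[OF square_integrable_nth[OF F]]
  note int = integrable_mult_right[OF square_integrable_integrable[OF F], of "p * (S powr (p - 1))\<^sup>2"]
  have S0: "norm (0 :: complex ^ 3) \<le> S" using order_trans[OF norm_ge_zero S[of 0]] by simp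
  have le: "norm (F x $ k) powr p * norm (F x $ j) powr p \<le> p * (S powr (p - 1))\<^sup>2 * (norm (F x))\<^sup>2" for x
    using powr_product_Lipschitz[OF S[of x] S0, of k j] p_ge_2 by (simp add: power2_eq_square)
  show i: "integrable lborel (\<lambda>x. norm (F x $ k) powr p * norm (F x $ j) powr p)"
    by (rule Bochner_Integration.integrable_bound[OF int]) (use le p_ge_2 in auto)
  show "0 \<le> N F k j" unfolding N_def by (rule Bochner_Integration.integral_nonneg) simp
  have "N F k j \<le> (LINT x|lborel. p * (S powr (p - 1))\<^sup>2 * (norm (F x))\<^sup>2)"
    unfolding N_def by (rule integral_mono[OF i int le])
  then show "N F k j \<le> p * (S powr (p - 1))\<^sup>2 * l2sq F" by (simp add: l2sq_def)
qed

text \<open>Splitting the interaction into pairs lets a separate scaling of each component act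
  through explicit factors.\<close>

lemma integral_W_N:
  assumes FG: "sobolev F G"
  shows "(LINT x|lborel. W (F x)) = 1 / p * (\<Sum>k\<in>UNIV. \<Sum>j\<in>UNIV. a k j * N F k j)"
proof -
  note i = N_integrable(1)[OF sobolevD(1)[OF FG] sobolev_bounded[OF FG]]
  have "(LINT x|lborel. W (F x)) = 1 / p * (LINT x|lborel. (\<Sum>k\<in>UNIV. \<Sum>j\<in>UNIV. a k j * (norm (F x $ k) powr p * norm (F x $ j) powr p)))"
    unfolding W_def mult.assoc by simp
  also have "(LINT x|lborel. (\<Sum>k\<in>UNIV. \<Sum>j\<in>UNIV. a k j * (norm (F x $ k) powr p * norm (F x $ j) powr p)))
     = (\<Sum>k\<in>UNIV. \<Sum>j\<in>UNIV. a k j * N F k j)"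
    unfolding N_def using i
    by (simp add: Bochner_Integration.integral_sum Bochner_Integration.integrable_sum)
  finally show ?thesis .
qed

definition scale_by :: "(3 \<Rightarrow> real) \<Rightarrow> complex ^ 3 \<Rightarrow> complex ^ 3" where
  "scale_by c z = (\<chi> j. c j *\<^sub>R (z $ j))"

lemma sobolev_scale_by: "sobolev F G \<Longrightarrow> sobolev (\<lambda>x. scale_by c (F x)) (\<lambda>x. scale_by c (G x))"
  unfolding scale_by_def by (intro sobolev_vec_lambda sobolev_cmult sobolev_nth)

lemma en_scale_by:
  assumes FG: "sobolev F G" and c: "\<And>j. 0 \<le> c j"
  shows "en (\<lambda>x. scale_by c (F x)) (\<lambda>x. scale_by c (G x)) =
    (\<Sum>j\<in>UNIV. (c j)\<^sup>2 * l2sq (\<lambda>x. G x $ j)) - 1 / p * (\<Sum>k\<in>UNIV. \<Sum>j\<in>UNIV. a k j * (c k powr p * c j powr p * N F k j))"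
proof -
  note s = sobolev_scale_by[OF FG, of c]
  have "l2sq (\<lambda>x. scale_by c (G x)) = (\<Sum>j\<in>UNIV. (c j)\<^sup>2 * l2sq (\<lambda>x. G x $ j))"
    unfolding l2sq_vec[OF sobolevD(2)[OF s]] by (simp add: scale_by_def l2sq_cmult[of _ "\<lambda>x. G x $ _"])
  moreover have "N (\<lambda>x. scale_by c (F x)) k j = c k powr p * c j powr p * N F k j" for k j
  proof -
    have "norm (scale_by c (F x) $ i) powr p = c i powr p * norm (F x $ i) powr p" for x i
      using c[of i] by (simp add: scale_by_def powr_mult)
    then have "N (\<lambda>x. scale_by c (F x)) k j = (LINT x|lborel. (c k powr p * c j powr p) * (norm (F x $ k) powr p * norm (F x $ j) powr p))"
      unfolding N_def by (simp add: mult_ac)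
    then show ?thesis by (simp add: N_def)
  qed
  ultimately show ?thesis unfolding en_def integral_W_N[OF s] by simp
qed

lemma en_eq:
  assumes FG: "sobolev F G"
  shows "en F G = (\<Sum>j\<in>UNIV. l2sq (\<lambda>x. G x $ j)) - 1 / p * (\<Sum>k\<in>UNIV. \<Sum>j\<in>UNIV. a k j * N F k j)"
  unfolding en_def integral_W_N[OF FG] l2sq_vec[OF sobolevD(2)[OF FG]] ..

text \<open>The lower bound \<open>lam\<close> is known only for exact masses. Rescaling each
  component to its exact mass changes it by a factor tending to 1, and since all integrals are
  bounded the energy changes by an amount tending to 0.\<close>

lemma energy_lower_limit:
  assumes m: "\<And>j. 0 < m j"
    and lower: "\<And>F G. sobolev F G \<Longrightarrow> (\<And>j. l2sq (\<lambda>x. F x $ j) = m j) \<Longrightarrow> lam \<le> en F G"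
    and FG: "\<And>n. sobolev (F n) (G n)" and B: "\<And>n. l2sq (F n) \<le> B" "\<And>n. l2sq (G n) \<le> B"
    and masses: "\<And>j. (\<lambda>n. l2sq (\<lambda>x. F n x $ j)) \<longlonglongrightarrow> m j"
    and \<epsilon>: "0 < \<epsilon>"
  shows "\<forall>\<^sub>F n in sequentially. lam - \<epsilon> \<le> en (F n) (G n)"
proof -
  \<comment> \<open>For vanishing mass the quotient has its default value 0; this concerns only
    finitely many \<open>n\<close>, because the limits \<open>m j\<close> are positive.\<close>
  define c where "c n j = sqrt (m j / l2sq (\<lambda>x. F n x $ j))" for n j
  have c0: "0 \<le> c n j" for n j using less_imp_le[OF m] by (simp add: c_def)
  have c_lim: "(\<lambda>n. c n j) \<longlonglongrightarrow> 1" for j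
  proof -
    have "(\<lambda>n. c n j) \<longlonglongrightarrow> sqrt (m j / m j)"
      unfolding c_def using m[of j] by (intro tendsto_intros masses) auto
    then show ?thesis using m[of j] by simp
  qed
  define S where "S = sqrt B + sqrt B"
  have S: "norm (F n x) \<le> S" for n x
  proof -
    have "norm (F n x) \<le> sqrt (l2sq (F n)) + sqrt (l2sq (G n))" by (rule sobolev_bounded[OF FG])
    also have "\<dots> \<le> S" unfolding S_def using B by (intro add_mono) auto
    finally show ?thesis .
  qed
  define D where "D = p * (S powr (p - 1))\<^sup>2 * B"
  have ND: "0 \<le> N (F n) k j" "N (F n) k j \<le> D" for n k j
  proof -
    show "0 \<le> N (F n) k j" by (rule N_integrable(2)[OF sobolevD(1)[OF FG] S])
    have "N (F n) k j \<le> p * (S powr (p - 1))\<^sup>2 * l2sq (F n)" by (rule N_integrable(3)[OF sobolevD(1)[OF FG] S])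
    also have "\<dots> \<le> D" unfolding D_def using B p_ge_2 by (intro mult_left_mono) auto
    finally show "N (F n) k j \<le> D" .
  qed
  have GB: "l2sq (\<lambda>x. G n x $ j) \<le> B" for n j
  proof -
    have "l2sq (\<lambda>x. G n x $ j) \<le> l2sq (G n)"
      by (rule l2sq_mono[OF square_integrable_nth]) (use sobolevD(2)[OF FG] Finite_Cartesian_Product.norm_nth_le in auto)
    with B(2)[of n] show ?thesis by linarith
  qed
  \<comment> \<open>A majorant of the energy change in which all integrals are replaced by their
    uniform bounds, so that only the scaling factors remain.\<close>
  define e where "e n = (\<Sum>j\<in>UNIV. \<bar>(c n j)\<^sup>2 - 1\<bar> * B) + 1 / p * (\<Sum>k\<in>UNIV. \<Sum>j\<in>UNIV. a k j * (\<bar>1 - c n k powr p * c n j powr p\<bar> * D))" for n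
  have "e \<longlonglongrightarrow> (\<Sum>j\<in>(UNIV :: 3 set). \<bar>1\<^sup>2 - 1\<bar> * B) + 1 / p * (\<Sum>k\<in>UNIV. \<Sum>j\<in>UNIV. a k j * (\<bar>1 - 1 powr p * 1 powr p\<bar> * D))"
    unfolding e_def by (intro tendsto_intros c_lim) auto
  then have "e \<longlonglongrightarrow> 0" by simp
  then have ev_e: "\<forall>\<^sub>F n in sequentially. e n < \<epsilon>" by (rule order_tendstoD(2)[OF _ \<epsilon>])
  have "\<forall>\<^sub>F n in sequentially. \<forall>j\<in>UNIV. 0 < l2sq (\<lambda>x. F n x $ j)"
    by (intro eventually_ball_finite ballI order_tendstoD(1)[OF masses m]) simp
  with ev_e show ?thesis
  proof eventually_elim
    case (elim n)
    note s = sobolev_scale_by[OF FG[of n], of "c n"]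
    have "l2sq (\<lambda>x. scale_by (c n) (F n x) $ j) = m j" for j
    proof -
      have "l2sq (\<lambda>x. scale_by (c n) (F n x) $ j) = (c n j)\<^sup>2 * l2sq (\<lambda>x. F n x $ j)"
        by (simp add: scale_by_def l2sq_cmult[of _ "\<lambda>x. F n x $ j"])
      also have "\<dots> = m j"
      proof -
        have "0 < l2sq (\<lambda>x. F n x $ j)" using elim(2) by blast
        then show ?thesis unfolding c_def using less_imp_le[OF m[of j]] by simp
      qed
      finally show ?thesis .
    qed
    from lower[OF s this] have lam: "lam \<le> en (\<lambda>x. scale_by (c n) (F n x)) (\<lambda>x. scale_by (c n) (G n x))" .
    have "en (\<lambda>x. scale_by (c n) (F n x)) (\<lambda>x. scale_by (c n) (G n x)) - en (F n) (G n) =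
      (\<Sum>j\<in>UNIV. ((c n j)\<^sup>2 - 1) * l2sq (\<lambda>x. G n x $ j)) + 1 / p * (\<Sum>k\<in>UNIV. \<Sum>j\<in>UNIV. a k j * ((1 - c n k powr p * c n j powr p) * N (F n) k j))"
      unfolding en_scale_by[OF FG[of n] c0] en_eq[OF FG[of n]]
      by (simp add: left_diff_distrib right_diff_distrib sum_subtractf)
    also have "\<dots> \<le> e n"
      unfolding e_def using ND[of n] GB[of n] less_imp_le[OF a_pos] p_ge_2
      by (intro add_mono sum_mono mult_left_mono) (auto intro!: mult_mono sum_mono mult_left_mono)
    finally show ?case using lam elim(1) by linarith
  qed
qed

end

section \<open>Compactness of minimizing sequences\<close>

context coupled_nls
begin

lemma en_translate: "en (\<lambda>x. F (x + y)) (\<lambda>x. G (x + y)) = en F G"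
  unfolding en_def l2sq_translate
  using lborel_integral_real_affine[of 1 "\<lambda>x. W (F x)" y] by (simp add: add.commute)

text \<open>By the common Hoelder bound both functions keep half of their size on an interval whose
  radius depends only on \<open>B\<close>, \<open>\<delta>\<close> and \<open>\<eta>\<close>. The
  overlap is thus bounded below independently of the functions and of the translation
  \<open>z\<close>.\<close>

lemma interaction_lower_bound:
  assumes \<delta>: "0 < \<delta>" and \<eta>: "0 < \<eta>"
  shows "\<exists>c>0. \<forall>P g w v z. sobolev P g \<longrightarrow> sobolev w v \<longrightarrow> l2sq g \<le> B \<longrightarrow> l2sq v \<le> B \<longrightarrow>
    \<delta> \<le> norm (P 0) \<longrightarrow> \<eta> \<le> norm (w z) \<longrightarrow>
    integrable lborel (\<lambda>x. norm (P x :: complex ^ 3) powr p * norm (w (x + z) :: complex ^ 3) powr p) \<longrightarrow>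
    c \<le> (LINT x|lborel. norm (P x) powr p * norm (w (x + z)) powr p)"
proof -
  define B' where "B' = max 0 B + 1"
  have B': "0 < B'" "B \<le> B'" by (auto simp: B'_def)
  \<comment> \<open>The radius for which the Hoelder error is exactly
    \<open>min \<delta> \<eta> / 2\<close>.\<close>
  define \<rho> where "\<rho> = (min \<delta> \<eta> / 2)\<^sup>2 / B'"
  have \<rho>: "0 < \<rho>" using \<delta> \<eta> B' by (simp add: \<rho>_def)
  have sq: "sqrt \<rho> * sqrt B' = min \<delta> \<eta> / 2"
    using \<delta> \<eta> B' by (simp add: \<rho>_def real_sqrt_mult[symmetric])
  define c where "c = 2 * \<rho> * ((\<delta> / 2) powr p * (\<eta> / 2) powr p)"
  have c: "0 < c" using \<rho> \<delta> \<eta> by (simp add: c_def)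
  have near: "norm (f y) \<ge> e / 2" if f: "sobolev f f'" "l2sq f' \<le> B" and e: "min \<delta> \<eta> \<le> e" "e \<le> norm (f x)" and xy: "\<bar>y - x\<bar> \<le> \<rho>"
    for f f' :: "real \<Rightarrow> complex ^ 3" and x y e
  proof -
    have "norm (f y - f x) \<le> sqrt \<bar>y - x\<bar> * sqrt (l2sq f')" by (rule sobolev_Hoelder[OF f(1)])
    also have "\<dots> \<le> sqrt \<rho> * sqrt B'" using xy f(2) B' by (intro mult_mono) auto
    finally show ?thesis using norm_triangle_ineq3[of "f y" "f x"] e unfolding sq by linarith
  qed
  have "c \<le> (LINT x|lborel. norm (P x) powr p * norm (w (x + z)) powr p)"
    if P: "sobolev P g" and w: "sobolev w v" and l: "l2sq g \<le> B" "l2sq v \<le> B" and d: "\<delta> \<le> norm (P 0)" "\<eta> \<le> norm (w z)"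
      and int: "integrable lborel (\<lambda>x. norm (P x) powr p * norm (w (x + z)) powr p)"
    for P g w v :: "real \<Rightarrow> complex ^ 3" and z
  proof -
    have "c = (LINT x|lborel. indicator {-\<rho>..\<rho>} x * ((\<delta> / 2) powr p * (\<eta> / 2) powr p))"
      using \<rho> by (simp add: c_def measure_def)
    also have "\<dots> \<le> (LINT x|lborel. norm (P x) powr p * norm (w (x + z)) powr p)"
    proof (rule integral_mono[OF _ int])
      show "integrable lborel (\<lambda>x. indicator {-\<rho>..\<rho>} x * ((\<delta> / 2) powr p * (\<eta> / 2) powr p))"
        by (intro integrable_mult_left integrable_real_indicator) (auto simp: emeasure_lborel_Icc_eq)
      fix x :: real
      show "indicator {-\<rho>..\<rho>} x * ((\<delta> / 2) powr p * (\<eta> / 2) powr p) \<le> norm (P x) powr p * norm (w (x + z)) powr p"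
      proof (cases "x \<in> {-\<rho>..\<rho>}")
        case True
        have "\<delta> / 2 \<le> norm (P x)" "\<eta> / 2 \<le> norm (w (x + z))"
          using near[OF P l(1) _ d(1), of x] near[OF w l(2) _ d(2), of "x + z"] True by auto
        then have "(\<delta> / 2) powr p * (\<eta> / 2) powr p \<le> norm (P x) powr p * norm (w (x + z)) powr p"
          using \<delta> \<eta> p_ge_2 by (intro mult_mono powr_mono2) auto
        then show ?thesis using True by simp
      qed simp
    qed
    finally show ?thesis .
  qed
  with c show ?thesis by blast
qed

text \<open>If the remainder \<open>w n\<close> did not vanish uniformly, translating it onto the profile \<open>P\<close> and
  combining the two would lower the energy by a fixed amount while keeping the limiting masses.\<close>

lemma remainder_vanishes_uniformly:
  assumes m: "\<And>j. 0 < m j"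
    and lower: "\<And>F G. sobolev F G \<Longrightarrow> (\<And>j. l2sq (\<lambda>x. F x $ j) = m j) \<Longrightarrow> lam \<le> en F G"
    and P: "sobolev P g" "0 < norm (P 0)"
    and wv: "\<And>n. sobolev (w n) (v n)" and B: "\<And>n. l2sq (w n) \<le> B" "\<And>n. l2sq (v n) \<le> B"
    and masses: "\<And>j. (\<lambda>n. l2sq (\<lambda>x. w n x $ j)) \<longlonglongrightarrow> m j - l2sq (\<lambda>x. P x $ j)"
    and en: "(\<lambda>n. en (w n) (v n)) \<longlonglongrightarrow> lam - en P g"
    and \<eta>: "0 < \<eta>"
  shows "\<forall>\<^sub>F n in sequentially. \<forall>x. norm (w n x) < \<eta>"
proof -
  define B' where "B' = max B (l2sq g)"
  have gB: "l2sq g \<le> B'" by (simp add: B'_def)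
  from interaction_lower_bound[OF P(2) \<eta>, of B'] obtain c where c0: "0 < c"
    and c1: "\<forall>P' g' w v z. sobolev P' g' \<longrightarrow> sobolev w v \<longrightarrow> l2sq g' \<le> B' \<longrightarrow> l2sq v \<le> B' \<longrightarrow>
    norm (P 0) \<le> norm (P' 0) \<longrightarrow> \<eta> \<le> norm (w z) \<longrightarrow>
    integrable lborel (\<lambda>x. norm (P' x :: complex ^ 3) powr p * norm (w (x + z) :: complex ^ 3) powr p) \<longrightarrow>
    c \<le> (LINT x|lborel. norm (P' x) powr p * norm (w (x + z)) powr p)" by blast
  note c = c0 c1[rule_format, OF P(1) _ gB _ order_refl]
  \<comment> \<open>A point where \<open>w n\<close> is at least \<open>\<eta>\<close>; for indices
    without such a point the value is arbitrary and harmless, because translations change neither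
    masses nor energy.\<close>
  define z where "z n = (SOME z. \<eta> \<le> norm (w n z))" for n
  define ww where "ww n x = w n (x + z n)" for n x
  define vv where "vv n x = v n (x + z n)" for n x
  have s: "sobolev (ww n) (vv n)" for n unfolding ww_def vv_def by (rule sobolev_translate[OF wv])
  have lw: "l2sq (ww n) = l2sq (w n)" "l2sq (vv n) = l2sq (v n)" "l2sq (\<lambda>x. ww n x $ j) = l2sq (\<lambda>x. w n x $ j)" for n j
    unfolding ww_def vv_def using l2sq_translate[of "\<lambda>x. w n x $ j"] by (simp_all add: l2sq_translate)
  have enw: "en (ww n) (vv n) = en (w n) (v n)" for n
    unfolding ww_def vv_def by (rule en_translate)
  have "\<forall>n. \<exists>M. sobolev (\<lambda>x. combine (P x) (ww n x)) M \<and>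
    (\<forall>j. l2sq (\<lambda>x. M x $ j) \<le> l2sq (\<lambda>x. g x $ j) + l2sq (\<lambda>x. vv n x $ j)) \<and>
    integrable lborel (\<lambda>x. norm (P x) powr p * norm (ww n x) powr p) \<and>
    en (\<lambda>x. combine (P x) (ww n x)) M \<le> en P g + en (ww n) (vv n) - gain * (LINT x|lborel. norm (P x) powr p * norm (ww n x) powr p)"
    using energy_combine[OF P(1) s] by blast
  from choice[OF this] obtain M where M: "\<And>n. sobolev (\<lambda>x. combine (P x) (ww n x)) (M n)"
    "\<And>n j. l2sq (\<lambda>x. M n x $ j) \<le> l2sq (\<lambda>x. g x $ j) + l2sq (\<lambda>x. vv n x $ j)"
    "\<And>n. integrable lborel (\<lambda>x. norm (P x) powr p * norm (ww n x) powr p)"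
    "\<And>n. en (\<lambda>x. combine (P x) (ww n x)) (M n) \<le> en P g + en (ww n) (vv n) - gain * (LINT x|lborel. norm (P x) powr p * norm (ww n x) powr p)"
    by blast
  have lR: "l2sq (\<lambda>x. combine (P x) (ww n x) $ j) = l2sq (\<lambda>x. P x $ j) + l2sq (\<lambda>x. w n x $ j)" for n j
    unfolding l2sq_combine[OF sobolevD(1)[OF P(1)] sobolevD(1)[OF s]] lw ..
  have bR: "l2sq (\<lambda>x. combine (P x) (ww n x)) \<le> max (l2sq P + B) (l2sq g + B)" for n
  proof -
    have "l2sq (\<lambda>x. combine (P x) (ww n x)) = l2sq P + l2sq (w n)"
      unfolding l2sq_vec[OF sobolevD(1)[OF M(1)]] lR l2sq_vec[OF sobolevD(1)[OF P(1)]] l2sq_vec[OF sobolevD(1)[OF wv]]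
      by (rule sum.distrib)
    then show ?thesis using B(1)[of n] by (simp add: le_max_iff_disj)
  qed
  have bM: "l2sq (M n) \<le> max (l2sq P + B) (l2sq g + B)" for n
  proof -
    have "l2sq (M n) \<le> l2sq g + l2sq (vv n)"
      unfolding l2sq_vec[OF sobolevD(2)[OF M(1)]] l2sq_vec[OF sobolevD(2)[OF P(1)]] l2sq_vec[OF sobolevD(2)[OF s]]
        sum.distrib[symmetric] by (intro sum_mono M(2))
    then show ?thesis using B(2)[of n] lw(2)[of n] by (simp add: le_max_iff_disj)
  qed
  have mR: "(\<lambda>n. l2sq (\<lambda>x. combine (P x) (ww n x) $ j)) \<longlonglongrightarrow> m j" for j
    using tendsto_add[OF tendsto_const[of "l2sq (\<lambda>x. P x $ j)"] masses[of j]] unfolding lR by simp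
  \<comment> \<open>A quarter of the gain is allowed as error in the lower and in the upper
    estimate; together they use half of it, which leaves a contradiction.\<close>
  have gc: "0 < gain * c / 4" using gain(1) c(1) by simp
  have low: "\<forall>\<^sub>F n in sequentially. lam - gain * c / 4 \<le> en (\<lambda>x. combine (P x) (ww n x)) (M n)"
    by (rule energy_lower_limit[OF m lower M(1) bR bM mR gc])
  have up: "\<forall>\<^sub>F n in sequentially. en (w n) (v n) < lam - en P g + gain * c / 4"
    by (rule order_tendstoD(2)[OF en]) (use gc in simp)
  from low up show ?thesis
  proof eventually_elim
    case (elim n)
    show ?case
    proof (rule ccontr)
      assume "\<not> (\<forall>x. norm (w n x) < \<eta>)"
      then have "\<exists>z. \<eta> \<le> norm (w n z)" by (auto simp: not_less)
      then have z: "\<eta> \<le> norm (w n (z n))" unfolding z_def by (rule someI_ex)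
      have "c \<le> (LINT x|lborel. norm (P x) powr p * norm (w n (x + z n)) powr p)"
        using c(2)[OF wv _ z] M(3)[of n] B(2)[of n] by (simp add: B'_def ww_def)
      then have "gain * c \<le> gain * (LINT x|lborel. norm (P x) powr p * norm (ww n x) powr p)"
        unfolding ww_def using gain(1) by (intro mult_left_mono) auto
      then show False using elim M(4)[of n] gc unfolding enw by linarith
    qed
  qed
qed

text \<open>The order of the conclusions matters. The remainder has vanishing interaction, so its
  kinetic energy tends to \<open>lam - en P g\<close>. Nonnegativity of that limit gives the energy
  inequality for \<open>P\<close>, this gives exact masses, these give equality of energies, and
  only then does the remainder vanish in norm.\<close>

lemma minimizing_sequence_compact:
  assumes m: "\<And>j. 0 < m j"
    and lower: "\<And>F G. sobolev F G \<Longrightarrow> (\<And>j. l2sq (\<lambda>x. F x $ j) = m j) \<Longrightarrow> lam \<le> en F G"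
    and FG: "\<And>n. sobolev (F n) (G n)"
    and masses: "\<And>j. (\<lambda>n. l2sq (\<lambda>x. F n x $ j)) \<longlonglongrightarrow> m j"
    and en: "(\<lambda>n. en (F n) (G n)) \<longlonglongrightarrow> lam"
  shows "\<exists>\<kappa> y P g. strict_mono (\<kappa> :: nat \<Rightarrow> nat) \<and> sobolev P g \<and> (\<forall>j. l2sq (\<lambda>x. P x $ j) = m j) \<and> en P g = lam \<and>
    (\<lambda>n. l2sq (\<lambda>x. F (\<kappa> n) (x + y (\<kappa> n)) - P x)) \<longlonglongrightarrow> 0 \<and>
    (\<lambda>n. l2sq (\<lambda>x. G (\<kappa> n) (x + y (\<kappa> n)) - g x)) \<longlonglongrightarrow> 0"
proof -
  have "(\<lambda>n. l2sq (F n)) \<longlonglongrightarrow> (\<Sum>j\<in>UNIV. m j)"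
    unfolding l2sq_vec[OF sobolevD(1)[OF FG]] by (intro tendsto_sum masses)
  then have "Bseq (\<lambda>n. l2sq (F n))" by (simp add: convergentI convergent_imp_Bseq)
  then obtain MB where MB: "\<And>n. l2sq (F n) \<le> MB" unfolding Bseq_def by (auto simp: abs_le_iff)
  have "Bseq (\<lambda>n. en (F n) (G n))" using en by (simp add: convergentI convergent_imp_Bseq)
  then obtain EB where EB: "\<And>n. en (F n) (G n) \<le> EB" unfolding Bseq_def by (auto simp: abs_le_iff)
  obtain GB where GB: "\<And>n. l2sq (G n) \<le> GB"
    using energy_coercive[of MB EB] FG MB EB by blast
  define B where "B = max MB GB"
  have B: "l2sq (F n) \<le> B" "l2sq (G n) \<le> B" for n using MB[of n] GB[of n] by (auto simp: B_def)
  have B0: "0 \<le> B" using B(1)[of 0] l2sq_nonneg[of "F 0"] by linarith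
  obtain F0 G0 where "sobolev F0 G0" "\<And>j. l2sq (\<lambda>x. F0 x $ j) = m j" "en F0 G0 < 0"
    using negative_energy[of m 1, OF less_imp_le[OF m] m] by blast
  then have lam: "lam < 0" using lower[of F0 G0] by force
  \<comment> \<open>If a term of the sequence stayed below \<open>\<delta>\<close> everywhere, its
    interaction would be less than \<open>- lam / 2\<close>, which is incompatible with an energy
    below \<open>lam / 2\<close>.\<close>
  obtain \<delta> where \<delta>: "0 < \<delta>" "K \<delta> * B < - lam / 2" using K_small[of "- lam / 2" B] lam B0 by auto
  have nonvanishing: "\<forall>\<^sub>F n in sequentially. \<exists>y. \<delta> \<le> norm (F n y)"
  proof -
    have "\<forall>\<^sub>F n in sequentially. en (F n) (G n) < lam / 2"
      by (rule order_tendstoD(2)[OF en]) (use lam in simp)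
    then show ?thesis
    proof eventually_elim
      case (elim n)
      show ?case
      proof (rule ccontr)
        assume "\<not> ?thesis"
        then have "norm (F n x) \<le> \<delta>" for x by (auto simp: not_le intro: less_imp_le)
        from integrable_W(2)[OF sobolevD(1)[OF FG] this]
        have "(LINT x|lborel. W (F n x)) \<le> K \<delta> * l2sq (F n)" .
        also have "\<dots> \<le> K \<delta> * B" using B K_nonneg by (intro mult_left_mono)
        finally show False using elim \<delta>(2) l2sq_nonneg[of "G n"] unfolding en_def by linarith
      qed
    qed
  qed
  define y where "y n = (SOME y. \<delta> \<le> norm (F n y))" for n
  define F' where "F' n x = F n (x + y n)" for n x
  define G' where "G' n x = G n (x + y n)" for n x
  have FG': "sobolev (F' n) (G' n)" for n unfolding F'_def G'_def by (rule sobolev_translate[OF FG])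
  have l': "l2sq (F' n) \<le> B" "l2sq (G' n) \<le> B" for n
    unfolding F'_def G'_def l2sq_translate by (rule B)+
  have mass': "(\<lambda>n. l2sq (\<lambda>x. F' n x $ j)) \<longlonglongrightarrow> m j" for j
    using masses[of j] unfolding F'_def by (simp add: l2sq_translate[of "\<lambda>x. F _ x $ j"])
  have en': "(\<lambda>n. en (F' n) (G' n)) \<longlonglongrightarrow> lam" using en unfolding F'_def G'_def en_translate .
  obtain \<kappa> P g where \<kappa>: "strict_mono (\<kappa> :: nat \<Rightarrow> nat)" and P: "sobolev P g"
    and lim: "\<And>x. (\<lambda>n. F' (\<kappa> n) x) \<longlonglongrightarrow> P x"
    and kin: "(\<lambda>n. l2sq (G' (\<kappa> n)) - l2sq (\<lambda>x. G' (\<kappa> n) x - g x)) \<longlonglongrightarrow> l2sq g"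
    using sobolev_bounded_sequence_compact[of F' G' B, OF FG' l'] by blast
  \<comment> \<open>Each translate was centred at a point of size at least \<open>\<delta>\<close>,
    and this survives in the pointwise limit, so the profile is nonzero.\<close>
  have P0: "\<delta> \<le> norm (P 0)"
  proof -
    have ev: "\<forall>\<^sub>F n in sequentially. \<delta> \<le> norm (F' (\<kappa> n) 0)"
      using eventually_subseq[OF \<kappa> nonvanishing]
    proof eventually_elim
      case (elim n)
      from someI_ex[OF elim] show ?case by (simp add: F'_def y_def)
    qed
    show ?thesis
      by (rule tendsto_lowerbound[OF tendsto_norm[OF lim[of 0]] ev]) simp
  qed
  define w where "w n x = F' (\<kappa> n) x - P x" for n x
  define v where "v n x = G' (\<kappa> n) x - g x" for n x
  have wv: "sobolev (w n) (v n)" for n unfolding w_def v_def by (rule sobolev_diff[OF FG' P])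
  define B' where "B' = max (2 * B + 2 * l2sq P) (2 * B + 2 * l2sq g)"
  have lw: "l2sq (w n) \<le> B'" and lv: "l2sq (v n) \<le> B'" for n
  proof -
    have "l2sq (w n) \<le> 2 * l2sq (F' (\<kappa> n)) + 2 * l2sq P"
      unfolding w_def by (rule l2sq_diff_le[OF sobolevD(1)[OF FG'] sobolevD(1)[OF P]])
    then show "l2sq (w n) \<le> B'" using l'(1)[of "\<kappa> n"] by (simp add: B'_def le_max_iff_disj)
    have "l2sq (v n) \<le> 2 * l2sq (G' (\<kappa> n)) + 2 * l2sq g"
      unfolding v_def by (rule l2sq_diff_le[OF sobolevD(2)[OF FG'] sobolevD(2)[OF P]])
    then show "l2sq (v n) \<le> B'" using l'(2)[of "\<kappa> n"] by (simp add: B'_def le_max_iff_disj)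
  qed
  have massw: "(\<lambda>n. l2sq (\<lambda>x. w n x $ j)) \<longlonglongrightarrow> m j - l2sq (\<lambda>x. P x $ j)" for j
  proof -
    have bd: "l2sq (\<lambda>x. F' n x $ j) \<le> B" for n
      by (rule order_trans[OF l2sq_mono[OF square_integrable_nth] l'(1)])
        (use sobolevD(1)[OF FG'] Finite_Cartesian_Product.norm_nth_le in auto)
    have "(\<lambda>n. l2sq (\<lambda>x. F' (\<kappa> n) x $ j) - l2sq (\<lambda>x. F' (\<kappa> n) x $ j - P x $ j)) \<longlonglongrightarrow> l2sq (\<lambda>x. P x $ j)"
      using l2sq_splitting[of "\<lambda>n x. F' (\<kappa> n) x $ j" B "\<lambda>x. P x $ j", OF square_integrable_nth[OF sobolevD(1)[OF FG']] bd
          square_integrable_nth[OF sobolevD(1)[OF P]] tendsto_vec_nth[OF lim]] .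
    from tendsto_diff[OF LIMSEQ_subseq_LIMSEQ[OF mass'[of j] \<kappa>, unfolded o_def] this]
    show ?thesis unfolding w_def by simp
  qed
  \<comment> \<open>One radius that contains the sequence, the profile and the remainders, so that a
    single Lipschitz constant serves all three.\<close>
  define S where "S = 2 * (sqrt B + sqrt B)"
  have SF: "norm (F' n x) \<le> sqrt B + sqrt B" for n x
  proof -
    have "norm (F' n x) \<le> sqrt (l2sq (F' n)) + sqrt (l2sq (G' n))" by (rule sobolev_bounded[OF FG'])
    also have "\<dots> \<le> sqrt B + sqrt B" using l' by (intro add_mono) auto
    finally show ?thesis .
  qed
  have SP: "norm (P x) \<le> sqrt B + sqrt B" for x
    by (rule tendsto_upperbound[OF tendsto_norm[OF lim[of x]] always_eventually[OF allI[OF SF]] sequentially_bot])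
  have Sw: "norm (w n x) \<le> S" for n x
    unfolding w_def S_def mult_2
    by (rule order_trans[OF norm_triangle_ineq4 add_mono[OF SF[of "\<kappa> n" x] SP[of x]]])
  have SS: "sqrt B + sqrt B \<le> S" using B0 by (simp add: S_def)
  \<comment> \<open>The Brezis--Lieb splitting of the interaction: the difference is bounded by
    products in which the fixed function \<open>P\<close> occurs, hence is a vanishing cross
    term.\<close>
  have Wlim: "(\<lambda>n. LINT x|lborel. W (F' (\<kappa> n) x) - W (w n x) - W (P x)) \<longlonglongrightarrow> 0"
  proof (rule integral_cross_terms_vanish(2)[OF sobolevD(1)[OF wv] lw sobolevD(1)[OF P]])
    fix n x
    note [measurable] = square_integrable_measurable[OF sobolevD(1)[OF FG']] square_integrable_measurable[OF sobolevD(1)[OF wv]]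
      square_integrable_measurable[OF sobolevD(1)[OF P]]
    show "(\<lambda>x. W (F' (\<kappa> n) x) - W (w n x) - W (P x)) \<in> borel_measurable borel" by measurable
    have w0: "(\<lambda>n. w n x) \<longlonglongrightarrow> 0"
      using tendsto_diff[OF lim[of x] tendsto_const[of "P x"]] by (simp add: w_def)
    have "(\<lambda>n. W (F' (\<kappa> n) x) - W (w n x) - W (P x)) \<longlonglongrightarrow> W (P x) - W 0 - W (P x)"
      by (intro tendsto_diff isCont_tendsto_compose[OF continuous_W] lim w0 tendsto_const)
    then show "(\<lambda>n. W (F' (\<kappa> n) x) - W (w n x) - W (P x)) \<longlonglongrightarrow> 0" by (simp add: W_zero)
    have nF: "norm (F' (\<kappa> n) x) \<le> norm (w n x) + norm (P x)"
      using norm_triangle_ineq[of "w n x" "P x"] by (simp add: w_def)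
    have "\<bar>W (F' (\<kappa> n) x) - W (w n x)\<bar> \<le> K S * ((norm (F' (\<kappa> n) x) + norm (w n x)) * norm (F' (\<kappa> n) x - w n x))"
      by (rule W_Lipschitz) (use SF[of "\<kappa> n" x] SS Sw in auto)
    also have "\<dots> \<le> K S * ((norm (w n x) + norm (P x) + norm (w n x)) * norm (P x))"
      using nF K_nonneg by (intro mult_left_mono mult_mono) (auto simp: w_def)
    finally have 1: "\<bar>W (F' (\<kappa> n) x) - W (w n x)\<bar> \<le> K S * ((norm (w n x) + norm (P x) + norm (w n x)) * norm (P x))" .
    have 2: "W (P x) \<le> K S * (norm (P x))\<^sup>2" by (rule W_le) (use SP[of x] SS in simp)
    have "\<bar>W (F' (\<kappa> n) x) - W (w n x) - W (P x)\<bar> \<le> \<bar>W (F' (\<kappa> n) x) - W (w n x)\<bar> + W (P x)"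
      using W_nonneg[of "P x"] by linarith
    also have "\<dots> \<le> (2 * K S) * (norm (w n x) * norm (P x) + (norm (P x))\<^sup>2)"
      using add_mono[OF 1 2] by (simp add: algebra_simps power2_eq_square)
    finally show "\<bar>W (F' (\<kappa> n) x) - W (w n x) - W (P x)\<bar> \<le> (2 * K S) * (norm (w n x) * norm (P x) + (norm (P x))\<^sup>2)" .
  qed
  have enw: "(\<lambda>n. en (w n) (v n)) \<longlonglongrightarrow> lam - en P g"
  proof -
    have eq: "en (w n) (v n) = en (F' (\<kappa> n)) (G' (\<kappa> n)) - (l2sq (G' (\<kappa> n)) - l2sq (\<lambda>x. G' (\<kappa> n) x - g x))
       + (LINT x|lborel. W (F' (\<kappa> n) x) - W (w n x) - W (P x)) + (LINT x|lborel. W (P x))" for n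
    proof -
      have "(LINT x|lborel. W (F' (\<kappa> n) x) - W (w n x) - W (P x)) = (LINT x|lborel. W (F' (\<kappa> n) x)) - (LINT x|lborel. W (w n x)) - (LINT x|lborel. W (P x))"
        using sobolev_integrable_W[OF FG'] sobolev_integrable_W[OF wv] sobolev_integrable_W[OF P] by simp
      then show ?thesis unfolding en_def v_def by simp
    qed
    have "(\<lambda>n. en (w n) (v n)) \<longlonglongrightarrow> lam - l2sq g + 0 + (LINT x|lborel. W (P x))"
      unfolding eq by (intro tendsto_intros LIMSEQ_subseq_LIMSEQ[OF en' \<kappa>, unfolded o_def] kin Wlim)
    then show ?thesis by (simp add: en_def diff_diff_eq2 diff_add_eq)
  qed
  have uniform: "\<forall>\<^sub>F n in sequentially. \<forall>x. norm (w n x) < \<eta>" if "0 < \<eta>" for \<eta>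
    by (rule remainder_vanishes_uniformly[OF m lower P _ wv lw lv massw enw that]) (use P0 \<delta> in auto)
  have Ww: "(\<lambda>n. LINT x|lborel. W (w n x)) \<longlonglongrightarrow> 0"
  proof (rule LIMSEQ_I)
    fix e :: real assume e: "0 < e"
    have B'0: "0 \<le> B'" using lw[of 0] l2sq_nonneg[of "w 0"] by linarith
    obtain \<eta> where \<eta>: "0 < \<eta>" "K \<eta> * B' < e" using K_small[OF e B'0] by blast
    have "\<forall>\<^sub>F n in sequentially. norm ((LINT x|lborel. W (w n x)) - 0) < e"
      using uniform[OF \<eta>(1)]
    proof eventually_elim
      case (elim n)
      have "norm (w n x) \<le> \<eta>" for x using elim by (simp add: less_imp_le)
      from integrable_W(2)[OF sobolevD(1)[OF wv] this]
      have "(LINT x|lborel. W (w n x)) \<le> K \<eta> * l2sq (w n)" .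
      also have "\<dots> \<le> K \<eta> * B'" using lw K_nonneg by (intro mult_left_mono)
      also have "\<dots> < e" by (rule \<eta>(2))
      finally have "(LINT x|lborel. W (w n x)) < e" .
      moreover have "0 \<le> (LINT x|lborel. W (w n x))" by (rule Bochner_Integration.integral_nonneg) (rule W_nonneg)
      ultimately show ?case by simp
    qed
    then show "\<exists>no. \<forall>n\<ge>no. norm ((LINT x|lborel. W (w n x)) - 0) < e" by (simp add: eventually_sequentially)
  qed
  \<comment> \<open>Adding the vanishing interaction to the energy of the remainder leaves its
    kinetic energy.\<close>
  have vlim: "(\<lambda>n. l2sq (v n)) \<longlonglongrightarrow> lam - en P g"
    using tendsto_add[OF enw Ww] by (simp add: en_def)
  have enP: "en P g \<le> lam"
    using LIMSEQ_le_const[OF vlim, of 0] by simp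
  \<comment> \<open>Missing mass in any component could be supplied by a triple of negative energy,
    and the combination would lie below \<open>lam\<close>.\<close>
  have mP: "l2sq (\<lambda>x. P x $ j) = m j" for j
  proof (rule ccontr)
    assume ne: "l2sq (\<lambda>x. P x $ j) \<noteq> m j"
    define \<mu> where "\<mu> j = m j - l2sq (\<lambda>x. P x $ j)" for j
    have \<mu>: "0 \<le> \<mu> j" for j unfolding \<mu>_def by (rule LIMSEQ_le_const[OF massw]) simp
    have "0 < \<mu> j" using \<mu>[of j] ne unfolding \<mu>_def by simp
    then obtain H h where H: "sobolev H h" "\<And>j. l2sq (\<lambda>x. H x $ j) = \<mu> j" "en H h < 0"
      using negative_energy[of \<mu> j, OF \<mu>] by blast
    obtain M where M: "sobolev (\<lambda>x. combine (P x) (H x)) M"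
      "en (\<lambda>x. combine (P x) (H x)) M \<le> en P g + en H h - gain * (LINT x|lborel. norm (P x) powr p * norm (H x) powr p)"
      using energy_combine[OF P H(1)] by blast
    have "l2sq (\<lambda>x. combine (P x) (H x) $ j) = m j" for j
      unfolding l2sq_combine[OF sobolevD(1)[OF P] sobolevD(1)[OF H(1)]] H(2) by (simp add: \<mu>_def)
    from lower[OF M(1) this] have "lam \<le> en (\<lambda>x. combine (P x) (H x)) M" .
    moreover have "0 \<le> gain * (LINT x|lborel. norm (P x) powr p * norm (H x) powr p)"
      using gain(1) by (intro mult_nonneg_nonneg Bochner_Integration.integral_nonneg) auto
    ultimately show False using M(2) enP H(3) by linarith
  qed
  have enP': "en P g = lam" using lower[OF P mP] enP by linarith
  have "(\<lambda>n. l2sq (w n)) \<longlonglongrightarrow> (\<Sum>j\<in>(UNIV :: 3 set). m j - l2sq (\<lambda>x. P x $ j))"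
    unfolding l2sq_vec[OF sobolevD(1)[OF wv]] by (intro tendsto_sum massw)
  then have "(\<lambda>n. l2sq (w n)) \<longlonglongrightarrow> 0" by (simp add: mP)
  moreover have "(\<lambda>n. l2sq (v n)) \<longlonglongrightarrow> 0" using vlim enP' by simp
  ultimately show ?thesis
    using \<kappa> P mP enP' unfolding w_def v_def F'_def G'_def by blast
qed

end

section \<open>The Euler--Lagrange equations\<close>

text \<open>Away from 0 this is a power of a quadratic polynomial in \<open>e\<close>. At
  \<open>z = 0\<close> the difference quotient is bounded by a multiple of |e|^(p-1), and the stated
  derivative is 0 because of the factor \<open>z \<bullet> h\<close>.\<close>

lemma has_real_derivative_norm_powr:
  fixes z h :: complex
  assumes p: "2 \<le> p"
  shows "((\<lambda>e. norm (z + e *\<^sub>R h) powr p) has_real_derivative p * norm z powr (p - 2) * (z \<bullet> h)) (at 0)"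
proof (cases "z = 0")
  case False
  have eq: "norm (z + e *\<^sub>R h) powr p = ((norm z)\<^sup>2 + 2 * e * (z \<bullet> h) + e\<^sup>2 * (norm h)\<^sup>2) powr (p / 2)" for e
  proof -
    have "(norm (z + e *\<^sub>R h))\<^sup>2 = (norm z)\<^sup>2 + 2 * e * (z \<bullet> h) + e\<^sup>2 * (norm h)\<^sup>2"
      by (simp only: power2_norm_eq_inner) (simp add: inner_simps inner_commute power2_eq_square algebra_simps)
    moreover have "norm (z + e *\<^sub>R h) powr p = ((norm (z + e *\<^sub>R h))\<^sup>2) powr (p / 2)"
      using powr_powr[of "norm (z + e *\<^sub>R h)" 2 "p / 2"] by (simp add: powr_numeral)
    ultimately show ?thesis by simp
  qed
  have base: "((\<lambda>e. (norm z)\<^sup>2 + 2 * e * (z \<bullet> h) + e\<^sup>2 * (norm h)\<^sup>2) has_real_derivative 2 * (z \<bullet> h)) (at 0)"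
    by (auto intro!: derivative_eq_intros)
  have pos: "0 < (norm z)\<^sup>2" using False by simp
  have "((\<lambda>x. x powr (p / 2)) has_real_derivative p / 2 * ((norm z)\<^sup>2) powr (p / 2 - 1)) (at ((norm z)\<^sup>2))"
    by (rule has_real_derivative_powr[OF pos])
  then have o: "((\<lambda>x. x powr (p / 2)) has_real_derivative p / 2 * ((norm z)\<^sup>2) powr (p / 2 - 1))
      (at ((norm z)\<^sup>2 + 2 * 0 * (z \<bullet> h) + 0\<^sup>2 * (norm h)\<^sup>2))" by simp
  have "((norm z)\<^sup>2) powr (p / 2 - 1) = norm z powr (p - 2)"
    using powr_powr[of "norm z" 2 "p / 2 - 1"] by (simp add: powr_numeral algebra_simps)
  with DERIV_chain2[OF o base] show ?thesis unfolding eq by (simp add: mult.assoc)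
next
  case True
  have "((\<lambda>e. (norm h powr p) * \<bar>e\<bar> powr (p - 1)) \<longlongrightarrow> (norm h powr p) * \<bar>0\<bar> powr (p - 1)) (at (0::real))"
    using p by (intro tendsto_intros) auto
  then have l: "((\<lambda>e. (norm h powr p) * \<bar>e\<bar> powr (p - 1)) \<longlongrightarrow> 0) (at (0::real))" using p by simp
  have "((\<lambda>e. (norm (z + e *\<^sub>R h) powr p - norm (z + 0 *\<^sub>R h) powr p) / (e - 0)) \<longlongrightarrow> 0) (at 0)"
  proof (rule Lim_null_comparison[OF always_eventually l], rule allI)
    fix e :: real
    show "norm ((norm (z + e *\<^sub>R h) powr p - norm (z + 0 *\<^sub>R h) powr p) / (e - 0)) \<le> (norm h powr p) * \<bar>e\<bar> powr (p - 1)"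
    proof (cases "e = 0")
      case False
      then have "\<bar>e\<bar> powr p = \<bar>e\<bar> powr (p - 1) * \<bar>e\<bar>" using powr_add[of "\<bar>e\<bar>" "p - 1" 1] by simp
      then show ?thesis using False True p by (simp add: powr_mult)
    qed (use True p in simp)
  qed
  then show ?thesis using True by (simp add: has_field_derivative_iff)
qed

text \<open>Symmetry of the coefficients merges the two sums of the product rule; the resulting
  factor 2 matches the one from the kinetic energy.\<close>

lemma has_real_derivative_sum_double:
  fixes f :: "'n::finite \<Rightarrow> real \<Rightarrow> real"
  assumes f: "\<And>k. (f k has_real_derivative d k) (at x)" and sym: "\<And>k j. c k j = c j k"
  shows "((\<lambda>e. \<Sum>k\<in>UNIV. \<Sum>j\<in>UNIV. c k j * f k e * f j e) has_real_derivative
    2 * (\<Sum>j\<in>UNIV. (\<Sum>k\<in>UNIV. c k j * f k x) * d j)) (at x)"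
proof -
  have "((\<lambda>e. \<Sum>k\<in>UNIV. \<Sum>j\<in>UNIV. c k j * f k e * f j e) has_real_derivative
    (\<Sum>k\<in>UNIV. \<Sum>j\<in>UNIV. c k j * d k * f j x + c k j * f k x * d j)) (at x)"
    by (intro DERIV_sum) (auto intro!: derivative_eq_intros f simp: algebra_simps)
  moreover have "(\<Sum>k\<in>UNIV. \<Sum>j\<in>UNIV. c k j * d k * f j x + c k j * f k x * d j)
    = 2 * (\<Sum>j\<in>UNIV. (\<Sum>k\<in>UNIV. c k j * f k x) * d j)"
  proof -
    have 1: "(\<Sum>k\<in>UNIV. \<Sum>j\<in>UNIV. c k j * f k x * d j) = (\<Sum>j\<in>UNIV. (\<Sum>k\<in>UNIV. c k j * f k x) * d j)"
      by (subst sum.swap) (simp add: sum_distrib_right)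
    have 2: "(\<Sum>k\<in>UNIV. \<Sum>j\<in>UNIV. c k j * d k * f j x) = (\<Sum>j\<in>UNIV. (\<Sum>k\<in>UNIV. c k j * f k x) * d j)"
      by (simp add: sum_distrib_left mult_ac sym)
    show ?thesis unfolding sum.distrib 1 2 by simp
  qed
  ultimately show ?thesis by simp
qed

text \<open>For \<open>r = 0\<close> the scalar factor jumps at \<open>w = 0\<close>, since
  \<open>0 powr 0 = 0\<close>, but the product with \<open>w\<close> does not.\<close>

lemma continuous_powr_scaleR:
  fixes w :: complex
  assumes "0 \<le> r"
  shows "isCont (\<lambda>w. norm w powr r *\<^sub>R w) w"
proof (cases "w = 0")
  case False
  then show ?thesis by (intro continuous_intros) auto
next
  case True
  have "((\<lambda>w::complex. norm w powr (r + 1)) \<longlongrightarrow> 0 powr (r + 1)) (at 0)"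
    using assms by (intro tendsto_powr2[OF tendsto_norm_zero[OF tendsto_ident_at] tendsto_const]) auto
  then have l: "((\<lambda>w::complex. norm w powr (r + 1)) \<longlongrightarrow> 0) (at 0)" using assms by simp
  have "((\<lambda>w::complex. norm w powr r *\<^sub>R w) \<longlongrightarrow> 0) (at 0)"
    by (rule Lim_null_comparison[OF always_eventually l]) (simp add: powr_add)
  then show ?thesis using True by (simp add: isCont_def)
qed

context coupled_nls
begin

abbreviation NL :: "complex ^ 3 \<Rightarrow> 3 \<Rightarrow> complex" where
  "NL z j \<equiv> nonlinearity p a (\<lambda>k. z $ k) j"

text \<open>At \<open>z $ j = 0\<close> both sides vanish for every admissible exponent, including
  \<open>p = 2\<close>.\<close>

lemma NL_inner_self: "NL z j \<bullet> z $ j = (\<Sum>k\<in>UNIV. a k j * (norm (z $ k) powr p * norm (z $ j) powr p))"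
proof -
  have "norm (z $ j) powr (p - 2) * (norm (z $ j))\<^sup>2 = norm (z $ j) powr p"
    using powr_add[of "norm (z $ j)" "p - 2" 2] p_ge_2 by (cases "z $ j = 0") (simp_all add: powr_numeral)
  then show ?thesis
    by (simp add: nonlinearity_def power2_norm_eq_inner[symmetric] mult.assoc sum_distrib_right)
qed

lemma continuous_NL: "isCont (\<lambda>z. NL z j) z"
proof -
  have "NL z j = (\<Sum>k\<in>UNIV. a k j * norm (z $ k) powr p) *\<^sub>R (norm (z $ j) powr (p - 2) *\<^sub>R z $ j)" for z
    by (simp add: nonlinearity_def)
  moreover have "isCont (\<lambda>z. (\<Sum>k\<in>UNIV. a k j * norm (z $ k) powr p) *\<^sub>R (norm (z $ j) powr (p - 2) *\<^sub>R z $ j)) z"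
  proof (rule continuous_scaleR)
    have "isCont (\<lambda>z :: complex ^ 3. norm (z $ k) powr p) z" for k
      using p_ge_2 unfolding isCont_def by (intro tendsto_powr2 tendsto_intros) auto
    then show "isCont (\<lambda>z. \<Sum>k\<in>UNIV. a k j * norm (z $ k) powr p) z"
      by (intro continuous_sum continuous_mult continuous_const)
    show "isCont (\<lambda>z. norm (z $ j) powr (p - 2) *\<^sub>R z $ j) z"
      by (rule isCont_o2[where f="\<lambda>z. z $ j" and g="\<lambda>w. norm w powr (p - 2) *\<^sub>R w"])
        (use p_ge_2 in \<open>auto intro!: continuous_powr_scaleR continuous_intros\<close>)
  qed
  ultimately show ?thesis by simp
qed

lemma has_real_derivative_W:
  "((\<lambda>e. W (z + e *\<^sub>R h)) has_real_derivative 2 * (\<Sum>j\<in>UNIV. NL z j \<bullet> h $ j)) (at 0)"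
proof -
  have f: "((\<lambda>e. norm ((z + e *\<^sub>R h) $ k) powr p) has_real_derivative p * norm (z $ k) powr (p - 2) * (z $ k \<bullet> h $ k)) (at 0)" for k
    using has_real_derivative_norm_powr[OF p_ge_2, of "z $ k" "h $ k"] by simp
  from DERIV_cmult[OF has_real_derivative_sum_double[OF f a_sym], of "1 / p"]
  have A: "((\<lambda>e. W (z + e *\<^sub>R h)) has_real_derivative 1 / p * (2 * (\<Sum>j\<in>UNIV. (\<Sum>k\<in>UNIV. a k j * norm ((z + 0 *\<^sub>R h) $ k) powr p) * (p * norm (z $ j) powr (p - 2) * (z $ j \<bullet> h $ j))))) (at 0)"
    unfolding W_def .
  have B: "1 / p * (2 * (\<Sum>j\<in>UNIV. (\<Sum>k\<in>UNIV. a k j * norm ((z + 0 *\<^sub>R h) $ k) powr p) * (p * norm (z $ j) powr (p - 2) * (z $ j \<bullet> h $ j))))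
     = 2 * (\<Sum>j\<in>UNIV. NL z j \<bullet> h $ j)"
  proof -
    have "(\<Sum>k\<in>UNIV. a k j * norm ((z + 0 *\<^sub>R h) $ k) powr p) * (p * norm (z $ j) powr (p - 2) * (z $ j \<bullet> h $ j)) = p * (NL z j \<bullet> h $ j)" for j
      by (simp add: nonlinearity_def mult_ac)
    then show ?thesis using p_ge_2 by (simp only: sum_distrib_left[symmetric]) simp
  qed
  show ?thesis using A unfolding B .
qed

text \<open>The limit is taken only along the positive steps 1/(n+1): the variations used later are
  admissible in one direction only, and they enter through an inequality.\<close>

lemma first_variation:
  fixes j :: 3
  assumes F: "sobolev F G" and \<psi>: "sobolev \<psi> \<psi>'"
  defines "\<Psi> \<equiv> \<lambda>x. axis j (\<psi> x)" and "\<Psi>' \<equiv> \<lambda>x. axis j (\<psi>' x)"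
  shows "integrable lborel (\<lambda>x. NL (F x) j \<bullet> \<psi> x)"
    and "(\<lambda>n. (en (\<lambda>x. F x + (1 / real (Suc n)) *\<^sub>R \<Psi> x) (\<lambda>x. G x + (1 / real (Suc n)) *\<^sub>R \<Psi>' x) - en F G) * real (Suc n))
      \<longlonglongrightarrow> 2 * ((LINT x|lborel. G x $ j \<bullet> \<psi>' x) - (LINT x|lborel. NL (F x) j \<bullet> \<psi> x))"
proof -
  define e where "e n = 1 / real (Suc n)" for n
  have e: "0 < e n" "e n \<le> 1" for n by (auto simp: e_def)
  have e_lim: "e \<longlonglongrightarrow> 0" unfolding e_def by (rule LIMSEQ_Suc[OF lim_1_over_n])
  have \<Psi>: "sobolev \<Psi> \<Psi>'" unfolding \<Psi>_def \<Psi>'_def by (rule sobolev_linear[OF \<psi> linear_axis])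
  have s: "sobolev (\<lambda>x. F x + e n *\<^sub>R \<Psi> x) (\<lambda>x. G x + e n *\<^sub>R \<Psi>' x)" for n
    by (intro sobolev_add sobolev_cmult F \<Psi>)
  note [measurable] = square_integrable_measurable[OF sobolevD(1)[OF F]] square_integrable_measurable[OF sobolevD(1)[OF \<Psi>]]
    square_integrable_measurable[OF sobolevD(1)[OF \<psi>]]
  have [measurable]: "(\<lambda>x. NL (F x) j) \<in> borel_measurable borel"
    by (rule measurable_compose[OF square_integrable_measurable[OF sobolevD(1)[OF F]]
          borel_measurable_continuous_onI[OF continuous_at_imp_continuous_on]]) (use continuous_NL in auto)
  define S where "S = (sqrt (l2sq F) + sqrt (l2sq G)) + (sqrt (l2sq \<Psi>) + sqrt (l2sq \<Psi>'))"
  have SF: "norm (F x) \<le> S" for x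
    using sobolev_bounded[OF F, of x] l2sq_nonneg[of \<Psi>] l2sq_nonneg[of \<Psi>'] by (simp add: S_def add_increasing2)
  have Se: "norm (F x + e n *\<^sub>R \<Psi> x) \<le> S" "norm (F x + e n *\<^sub>R \<Psi> x) \<le> norm (F x) + norm (\<Psi> x)" for n x
  proof -
    have "norm (F x + e n *\<^sub>R \<Psi> x) \<le> norm (F x) + e n * norm (\<Psi> x)"
      using norm_triangle_ineq[of "F x" "e n *\<^sub>R \<Psi> x"] e[of n] by simp
    also have "e n * norm (\<Psi> x) \<le> 1 * norm (\<Psi> x)" using e[of n] by (intro mult_right_mono) auto
    finally show "norm (F x + e n *\<^sub>R \<Psi> x) \<le> norm (F x) + norm (\<Psi> x)" by simp
    then show "norm (F x + e n *\<^sub>R \<Psi> x) \<le> S"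
      using sobolev_bounded[OF F, of x] sobolev_bounded[OF \<Psi>, of x] unfolding S_def by linarith
  qed
  define q where "q n x = (W (F x + e n *\<^sub>R \<Psi> x) - W (F x)) / e n" for n x
  \<comment> \<open>A majorant of the difference quotients of the interaction that does not depend
    on \<open>n\<close>, from the quadratic Lipschitz bound and \<open>e n \<le> 1\<close>.\<close>
  define D where "D x = K S * (2 * (norm (F x) * norm (\<Psi> x)) + norm (\<Psi> x) * norm (\<Psi> x))" for x
  have Dint: "integrable lborel D"
    unfolding D_def
    using square_integrable_norm_mult[OF sobolevD(1)[OF F] sobolevD(1)[OF \<Psi>]]
      square_integrable_norm_mult[OF sobolevD(1)[OF \<Psi>] sobolevD(1)[OF \<Psi>]] by simp
  have qD: "norm (q n x) \<le> D x" for n x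
  proof -
    have "\<bar>W (F x + e n *\<^sub>R \<Psi> x) - W (F x)\<bar> \<le> K S * ((norm (F x + e n *\<^sub>R \<Psi> x) + norm (F x)) * norm (F x + e n *\<^sub>R \<Psi> x - F x))"
      by (rule W_Lipschitz[OF Se(1) SF])
    also have "\<dots> \<le> K S * ((norm (F x) + norm (\<Psi> x) + norm (F x)) * (e n * norm (\<Psi> x)))"
      using Se(2)[of x n] e[of n] K_nonneg by (intro mult_left_mono mult_mono) auto
    also have "\<dots> = D x * e n" by (simp add: D_def algebra_simps)
    finally show ?thesis using e(1)[of n] by (simp add: q_def pos_divide_le_eq)
  qed
  have NLj: "(\<Sum>i\<in>UNIV. NL (F x) i \<bullet> \<Psi> x $ i) = NL (F x) j \<bullet> \<psi> x" for x
  proof -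
    have "NL (F x) i \<bullet> \<Psi> x $ i = (if i = j then NL (F x) j \<bullet> \<psi> x else 0)" for i
      by (simp add: \<Psi>_def axis_def)
    then show ?thesis by simp
  qed
  have qlim: "(\<lambda>n. q n x) \<longlonglongrightarrow> 2 * (NL (F x) j \<bullet> \<psi> x)" for x
  proof -
    have d: "((\<lambda>h. (W (F x + h *\<^sub>R \<Psi> x) - W (F x + 0 *\<^sub>R \<Psi> x)) / (h - 0)) \<longlongrightarrow> 2 * (NL (F x) j \<bullet> \<psi> x)) (at 0)"
      using has_real_derivative_W[of "F x" "\<Psi> x"] unfolding has_field_derivative_iff NLj by simp
    have f: "filterlim e (at 0) sequentially"
      unfolding filterlim_at using e e_lim by (auto simp: less_imp_neq[OF e(1), symmetric])
    from filterlim_compose[OF d f] show ?thesis by (simp add: q_def)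
  qed
  have qm: "q n \<in> borel_measurable lborel" for n unfolding q_def by measurable
  have lm: "(\<lambda>x. 2 * (NL (F x) j \<bullet> \<psi> x)) \<in> borel_measurable lborel" by measurable
  have "integrable lborel (\<lambda>x. 2 * (NL (F x) j \<bullet> \<psi> x))"
    by (rule integrable_dominated_convergence[OF lm qm Dint AE_I2[OF qlim] AE_I2[OF qD]])
  then show int: "integrable lborel (\<lambda>x. NL (F x) j \<bullet> \<psi> x)" by simp
  have ql: "(\<lambda>n. LINT x|lborel. q n x) \<longlonglongrightarrow> (LINT x|lborel. 2 * (NL (F x) j \<bullet> \<psi> x))"
    by (rule Bochner_Integration.integral_dominated_convergence[OF lm qm Dint AE_I2[OF qlim] AE_I2[OF qD]])
  have GPsi: "(LINT x|lborel. G x \<bullet> \<Psi>' x) = (LINT x|lborel. G x $ j \<bullet> \<psi>' x)"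
    unfolding \<Psi>'_def by (simp add: inner_axis)
  have "(en (\<lambda>x. F x + e n *\<^sub>R \<Psi> x) (\<lambda>x. G x + e n *\<^sub>R \<Psi>' x) - en F G) / e n
     = 2 * (LINT x|lborel. G x $ j \<bullet> \<psi>' x) + e n * l2sq \<Psi>' - (LINT x|lborel. q n x)" for n
  proof -
    have "l2sq (\<lambda>x. G x + e n *\<^sub>R \<Psi>' x) = l2sq G + 2 * (LINT x|lborel. G x \<bullet> (e n *\<^sub>R \<Psi>' x)) + (e n)\<^sup>2 * l2sq \<Psi>'"
      unfolding square_integrable_add(2)[OF sobolevD(2)[OF F] square_integrable_cmult[OF sobolevD(2)[OF \<Psi>]]] l2sq_cmult ..
    also have "(LINT x|lborel. G x \<bullet> (e n *\<^sub>R \<Psi>' x)) = e n * (LINT x|lborel. G x $ j \<bullet> \<psi>' x)"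
      by (simp add: GPsi)
    finally have 1: "l2sq (\<lambda>x. G x + e n *\<^sub>R \<Psi>' x) = l2sq G + 2 * (e n * (LINT x|lborel. G x $ j \<bullet> \<psi>' x)) + (e n)\<^sup>2 * l2sq \<Psi>'" .
    have "(LINT x|lborel. q n x) = ((LINT x|lborel. W (F x + e n *\<^sub>R \<Psi> x)) - (LINT x|lborel. W (F x))) / e n"
      unfolding q_def using sobolev_integrable_W[OF s[of n]] sobolev_integrable_W[OF F] by simp
    then show ?thesis unfolding en_def 1 using e(1)[of n] by (simp add: field_simps power2_eq_square)
  qed
  moreover have "(\<lambda>n. 2 * (LINT x|lborel. G x $ j \<bullet> \<psi>' x) + e n * l2sq \<Psi>' - (LINT x|lborel. q n x)) \<longlonglongrightarrow>
     2 * (LINT x|lborel. G x $ j \<bullet> \<psi>' x) + 0 * l2sq \<Psi>' - (LINT x|lborel. 2 * (NL (F x) j \<bullet> \<psi> x))"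
    by (intro tendsto_intros e_lim ql)
  ultimately have "(\<lambda>n. (en (\<lambda>x. F x + e n *\<^sub>R \<Psi> x) (\<lambda>x. G x + e n *\<^sub>R \<Psi>' x) - en F G) / e n) \<longlonglongrightarrow>
     2 * (LINT x|lborel. G x $ j \<bullet> \<psi>' x) + 0 * l2sq \<Psi>' - (LINT x|lborel. 2 * (NL (F x) j \<bullet> \<psi> x))"
    by simp
  then show "(\<lambda>n. (en (\<lambda>x. F x + (1 / real (Suc n)) *\<^sub>R \<Psi> x) (\<lambda>x. G x + (1 / real (Suc n)) *\<^sub>R \<Psi>' x) - en F G) * real (Suc n))
      \<longlonglongrightarrow> 2 * ((LINT x|lborel. G x $ j \<bullet> \<psi>' x) - (LINT x|lborel. NL (F x) j \<bullet> \<psi> x))"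
    by (simp add: e_def right_diff_distrib)
qed

end

section \<open>Euler--Lagrange equations and frequencies of minimizers\<close>

lemma is_primitive_has_vector_derivative:
  fixes P :: "real \<Rightarrow> 'e::euclidean_space"
  assumes P: "is_primitive P g" and g: "continuous_on UNIV g"
  shows "(P has_vector_derivative g x) (at x)"
proof -
  have eq: "P (x - 1) + integral {x - 1..y} g = P y" if "y \<in> {x - 1<..<x + 1}" for y
    using is_primitiveD(2)[OF P, of "x - 1" y] set_borel_integral_eq_integral(2)[OF is_primitiveD(1)[OF P], of "x - 1" y] that
    by (simp add: algebra_simps)
  have "((\<lambda>y. integral {x - 1..y} g) has_vector_derivative g x) (at x within {x - 1..x + 1})"
    by (rule integral_has_vector_derivative[OF continuous_on_subset[OF g]]) auto
  then have "((\<lambda>y. integral {x - 1..y} g) has_vector_derivative g x) (at x)"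
    by (simp add: at_within_Icc_at)
  then have "((\<lambda>y. P (x - 1) + integral {x - 1..y} g) has_vector_derivative g x) (at x)"
    using has_vector_derivative_add[OF has_vector_derivative_const[of "P (x - 1)"]] by fastforce
  then show ?thesis
    by (rule has_vector_derivative_transform_within_open[of _ _ _ "{x - 1<..<x + 1}"]) (use eq in auto)
qed

lemma is_primitive_cong_AE:
  assumes P: "is_primitive P g" and g': "g' \<in> borel_measurable borel" and eq: "AE x in lborel. g x = g' x"
  shows "is_primitive P g'"
proof -
  have i: "set_integrable lborel {a..b} g'" "(LINT x:{a..b}|lborel. g' x) = (LINT x:{a..b}|lborel. g x)" for a b :: real
  proof -
    have ae: "AE x in lborel. indicator {a..b} x *\<^sub>R g x = indicator {a..b} x *\<^sub>R g' x"
      by (rule eventually_mono[OF eq]) simp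
    have m: "(\<lambda>x. indicator {a..b} x *\<^sub>R g' x) \<in> borel_measurable lborel" using g' by simp
    note ig = is_primitiveD(1)[OF P, of a b, unfolded set_integrable_def]
    show "set_integrable lborel {a..b} g'"
      unfolding set_integrable_def by (rule integrable_cong_AE_imp[OF ig m ae])
    show "(LINT x:{a..b}|lborel. g' x) = (LINT x:{a..b}|lborel. g x)"
      unfolding set_lebesgue_integral_def
      by (rule integral_cong_AE[OF m borel_measurable_integrable[OF ig] eventually_mono[OF ae]]) (erule sym)
  qed
  show ?thesis using is_primitiveD(2)[OF P] i by (simp add: is_primitive_def)
qed

context coupled_nls
begin

definition minimal :: "(3 \<Rightarrow> real) \<Rightarrow> (real \<Rightarrow> complex ^ 3) \<Rightarrow> (real \<Rightarrow> complex ^ 3) \<Rightarrow> bool" where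
  "minimal m F G \<longleftrightarrow> sobolev F G \<and> (\<forall>j. l2sq (\<lambda>x. F x $ j) = m j) \<and>
    (\<forall>F' G'. sobolev F' G' \<longrightarrow> (\<forall>j. l2sq (\<lambda>x. F' x $ j) = m j) \<longrightarrow> en F G \<le> en F' G')"

lemma energy_ge_if_mass_le:
  assumes lower: "\<And>F G. sobolev F G \<Longrightarrow> (\<And>j. l2sq (\<lambda>x. F x $ j) = m j) \<Longrightarrow> lam \<le> en F G"
    and FG: "sobolev F G" and le: "\<And>j. l2sq (\<lambda>x. F x $ j) \<le> m j"
  shows "lam \<le> en F G"
proof (cases "\<forall>j. l2sq (\<lambda>x. F x $ j) = m j")
  case True
  then show ?thesis using lower[OF FG] by blast
next
  case False
  then obtain i where i: "l2sq (\<lambda>x. F x $ i) \<noteq> m i" by blast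
  define \<mu> where "\<mu> j = m j - l2sq (\<lambda>x. F x $ j)" for j
  have \<mu>: "0 \<le> \<mu> j" "0 < \<mu> i" for j using le[of j] le[of i] i by (auto simp: \<mu>_def)
  obtain H h where H: "sobolev H h" "\<And>j. l2sq (\<lambda>x. H x $ j) = \<mu> j" "en H h < 0"
    using negative_energy[of \<mu> i, OF \<mu>] by blast
  obtain M where M: "sobolev (\<lambda>x. combine (F x) (H x)) M"
    "en (\<lambda>x. combine (F x) (H x)) M \<le> en F G + en H h - gain * (LINT x|lborel. norm (F x) powr p * norm (H x) powr p)"
    using energy_combine[OF FG H(1)] by blast
  have "l2sq (\<lambda>x. combine (F x) (H x) $ j) = m j" for j
    unfolding l2sq_combine[OF sobolevD(1)[OF FG] sobolevD(1)[OF H(1)]] H(2) by (simp add: \<mu>_def)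
  from lower[OF M(1) this] have "lam \<le> en (\<lambda>x. combine (F x) (H x)) M" .
  moreover have "0 \<le> gain * (LINT x|lborel. norm (F x) powr p * norm (H x) powr p)"
    using gain(1) by (intro mult_nonneg_nonneg Bochner_Integration.integral_nonneg) auto
  ultimately show ?thesis using M(2) H(3) by linarith
qed

text \<open>The value forced by testing the \<open>j\<close>-th equation with \<open>F\<close> in
  that component: the kinetic energy plus the frequency times the mass equals the interaction
  sum.\<close>

definition frequency :: "(3 \<Rightarrow> real) \<Rightarrow> (real \<Rightarrow> complex ^ 3) \<Rightarrow> (real \<Rightarrow> complex ^ 3) \<Rightarrow> 3 \<Rightarrow> real" where
  "frequency m F G j = ((\<Sum>k\<in>UNIV. a k j * N F k j) - l2sq (\<lambda>x. G x $ j)) / m j"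

text \<open>Since smaller masses never have less energy, any variation that lowers the \<open>j\<close>-th mass is admissible,
  and no competitor has to be renormalized. Subtracting slightly more than the component of
  \<open>\<eta>\<close> along the minimizer gives such a variation.\<close>

lemma Euler_Lagrange:
  assumes min: "minimal m F G" and m: "\<And>j. 0 < m j"
  shows "0 \<le> frequency m F G j"
    and "sobolev \<eta> \<eta>' \<Longrightarrow> (LINT x|lborel. G x $ j \<bullet> \<eta>' x) + frequency m F G j * (LINT x|lborel. F x $ j \<bullet> \<eta> x)
      = (LINT x|lborel. NL (F x) j \<bullet> \<eta> x)"
    and "sobolev \<eta> \<eta>' \<Longrightarrow> integrable lborel (\<lambda>x. NL (F x) j \<bullet> \<eta> x)"
proof -
  have FG: "sobolev F G" and mass: "\<And>j. l2sq (\<lambda>x. F x $ j) = m j"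
    and lower: "\<And>F' G'. sobolev F' G' \<Longrightarrow> (\<And>j. l2sq (\<lambda>x. F' x $ j) = m j) \<Longrightarrow> en F G \<le> en F' G'"
    using min by (auto simp: minimal_def)
  note Fj = sobolev_nth[OF FG, of j]
  define L where "L \<eta> \<eta>' = (LINT x|lborel. G x $ j \<bullet> \<eta>' x) - (LINT x|lborel. NL (F x) j \<bullet> \<eta> x)" for \<eta> \<eta>'
  define b where "b \<eta> = (LINT x|lborel. F x $ j \<bullet> \<eta> x)" for \<eta>
  have NLint: "integrable lborel (\<lambda>x. NL (F x) j \<bullet> \<eta> x)" if "sobolev \<eta> \<eta>'" for \<eta> \<eta>'
    by (rule first_variation(1)[OF FG that])
  then show "sobolev \<eta> \<eta>' \<Longrightarrow> integrable lborel (\<lambda>x. NL (F x) j \<bullet> \<eta> x)" .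
  have Llin: "L (\<lambda>x. \<eta> x - s *\<^sub>R F x $ j) (\<lambda>x. \<eta>' x - s *\<^sub>R G x $ j) = L \<eta> \<eta>' - s * L (\<lambda>x. F x $ j) (\<lambda>x. G x $ j)"
    if \<eta>: "sobolev \<eta> \<eta>'" for \<eta> \<eta>' s
  proof -
    have 1: "(LINT x|lborel. G x $ j \<bullet> (\<eta>' x - s *\<^sub>R G x $ j)) = (LINT x|lborel. G x $ j \<bullet> \<eta>' x) - s * (LINT x|lborel. G x $ j \<bullet> G x $ j)"
      unfolding inner_diff_right inner_scaleR_right
      using square_integrable_inner[OF sobolevD(2)[OF Fj] sobolevD(2)[OF \<eta>]] square_integrable_inner[OF sobolevD(2)[OF Fj] sobolevD(2)[OF Fj]]
      by simp
    have 2: "(LINT x|lborel. NL (F x) j \<bullet> (\<eta> x - s *\<^sub>R F x $ j)) = (LINT x|lborel. NL (F x) j \<bullet> \<eta> x) - s * (LINT x|lborel. NL (F x) j \<bullet> F x $ j)"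
      unfolding inner_diff_right inner_scaleR_right using NLint[OF \<eta>] NLint[OF Fj] by simp
    show ?thesis unfolding L_def 1 2 by (simp add: algebra_simps)
  qed
  have admissible: "0 \<le> L \<psi> \<psi>'" if \<psi>: "sobolev \<psi> \<psi>'" and neg: "b \<psi> < 0" for \<psi> \<psi>'
  proof -
    note fv = first_variation(2)[OF FG \<psi>, of j]
    have "(\<lambda>n. 1 / real (Suc n) * l2sq \<psi>) \<longlonglongrightarrow> 0 * l2sq \<psi>"
      by (intro tendsto_intros LIMSEQ_Suc[OF lim_1_over_n])
    then have "(\<lambda>n. 1 / real (Suc n) * l2sq \<psi>) \<longlonglongrightarrow> 0" by simp
    \<comment> \<open>The first order change \<open>2 * b \<psi>\<close> of the mass is negative;
      for small steps it outweighs the quadratic term, so the mass decreases.\<close>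
    then have "\<forall>\<^sub>F n in sequentially. 1 / real (Suc n) * l2sq \<psi> < - 2 * b \<psi>"
      by (rule order_tendstoD(2)) (use neg in simp)
    then have "\<forall>\<^sub>F n in sequentially. 0 \<le> (en (\<lambda>x. F x + (1 / real (Suc n)) *\<^sub>R axis j (\<psi> x)) (\<lambda>x. G x + (1 / real (Suc n)) *\<^sub>R axis j (\<psi>' x)) - en F G) * real (Suc n)"
    proof eventually_elim
      case (elim n)
      define e where "e = 1 / real (Suc n)"
      have e: "0 < e" by (simp add: e_def)
      have s: "sobolev (\<lambda>x. F x + e *\<^sub>R axis j (\<psi> x)) (\<lambda>x. G x + e *\<^sub>R axis j (\<psi>' x))"
        by (intro sobolev_add sobolev_cmult FG sobolev_linear[OF \<psi> linear_axis])
      have "l2sq (\<lambda>x. (F x + e *\<^sub>R axis j (\<psi> x)) $ i) \<le> m i" for i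
      proof (cases "i = j")
        case False
        then show ?thesis using mass[of i] by (simp add: axis_def)
      next
        case True
        have "l2sq (\<lambda>x. F x $ j + e *\<^sub>R \<psi> x) = m j + 2 * (e * b \<psi>) + e\<^sup>2 * l2sq \<psi>"
          unfolding square_integrable_add(2)[OF sobolevD(1)[OF Fj] square_integrable_cmult[OF sobolevD(1)[OF \<psi>]]] l2sq_cmult mass
          by (simp add: b_def)
        also have "\<dots> = m j + e * (2 * b \<psi> + e * l2sq \<psi>)" by (simp add: power2_eq_square algebra_simps)
        also have "\<dots> \<le> m j" using e elim unfolding e_def[symmetric] by (simp add: mult_le_0_iff)
        finally show ?thesis using True by simp
      qed
      from energy_ge_if_mass_le[OF lower s this] have "en F G \<le> en (\<lambda>x. F x + e *\<^sub>R axis j (\<psi> x)) (\<lambda>x. G x + e *\<^sub>R axis j (\<psi>' x))" .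
      then show ?case unfolding e_def by simp
    qed
    then have "0 \<le> 2 * L \<psi> \<psi>'"
      unfolding L_def by (intro tendsto_lowerbound[OF fv]) auto
    then show ?thesis by simp
  qed
  have bF: "b (\<lambda>x. F x $ j) = m j" unfolding b_def mass[of j, symmetric] by (simp add: l2sq_def power2_norm_eq_inner)
  define l where "l = L (\<lambda>x. F x $ j) (\<lambda>x. G x $ j)"
  have half: "b \<eta> / m j * l \<le> L \<eta> \<eta>'" if \<eta>: "sobolev \<eta> \<eta>'" for \<eta> \<eta>'
  proof -
    have adm: "0 \<le> L \<eta> \<eta>' - (b \<eta> / m j + 1 / real (Suc n)) * l" for n
    proof -
      define s where "s = b \<eta> / m j + 1 / real (Suc n)"
      have "b (\<lambda>x. \<eta> x - s *\<^sub>R F x $ j) = b \<eta> - s * m j"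
        unfolding bF[symmetric] unfolding b_def inner_diff_right inner_scaleR_right
        using square_integrable_inner[OF sobolevD(1)[OF Fj] sobolevD(1)[OF \<eta>]] square_integrable_inner[OF sobolevD(1)[OF Fj] sobolevD(1)[OF Fj]]
        by simp
      also have "\<dots> < 0" using m[of j] by (simp add: s_def distrib_right)
      finally have neg: "b (\<lambda>x. \<eta> x - s *\<^sub>R F x $ j) < 0" .
      from admissible[OF sobolev_diff[OF \<eta> sobolev_cmult[OF Fj]] neg] show ?thesis
        unfolding Llin[OF \<eta>] l_def[symmetric] s_def .
    qed
    have "(\<lambda>n. L \<eta> \<eta>' - (b \<eta> / m j + 1 / real (Suc n)) * l) \<longlonglongrightarrow> L \<eta> \<eta>' - (b \<eta> / m j + 0) * l"
      by (intro tendsto_intros LIMSEQ_Suc[OF lim_1_over_n])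
    from LIMSEQ_le_const[OF this, of 0] adm show ?thesis by auto
  qed
  have lval: "l = l2sq (\<lambda>x. G x $ j) - (\<Sum>k\<in>UNIV. a k j * N F k j)"
  proof -
    have "(LINT x|lborel. NL (F x) j \<bullet> F x $ j) = (\<Sum>k\<in>UNIV. a k j * N F k j)"
      unfolding NL_inner_self N_def
      using N_integrable(1)[OF sobolevD(1)[OF FG] sobolev_bounded[OF FG]]
      by (subst Bochner_Integration.integral_sum) auto
    then show ?thesis by (simp add: l_def L_def l2sq_def power2_norm_eq_inner)
  qed
  then have freq: "frequency m F G j = - l / m j" by (simp add: frequency_def)
  \<comment> \<open>Shrinking the component itself lowers its mass; this admissible variation fixes
    the sign of the frequency.\<close>
  have "0 \<le> L (\<lambda>x. - 1 *\<^sub>R F x $ j) (\<lambda>x. - 1 *\<^sub>R G x $ j)"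
    by (rule admissible[OF sobolev_cmult[OF Fj]]) (use bF m[of j] in \<open>simp add: b_def\<close>)
  then have "l \<le> 0" by (simp add: l_def L_def)
  then show "0 \<le> frequency m F G j" unfolding freq using m[of j] by (simp add: divide_nonpos_pos)
  show "(LINT x|lborel. G x $ j \<bullet> \<eta>' x) + frequency m F G j * (LINT x|lborel. F x $ j \<bullet> \<eta> x)
      = (LINT x|lborel. NL (F x) j \<bullet> \<eta> x)" if \<eta>: "sobolev \<eta> \<eta>'"
  proof -
    have "b \<eta> / m j * l \<le> L \<eta> \<eta>'" by (rule half[OF \<eta>])
    \<comment> \<open>The same inequality for \<open>- \<eta>\<close> is the reverse one, so
      equality holds.\<close>
    moreover have "b (\<lambda>x. - 1 *\<^sub>R \<eta> x) / m j * l \<le> L (\<lambda>x. - 1 *\<^sub>R \<eta> x) (\<lambda>x. - 1 *\<^sub>R \<eta>' x)" by (rule half[OF sobolev_cmult[OF \<eta>]])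
    ultimately have "L \<eta> \<eta>' = b \<eta> / m j * l" by (simp add: b_def L_def)
    then show ?thesis unfolding freq by (simp add: L_def b_def algebra_simps)
  qed
qed

text \<open>With zero frequency the modulus of the component would have a nonpositive second
  derivative, hence be concave on the whole line, which a nonzero square integrable function cannot
  be. The quantitative form: a bump dilated by \<open>\<theta>\<close> has derivative norm of order
  sqrt \<theta>, while its pairing with the nonlinearity stays above a fixed positive
  number.\<close>

lemma frequency_pos:
  assumes min: "minimal m F G" and m: "\<And>j. 0 < m j"
  shows "0 < frequency m F G j"
proof -
  have FG: "sobolev F G" and mass: "\<And>j. l2sq (\<lambda>x. F x $ j) = m j"
    and lower: "\<And>F' G'. sobolev F' G' \<Longrightarrow> (\<And>j. l2sq (\<lambda>x. F' x $ j) = m j) \<Longrightarrow> en F G \<le> en F' G'"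
    using min by (auto simp: minimal_def)
  \<comment> \<open>Combining with zero gives the componentwise modulus. A minimizer may have
    complex values, and only for the modulus does the nonlinearity have a sign.\<close>
  define R where "R x = combine (F x) 0" for x
  have Rj: "R x $ j = of_real (norm (F x $ j))" for x j by (simp add: R_def combine_def norm_Pair)
  obtain M where M: "sobolev R M" "\<And>j. l2sq (\<lambda>x. M x $ j) \<le> l2sq (\<lambda>x. G x $ j)"
    using sobolev_combine[OF FG sobolev_zero] unfolding R_def by (auto simp: l2sq_def)
  have NR: "N R k j = N F k j" for k j by (simp add: N_def Rj)
  have massR: "l2sq (\<lambda>x. R x $ j) = m j" for j using mass[of j] by (simp add: l2sq_def Rj)
  have "en F G \<le> en R M" by (rule lower[OF M(1) massR])
  then have "(\<Sum>j\<in>UNIV. l2sq (\<lambda>x. G x $ j)) \<le> (\<Sum>j\<in>UNIV. l2sq (\<lambda>x. M x $ j))"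
    unfolding en_eq[OF FG] en_eq[OF M(1)] NR by simp
  then have "(\<Sum>j\<in>UNIV. l2sq (\<lambda>x. M x $ j)) = (\<Sum>j\<in>UNIV. l2sq (\<lambda>x. G x $ j))"
    using sum_mono[of UNIV "\<lambda>j. l2sq (\<lambda>x. M x $ j)" "\<lambda>j. l2sq (\<lambda>x. G x $ j)"] M(2) by (auto intro: antisym)
  \<comment> \<open>No component of the modulus has more kinetic energy, and minimality makes the
    totals equal, so the components agree; this is why the frequencies do not change.\<close>
  then have kin: "l2sq (\<lambda>x. M x $ j) = l2sq (\<lambda>x. G x $ j)" for j
    by (rule sum_mono_inv[of _ UNIV _ j]) (use M(2) in auto)
  have enR: "en R M = en F G" unfolding en_eq[OF FG] en_eq[OF M(1)] NR kin ..
  have minR: "minimal m R M" using M(1) massR lower unfolding minimal_def enR by blast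
  have freq: "frequency m R M j = frequency m F G j" by (simp add: frequency_def NR kin)
  show ?thesis
  proof (rule ccontr)
    assume "\<not> ?thesis"
    then have zero: "frequency m R M j = 0" using Euler_Lagrange(1)[OF minR m, of j] freq by simp
    define C where "C x = (\<Sum>k\<in>UNIV. a k j * norm (R x $ k) powr p) * norm (F x $ j) powr (p - 2) * norm (F x $ j)" for x
    have NLC: "NL (R x) j = of_real (C x)" for x
      by (simp add: nonlinearity_def C_def Rj scaleR_conv_of_real)
    have C0: "0 \<le> C x" for x unfolding C_def using less_imp_le[OF a_pos] by (intro mult_nonneg_nonneg sum_nonneg) auto
    have contC: "isCont C x" for x
    proof -
      have "isCont (\<lambda>x. Re (NL (R x) j)) x"
        by (rule isCont_Re[OF isCont_o2[OF sobolev_isCont[OF M(1)] continuous_NL]])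
      then show ?thesis by (simp add: NLC)
    qed
    obtain x0 where x0: "F x0 $ j \<noteq> 0"
    proof (rule ccontr)
      assume "\<not> thesis"
      with that have "F x $ j = 0" for x by blast
      then have "l2sq (\<lambda>x. F x $ j) = 0" by (simp add: l2sq_def)
      with mass[of j] m[of j] show False by simp
    qed
    have "0 < C x0"
    proof -
      have "0 < a j j * norm (R x0 $ j) powr p" using x0 a_pos by (simp add: Rj)
      also have "\<dots> \<le> (\<Sum>k\<in>UNIV. a k j * norm (R x0 $ k) powr p)"
        by (rule member_le_sum[of j UNIV "\<lambda>k. a k j * norm (R x0 $ k) powr p"]) (use less_imp_le[OF a_pos] in auto)
      finally show ?thesis unfolding C_def using x0 by simp
    qed
    then have "\<forall>\<^sub>F x in at x0. C x0 / 2 < C x"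
      by (intro order_tendstoD(1)[OF contC[unfolded isCont_def]]) simp
    then obtain d0 where d0: "0 < d0" "\<And>x. x \<noteq> x0 \<Longrightarrow> dist x x0 < d0 \<Longrightarrow> C x0 / 2 < C x"
      unfolding eventually_at by blast
    \<comment> \<open>The cap 1/4 keeps the dilated argument within 1/4 of the centre of the bump,
      since \<open>\<theta>\<close> is at most 1.\<close>
    define d where "d = min (d0 / 2) (1/4)"
    have d: "0 < d" "d < d0" "d \<le> 1/4" using d0(1) by (auto simp: d_def)
    have Cd: "C x0 / 2 \<le> C x" if "\<bar>x - x0\<bar> \<le> d" for x
      using d0(2)[of x] that d \<open>0 < C x0\<close> by (cases "x = x0") (auto simp: dist_real_def intro: less_imp_le)
    define q where "q = bump_family 0 1 1 1 0"
    have tq: "test_function q" unfolding q_def by (rule bump_test_function) auto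
    define q' where "q' = dir_deriv 1 q"
    have sq: "sobolev q q'" unfolding q'_def by (rule test_function_sobolev[OF tq])
    \<comment> \<open>The value of the bump at distance 1/4 from its centre, where y(1 - y) =
      3/16.\<close>
    define q0 where "q0 = exp (- 16 / 3 :: real)"
    have q_nonneg: "0 \<le> q y" for y by (simp add: q_def bump_family_def)
    have q_ge: "q0 \<le> q y" if "\<bar>y - 1/2\<bar> \<le> 1/4" for y
    proof -
      have y: "1/4 \<le> y" "y \<le> 3/4" using that by linarith+
      have "0 \<le> (y - 1/4) * (3/4 - y)" using y by (intro mult_nonneg_nonneg) auto
      moreover have "(y - 1/4) * (3/4 - y) = y * (1 - y) - 3 / 16" by (simp add: field_simps)
      ultimately have "3 / 16 \<le> y * (1 - y)" by simp
      then have "1 / (y * (1 - y)) \<le> 1 / (3 / 16)" by (intro divide_left_mono) auto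
      then show ?thesis using y by (simp add: q_def q0_def bump_family_def)
    qed
    define \<gamma> where "\<gamma> = 2 * d * (C x0 / 2 * q0)"
    have \<gamma>: "0 < \<gamma>" using d \<open>0 < C x0\<close> by (simp add: \<gamma>_def q0_def)
    define A where "A = l2sq (\<lambda>x. M x $ j) * l2sq q'"
    have A: "0 \<le> A" by (simp add: A_def)
    \<comment> \<open>Testing gives \<gamma>^2 <= \<theta> A; this choice makes the right side
      smaller than \<gamma>^2.\<close>
    define \<theta> where "\<theta> = min 1 (\<gamma>\<^sup>2 / (A + 1))"
    have \<theta>: "0 < \<theta>" "\<theta> \<le> 1" "\<theta> \<le> \<gamma>\<^sup>2 / (A + 1)" using \<gamma> A by (auto simp: \<theta>_def)
    \<comment> \<open>Centres the dilated bump at \<open>x0\<close>, that is,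
      \<open>\<theta> * (x0 + c) = 1/2\<close>.\<close>
    define c where "c = 1 / (2 * \<theta>) - x0"
    define \<eta> where "\<eta> x = complex_of_real (q (\<theta> * (x + c)))" for x
    define \<eta>' where "\<eta>' x = complex_of_real (\<theta> * q' (\<theta> * (x + c)))" for x
    have arg: "\<theta> * (x + c) = \<theta> * (x - x0) + 1/2" for x
      using \<theta>(1) by (simp add: c_def algebra_simps)
    have s\<eta>: "sobolev \<eta> \<eta>'"
      using sobolev_linear[OF sobolev_translate[OF sobolev_dilate[OF sq \<theta>(1)], of c] linear_of_real]
      unfolding \<eta>_def \<eta>'_def by simp
    have l\<eta>': "l2sq \<eta>' = \<theta> * l2sq q'"
    proof -
      have "l2sq \<eta>' = l2sq (\<lambda>x. \<theta> *\<^sub>R q' (\<theta> * (x + c)))" by (simp add: l2sq_def \<eta>'_def norm_mult power_mult_distrib)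
      also have "\<dots> = \<theta>\<^sup>2 * l2sq (\<lambda>x. q' (\<theta> * x))"
        unfolding l2sq_cmult using l2sq_translate[of "\<lambda>x. q' (\<theta> * x)" c] by simp
      finally show ?thesis unfolding l2sq_dilate[OF \<theta>(1)] using \<theta>(1) by (simp add: power2_eq_square)
    qed
    have EL: "(LINT x|lborel. M x $ j \<bullet> \<eta>' x) = (LINT x|lborel. NL (R x) j \<bullet> \<eta> x)"
      using Euler_Lagrange(2)[OF minR m s\<eta>, of j] zero by simp
    have inner: "NL (R x) j \<bullet> \<eta> x = C x * q (\<theta> * (x + c))" for x
      by (simp add: NLC \<eta>_def inner_complex_def)
    have "\<gamma> = (LINT x|lborel. indicator {x0 - d..x0 + d} x * (C x0 / 2 * q0))"
      using d(1) by (simp add: \<gamma>_def measure_def)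
    also have "\<dots> \<le> (LINT x|lborel. NL (R x) j \<bullet> \<eta> x)"
    proof (rule integral_mono[OF _ Euler_Lagrange(3)[OF minR m s\<eta>]])
      show "integrable lborel (\<lambda>x. indicator {x0 - d..x0 + d} x * (C x0 / 2 * q0))"
        by (intro integrable_mult_left integrable_real_indicator) (auto simp: emeasure_lborel_Icc_eq)
      fix x :: real
      show "indicator {x0 - d..x0 + d} x * (C x0 / 2 * q0) \<le> NL (R x) j \<bullet> \<eta> x"
      proof (cases "x \<in> {x0 - d..x0 + d}")
        case True
        then have xd: "\<bar>x - x0\<bar> \<le> d" by (auto simp: abs_le_iff)
        have "\<bar>\<theta> * (x + c) - 1/2\<bar> = \<theta> * \<bar>x - x0\<bar>" unfolding arg using \<theta>(1) by (simp add: abs_mult)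
        also have "\<dots> \<le> 1 * d" using xd \<theta> by (intro mult_mono) auto
        finally have "q0 \<le> q (\<theta> * (x + c))" using d by (intro q_ge) simp
        then have "C x0 / 2 * q0 \<le> C x * q (\<theta> * (x + c))"
          using Cd[OF xd] C0[of x] by (intro mult_mono) (auto simp: q0_def)
        then show ?thesis using True unfolding inner by simp
      next
        case False
        then show ?thesis unfolding inner using C0[of x] q_nonneg by simp
      qed
    qed
    also have "\<dots> \<le> \<bar>LINT x|lborel. M x $ j \<bullet> \<eta>' x\<bar>" unfolding EL by simp
    also have "\<dots> \<le> sqrt (l2sq (\<lambda>x. M x $ j)) * sqrt (l2sq \<eta>')"
      by (rule l2_inner_bound[OF sobolevD(2)[OF sobolev_nth[OF M(1)]] sobolevD(2)[OF s\<eta>]])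
    also have "\<dots> = sqrt (\<theta> * A)" unfolding l\<eta>' A_def by (simp add: real_sqrt_mult mult_ac)
    finally have "\<gamma>\<^sup>2 \<le> \<theta> * A"
      using \<gamma> A \<theta>(1) by (metis less_imp_le mult_nonneg_nonneg power_mono real_sqrt_pow2)
    also have "\<dots> \<le> \<gamma>\<^sup>2 / (A + 1) * A" using \<theta>(3) A by (rule mult_right_mono)
    also have "\<dots> < \<gamma>\<^sup>2" using A \<gamma> by (simp add: field_simps)
    finally show False by simp
  qed
qed

text \<open>The variational equation involves the real inner product. Testing with a real test
  function times an arbitrary complex constant \<open>c\<close> recovers the complex
  identity.\<close>

lemma minimal_stationary:
  assumes min: "minimal m F G" and m: "\<And>j. 0 < m j"
  shows "weak_derivative (\<lambda>x. G x $ j) (\<lambda>x. frequency m F G j *\<^sub>R F x $ j - NL (F x) j)"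
  unfolding weak_derivative_def
proof (intro conjI allI impI)
  have FG: "sobolev F G" using min by (simp add: minimal_def)
  note Fj = sobolev_nth[OF FG, of j]
  define \<omega> where "\<omega> = frequency m F G j"
  define g where "g x = \<omega> *\<^sub>R F x $ j - NL (F x) j" for x
  show lG: "locally_integrable (\<lambda>x. G x $ j)"
    unfolding locally_integrable_iff_intervals using l2_set_integrable(1)[OF sobolevD(2)[OF Fj]] by blast
  have "isCont g x" for x
    unfolding g_def
    by (rule continuous_diff[OF continuous_scaleR[OF continuous_const sobolev_isCont[OF Fj]]
          isCont_o2[OF sobolev_isCont[OF FG] continuous_NL]])
  then have "continuous_on A g" for A by (simp add: continuous_at_imp_continuous_on)
  then have lg: "locally_integrable g"
    unfolding locally_integrable_iff_intervals by (auto intro: borel_integrable_atLeastAtMost')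
  then show "locally_integrable (\<lambda>x. frequency m F G j *\<^sub>R F x $ j - NL (F x) j)"
    unfolding g_def[abs_def] \<omega>_def .
  fix \<phi> :: "real \<Rightarrow> real" assume \<phi>: "test_function \<phi>"
  have "(LINT x|lborel. dir_deriv 1 \<phi> x *\<^sub>R G x $ j) \<bullet> c = (- (LINT x|lborel. \<phi> x *\<^sub>R g x)) \<bullet> c" for c
  proof -
    have lin: "linear (\<lambda>t::real. t *\<^sub>R c)" by (rule linearI) (auto simp: scaleR_add_left)
    note s = sobolev_linear[OF test_function_sobolev[OF \<phi>] lin]
    note EL = Euler_Lagrange(2)[OF min m s, of j] and int = Euler_Lagrange(3)[OF min m s, of j]
    have "(LINT x|lborel. dir_deriv 1 \<phi> x *\<^sub>R G x $ j) \<bullet> c = (LINT x|lborel. (dir_deriv 1 \<phi> x *\<^sub>R G x $ j) \<bullet> c)"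
      by (rule integral_inner_left[symmetric]) (rule test_function_mult_integrable[OF test_function_derivative(2)[OF \<phi>] lG])
    also have "\<dots> = (LINT x|lborel. G x $ j \<bullet> (dir_deriv 1 \<phi> x *\<^sub>R c))" by simp
    also have "\<dots> = (LINT x|lborel. NL (F x) j \<bullet> (\<phi> x *\<^sub>R c)) - \<omega> * (LINT x|lborel. F x $ j \<bullet> (\<phi> x *\<^sub>R c))"
      using EL unfolding \<omega>_def by linarith
    also have "\<dots> = (LINT x|lborel. NL (F x) j \<bullet> (\<phi> x *\<^sub>R c) - \<omega> * (F x $ j \<bullet> (\<phi> x *\<^sub>R c)))"
      using int square_integrable_inner[OF sobolevD(1)[OF Fj] sobolevD(1)[OF s]] by simp
    also have "\<dots> = (LINT x|lborel. - ((\<phi> x *\<^sub>R g x) \<bullet> c))"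
      by (intro Bochner_Integration.integral_cong) (auto simp: g_def inner_diff_left algebra_simps)
    also have "\<dots> = - (LINT x|lborel. (\<phi> x *\<^sub>R g x) \<bullet> c)" by simp
    also have "(LINT x|lborel. (\<phi> x *\<^sub>R g x) \<bullet> c) = (LINT x|lborel. \<phi> x *\<^sub>R g x) \<bullet> c"
      by (rule integral_inner_left) (rule test_function_mult_integrable[OF \<phi> lg])
    finally show ?thesis by simp
  qed
  then have "(LINT x|lborel. dir_deriv 1 \<phi> x *\<^sub>R G x $ j) = - (LINT x|lborel. \<phi> x *\<^sub>R g x)"
    using vector_eq_rdot by blast
  then show "(LINT x|lborel. dir_deriv 1 \<phi> x *\<^sub>R G x $ j) = - (LINT x|lborel. \<phi> x *\<^sub>R (frequency m F G j *\<^sub>R F x $ j - NL (F x) j))"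
    unfolding g_def \<omega>_def .
qed

text \<open>The right side of the equation is continuous, so the derivative has a continuously
  differentiable representative \<open>Q\<close> and the profile is twice differentiable in the
  classical sense. The wave ansatz can then be differentiated pointwise.\<close>

lemma minimal_regular:
  assumes min: "minimal m F G" and m: "\<And>j. 0 < m j"
  shows "\<exists>Q. (AE x in lborel. G x $ j = Q x) \<and> sobolev (\<lambda>x. F x $ j) Q \<and>
    (\<forall>x. ((\<lambda>x. F x $ j) has_vector_derivative Q x) (at x)) \<and>
    (\<forall>x. (Q has_vector_derivative frequency m F G j *\<^sub>R F x $ j - NL (F x) j) (at x))"
proof -
  have FG: "sobolev F G" using min by (simp add: minimal_def)
  note Fj = sobolev_nth[OF FG, of j]
  define g where "g x = frequency m F G j *\<^sub>R F x $ j - NL (F x) j" for x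
  have "isCont g x" for x
    unfolding g_def
    by (rule continuous_diff[OF continuous_scaleR[OF continuous_const sobolev_isCont[OF Fj]]
          isCont_o2[OF sobolev_isCont[OF FG] continuous_NL]])
  then have contg: "continuous_on UNIV g" by (simp add: continuous_at_imp_continuous_on)
  obtain Q where Q: "is_primitive Q g" "AE x in lborel. G x $ j = Q x"
    using weak_derivative_imp_primitive[OF minimal_stationary[OF min m, of j]] unfolding g_def[abs_def] by blast
  have contQ: "continuous_on UNIV Q" by (rule is_primitive_continuous[OF Q(1)])
  have Qm: "Q \<in> borel_measurable borel" by (rule borel_measurable_continuous_onI[OF contQ])
  have "AE x in lborel. Q x = G x $ j" by (rule eventually_mono[OF Q(2)]) simp
  then have "square_integrable Q" by (rule square_integrable_cong_AE[OF Qm sobolevD(2)[OF Fj]])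
  moreover have pQ: "is_primitive (\<lambda>x. F x $ j) Q" by (rule is_primitive_cong_AE[OF sobolevD(3)[OF Fj] Qm Q(2)])
  ultimately have "sobolev (\<lambda>x. F x $ j) Q" using sobolevD(1)[OF Fj] by (simp add: sobolev_def)
  moreover have "((\<lambda>x. F x $ j) has_vector_derivative Q x) (at x)" for x
    by (rule is_primitive_has_vector_derivative[OF pQ contQ])
  moreover have "(Q has_vector_derivative g x) (at x)" for x
    by (rule is_primitive_has_vector_derivative[OF Q(1) contg])
  ultimately show ?thesis using Q(2) unfolding g_def by blast
qed

end

section \<open>Solitary waves\<close>

lemma is_primitive_if_has_vector_derivative:
  fixes P :: "real \<Rightarrow> 'e::euclidean_space"
  assumes "\<And>x. (P has_vector_derivative g x) (at x)" "\<And>x. isCont g x"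
  shows "is_primitive P g"
proof -
  have c: "continuous_on A g" for A using assms(2) by (simp add: continuous_at_imp_continuous_on)
  show ?thesis
    unfolding is_primitive_def set_lebesgue_integral_def
    using integral_FTC_atLeastAtMost[of _ _ P g, OF _ has_vector_derivative_at_within[OF assms(1)] c]
      borel_integrable_atLeastAtMost'[OF c] by auto
qed

lemma AE_lborel_translate:
  fixes c :: real
  assumes "AE x in lborel. S x" "{x. S x} \<in> sets borel"
  shows "AE x in lborel. S (x - c)"
proof -
  have "AE x in distr lborel borel ((+) (- c)). S x" using assms(1) by (simp only: lborel_distr_plus)
  then show ?thesis by (subst (asm) AE_distr_iff) (use assms(2) in auto)
qed

text \<open>The norm does not depend on the time, and continuity of \<open>v\<close> gives pointwise
  convergence; the splitting of squared norms then leaves nothing for the difference.\<close>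

lemma l2_continuous_phase_translate:
  fixes v :: "real \<Rightarrow> complex" and \<alpha> :: "real \<Rightarrow> real"
  assumes v: "square_integrable v" "\<And>x. isCont v x" and \<alpha>: "isCont \<alpha> \<tau>\<^sub>0"
  shows "((\<lambda>\<tau>. l2sq (\<lambda>x. cis (\<alpha> \<tau>) * v (x - s * \<tau>) - cis (\<alpha> \<tau>\<^sub>0) * v (x - s * \<tau>\<^sub>0))) \<longlongrightarrow> 0) (at \<tau>\<^sub>0)"
  unfolding tendsto_at_iff_sequentially o_def
proof (intro allI impI)
  fix X :: "nat \<Rightarrow> real" assume X: "X \<longlonglongrightarrow> \<tau>\<^sub>0"
  define u where "u \<tau> x = cis (\<alpha> \<tau>) * v (x - s * \<tau>)" for \<tau> x
  have lin: "linear (\<lambda>z. cis t * z)" for t by (rule linearI) (auto simp: distrib_left)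
  have sq: "square_integrable (u \<tau>)" for \<tau>
    using square_integrable_linear[OF square_integrable_translate[OF v(1), of "- s * \<tau>"] lin, of "\<alpha> \<tau>"]
    unfolding u_def by simp
  have l: "l2sq (u \<tau>) = l2sq v" for \<tau>
  proof -
    have "l2sq (u \<tau>) = l2sq (\<lambda>x. v (x + - s * \<tau>))" by (simp add: l2sq_def u_def norm_mult)
    then show ?thesis unfolding l2sq_translate .
  qed
  have lim: "(\<lambda>n. u (X n) x) \<longlonglongrightarrow> u \<tau>\<^sub>0 x" for x
    unfolding u_def cis_conv_exp
    by (intro tendsto_intros isCont_tendsto_compose[OF v(2)] isCont_tendsto_compose[OF \<alpha>] X)
  have "(\<lambda>n. l2sq (u (X n)) - l2sq (\<lambda>x. u (X n) x - u \<tau>\<^sub>0 x)) \<longlonglongrightarrow> l2sq (u \<tau>\<^sub>0)"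
    by (rule l2sq_splitting[of "\<lambda>n. u (X n)" "l2sq v", OF sq _ sq lim]) (simp add: l)
  from tendsto_diff[OF tendsto_const[of "l2sq v"] this[unfolded l]]
  show "(\<lambda>n. l2sq (\<lambda>x. cis (\<alpha> (X n)) * v (x - s * X n) - cis (\<alpha> \<tau>\<^sub>0) * v (x - s * \<tau>\<^sub>0))) \<longlonglongrightarrow> 0"
    by (simp add: u_def)
qed

section \<open>From classical to distributional solutions on the plane\<close>

lemma integral_compact_support_parts:
  fixes \<psi> :: "real \<Rightarrow> real" and V :: "real \<Rightarrow> complex"
  assumes \<psi>: "\<And>t. (\<psi> has_real_derivative \<psi>' t) (at t)" and V: "\<And>t. (V has_vector_derivative V' t) (at t)"
    and cont: "\<And>t. isCont \<psi>' t" "\<And>t. isCont V' t"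
    and supp: "\<And>t. t \<notin> {-M..M} \<Longrightarrow> \<psi> t = 0 \<and> \<psi>' t = 0"
  shows "(LINT t|lborel. \<psi>' t *\<^sub>R V t) = - (LINT t|lborel. \<psi> t *\<^sub>R V' t)"
proof -
  have c: "isCont \<psi> t" "isCont V t" for t
    using \<psi> V by (auto intro: DERIV_isCont has_vector_derivative_continuous)
  define L where "L = max M 0 + 1"
  have L: "-L \<le> L" "\<psi> L = 0" "\<psi> (-L) = 0" "\<And>t. t \<notin> {-L..L} \<Longrightarrow> \<psi> t = 0 \<and> \<psi>' t = 0"
  proof -
    have *: "\<psi> t = 0 \<and> \<psi>' t = 0" if "\<not> (-L < t \<and> t < L)" for t
    proof (rule supp)
      show "t \<notin> {-M..M}" using that by (auto simp: L_def max_def split: if_splits)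
    qed
    show "-L \<le> L" "\<psi> L = 0" "\<psi> (-L) = 0" using *[of L] *[of "-L"] by (auto simp: L_def)
    show "\<psi> t = 0 \<and> \<psi>' t = 0" if "t \<notin> {-L..L}" for t by (rule *) (use that in auto)
  qed
  have ind: "indicator {-L..L} t *\<^sub>R (\<psi>' t *\<^sub>R V t) = \<psi>' t *\<^sub>R V t" "indicator {-L..L} t *\<^sub>R (\<psi> t *\<^sub>R V' t) = \<psi> t *\<^sub>R V' t" for t
    using L(4)[of t] by (cases "t \<in> {-L..L}"; simp)+
  have "integrable lborel (\<lambda>t. indicator {-L..L} t *\<^sub>R (\<psi>' t *\<^sub>R V t))" "integrable lborel (\<lambda>t. indicator {-L..L} t *\<^sub>R (\<psi> t *\<^sub>R V' t))"
    by (intro borel_integrable_compact compact_Icc continuous_at_imp_continuous_on ballI continuous_scaleR cont c)+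
  then have int: "integrable lborel (\<lambda>t. \<psi>' t *\<^sub>R V t)" "integrable lborel (\<lambda>t. \<psi> t *\<^sub>R V' t)"
    unfolding ind .
  have "(LINT t|lborel. indicator {-L..L} t *\<^sub>R (\<psi> t *\<^sub>R V' t + \<psi>' t *\<^sub>R V t)) = \<psi> L *\<^sub>R V L - \<psi> (-L) *\<^sub>R V (-L)"
  proof (rule integral_FTC_atLeastAtMost[OF L(1)])
    show "((\<lambda>t. \<psi> t *\<^sub>R V t) has_vector_derivative \<psi> t *\<^sub>R V' t + \<psi>' t *\<^sub>R V t) (at t within {-L..L})" for t
      by (rule has_vector_derivative_at_within[OF has_vector_derivative_scaleR[OF \<psi> V]])
    show "continuous_on {-L..L} (\<lambda>t. \<psi> t *\<^sub>R V' t + \<psi>' t *\<^sub>R V t)"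
      by (intro continuous_at_imp_continuous_on ballI continuous_add continuous_scaleR cont c)
  qed
  then have "(LINT t|lborel. \<psi> t *\<^sub>R V' t + \<psi>' t *\<^sub>R V t) = 0"
    unfolding scaleR_add_right ind L(2,3) by simp
  then have "(LINT t|lborel. \<psi> t *\<^sub>R V' t) + (LINT t|lborel. \<psi>' t *\<^sub>R V t) = 0" using int by simp
  then show ?thesis by (simp add: add_eq_0_iff)
qed

lemma integrable_plane_compact_support:
  fixes f :: "real \<times> real \<Rightarrow> complex"
  assumes "\<And>z. isCont f z" "\<And>z. z \<notin> cbox (-b) b \<Longrightarrow> f z = 0"
  shows "integrable lborel f"
proof -
  have "integrable lborel (\<lambda>z. indicator (cbox (-b) b) z *\<^sub>R f z)"
    by (intro borel_integrable_compact compact_cbox continuous_at_imp_continuous_on ballI assms(1))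
  also have "(\<lambda>z. indicator (cbox (-b) b) z *\<^sub>R f z) = f"
  proof
    show "indicator (cbox (-b) b) z *\<^sub>R f z = f z" for z using assms(2)[of z] by (cases "z \<in> cbox (-b) b") auto
  qed
  finally show ?thesis .
qed

lemma lborel_plane_Fubini:
  fixes f :: "real \<times> real \<Rightarrow> complex"
  assumes "integrable lborel f"
  shows "(LINT z|lborel. f z) = (LINT x|lborel. LINT t|lborel. f (x, t))"
    and "(LINT z|lborel. f z) = (LINT t|lborel. LINT x|lborel. f (x, t))"
proof -
  have i: "integrable (lborel \<Otimes>\<^sub>M lborel) (\<lambda>(x, t). f (x, t))" using assms by (simp add: lborel_prod)
  show "(LINT z|lborel. f z) = (LINT x|lborel. LINT t|lborel. f (x, t))"
    using lborel_pair.integral_fst[OF i] by (simp add: lborel_prod)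
  show "(LINT z|lborel. f z) = (LINT t|lborel. LINT x|lborel. f (x, t))"
    using lborel_pair.integral_snd[OF i] by (simp add: lborel_prod)
qed

text \<open>The box that contains the support serves all derivatives: on its open complement each
  iterated derivative is a derivative of the zero function.\<close>

lemma plane_test_function:
  fixes \<phi> :: "real \<times> real \<Rightarrow> real"
  assumes "test_function \<phi>"
  shows "\<exists>b. \<forall>bs\<in>lists Basis. (\<forall>z. isCont (foldr dir_deriv bs \<phi>) z) \<and>
    (\<forall>x t. ((\<lambda>x. foldr dir_deriv bs \<phi> (x, t)) has_real_derivative dir_deriv (1, 0) (foldr dir_deriv bs \<phi>) (x, t)) (at x)) \<and>
    (\<forall>x t. ((\<lambda>t. foldr dir_deriv bs \<phi> (x, t)) has_real_derivative dir_deriv (0, 1) (foldr dir_deriv bs \<phi>) (x, t)) (at t)) \<and>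
    (\<forall>z. z \<notin> cbox (-b) b \<longrightarrow> foldr dir_deriv bs \<phi> z = 0)"
proof -
  have "bounded {z. \<phi> z \<noteq> 0}"
    using assms compact_imp_bounded bounded_subset closure_subset unfolding test_function_def by blast
  from bounded_subset_cbox_symmetric[OF this] obtain b where b: "{z. \<phi> z \<noteq> 0} \<subseteq> cbox (-b) b" .
  have diff: "foldr dir_deriv bs \<phi> differentiable (at z)" if "bs \<in> lists Basis" for bs z
    using assms that unfolding test_function_def differentiable_on_def by blast
  have frechet: "(foldr dir_deriv bs \<phi> has_derivative frechet_derivative (foldr dir_deriv bs \<phi>) (at z)) (at z)" if "bs \<in> lists Basis" for bs z
    using diff[OF that] by (simp only: frechet_derivative_works)
  have zero: "foldr dir_deriv bs \<phi> z = 0" if "bs \<in> lists Basis" "z \<notin> cbox (-b) b" for bs z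
    using that
  proof (induction bs arbitrary: z)
    case Nil
    then show ?case using b by auto
  next
    case (Cons e bs)
    have bs: "bs \<in> lists Basis" using Cons.hyps by simp
    have op: "open (- cbox (-b) b)" by (simp only: open_Compl closed_cbox)
    have z: "z \<in> - cbox (-b) b" using Cons.prems by simp
    have "((\<lambda>_. 0) has_derivative frechet_derivative (foldr dir_deriv bs \<phi>) (at z)) (at z)"
      by (rule has_derivative_transform_within_open[OF frechet[OF bs] op z]) (rule Cons.IH, erule ComplD)
    from has_derivative_unique[OF this has_derivative_const]
    have "frechet_derivative (foldr dir_deriv bs \<phi>) (at z) = (\<lambda>_. 0)" .
    then show ?case by (simp add: dir_deriv_def[of e "foldr dir_deriv bs \<phi>"])
  qed
  have dx: "((\<lambda>x. foldr dir_deriv bs \<phi> (x, t)) has_real_derivative dir_deriv (1, 0) (foldr dir_deriv bs \<phi>) (x, t)) (at x)"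
    if bs: "bs \<in> lists Basis" for bs x t
  proof -
    let ?D = "frechet_derivative (foldr dir_deriv bs \<phi>) (at (x, t))"
    have 1: "((\<lambda>x. (x, t)) has_derivative (\<lambda>h. (h, 0))) (at x)"
      by (rule has_derivative_Pair[OF has_derivative_ident has_derivative_const])
    have sc: "?D (h, 0) = h * ?D (1, 0)" for h
      using linear_scale[OF has_derivative_linear[OF frechet[OF bs, of "(x, t)"]], of h "(1, 0)"] by simp
    have "(\<lambda>h. ?D (h, 0)) = (*) (?D (1, 0))" by (rule ext, subst sc, rule mult.commute)
    with has_derivative_compose[OF 1 frechet[OF bs]] show ?thesis
      by (simp add: has_field_derivative_def dir_deriv_def)
  qed
  have dt: "((\<lambda>t. foldr dir_deriv bs \<phi> (x, t)) has_real_derivative dir_deriv (0, 1) (foldr dir_deriv bs \<phi>) (x, t)) (at t)"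
    if bs: "bs \<in> lists Basis" for bs x t
  proof -
    let ?D = "frechet_derivative (foldr dir_deriv bs \<phi>) (at (x, t))"
    have 1: "((\<lambda>t. (x, t)) has_derivative (\<lambda>h. (0, h))) (at t)"
      by (rule has_derivative_Pair[OF has_derivative_const has_derivative_ident])
    have sc: "?D (0, h) = h * ?D (0, 1)" for h
      using linear_scale[OF has_derivative_linear[OF frechet[OF bs, of "(x, t)"]], of h "(0, 1)"] by simp
    have "(\<lambda>h. ?D (0, h)) = (*) (?D (0, 1))" by (rule ext, subst sc, rule mult.commute)
    with has_derivative_compose[OF 1 frechet[OF bs]] show ?thesis
      by (simp add: has_field_derivative_def dir_deriv_def)
  qed
  show ?thesis
  proof (intro exI[of _ b] ballI conjI allI impI)
    fix bs :: "(real \<times> real) list" assume bs: "bs \<in> lists Basis"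
    show "isCont (foldr dir_deriv bs \<phi>) z" for z by (rule differentiable_imp_continuous_within[OF diff[OF bs]])
    show "foldr dir_deriv bs \<phi> z = 0" if "z \<notin> cbox (-b) b" for z by (rule zero[OF bs that])
  qed (rule dx dt, assumption)+
qed

lemma nonlinearity_phase:
  assumes "\<And>k. norm (c k) = 1"
  shows "nonlinearity p a (\<lambda>k. c k * w k) j = c j * nonlinearity p a w j"
  using assms by (simp add: nonlinearity_def norm_mult)

context coupled_nls
begin

text \<open>One time derivative and two space derivatives are moved from the test function to
  \<open>U\<close>, each by Fubini with the relevant variable innermost and one-dimensional
  integration by parts.\<close>

lemma plane_equation:
  fixes \<phi> :: "real \<times> real \<Rightarrow> real" and U Ut Ux Uxx V :: "real \<times> real \<Rightarrow> complex"
  assumes \<phi>: "test_function \<phi>"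
    and dt: "\<And>x t. ((\<lambda>t. U (x, t)) has_vector_derivative Ut (x, t)) (at t)"
    and dx: "\<And>x t. ((\<lambda>x. U (x, t)) has_vector_derivative Ux (x, t)) (at x)"
    and dxx: "\<And>x t. ((\<lambda>x. Ux (x, t)) has_vector_derivative Uxx (x, t)) (at x)"
    and cont: "\<And>z. isCont U z" "\<And>z. isCont Ut z" "\<And>z. isCont Ux z" "\<And>z. isCont Uxx z" "\<And>z. isCont V z"
    and eq: "\<And>z. \<i> * Ut z + Uxx z + V z = 0"
  shows "(LINT z|lborel. - (\<i> * of_real (dir_deriv (0, 1) \<phi> z) * U z)
    + of_real (dir_deriv (1, 0) (dir_deriv (1, 0) \<phi>) z) * U z + of_real (\<phi> z) * V z) = 0"
proof -
  obtain b where b: "\<forall>bs\<in>lists Basis. (\<forall>z. isCont (foldr dir_deriv bs \<phi>) z) \<and>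
    (\<forall>x t. ((\<lambda>x. foldr dir_deriv bs \<phi> (x, t)) has_real_derivative dir_deriv (1, 0) (foldr dir_deriv bs \<phi>) (x, t)) (at x)) \<and>
    (\<forall>x t. ((\<lambda>t. foldr dir_deriv bs \<phi> (x, t)) has_real_derivative dir_deriv (0, 1) (foldr dir_deriv bs \<phi>) (x, t)) (at t)) \<and>
    (\<forall>z. z \<notin> cbox (-b) b \<longrightarrow> foldr dir_deriv bs \<phi> z = 0)"
    using plane_test_function[OF \<phi>] by blast
  define \<phi>t where "\<phi>t = dir_deriv (0, 1) \<phi>"
  define \<phi>x where "\<phi>x = dir_deriv (1, 0) \<phi>"
  define \<phi>xx where "\<phi>xx = dir_deriv (1, 0) \<phi>x"
  have B: "(1, 0) \<in> (Basis :: (real \<times> real) set)" "(0, 1) \<in> (Basis :: (real \<times> real) set)"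
    by (auto simp: Basis_prod_def)
  have b0: "isCont \<phi> z" "((\<lambda>x. \<phi> (x, t)) has_real_derivative \<phi>x (x, t)) (at x)" "((\<lambda>t. \<phi> (x, t)) has_real_derivative \<phi>t (x, t)) (at t)"
    "z \<notin> cbox (-b) b \<Longrightarrow> \<phi> z = 0" for x t z
    using b[rule_format, of "[]"] unfolding \<phi>t_def \<phi>x_def by (simp_all del: split_paired_All)
  have bt: "isCont \<phi>t z" "z \<notin> cbox (-b) b \<Longrightarrow> \<phi>t z = 0" for z
    using b[rule_format, of "[(0, 1)]"] B unfolding \<phi>t_def by (simp_all del: split_paired_All)
  have bx: "isCont \<phi>x z" "((\<lambda>x. \<phi>x (x, t)) has_real_derivative \<phi>xx (x, t)) (at x)" "z \<notin> cbox (-b) b \<Longrightarrow> \<phi>x z = 0" for x t z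
    using b[rule_format, of "[(1, 0)]"] B unfolding \<phi>x_def \<phi>xx_def by (simp_all del: split_paired_All)
  have bxx: "isCont \<phi>xx z" "z \<notin> cbox (-b) b \<Longrightarrow> \<phi>xx z = 0" for z
    using b[rule_format, of "[(1, 0), (1, 0)]"] B unfolding \<phi>x_def \<phi>xx_def by (simp_all del: split_paired_All)
  have notin: "(x, t) \<notin> cbox (-b) b" if "x \<notin> {- fst b..fst b} \<or> t \<notin> {- snd b..snd b}" for x t :: real
    using that by (cases b) (auto simp: cbox_Pair_eq)
  have slice: "isCont (\<lambda>t. f (x, t)) t" "isCont (\<lambda>x. f (x, t)) x" if "\<And>z. isCont f z" for f :: "real \<times> real \<Rightarrow> 'c::t2_space" and x t
    by (rule isCont_o2[where g=f, OF _ that], intro continuous_Pair continuous_const continuous_ident)+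
  have int: "integrable lborel (\<lambda>z. f z *\<^sub>R g z)" if "\<And>z. isCont f z" "\<And>z. z \<notin> cbox (-b) b \<Longrightarrow> f z = 0" "\<And>z. isCont g z"
    for f :: "real \<times> real \<Rightarrow> real" and g :: "real \<times> real \<Rightarrow> complex"
    by (rule integrable_plane_compact_support[of _ b]) (use that in \<open>auto intro: continuous_scaleR\<close>)
  note i1 = int[of \<phi>t, OF bt cont(1)] and i2 = int[of \<phi>xx, OF bxx cont(1)] and i3 = int[of \<phi>, OF b0(1,4) cont(5)]
    and i4 = int[of \<phi>, OF b0(1,4) cont(2)] and i5 = int[of \<phi>, OF b0(1,4) cont(4)] and i6 = int[of \<phi>x, OF bx(1,3) cont(3)]
  have t: "(LINT z|lborel. \<phi>t z *\<^sub>R U z) = - (LINT z|lborel. \<phi> z *\<^sub>R Ut z)"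
  proof -
    have "(LINT t|lborel. \<phi>t (x, t) *\<^sub>R U (x, t)) = - (LINT t|lborel. \<phi> (x, t) *\<^sub>R Ut (x, t))" for x
      by (rule integral_compact_support_parts[OF b0(3) dt slice(1)[OF bt(1)] slice(1)[OF cont(2)], of "snd b"])
        (use notin b0(4) bt(2) in blast)
    note parts = this
    have "(LINT z|lborel. \<phi>t z *\<^sub>R U z) = (LINT x|lborel. LINT t|lborel. \<phi>t (x, t) *\<^sub>R U (x, t))"
      by (rule lborel_plane_Fubini(1)[OF i1])
    also have "\<dots> = (LINT x|lborel. - (LINT t|lborel. \<phi> (x, t) *\<^sub>R Ut (x, t)))" by (simp only: parts)
    also have "\<dots> = - (LINT x|lborel. LINT t|lborel. \<phi> (x, t) *\<^sub>R Ut (x, t))" by (rule Bochner_Integration.integral_minus)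
    also have "(LINT x|lborel. LINT t|lborel. \<phi> (x, t) *\<^sub>R Ut (x, t)) = (LINT z|lborel. \<phi> z *\<^sub>R Ut z)"
      by (rule lborel_plane_Fubini(1)[OF i4, symmetric])
    finally show ?thesis .
  qed
  have xx: "(LINT z|lborel. \<phi>xx z *\<^sub>R U z) = - (LINT z|lborel. \<phi>x z *\<^sub>R Ux z)"
  proof -
    have "(LINT x|lborel. \<phi>xx (x, t) *\<^sub>R U (x, t)) = - (LINT x|lborel. \<phi>x (x, t) *\<^sub>R Ux (x, t))" for t
      by (rule integral_compact_support_parts[OF bx(2) dx slice(2)[OF bxx(1)] slice(2)[OF cont(3)], of "fst b"])
        (use notin bx(3) bxx(2) in blast)
    note parts = this
    have "(LINT z|lborel. \<phi>xx z *\<^sub>R U z) = (LINT t|lborel. LINT x|lborel. \<phi>xx (x, t) *\<^sub>R U (x, t))"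
      by (rule lborel_plane_Fubini(2)[OF i2])
    also have "\<dots> = (LINT t|lborel. - (LINT x|lborel. \<phi>x (x, t) *\<^sub>R Ux (x, t)))" by (simp only: parts)
    also have "\<dots> = - (LINT t|lborel. LINT x|lborel. \<phi>x (x, t) *\<^sub>R Ux (x, t))" by (rule Bochner_Integration.integral_minus)
    also have "(LINT t|lborel. LINT x|lborel. \<phi>x (x, t) *\<^sub>R Ux (x, t)) = (LINT z|lborel. \<phi>x z *\<^sub>R Ux z)"
      by (rule lborel_plane_Fubini(2)[OF i6, symmetric])
    finally show ?thesis .
  qed
  have x: "(LINT z|lborel. \<phi>x z *\<^sub>R Ux z) = - (LINT z|lborel. \<phi> z *\<^sub>R Uxx z)"
  proof -
    have "(LINT x|lborel. \<phi>x (x, t) *\<^sub>R Ux (x, t)) = - (LINT x|lborel. \<phi> (x, t) *\<^sub>R Uxx (x, t))" for t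
      by (rule integral_compact_support_parts[OF b0(2) dxx slice(2)[OF bx(1)] slice(2)[OF cont(4)], of "fst b"])
        (use notin b0(4) bx(3) in blast)
    note parts = this
    have "(LINT z|lborel. \<phi>x z *\<^sub>R Ux z) = (LINT t|lborel. LINT x|lborel. \<phi>x (x, t) *\<^sub>R Ux (x, t))"
      by (rule lborel_plane_Fubini(2)[OF i6])
    also have "\<dots> = (LINT t|lborel. - (LINT x|lborel. \<phi> (x, t) *\<^sub>R Uxx (x, t)))" by (simp only: parts)
    also have "\<dots> = - (LINT t|lborel. LINT x|lborel. \<phi> (x, t) *\<^sub>R Uxx (x, t))" by (rule Bochner_Integration.integral_minus)
    also have "(LINT t|lborel. LINT x|lborel. \<phi> (x, t) *\<^sub>R Uxx (x, t)) = (LINT z|lborel. \<phi> z *\<^sub>R Uxx z)"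
      by (rule lborel_plane_Fubini(2)[OF i5, symmetric])
    finally show ?thesis .
  qed
  have j1: "integrable lborel (\<lambda>z. - (\<i> * (\<phi>t z *\<^sub>R U z)))"
    by (intro Bochner_Integration.integrable_minus integrable_mult_right i1)
  have j4: "integrable lborel (\<lambda>z. \<i> * (\<phi> z *\<^sub>R Ut z))" by (intro integrable_mult_right i4)
  have "(LINT z|lborel. - (\<i> * (\<phi>t z *\<^sub>R U z)) + \<phi>xx z *\<^sub>R U z + \<phi> z *\<^sub>R V z)
    = - (\<i> * (LINT z|lborel. \<phi>t z *\<^sub>R U z)) + (LINT z|lborel. \<phi>xx z *\<^sub>R U z) + (LINT z|lborel. \<phi> z *\<^sub>R V z)"
  proof -
    have 1: "(LINT z|lborel. - (\<i> * (\<phi>t z *\<^sub>R U z)) + \<phi>xx z *\<^sub>R U z + \<phi> z *\<^sub>R V z)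
      = (LINT z|lborel. - (\<i> * (\<phi>t z *\<^sub>R U z)) + \<phi>xx z *\<^sub>R U z) + (LINT z|lborel. \<phi> z *\<^sub>R V z)"
      by (rule Bochner_Integration.integral_add[OF Bochner_Integration.integrable_add[OF j1 i2] i3])
    have 2: "(LINT z|lborel. - (\<i> * (\<phi>t z *\<^sub>R U z)) + \<phi>xx z *\<^sub>R U z)
      = (LINT z|lborel. - (\<i> * (\<phi>t z *\<^sub>R U z))) + (LINT z|lborel. \<phi>xx z *\<^sub>R U z)"
      by (rule Bochner_Integration.integral_add[OF j1 i2])
    have 3: "(LINT z|lborel. - (\<i> * (\<phi>t z *\<^sub>R U z))) = - (\<i> * (LINT z|lborel. \<phi>t z *\<^sub>R U z))"
      unfolding Bochner_Integration.integral_minus integral_mult_right_zero ..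
    show ?thesis unfolding 1 2 3 ..
  qed
  also have "\<dots> = \<i> * (LINT z|lborel. \<phi> z *\<^sub>R Ut z) + (LINT z|lborel. \<phi> z *\<^sub>R Uxx z) + (LINT z|lborel. \<phi> z *\<^sub>R V z)"
    unfolding xx x t by simp
  also have "\<dots> = (LINT z|lborel. \<i> * (\<phi> z *\<^sub>R Ut z) + \<phi> z *\<^sub>R Uxx z + \<phi> z *\<^sub>R V z)"
  proof -
    have 1: "(LINT z|lborel. \<i> * (\<phi> z *\<^sub>R Ut z) + \<phi> z *\<^sub>R Uxx z + \<phi> z *\<^sub>R V z)
      = (LINT z|lborel. \<i> * (\<phi> z *\<^sub>R Ut z) + \<phi> z *\<^sub>R Uxx z) + (LINT z|lborel. \<phi> z *\<^sub>R V z)"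
      by (rule Bochner_Integration.integral_add[OF Bochner_Integration.integrable_add[OF j4 i5] i3])
    have 2: "(LINT z|lborel. \<i> * (\<phi> z *\<^sub>R Ut z) + \<phi> z *\<^sub>R Uxx z)
      = (LINT z|lborel. \<i> * (\<phi> z *\<^sub>R Ut z)) + (LINT z|lborel. \<phi> z *\<^sub>R Uxx z)"
      by (rule Bochner_Integration.integral_add[OF j4 i5])
    show ?thesis unfolding 1 2 integral_mult_right_zero ..
  qed
  also have "(\<lambda>z. \<i> * (\<phi> z *\<^sub>R Ut z) + \<phi> z *\<^sub>R Uxx z + \<phi> z *\<^sub>R V z) = (\<lambda>z. \<phi> z *\<^sub>R (\<i> * Ut z + Uxx z + V z))"
    by (simp add: scaleR_add_right)
  finally show ?thesis unfolding eq \<phi>t_def \<phi>xx_def \<phi>x_def by (simp add: scaleR_conv_of_real mult.assoc)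
qed

end

text \<open>An exceptional set of the profile is carried along parallel lines of the plane. At each
  fixed time it is a translate of a null set, and Fubini makes the union null in the plane.\<close>

lemma AE_plane_translate:
  fixes S :: "real \<Rightarrow> bool"
  assumes ae: "AE x in lborel. S x" and S: "{x. S x} \<in> sets borel"
  shows "AE z in lborel. S (fst z - c * snd z)"
proof -
  have [measurable]: "Measurable.pred borel S" using S by (simp add: pred_def)
  have m: "{z \<in> space (lborel \<Otimes>\<^sub>M lborel). S (fst z - c * snd z)} \<in> sets (lborel \<Otimes>\<^sub>M lborel :: (real \<times> real) measure)"
    by measurable
  have "AE t in lborel. AE x in lborel. S (x - c * t)"
    using AE_lborel_translate[OF ae S] by simp
  then have "AE x in lborel. AE t in lborel. S (x - c * t)"
    by (subst lborel_pair.AE_commute[OF m])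
  then have "AE z in lborel \<Otimes>\<^sub>M lborel. S (fst z - c * snd z)"
    by (intro lborel_pair.AE_pair_measure m) simp
  then show ?thesis unfolding lborel_prod .
qed

context coupled_nls
begin

text \<open>Two descriptions of the wave are used. At fixed time it is a constant phase times a
  translate of \<open>v\<close>, which gives continuity in time; on the plane it agrees almost
  everywhere with the classical solution \<open>U\<close>, which gives the equation.\<close>

lemma solitary_wave_solves_NLS:
  assumes \<Phi>: "\<And>j. \<Phi> j \<in> borel_measurable borel" "\<And>j. AE x in lborel. \<Phi> j x = F x $ j"
    and contF: "\<And>x. isCont F x"
    and Q: "\<And>j. sobolev (\<lambda>x. F x $ j) (Q j)"
    and d1: "\<And>j x. ((\<lambda>x. F x $ j) has_vector_derivative Q j x) (at x)"
    and d2: "\<And>j x. (Q j has_vector_derivative \<omega> j *\<^sub>R F x $ j - NL (F x) j) (at x)"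
  shows "solves_NLS p a (solitary_wave \<omega> \<sigma> \<beta> \<Phi>)"
proof -
  note [measurable] = \<Phi>(1)
  define s where "s = 2 * \<sigma>"
  define A where "A = \<i> * complex_of_real \<sigma>"
  \<comment> \<open>The phase that remains after the factor exp(i \<sigma> y), with y = x - 2
    \<sigma> \<tau>, is absorbed into the profile; this changes the sign of \<sigma>^2.\<close>
  define \<alpha> where "\<alpha> j \<tau> = (\<omega> j + \<sigma>\<^sup>2) * \<tau> + \<beta> j" for j \<tau>
  define e where "e j x \<tau> = exp (\<i> * of_real ((\<omega> j - \<sigma>\<^sup>2) * \<tau> + \<sigma> * x + \<beta> j))" for j x \<tau>
  define v where "v j y = exp (y *\<^sub>R A) * F y $ j" for j y
  define v' where "v' j y = exp (y *\<^sub>R A) * (A * F y $ j + Q j y)" for j y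
  define u where "u = solitary_wave \<omega> \<sigma> \<beta> \<Phi>"
  have u: "u j x \<tau> = e j x \<tau> * \<Phi> j (x - s * \<tau>)" for j x \<tau>
    by (simp add: u_def solitary_wave_def e_def s_def)
  have norm_e: "norm (e j x \<tau>) = 1" for j x \<tau>
    unfolding e_def by (rule norm_exp_i_times)
  have e_split: "e j x \<tau> * z = cis (\<alpha> j \<tau>) * (exp ((x - s * \<tau>) *\<^sub>R A) * z)" for j x \<tau> z
  proof -
    have "cis (\<alpha> j \<tau>) * exp ((x - s * \<tau>) *\<^sub>R A) = e j x \<tau>"
      unfolding cis_conv_exp e_def exp_add[symmetric]
      by (rule arg_cong[where f=exp]) (simp add: \<alpha>_def s_def A_def scaleR_conv_of_real algebra_simps power2_eq_square)
    then show ?thesis by (simp add: mult.assoc[symmetric])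
  qed
  have ReA: "Re A = 0" by (simp add: A_def)
  have dA: "((\<lambda>y. exp (y *\<^sub>R A)) has_vector_derivative exp (y *\<^sub>R A) * A) (at y)" for y
    by (rule exp_scaleR_has_vector_derivative_right)
  have cF: "isCont (\<lambda>x. F x $ j) x" for j x using sobolev_isCont[OF Q] .
  have cQ: "isCont (Q j) x" for j x using d2 has_vector_derivative_continuous by blast
  have cN: "isCont (\<lambda>x. NL (F x) j) x" for j x by (rule isCont_o2[OF contF continuous_NL])
  have cA: "isCont (\<lambda>y. exp (y *\<^sub>R A)) y" for y using dA has_vector_derivative_continuous by blast
  have cv: "isCont (v j) y" "isCont (v' j) y" for j y
    unfolding v_def v'_def by (intro continuous_mult continuous_add continuous_const cA cF cQ)+
  have dv: "(v j has_vector_derivative v' j y) (at y)" for j y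
    unfolding v_def[abs_def] v'_def
    using has_vector_derivative_mult[OF dA[of y] d1[of j y]] by (simp add: algebra_simps)
  have sv: "sobolev (v j) (v' j)" for j
    unfolding sobolev_def
  proof (intro conjI)
    note mv = borel_measurable_continuous_onI[OF continuous_at_imp_continuous_on, OF ballI]
    show "square_integrable (v j)"
      by (rule square_integrable_bound[OF mv[OF cv(1)] sobolevD(1)[OF Q, of j]]) (simp add: v_def norm_mult ReA)
    have lin: "linear (\<lambda>z. A * z)" by (rule linearI) (auto simp: distrib_left)
    show "square_integrable (v' j)"
      by (rule square_integrable_bound[OF mv[OF cv(2)] square_integrable_add(1)[OF square_integrable_linear[OF sobolevD(1)[OF Q, of j] lin] sobolevD(2)[OF Q, of j]]])
        (simp add: v'_def norm_mult ReA)
    show "is_primitive (v j) (v' j)" by (rule is_primitive_if_has_vector_derivative[OF dv cv(2)])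
  qed
  have sU: "sobolev (\<lambda>x. cis (\<alpha> j \<tau>) * v j (x - s * \<tau>)) (\<lambda>x. cis (\<alpha> j \<tau>) * v' j (x - s * \<tau>))" for j \<tau>
  proof -
    have lin: "linear (\<lambda>z. cis (\<alpha> j \<tau>) * z)" by (rule linearI) (auto simp: distrib_left)
    show ?thesis using sobolev_linear[OF sobolev_translate[OF sv, of _ "- s * \<tau>"] lin] by simp
  qed
  have um: "(\<lambda>x. u j x \<tau>) \<in> borel_measurable borel" for j \<tau>
    unfolding u e_def by measurable
  have set_eq: "{x. \<forall>j. \<Phi> j x = F x $ j} \<in> sets borel"
  proof -
    have [measurable]: "(\<lambda>x. F x $ j) \<in> borel_measurable borel" for j
      using square_integrable_measurable[OF sobolevD(1)[OF Q]] .
    show ?thesis by measurable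
  qed
  have all_eq: "AE x in lborel. \<forall>j. \<Phi> j x = F x $ j"
    using \<Phi>(2) by (simp add: AE_all_countable countable_finite)
  have u_ae: "AE x in lborel. u j x \<tau> = cis (\<alpha> j \<tau>) * v j (x - s * \<tau>)" for j \<tau>
    by (rule eventually_mono[OF AE_lborel_translate[OF all_eq set_eq, of "s * \<tau>"]])
      (simp add: u v_def e_split)
  have Y: "(\<lambda>j x. u j x \<tau>) \<in> Y" for \<tau>
    unfolding Y_def using H1_if_sobolev(1)[OF sU um u_ae] by simp
  have continuous: "((\<lambda>\<tau>. Y_dist (\<lambda>j x. u j x \<tau>) (\<lambda>j x. u j x \<tau>\<^sub>0)) \<longlongrightarrow> 0) (at \<tau>\<^sub>0)" for \<tau>\<^sub>0
  proof -
    define D where "D j \<tau> = l2sq (\<lambda>x. cis (\<alpha> j \<tau>) * v j (x - s * \<tau>) - cis (\<alpha> j \<tau>\<^sub>0) * v j (x - s * \<tau>\<^sub>0))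
      + l2sq (\<lambda>x. cis (\<alpha> j \<tau>) * v' j (x - s * \<tau>) - cis (\<alpha> j \<tau>\<^sub>0) * v' j (x - s * \<tau>\<^sub>0))" for j \<tau>
    have "(H1_norm (\<lambda>x. u j x \<tau> - u j x \<tau>\<^sub>0))\<^sup>2 = D j \<tau>" for j \<tau>
      unfolding D_def
    proof (rule H1_if_sobolev(5)[OF sobolev_diff[OF sU sU]])
      show "(\<lambda>x. u j x \<tau> - u j x \<tau>\<^sub>0) \<in> borel_measurable borel" by (intro borel_measurable_diff um)
      show "AE x in lborel. u j x \<tau> - u j x \<tau>\<^sub>0 = cis (\<alpha> j \<tau>) * v j (x - s * \<tau>) - cis (\<alpha> j \<tau>\<^sub>0) * v j (x - s * \<tau>\<^sub>0)"
        using u_ae[of j \<tau>] u_ae[of j \<tau>\<^sub>0] by eventually_elim simp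
    qed
    then have eq: "Y_dist (\<lambda>j x. u j x \<tau>) (\<lambda>j x. u j x \<tau>\<^sub>0) = sqrt (\<Sum>j\<in>UNIV. D j \<tau>)" for \<tau>
      by (simp add: Y_dist_def Y_norm_def)
    have c\<alpha>: "isCont (\<alpha> j) \<tau>\<^sub>0" for j unfolding \<alpha>_def by (intro continuous_intros)
    have "((\<lambda>\<tau>. sqrt (\<Sum>j\<in>UNIV. D j \<tau>)) \<longlongrightarrow> sqrt (\<Sum>j\<in>(UNIV :: 3 set). 0 + 0)) (at \<tau>\<^sub>0)"
      unfolding D_def
      by (intro tendsto_real_sqrt tendsto_sum tendsto_add l2_continuous_phase_translate sobolevD(1)[OF sv] sobolevD(2)[OF sv] cv c\<alpha>)
    then show ?thesis unfolding eq by simp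
  qed
  have nl: "nonlinearity p a (\<lambda>k. u k x \<tau>) j = e j x \<tau> * nonlinearity p a (\<lambda>k. \<Phi> k (x - s * \<tau>)) j" for j x \<tau>
    unfolding u by (rule nonlinearity_phase) (rule norm_e)
  define y where "y z = fst z - s * snd z" for z :: "real \<times> real"
  define E where "E j z = e j (fst z) (snd z)" for j and z :: "real \<times> real"
  have cy: "isCont y z" for z unfolding y_def by (intro continuous_intros)
  have cE: "isCont (E j) z" for j z unfolding E_def e_def by (intro continuous_intros)
  note comp = isCont_o2[OF cy]
  have ym [measurable]: "y \<in> borel_measurable borel" by (intro borel_measurable_continuous_onI continuous_at_imp_continuous_on ballI cy)
  have Em [measurable]: "E j \<in> borel_measurable borel" for j by (intro borel_measurable_continuous_onI continuous_at_imp_continuous_on ballI cE)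
  define U where "U j z = E j z * F (y z) $ j" for j z
  define V where "V j z = E j z * NL (F (y z)) j" for j z
  have plane: "AE z in lborel. \<forall>j. \<Phi> j (y z) = F (y z) $ j"
    unfolding y_def by (rule AE_plane_translate[OF all_eq set_eq])
  have u_plane: "AE z in lborel. u j (fst z) (snd z) = U j z" for j
    by (rule eventually_mono[OF plane]) (simp add: u U_def E_def y_def)
  have nl_plane: "AE z in lborel. nonlinearity p a (\<lambda>k. u k (fst z) (snd z)) j = V j z" for j
    by (rule eventually_mono[OF plane]) (simp add: nl V_def E_def y_def)
  have um2 [measurable]: "(\<lambda>z. u j (fst z) (snd z)) \<in> borel_measurable borel" for j
  proof -
    have "(\<lambda>z. u j (fst z) (snd z)) = (\<lambda>z. E j z * \<Phi> j (y z))" by (simp add: u E_def y_def)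
    then show ?thesis by simp
  qed
  have nm2 [measurable]: "(\<lambda>z. nonlinearity p a (\<lambda>k. u k (fst z) (snd z)) j) \<in> borel_measurable borel" for j
    unfolding nonlinearity_def by measurable
  have cU: "isCont (U j) z" for j z unfolding U_def by (intro continuous_mult cE comp[OF cF])
  have cV: "isCont (V j) z" for j z unfolding V_def by (intro continuous_mult cE comp[OF cN])
  have loc: "locally_integrable (\<lambda>(x, \<tau>). u j x \<tau>)" "locally_integrable (\<lambda>(x, \<tau>). nonlinearity p a (\<lambda>k. u k x \<tau>) j)" for j
    unfolding split_beta
    by (rule locally_integrable_continuous_AE[OF um2 u_plane continuous_at_imp_continuous_on[OF ballI[OF cU]]]
        locally_integrable_continuous_AE[OF nm2 nl_plane continuous_at_imp_continuous_on[OF ballI[OF cV]]])+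
  have weak: "(LINT (x, \<tau>)|lborel. - (\<i> * of_real (dir_deriv (0, 1) \<phi> (x, \<tau>)) * u j x \<tau>)
      + of_real (dir_deriv (1, 0) (dir_deriv (1, 0) \<phi>) (x, \<tau>)) * u j x \<tau>
      + of_real (\<phi> (x, \<tau>)) * nonlinearity p a (\<lambda>k. u k x \<tau>) j) = 0" if \<phi>: "test_function \<phi>" for j \<phi>
  proof -
    define Ut where "Ut z = \<i> * of_real (\<omega> j - \<sigma>\<^sup>2) * U j z - of_real s * (E j z * Q j (y z))" for z
    define Ux where "Ux z = E j z * (A * F (y z) $ j + Q j (y z))" for z
    define Uxx where "Uxx z = E j z * (A * (A * F (y z) $ j + Q j (y z)) + (A * Q j (y z) + (\<omega> j *\<^sub>R F (y z) $ j - NL (F (y z)) j)))" for z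
    have dE: "((\<lambda>t. E j (x, t)) has_vector_derivative \<i> * of_real (\<omega> j - \<sigma>\<^sup>2) * E j (x, t)) (at t)"
      "((\<lambda>x. E j (x, t)) has_vector_derivative A * E j (x, t)) (at x)" for x t
    proof -
      have exp_affine: "((\<lambda>t. exp (\<i> * of_real (b * t + d))) has_vector_derivative \<i> * of_real b * exp (\<i> * of_real (b * t + d))) (at t)" for b d t :: real
      proof -
        have "((\<lambda>t. \<i> * of_real (b * t + d)) has_vector_derivative \<i> * of_real b) (at t)"
          by (auto intro!: derivative_eq_intros)
        from field_vector_diff_chain_at[OF this DERIV_exp] show ?thesis by (simp add: o_def)
      qed
      show "((\<lambda>t. E j (x, t)) has_vector_derivative \<i> * of_real (\<omega> j - \<sigma>\<^sup>2) * E j (x, t)) (at t)"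
        using exp_affine[of "\<omega> j - \<sigma>\<^sup>2" "\<sigma> * x + \<beta> j" t] by (simp add: E_def e_def add.assoc)
      show "((\<lambda>x. E j (x, t)) has_vector_derivative A * E j (x, t)) (at x)"
        using exp_affine[of \<sigma> "(\<omega> j - \<sigma>\<^sup>2) * t + \<beta> j" x] by (simp add: E_def e_def A_def add_ac)
    qed
    have chain_t: "((\<lambda>t. f (y (x, t))) has_vector_derivative - s *\<^sub>R f' (y (x, t))) (at t)"
      and chain_x: "((\<lambda>x. f (y (x, t))) has_vector_derivative f' (y (x, t))) (at x)"
      if "\<And>y. (f has_vector_derivative f' y) (at y)" for f f' :: "real \<Rightarrow> complex" and x t
    proof -
      have 1: "((\<lambda>t. y (x, t)) has_vector_derivative - s) (at t)"
        unfolding y_def has_real_derivative_iff_has_vector_derivative[symmetric] by (auto intro!: derivative_eq_intros)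
      have 2: "((\<lambda>x. y (x, t)) has_vector_derivative 1) (at x)"
        unfolding y_def has_real_derivative_iff_has_vector_derivative[symmetric] by (auto intro!: derivative_eq_intros)
      show "((\<lambda>t. f (y (x, t))) has_vector_derivative - s *\<^sub>R f' (y (x, t))) (at t)"
        using vector_diff_chain_at[OF 1 that] by (simp add: o_def)
      show "((\<lambda>x. f (y (x, t))) has_vector_derivative f' (y (x, t))) (at x)"
        using vector_diff_chain_at[OF 2 that] by (simp add: o_def)
    qed
    have dt: "((\<lambda>t. U j (x, t)) has_vector_derivative Ut (x, t)) (at t)" for x t
      unfolding U_def[abs_def] Ut_def
      by (rule has_vector_derivative_eq_rhs[OF has_vector_derivative_mult[OF dE(1) chain_t[OF d1[of j]]]])
        (simp add: U_def scaleR_conv_of_real algebra_simps)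
    have dx: "((\<lambda>x. U j (x, t)) has_vector_derivative Ux (x, t)) (at x)" for x t
      unfolding U_def[abs_def] Ux_def
      by (rule has_vector_derivative_eq_rhs[OF has_vector_derivative_mult[OF dE(2) chain_x[OF d1[of j]]]])
        (simp add: algebra_simps)
    have dxx: "((\<lambda>x. Ux (x, t)) has_vector_derivative Uxx (x, t)) (at x)" for x t
      unfolding Ux_def[abs_def] Uxx_def
      by (rule has_vector_derivative_eq_rhs[OF has_vector_derivative_mult[OF dE(2)
              has_vector_derivative_add[OF has_vector_derivative_mult_right[OF chain_x[OF d1[of j]]] chain_x[OF d2[of j]]]]])
        (simp add: algebra_simps)
    have c: "isCont Ut z" "isCont Ux z" "isCont Uxx z" for z
      unfolding Ut_def Ux_def Uxx_def
      by (intro continuous_mult continuous_add continuous_diff continuous_const continuous_scaleR cU cE comp[OF cF] comp[OF cQ] comp[OF cN])+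
    \<comment> \<open>The transport term of the time derivative cancels the two mixed terms with
      \<open>A * Q\<close>, and A^2 = -\<sigma>^2 cancels the shift of the frequency; what remains
      is the stationary equation.\<close>
    have eq: "\<i> * Ut z + Uxx z + V j z = 0" for z
      by (simp add: Ut_def Uxx_def V_def U_def A_def s_def scaleR_conv_of_real algebra_simps power2_eq_square)
    obtain b where b: "\<forall>bs\<in>lists Basis. \<forall>z. isCont (foldr dir_deriv bs \<phi>) z"
      using plane_test_function[OF \<phi>] by blast
    have B: "(1, 0) \<in> (Basis :: (real \<times> real) set)" "(0, 1) \<in> (Basis :: (real \<times> real) set)"
      by (auto simp: Basis_prod_def)
    have cont: "isCont \<phi> z" "isCont (dir_deriv (0, 1) \<phi>) z" "isCont (dir_deriv (1, 0) (dir_deriv (1, 0) \<phi>)) z" for z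
      using b[rule_format, of "[]" z] b[rule_format, of "[(0, 1)]" z] b[rule_format, of "[(1, 0), (1, 0)]" z] B by simp_all
    note mc = borel_measurable_continuous_onI[OF continuous_at_imp_continuous_on, OF ballI]
    have [measurable]: "\<phi> \<in> borel_measurable borel" "dir_deriv (0, 1) \<phi> \<in> borel_measurable borel"
      "dir_deriv (1, 0) (dir_deriv (1, 0) \<phi>) \<in> borel_measurable borel"
      by (rule mc[OF cont(1)] mc[OF cont(2)] mc[OF cont(3)])+
    have meas: "(\<lambda>z. - (\<i> * of_real (f1 z) * w z) + of_real (f2 z) * w z + of_real (\<phi> z) * k z) \<in> borel_measurable lborel"
      if [measurable]: "f1 \<in> borel_measurable borel" "f2 \<in> borel_measurable borel" "w \<in> borel_measurable borel" "k \<in> borel_measurable borel"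
      for f1 f2 :: "real \<times> real \<Rightarrow> real" and w k :: "real \<times> real \<Rightarrow> complex"
      by measurable
    note meas = meas[OF mc[OF cont(2)] mc[OF cont(3)]]
    note plane_equation[OF \<phi> dt dx dxx cU c(1) c(2) c(3) cV eq]
    moreover have "(LINT z|lborel. - (\<i> * of_real (dir_deriv (0, 1) \<phi> z) * u j (fst z) (snd z))
      + of_real (dir_deriv (1, 0) (dir_deriv (1, 0) \<phi>) z) * u j (fst z) (snd z)
      + of_real (\<phi> z) * nonlinearity p a (\<lambda>k. u k (fst z) (snd z)) j)
      = (LINT z|lborel. - (\<i> * of_real (dir_deriv (0, 1) \<phi> z) * U j z)
      + of_real (dir_deriv (1, 0) (dir_deriv (1, 0) \<phi>) z) * U j z + of_real (\<phi> z) * V j z)"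
    proof (rule integral_cong_AE)
      show "AE z in lborel. - (\<i> * of_real (dir_deriv (0, 1) \<phi> z) * u j (fst z) (snd z))
        + of_real (dir_deriv (1, 0) (dir_deriv (1, 0) \<phi>) z) * u j (fst z) (snd z)
        + of_real (\<phi> z) * nonlinearity p a (\<lambda>k. u k (fst z) (snd z)) j
        = - (\<i> * of_real (dir_deriv (0, 1) \<phi> z) * U j z)
        + of_real (dir_deriv (1, 0) (dir_deriv (1, 0) \<phi>) z) * U j z + of_real (\<phi> z) * V j z"
        using u_plane[of j] nl_plane[of j] by eventually_elim simp
    qed (rule meas[OF um2 nm2] meas[OF mc[OF cU] mc[OF cV]])+
    ultimately show ?thesis unfolding split_beta by simp
  qed
  show ?thesis unfolding solves_NLS_def u_def[symmetric] using Y continuous loc weak by blast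
qed

end

section \<open>Minimizers and minimizing sequences\<close>

text \<open>Here \<open>f\<close> is an arbitrary Borel representative, while \<open>F\<close>
  collects the continuous ones in a single vector-valued function and \<open>G\<close> their
  derivatives.\<close>

definition represents :: "triple \<Rightarrow> (real \<Rightarrow> complex ^ 3) \<Rightarrow> (real \<Rightarrow> complex ^ 3) \<Rightarrow> bool" where
  "represents f F G \<longleftrightarrow> sobolev F G \<and>
    (\<forall>j. f j \<in> borel_measurable borel \<and> (AE x in lborel. f j x = F x $ j))"

lemma representsD:
  assumes "represents f F G"
  shows "sobolev F G" "f j \<in> borel_measurable borel" "AE x in lborel. f j x = F x $ j"
  using assms by (auto simp: represents_def)

lemma Y_represents:
  assumes "f \<in> Y"
  shows "\<exists>F. represents f F (\<lambda>x. \<chi> j. wderiv (f j) x)"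
proof -
  have f: "f j \<in> H1" for j using assms by (simp add: Y_def)
  have "\<forall>j. \<exists>P. sobolev P (wderiv (f j)) \<and> (AE x in lborel. f j x = P x)"
    using H1_sobolev[OF f] by blast
  from choice[OF this] obtain P where P: "\<And>j. sobolev (P j) (wderiv (f j))" "\<And>j. AE x in lborel. f j x = P j x"
    by blast
  have "f j \<in> borel_measurable borel" for j using f[of j] by (simp add: H1_def L2_def)
  then have "represents f (\<lambda>x. \<chi> j. P j x) (\<lambda>x. \<chi> j. wderiv (f j) x)"
    unfolding represents_def using sobolev_vec_lambda[OF P(1)] P(2) by simp
  then show ?thesis by blast
qed

lemma represents_norms:
  assumes f: "represents f F G"
  shows "f \<in> Y" "(L2_norm (f j))\<^sup>2 = l2sq (\<lambda>x. F x $ j)" "Y_norm f = sqrt (l2sq F + l2sq G)"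
    "AE x in lborel. wderiv (f j) x = G x $ j" "wderiv (f j) \<in> borel_measurable borel"
proof -
  note h = H1_if_sobolev[OF sobolev_nth[OF representsD(1)[OF f]] representsD(2,3)[OF f]]
  show "f \<in> Y" using h(1) by (simp add: Y_def)
  show "(L2_norm (f j))\<^sup>2 = l2sq (\<lambda>x. F x $ j)" by (rule h(4))
  show "AE x in lborel. wderiv (f j) x = G x $ j" by (rule h(2))
  show "wderiv (f j) \<in> borel_measurable borel" by (rule h(3))
  show "Y_norm f = sqrt (l2sq F + l2sq G)"
    unfolding Y_norm_def h(5) sum.distrib
      l2sq_vec[OF sobolevD(1)[OF representsD(1)[OF f]]] l2sq_vec[OF sobolevD(2)[OF representsD(1)[OF f]]] ..
qed

lemma represents_diff:
  assumes f: "represents f F G" and g: "represents g P Q"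
  shows "represents (\<lambda>j x. f j x - g j x) (\<lambda>x. F x - P x) (\<lambda>x. G x - Q x)"
  unfolding represents_def
proof (intro conjI allI)
  show "sobolev (\<lambda>x. F x - P x) (\<lambda>x. G x - Q x)" by (rule sobolev_diff[OF representsD(1)[OF f] representsD(1)[OF g]])
  fix j
  show "(\<lambda>x. f j x - g j x) \<in> borel_measurable borel" using representsD(2)[OF f] representsD(2)[OF g] by simp
  show "AE x in lborel. f j x - g j x = (F x - P x) $ j"
    using representsD(3)[OF f, of j] representsD(3)[OF g, of j] by eventually_elim simp
qed

lemma represents_Y_dist:
  assumes "represents f F G" "represents g P Q"
  shows "Y_dist f g = sqrt (l2sq (\<lambda>x. F x - P x) + l2sq (\<lambda>x. G x - Q x))"
  unfolding Y_dist_def by (rule represents_norms(3)[OF represents_diff[OF assms]])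

lemma represents_translate:
  assumes f: "represents f F G"
  shows "represents (translate y f) (\<lambda>x. F (x + y)) (\<lambda>x. G (x + y))"
  unfolding represents_def translate_def
proof (intro conjI allI)
  show "sobolev (\<lambda>x. F (x + y)) (\<lambda>x. G (x + y))" by (rule sobolev_translate[OF representsD(1)[OF f]])
  fix j
  note [measurable] = representsD(2)[OF f] square_integrable_measurable[OF sobolevD(1)[OF sobolev_nth[OF representsD(1)[OF f]]]]
  show "(\<lambda>x. f j (x + y)) \<in> borel_measurable borel" by measurable
  have "{x. f j x = F x $ j} \<in> sets borel" by measurable
  from AE_lborel_translate[OF representsD(3)[OF f] this, of "- y"]
  show "AE x in lborel. f j (x + y) = F (x + y) $ j" by simp
qed

lemma represents_self:
  "sobolev F G \<Longrightarrow> represents (\<lambda>j x. F x $ j) F G"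
  unfolding represents_def using square_integrable_measurable[OF sobolevD(1)[OF sobolev_nth]] by auto

lemma translate_translate: "translate y (translate z f) = translate (y + z) f"
  by (simp add: translate_def add.assoc)

lemma translate_0: "translate 0 f = f"
  by (simp add: translate_def)

lemma Y_dist_translate:
  assumes "f \<in> Y" "g \<in> Y"
  shows "Y_dist (translate y f) (translate y g) = Y_dist f g"
proof -
  obtain F G P Q where "represents f F G" "represents g P Q" using Y_represents assms by blast
  then show ?thesis
    using l2sq_translate[of "\<lambda>x. F x - P x" y] l2sq_translate[of "\<lambda>x. G x - Q x" y]
    by (simp add: represents_Y_dist[OF represents_translate represents_translate] represents_Y_dist)
qed

lemma Y_dist_nonneg: "0 \<le> Y_dist f g"
  unfolding Y_dist_def Y_norm_def by (intro real_sqrt_ge_zero sum_nonneg) simp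

section \<open>The variational problem with masses \<open>r\<close>, \<open>s\<close>,
  \<open>t\<close>\<close>

definition mass_vector :: "real \<Rightarrow> real \<Rightarrow> real \<Rightarrow> 3 \<Rightarrow> real" where
  "mass_vector r s t j = (if j = 1 then r else if j = 2 then s else t)"

lemma mass_vector_simps: "mass_vector r s t 1 = r" "mass_vector r s t 2 = s" "mass_vector r s t 3 = t"
  by (simp_all add: mass_vector_def)

lemma forall_mass_vector: "(\<forall>j. P j (mass_vector r s t j)) \<longleftrightarrow> P 1 r \<and> P 2 s \<and> P 3 t"
  unfolding forall_3 mass_vector_simps ..

lemma Delta_iff: "f \<in> Delta r s t \<longleftrightarrow> f \<in> Y \<and> (\<forall>j. (L2_norm (f j))\<^sup>2 = mass_vector r s t j)"
  unfolding Delta_def forall_mass_vector[of "\<lambda>j c. (L2_norm (f j))\<^sup>2 = c"] by simp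

lemma minimizing_sequence_iff:
  "minimizing_sequence p a r s t f \<longleftrightarrow> (\<forall>n. f n \<in> Y) \<and>
    (\<forall>j. (\<lambda>n. (L2_norm (f n j))\<^sup>2) \<longlonglongrightarrow> mass_vector r s t j) \<and>
    (\<lambda>n. energy p a (f n)) \<longlonglongrightarrow> min_energy p a r s t"
  unfolding minimizing_sequence_def forall_mass_vector[of "\<lambda>j c. (\<lambda>n. (L2_norm (f n j))\<^sup>2) \<longlonglongrightarrow> c"] by simp

lemma minimizing_sequence_subseq:
  assumes "minimizing_sequence p a r s t f" "strict_mono \<kappa>"
  shows "minimizing_sequence p a r s t (\<lambda>n. f (\<kappa> n))"
  using assms(1) LIMSEQ_subseq_LIMSEQ[OF _ assms(2)] unfolding minimizing_sequence_iff o_def by fast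

context coupled_nls
begin

lemma represents_energy:
  assumes f: "represents f F G"
  shows "energy p a f = en F G"
proof -
  note FG = representsD(1)[OF f]
  note [measurable] = representsD(2)[OF f] represents_norms(5)[OF f]
    square_integrable_measurable[OF sobolevD(1)[OF FG]] square_integrable_measurable[OF sobolevD(2)[OF FG]]
  have all: "AE x in lborel. \<forall>j. wderiv (f j) x = G x $ j \<and> f j x = F x $ j"
    using representsD(3)[OF f] represents_norms(4)[OF f] by (simp add: AE_all_countable countable_finite)
  have "energy p a f = (LINT x|lborel. (norm (G x))\<^sup>2 - W (F x))"
    unfolding energy_def
  proof (rule integral_cong_AE)
    show "AE x in lborel. (\<Sum>j\<in>UNIV. (norm (wderiv (f j) x))\<^sup>2) -
       1 / p * (\<Sum>k\<in>UNIV. \<Sum>j\<in>UNIV. a k j * norm (f k x) powr p * norm (f j x) powr p) = (norm (G x))\<^sup>2 - W (F x)"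
      using all by eventually_elim (simp add: W_def norm_vec_square)
  qed measurable
  also have "\<dots> = en F G"
    unfolding en_def l2sq_def
    by (rule Bochner_Integration.integral_diff[OF square_integrable_integrable[OF sobolevD(2)[OF FG]] sobolev_integrable_W[OF FG]])
  finally show ?thesis .
qed

text \<open>An infimum of real numbers is meaningful only for a set that is bounded below. Where the
  energy is nonpositive, coercivity at level 0 bounds the derivative, hence the supremum norm and
  the interaction.\<close>

lemma energy_bounded_below: "\<exists>C. \<forall>F G. sobolev F G \<longrightarrow> l2sq F \<le> M \<longrightarrow> C \<le> en F G"
proof -
  obtain B where B: "\<And>F G. sobolev F G \<Longrightarrow> l2sq F \<le> M \<Longrightarrow> en F G \<le> 0 \<Longrightarrow> l2sq G \<le> B"
    using energy_coercive[of M 0] by blast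
  define S where "S = sqrt M + sqrt B"
  define C where "C = min 0 (- (K S * M))"
  have "C \<le> en F G" if FG: "sobolev F G" and M: "l2sq F \<le> M" for F G
  proof (cases "en F G \<le> 0")
    case True
    have "norm (F x) \<le> S" for x
    proof -
      have "sqrt (l2sq F) \<le> sqrt M" "sqrt (l2sq G) \<le> sqrt B" using M B[OF FG M True] by simp_all
      then show ?thesis unfolding S_def by (rule order_trans[OF sobolev_bounded[OF FG] add_mono])
    qed
    from integrable_W(2)[OF sobolevD(1)[OF FG] this]
    have "(LINT x|lborel. W (F x)) \<le> K S * l2sq F" .
    also have "\<dots> \<le> K S * M" using M K_nonneg by (rule mult_left_mono)
    finally show ?thesis using l2sq_nonneg[of G] unfolding C_def en_def by linarith
  qed (simp add: C_def)
  then show ?thesis by blast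
qed

context
  fixes r s t :: real
  assumes rst: "0 < r" "0 < s" "0 < t"
begin

abbreviation "m \<equiv> mass_vector r s t"

lemma mass_pos: "0 < m j"
  using rst by (simp add: mass_vector_def)

lemma represents_Delta:
  "represents f F G \<Longrightarrow> f \<in> Delta r s t \<longleftrightarrow> (\<forall>j. l2sq (\<lambda>x. F x $ j) = m j)"
  unfolding Delta_iff using represents_norms(1,2) by fastforce

lemma Delta_nonempty: "Delta r s t \<noteq> {}"
proof -
  obtain F G :: "real \<Rightarrow> complex ^ 3" where "sobolev F G" "\<And>j. l2sq (\<lambda>x. F x $ j) = m j"
    using negative_energy[of m 1, OF less_imp_le[OF mass_pos] mass_pos] by blast
  then show ?thesis using represents_Delta[OF represents_self] by blast
qed

lemma energy_bdd_below: "bdd_below (energy p a ` Delta r s t)"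
proof -
  obtain C where C: "\<And>F G. sobolev F G \<Longrightarrow> l2sq F \<le> (\<Sum>j\<in>UNIV. m j) \<Longrightarrow> C \<le> en F G"
    using energy_bounded_below[of "\<Sum>j\<in>UNIV. m j"] by blast
  have "C \<le> energy p a f" if f: "f \<in> Delta r s t" for f
  proof -
    obtain F G where F: "represents f F G" using Y_represents f unfolding Delta_iff by blast
    then have "\<forall>j. l2sq (\<lambda>x. F x $ j) = m j" using f represents_Delta by blast
    then have "l2sq F = (\<Sum>j\<in>UNIV. m j)" by (simp add: l2sq_vec[OF sobolevD(1)[OF representsD(1)[OF F]]])
    then show ?thesis using C[OF representsD(1)[OF F]] represents_energy[OF F] by simp
  qed
  then show ?thesis by (rule bdd_belowI2)
qed

lemma min_energy_le:
  assumes FG: "sobolev F G" and mass: "\<And>j. l2sq (\<lambda>x. F x $ j) = m j"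
  shows "min_energy p a r s t \<le> en F G"
proof -
  have "(\<lambda>j x. F x $ j) \<in> Delta r s t" using represents_Delta[OF represents_self[OF FG]] mass by blast
  then show ?thesis
    unfolding min_energy_def represents_energy[OF represents_self[OF FG], symmetric]
    by (rule cINF_lower[OF energy_bdd_below])
qed

lemma minimizers_iff:
  assumes "represents f F G"
  shows "f \<in> minimizers p a r s t \<longleftrightarrow> (\<forall>j. l2sq (\<lambda>x. F x $ j) = m j) \<and> en F G = min_energy p a r s t"
  unfolding minimizers_def using represents_Delta[OF assms] represents_energy[OF assms] by simp

lemma minimizers_Y: "f \<in> minimizers p a r s t \<Longrightarrow> f \<in> Y"
  by (simp add: minimizers_def Delta_def)

lemma translate_minimizers:
  assumes f: "f \<in> minimizers p a r s t"
  shows "translate y f \<in> minimizers p a r s t"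
proof -
  obtain F G where F: "represents f F G" using Y_represents minimizers_Y[OF f] by blast
  have "l2sq (\<lambda>x. F (x + y) $ j) = l2sq (\<lambda>x. F x $ j)" for j by (rule l2sq_translate[of "\<lambda>x. F x $ j"])
  then show ?thesis
    using f unfolding minimizers_iff[OF F] minimizers_iff[OF represents_translate[OF F]] en_translate by simp
qed

lemma minimizing_sequence_convergent:
  assumes f: "minimizing_sequence p a r s t f"
  shows "\<exists>y :: nat \<Rightarrow> real. \<exists>\<Phi>\<in>minimizers p a r s t. \<exists>\<kappa> :: nat \<Rightarrow> nat. strict_mono \<kappa> \<and>
    (\<lambda>n. Y_dist (translate (y (\<kappa> n)) (f (\<kappa> n))) \<Phi>) \<longlonglongrightarrow> 0"
proof -
  have Yn: "f n \<in> Y" for n using f by (simp add: minimizing_sequence_iff)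
  have "\<forall>n. \<exists>F. represents (f n) F (\<lambda>x. \<chi> j. wderiv (f n j) x)" using Y_represents[OF Yn] by blast
  from choice[OF this] obtain F where F: "\<And>n. represents (f n) (F n) (\<lambda>x. \<chi> j. wderiv (f n j) x)" by blast
  define G where "G n x = (\<chi> j. wderiv (f n j) x)" for n x
  have FG: "represents (f n) (F n) (G n)" for n using F[of n] unfolding G_def[abs_def] .
  have masses: "(\<lambda>n. l2sq (\<lambda>x. F n x $ j)) \<longlonglongrightarrow> m j" for j
    using f unfolding minimizing_sequence_iff represents_norms(2)[OF FG] by blast
  have ens: "(\<lambda>n. en (F n) (G n)) \<longlonglongrightarrow> min_energy p a r s t"
    using f unfolding minimizing_sequence_iff represents_energy[OF FG] by blast
  obtain \<kappa> y P g where \<kappa>: "strict_mono (\<kappa> :: nat \<Rightarrow> nat)" and P: "sobolev P g" "\<forall>j. l2sq (\<lambda>x. P x $ j) = m j"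
    "en P g = min_energy p a r s t"
    and lim: "(\<lambda>n. l2sq (\<lambda>x. F (\<kappa> n) (x + y (\<kappa> n)) - P x)) \<longlonglongrightarrow> 0"
      "(\<lambda>n. l2sq (\<lambda>x. G (\<kappa> n) (x + y (\<kappa> n)) - g x)) \<longlonglongrightarrow> 0"
    using minimizing_sequence_compact[of m "min_energy p a r s t" F G, OF mass_pos min_energy_le representsD(1)[OF FG] masses ens]
    by blast
  note rP = represents_self[OF P(1)]
  have "(\<lambda>j x. P x $ j) \<in> minimizers p a r s t" using P(2,3) minimizers_iff[OF rP] by blast
  moreover have "(\<lambda>n. Y_dist (translate (y (\<kappa> n)) (f (\<kappa> n))) (\<lambda>j x. P x $ j)) \<longlonglongrightarrow> 0"
    unfolding represents_Y_dist[OF represents_translate[OF FG] rP]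
    using tendsto_real_sqrt[OF tendsto_add[OF lim]] by simp
  ultimately show ?thesis using \<kappa> by blast
qed

lemma minimizing_sequence_exists: "\<exists>f. minimizing_sequence p a r s t f"
proof -
  have "\<forall>n. \<exists>f. f \<in> Delta r s t \<and> energy p a f < min_energy p a r s t + 1 / real (Suc n)"
  proof
    fix n
    have "\<exists>e\<in>energy p a ` Delta r s t. e < min_energy p a r s t + 1 / real (Suc n)"
      by (rule cInf_lessD) (use Delta_nonempty in \<open>simp_all add: min_energy_def\<close>)
    then show "\<exists>f. f \<in> Delta r s t \<and> energy p a f < min_energy p a r s t + 1 / real (Suc n)" by blast
  qed
  from choice[OF this] obtain f
    where f: "\<And>n. f n \<in> Delta r s t" "\<And>n. energy p a (f n) < min_energy p a r s t + 1 / real (Suc n)" by blast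
  have low: "min_energy p a r s t \<le> energy p a (f n)" for n
    unfolding min_energy_def by (rule cINF_lower[OF energy_bdd_below f(1)])
  have "(\<lambda>n. min_energy p a r s t + 1 / real (Suc n)) \<longlonglongrightarrow> min_energy p a r s t + 0"
    by (intro tendsto_add tendsto_const LIMSEQ_Suc[OF lim_1_over_n])
  then have lim: "(\<lambda>n. min_energy p a r s t + 1 / real (Suc n)) \<longlonglongrightarrow> min_energy p a r s t" by simp
  have "(\<lambda>n. energy p a (f n)) \<longlonglongrightarrow> min_energy p a r s t"
    by (rule real_tendsto_sandwich[OF always_eventually[OF allI[OF low]]
          always_eventually[OF allI[OF less_imp_le[OF f(2)]]] tendsto_const lim])
  then have "minimizing_sequence p a r s t f"
    using f(1) unfolding minimizing_sequence_iff Delta_iff by simp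
  then show ?thesis by (rule exI[where x=f])
qed

lemma minimizers_nonempty: "minimizers p a r s t \<noteq> {}"
  using minimizing_sequence_exists minimizing_sequence_convergent by blast

lemma minimizer_solitary_wave:
  assumes \<Phi>: "\<Phi> \<in> minimizers p a r s t"
  shows "\<exists>\<omega> :: 3 \<Rightarrow> real. (\<forall>j. 0 < \<omega> j) \<and> solves_stationary p a \<omega> \<Phi> \<and>
    (\<forall>\<sigma> \<beta>. solves_NLS p a (solitary_wave \<omega> \<sigma> \<beta> \<Phi>))"
proof -
  obtain F where F: "represents \<Phi> F (\<lambda>x. \<chi> j. wderiv (\<Phi> j) x)"
    using Y_represents[OF minimizers_Y[OF \<Phi>]] by blast
  define G where "G x = (\<chi> j. wderiv (\<Phi> j) x)" for x
  have FG: "represents \<Phi> F G" using F unfolding G_def[abs_def] .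
  have min: "minimal m F G"
    using \<Phi> min_energy_le representsD(1)[OF FG] unfolding minimizers_iff[OF FG] minimal_def by simp
  define \<omega> where "\<omega> = frequency m F G"
  have "solves_stationary p a \<omega> \<Phi>"
    unfolding solves_stationary_def
  proof (intro conjI allI exI)
    show "\<Phi> \<in> Y" by (rule minimizers_Y[OF \<Phi>])
    fix j
    show "weak_derivative (wderiv (\<Phi> j)) (\<lambda>x. \<omega> j *\<^sub>R F x $ j - NL (F x) j)"
      using minimal_stationary[OF min mass_pos, of j] by (simp add: G_def \<omega>_def)
    have "AE x in lborel. \<forall>k. \<Phi> k x = F x $ k"
      using representsD(3)[OF FG] by (simp add: AE_all_countable countable_finite)
    then show "AE x in lborel. - (\<omega> j *\<^sub>R F x $ j - NL (F x) j) + \<omega> j *\<^sub>R \<Phi> j x = nonlinearity p a (\<lambda>k. \<Phi> k x) j"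
      by eventually_elim simp
  qed
  moreover have "solves_NLS p a (solitary_wave \<omega> \<sigma> \<beta> \<Phi>)" for \<sigma> \<beta>
  proof -
    have "\<forall>j. \<exists>Q. sobolev (\<lambda>x. F x $ j) Q \<and> (\<forall>x. ((\<lambda>x. F x $ j) has_vector_derivative Q x) (at x)) \<and>
        (\<forall>x. (Q has_vector_derivative \<omega> j *\<^sub>R F x $ j - NL (F x) j) (at x))"
      using minimal_regular[OF min mass_pos] unfolding \<omega>_def by blast
    from choice[OF this] obtain Q where Q: "\<And>j. sobolev (\<lambda>x. F x $ j) (Q j)"
      "\<And>j x. ((\<lambda>x. F x $ j) has_vector_derivative Q j x) (at x)"
      "\<And>j x. (Q j has_vector_derivative \<omega> j *\<^sub>R F x $ j - NL (F x) j) (at x)" by blast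
    show ?thesis
      by (rule solitary_wave_solves_NLS[OF representsD(2,3)[OF FG] sobolev_isCont[OF representsD(1)[OF FG]] Q])
  qed
  moreover have "0 < \<omega> j" for j unfolding \<omega>_def by (rule frequency_pos[OF min mass_pos])
  ultimately show ?thesis by blast
qed

lemma INF_nonneg_minimizers: "0 \<le> (INF \<Phi>\<in>minimizers p a r s t. Y_dist f \<Phi>)"
  by (rule cINF_greatest[OF minimizers_nonempty Y_dist_nonneg])

lemma INF_le_minimizers: "\<Phi> \<in> minimizers p a r s t \<Longrightarrow> (INF \<Phi>\<in>minimizers p a r s t. Y_dist f \<Phi>) \<le> Y_dist f \<Phi>"
  by (rule cINF_lower) (auto intro: bdd_belowI2[of _ 0] Y_dist_nonneg)

text \<open>A subsequence that stays at distance \<open>e\<close> is again minimizing, so translates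
  of some of its terms converge to a minimizer. The translation can be moved onto the minimizer,
  because the set of minimizers and the distance are translation invariant.\<close>

lemma minimizing_sequence_dist:
  assumes f: "minimizing_sequence p a r s t f"
  shows "(\<lambda>n. INF \<Phi>\<in>minimizers p a r s t. Y_dist (f n) \<Phi>) \<longlonglongrightarrow> 0"
proof (rule ccontr)
  define d where "d n = (INF \<Phi>\<in>minimizers p a r s t. Y_dist (f n) \<Phi>)" for n
  have d0: "0 \<le> d n" for n unfolding d_def by (rule INF_nonneg_minimizers)
  assume "\<not> ?thesis"
  then have "\<not> d \<longlonglongrightarrow> 0" by (simp add: d_def[abs_def])
  then obtain e where e: "0 < e" "\<not> (\<forall>\<^sub>F n in sequentially. dist (d n) 0 < e)" unfolding tendsto_iff by blast
  then have "\<exists>\<^sub>F n in sequentially. e \<le> d n"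
    using d0 by (auto simp: not_eventually not_less elim: frequently_elim1)
  then have "infinite {n. e \<le> d n}" by (simp add: INFM_iff_infinite frequently_cofinite[symmetric] cofinite_eq_sequentially)
  then obtain \<kappa> :: "nat \<Rightarrow> nat" where \<kappa>: "strict_mono \<kappa>" "\<And>n. e \<le> d (\<kappa> n)"
    using infinite_enumerate by blast
  from minimizing_sequence_convergent[OF minimizing_sequence_subseq[OF f \<kappa>(1)]]
  obtain y \<Phi> \<kappa>' where \<Phi>: "\<Phi> \<in> minimizers p a r s t"
    and lim: "(\<lambda>n. Y_dist (translate (y (\<kappa>' n)) (f (\<kappa> (\<kappa>' n)))) \<Phi>) \<longlonglongrightarrow> 0" by blast
  have "e \<le> Y_dist (translate (y (\<kappa>' n)) (f (\<kappa> (\<kappa>' n)))) \<Phi>" for n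
  proof -
    have fY: "f (\<kappa> (\<kappa>' n)) \<in> Y" using f by (simp add: minimizing_sequence_iff)
    define z where "z = y (\<kappa>' n)"
    have \<Phi>z: "translate (- z) \<Phi> \<in> minimizers p a r s t" by (rule translate_minimizers[OF \<Phi>])
    have "e \<le> d (\<kappa> (\<kappa>' n))" by (rule \<kappa>(2))
    also have "\<dots> \<le> Y_dist (f (\<kappa> (\<kappa>' n))) (translate (- z) \<Phi>)" unfolding d_def by (rule INF_le_minimizers[OF \<Phi>z])
    also have "\<dots> = Y_dist (translate z (f (\<kappa> (\<kappa>' n)))) (translate z (translate (- z) \<Phi>))"
      by (rule Y_dist_translate[OF fY minimizers_Y[OF \<Phi>z], symmetric])
    also have "translate z (translate (- z) \<Phi>) = \<Phi>" by (simp add: translate_translate translate_0)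
    finally show ?thesis unfolding z_def .
  qed
  then have "e \<le> 0" by (intro LIMSEQ_le_const[OF lim]) blast
  with e(1) show False by simp
qed

lemma minimizing_sequence_translate_dist:
  assumes f: "minimizing_sequence p a r s t f"
  shows "(\<lambda>n. INF y :: real. INF \<Phi>\<in>minimizers p a r s t. Y_dist (translate y (f n)) \<Phi>) \<longlonglongrightarrow> 0"
proof (rule real_tendsto_sandwich[OF _ _ tendsto_const minimizing_sequence_dist[OF f]])
  show "\<forall>\<^sub>F n in sequentially. 0 \<le> (INF y :: real. INF \<Phi>\<in>minimizers p a r s t. Y_dist (translate y (f n)) \<Phi>)"
    by (intro always_eventually allI cINF_greatest INF_nonneg_minimizers) simp
  show "\<forall>\<^sub>F n in sequentially. (INF y :: real. INF \<Phi>\<in>minimizers p a r s t. Y_dist (translate y (f n)) \<Phi>)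
      \<le> (INF \<Phi>\<in>minimizers p a r s t. Y_dist (f n) \<Phi>)"
  proof (intro always_eventually allI)
    fix n
    \<comment> \<open>The shift 0 is one of the competitors, so the previous convergence already
      bounds the double infimum.\<close>
    have "(INF y :: real. INF \<Phi>\<in>minimizers p a r s t. Y_dist (translate y (f n)) \<Phi>)
        \<le> (INF \<Phi>\<in>minimizers p a r s t. Y_dist (translate 0 (f n)) \<Phi>)"
      by (rule cINF_lower[OF bdd_belowI2[of _ 0]]) (rule INF_nonneg_minimizers, simp)
    then show "(INF y :: real. INF \<Phi>\<in>minimizers p a r s t. Y_dist (translate y (f n)) \<Phi>)
        \<le> (INF \<Phi>\<in>minimizers p a r s t. Y_dist (f n) \<Phi>)" by (simp only: translate_0)
  qed
qed

end

end

theorem theorem3p6: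
  fixes p r s t :: real and a :: "3 \<Rightarrow> 3 \<Rightarrow> real"
  assumes "2 \<le> p" and "p < 3"
    and "\<And>k j. 0 < a k j" and "\<And>k j. a k j = a j k"
    and "0 < r" and "0 < s" and "0 < t"
  shows "minimizers p a r s t \<noteq> {} \<and>
    (\<forall>f. minimizing_sequence p a r s t f \<longrightarrow>
      (\<exists>y :: nat \<Rightarrow> real. \<exists>\<Phi>\<in>minimizers p a r s t. \<exists>\<kappa> :: nat \<Rightarrow> nat. strict_mono \<kappa> \<and>
         (\<lambda>n. Y_dist (translate (y (\<kappa> n)) (f (\<kappa> n))) \<Phi>) \<longlonglongrightarrow> 0) \<and>
      (\<forall>\<Phi>\<in>minimizers p a r s t. \<exists>\<omega> :: 3 \<Rightarrow> real. (\<forall>j. 0 < \<omega> j) \<and>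
         solves_stationary p a \<omega> \<Phi> \<and>
         (\<forall>\<sigma> \<beta>. solves_NLS p a (solitary_wave \<omega> \<sigma> \<beta> \<Phi>))) \<and>
      (\<lambda>n. INF y :: real. INF \<Phi>\<in>minimizers p a r s t. Y_dist (translate y (f n)) \<Phi>) \<longlonglongrightarrow> 0 \<and>
      (\<lambda>n. INF \<Phi>\<in>minimizers p a r s t. Y_dist (f n) \<Phi>) \<longlonglongrightarrow> 0)"
proof -
  interpret coupled_nls p a by unfold_locales (use assms in auto)
  note rst = assms(5-7)
  show ?thesis
    using minimizers_nonempty[OF rst] minimizing_sequence_convergent[OF rst] minimizer_solitary_wave[OF rst]
      minimizing_sequence_translate_dist[OF rst] minimizing_sequence_dist[OF rst]
    by (intro conjI allI impI ballI) blast+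
qed

end
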